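(* Under the standing assumptions below, let $\{u_k\}_{k\ge1}\subset L^{\bar p}(\Omega)$ converge weakly to $u$ in $L^{\bar p}(\Omega)$. Then $y_{u_k}\to y_u$ strongly in $H_0^1(\Omega)\cap C(\bar\Omega)$, where $y_v$ denotes the unique solution in $H_0^1(\Omega)\cap C(\bar\Omega)$ of $Ay+b(x)\cdot\nabla y+f(x,y)=v$ in $\Omega$, $y=0$ on $\Gamma$.
   Context: Assumption 1: $n\in\{2,3\}$, $\Omega\subset\mathbb{R}^n$ a bounded open domain with Lipschitz boundary $\Gamma$; $Ay=-\sum_{i,j=1}^n\partial_{x_j}(a_{ij}(x)\partial_{x_i}y)$ with $a_{ij}\in L^\infty(\Omega)$ and $\sum_{i,j}a_{ij}(x)\xi_i\xi_j\ge\Lambda|\xi|^2$ for some $\Lambda>0$, all $\xi\in\mathbb{R}^n$, a.e. $x$; $b\in L^p(\Omega)^n$ with $p\ge3$ if $n=3$ and $p>2$ if $n=2$. $\bar p$ is a fixed real number with $\bar p>n/2$. Assumption 2: $f:\Omega\times\mathbb{R}\to\mathbb{R}$ is a Carathéodory function, nondecreasing in the second variable, such that for every $M>0$ there is $\phi_M\in L^{\bar p}(\Omega)$ with $|f(x,y)|\le\phi_M(x)$ for a.a. $x\in\Omega$ and all $|y|\le M$. Solutions are weak: $\int_\Omega\big(\sum_{i,j}a_{ij}\partial_{x_i}y\,\partial_{x_j}z+(b\cdot\nabla y)z+f(x,y)z\big)dx=\int_\Omega vz\,dx$ for all $z\in H_0^1(\Omega)$; existence and uniqueness of $y_v$ for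 every $v\in L^{\bar p}(\Omega)$ holds under these assumptions. *)

theory Defs
  imports "HOL-Analysis.Analysis"
begin

definition partial :: "'n::finite \<Rightarrow> (real^'n \<Rightarrow> real) \<Rightarrow> real^'n \<Rightarrow> real" where
  "partial i \<phi> x = frechet_derivative \<phi> (at x) (axis i 1)"

primrec iter_partial :: "'n::finite list \<Rightarrow> (real^'n \<Rightarrow> real) \<Rightarrow> real^'n \<Rightarrow> real" where
  "iter_partial [] \<phi> = \<phi>"
| "iter_partial (i # is) \<phi> = partial i (iter_partial is \<phi>)"

definition smooth_fun :: "(real^'n::finite \<Rightarrow> real) \<Rightarrow> bool" where
  "smooth_fun \<phi> \<longleftrightarrow> (\<forall>is. \<forall>x. iter_partial is \<phi> differentiable (at x))"

definition test_fun :: "(real^'n::finite) set \<Rightarrow> (real^'n \<Rightarrow> real) set" where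
  "test_fun \<Omega> = {\<phi>. smooth_fun \<phi> \<and> compact (closure {x. \<phi> x \<noteq> 0})
                      \<and> closure {x. \<phi> x \<noteq> 0} \<subseteq> \<Omega>}"

definition grad :: "(real^'n::finite \<Rightarrow> real) \<Rightarrow> real^'n \<Rightarrow> real^'n" where
  "grad \<phi> x = (\<chi> i. partial i \<phi> x)"

definition Lp :: "(real^'n::finite) set \<Rightarrow> real \<Rightarrow> (real^'n \<Rightarrow> real) \<Rightarrow> bool" where
  "Lp \<Omega> p f \<longleftrightarrow> f \<in> borel_measurable (lebesgue_on \<Omega>)
      \<and> integrable (lebesgue_on \<Omega>) (\<lambda>x. \<bar>f x\<bar> powr p)"

definition Linf :: "(real^'n::finite) set \<Rightarrow> (real^'n \<Rightarrow> real) \<Rightarrow> bool" where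
  "Linf \<Omega> f \<longleftrightarrow> f \<in> borel_measurable (lebesgue_on \<Omega>)
      \<and> (\<exists>C. AE x in lebesgue_on \<Omega>. \<bar>f x\<bar> \<le> C)"

definition L1loc :: "(real^'n::finite) set \<Rightarrow> (real^'n \<Rightarrow> real) \<Rightarrow> bool" where
  "L1loc \<Omega> f \<longleftrightarrow> (\<forall>K. compact K \<and> K \<subseteq> \<Omega> \<longrightarrow> integrable (lebesgue_on K) f)"

definition weak_grad :: "(real^'n::finite) set \<Rightarrow> (real^'n \<Rightarrow> real) \<Rightarrow> (real^'n \<Rightarrow> real^'n) \<Rightarrow> bool" where
  "weak_grad \<Omega> y g \<longleftrightarrow> L1loc \<Omega> y \<and> (\<forall>i. L1loc \<Omega> (\<lambda>x. g x $ i))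
     \<and> (\<forall>\<phi>\<in>test_fun \<Omega>. \<forall>i.
          (LINT x|lebesgue_on \<Omega>. y x * partial i \<phi> x) = - (LINT x|lebesgue_on \<Omega>. g x $ i * \<phi> x))"

definition H01 :: "(real^'n::finite) set \<Rightarrow> (real^'n \<Rightarrow> real) \<Rightarrow> bool" where
  "H01 \<Omega> y \<longleftrightarrow> Lp \<Omega> 2 y \<and>
     (\<exists>G. weak_grad \<Omega> y G \<and> (\<forall>i. Lp \<Omega> 2 (\<lambda>x. G x $ i)) \<and>
        (\<exists>\<phi>. (\<forall>k. \<phi> k \<in> test_fun \<Omega>)
           \<and> (\<lambda>k. LINT x|lebesgue_on \<Omega>. (\<phi> k x - y x)^2) \<longlonglongrightarrow> 0
           \<and> (\<lambda>k. LINT x|lebesgue_on \<Omega>. (norm (grad (\<phi> k) x - G x))^2) \<longlonglongrightarrow> 0))"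

text \<open>Lipschitz boundary: locally, after an orthogonal change of coordinates, Omega is
  the region below the graph of a Lipschitz function of the remaining coordinates.\<close>
definition lipschitz_boundary :: "(real^'n::finite) set \<Rightarrow> bool" where
  "lipschitz_boundary \<Omega> \<longleftrightarrow> (\<forall>x0\<in>frontier \<Omega>. \<exists>T k U L \<gamma>.
      orthogonal_transformation T \<and> open U \<and> x0 \<in> U \<and>
      L-lipschitz_on UNIV (\<gamma> :: real^'n \<Rightarrow> real) \<and>
      (\<forall>x c. \<gamma> (x + c *\<^sub>R axis k 1) = \<gamma> x) \<and>
      \<Omega> \<inter> U = {x\<in>U. T x $ k < \<gamma> (T x)})"

definition caratheodory :: "(real^'n::finite) set \<Rightarrow> (real^'n \<Rightarrow> real \<Rightarrow> real) \<Rightarrow> bool" where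
  "caratheodory \<Omega> f \<longleftrightarrow> (\<forall>s. (\<lambda>x. f x s) \<in> borel_measurable (lebesgue_on \<Omega>))
      \<and> (AE x in lebesgue_on \<Omega>. continuous_on UNIV (f x))"

definition is_solution ::
  "(real^'n::finite) set \<Rightarrow> ('n \<Rightarrow> 'n \<Rightarrow> real^'n \<Rightarrow> real) \<Rightarrow> (real^'n \<Rightarrow> real^'n)
   \<Rightarrow> (real^'n \<Rightarrow> real \<Rightarrow> real) \<Rightarrow> (real^'n \<Rightarrow> real) \<Rightarrow> (real^'n \<Rightarrow> real) \<Rightarrow> bool" where
  "is_solution \<Omega> a b f v y \<longleftrightarrow> H01 \<Omega> y \<and> continuous_on (closure \<Omega>) y \<and>
     (\<exists>G. weak_grad \<Omega> y G \<and>
       (\<forall>z Gz. H01 \<Omega> z \<and> weak_grad \<Omega> z Gz \<longrightarrow>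
          (LINT x|lebesgue_on \<Omega>. (\<Sum>i\<in>UNIV. \<Sum>j\<in>UNIV. a i j x * G x $ i * Gz x $ j)
              + (b x \<bullet> G x) * z x + f x (y x) * z x)
          = (LINT x|lebesgue_on \<Omega>. v x * z x)))"

end

theory Submission
  imports Defs "HOL-Computational_Algebra.Polynomial"
begin

text \<open>
  The difference \<open>w = y\<^sub>k - y\<close> of two solutions is tested with \<open>(w - s)\<^sup>+\<close>, \<open>s \<ge> 0\<close>. The nonlinearity
  drops out by monotonicity and leaves
  \<open>\<Lambda> \<integral>\<bar>\<nabla>(w - s)\<^sup>+\<bar>\<^sup>2 \<le> \<integral> \<bar>b\<bar> \<bar>\<nabla>(w - s)\<^sup>+\<bar> (w - s)\<^sup>+ + \<integral> v (w - s)\<^sup>+\<close> with \<open>v = u\<^sub>k - u\<close>.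
  The drift is absorbed band by band in the range of \<open>w\<close>, from the top downwards, so that
  \<open>\<parallel>\<nabla>(w - s)\<^sup>+\<parallel>\<close> is bounded by a constant times the norm of \<open>v\<close> as a functional on truncations.
  For \<open>s = 0\<close> this norm tends to zero: \<open>v\<close> is bounded in \<open>L\<^sup>p\<close> by uniform boundedness, and since \<open>p\<close> is
  subcritical the weak convergence becomes strong in the dual of \<open>H\<^sub>0\<^sup>1\<close>, which is seen by mollifying
  the test function. This is convergence in \<open>H\<^sub>0\<^sup>1\<close>. For general \<open>s\<close> the norm is controlled by a power of the
  measure of \<open>{w > s}\<close>, and Stampacchia's iteration started at a small level \<open>\<epsilon>\<close> gives
  \<open>w \<le> \<epsilon> + K \<bar>{w > \<epsilon>}\<bar>\<^sup>\<gamma>\<close>, hence uniform convergence without Hoelder regularity or compactness.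
\<close>

section \<open>Smooth functions and test functions\<close>

text \<open>The drift destroys coercivity, and for \<open>p = 3\<close> in dimension three it has
  the same scaling as the principal part, so no lower-order argument absorbs it. What can be made
  small is the integral of \<open>\<bar>b\<bar>^r\<close> over a part of the domain. Bands of the
  range of \<open>w\<close> are suited to this because \<open>(w - s)^+\<close> sees only the levels
  above \<open>s\<close>: the term above a band involves a gradient that is already estimated,
  whence the order from the top. The exponents are tied by Hoelder: \<open>q\<close> is a Sobolev
  exponent (\<open>6\<close> in dimension three, a large even integer in dimension two) and
  \<open>r = 2 * q / (q - 2)\<close> solves \<open>1/r + 1/2 + 1/q = 1\<close>. The condition
  \<open>pbar > n/2\<close> becomes \<open>2/q < 1 - 1/pbar\<close>, which is what pushes the power
  of the measure in Stampacchia's recursion above one. All constants are chosen before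
  \<open>w\<close>, hence serve every \<open>k\<close> and, after exchanging the two solutions, also
  \<open>- w\<close>; this matters since each estimate is one-sided. Membership in
  \<open>H01\<close> means approximability by test functions, so facts about such functions are
  proved for test functions and carried over by limits.\<close>

lemma iter_partial_snoc: "iter_partial (is @ [i]) \<phi> = iter_partial is (partial i \<phi>)"
  by (induction "is") auto

text \<open>Smoothness is the largest property that implies differentiability and is inherited by
  partial derivatives. Exhibiting one class \<open>X\<close> closed under \<open>partial\<close>
  therefore suffices, and no higher-order Leibniz or chain formula has to be written down.\<close>

lemma smooth_fun_coinduct:
  assumes "\<phi> \<in> X" and "\<And>f x. f \<in> X \<Longrightarrow> f differentiable (at x)"
    and "\<And>f i. f \<in> X \<Longrightarrow> partial i f \<in> X"
  shows "smooth_fun \<phi>"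
proof -
  have "iter_partial is \<phi> \<in> X" for "is"
    by (induction "is") (auto simp: assms)
  then show ?thesis
    unfolding smooth_fun_def using assms(2) by blast
qed

lemma smooth_fun_differentiable: "smooth_fun \<phi> \<Longrightarrow> \<phi> differentiable (at x)"
  unfolding smooth_fun_def using iter_partial.simps(1) by metis

lemma smooth_fun_partial: "smooth_fun \<phi> \<Longrightarrow> smooth_fun (partial i \<phi>)"
  unfolding smooth_fun_def by (metis iter_partial_snoc)

lemma smooth_fun_has_derivative:
  "smooth_fun \<phi> \<Longrightarrow> (\<phi> has_derivative frechet_derivative \<phi> (at x)) (at x)"
  by (simp add: frechet_derivative_works[THEN iffD1] smooth_fun_differentiable)

lemma smooth_fun_continuous: "smooth_fun \<phi> \<Longrightarrow> continuous_on S \<phi>"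
  by (simp add: continuous_at_imp_continuous_on differentiable_imp_continuous_within
      smooth_fun_differentiable)

lemma smooth_fun_borel: "smooth_fun \<phi> \<Longrightarrow> \<phi> \<in> borel_measurable borel"
  by (simp add: borel_measurable_continuous_onI smooth_fun_continuous)

lemma partial_eqI: "(f has_derivative f') (at x) \<Longrightarrow> partial i f x = f' (axis i 1)"
  unfolding partial_def using frechet_derivative_at by metis

lemma frechet_derivative_eq_grad:
  assumes "smooth_fun \<phi>"
  shows "frechet_derivative \<phi> (at x) v = grad \<phi> x \<bullet> v"
proof -
  interpret D: bounded_linear "frechet_derivative \<phi> (at x)"
    using smooth_fun_has_derivative[OF assms] has_derivative_bounded_linear by blast
  have "frechet_derivative \<phi> (at x) v = frechet_derivative \<phi> (at x) (\<Sum>i\<in>UNIV. v $ i *\<^sub>R axis i 1)"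
    by (simp add: basis_expansion[of v, unfolded scalar_mult_eq_scaleR])
  also have "\<dots> = (\<Sum>i\<in>UNIV. v $ i * partial i \<phi> x)"
    by (simp add: D.sum D.scaleR partial_def)
  finally show ?thesis
    by (simp add: inner_vec_def grad_def mult.commute)
qed

lemma smooth_fun_has_derivative_grad:
  "smooth_fun \<phi> \<Longrightarrow> (\<phi> has_derivative (\<lambda>v. grad \<phi> x \<bullet> v)) (at x)"
  by (rule has_derivative_eq_rhs[OF smooth_fun_has_derivative])
    (simp_all add: frechet_derivative_eq_grad fun_eq_iff)

lemma partial_nth_grad: "grad \<phi> x $ i = partial i \<phi> x"
  by (simp add: grad_def)

section \<open>Differentiation rules and closure properties of smooth functions\<close>

lemma partial_add:
  "smooth_fun f \<Longrightarrow> smooth_fun g \<Longrightarrow> partial i (\<lambda>x. f x + g x) = (\<lambda>x. partial i f x + partial i g x)"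
  by (rule ext, rule partial_eqI[THEN trans])
    (auto intro!: has_derivative_add smooth_fun_has_derivative simp: partial_def)

lemma partial_mult:
  "smooth_fun f \<Longrightarrow> smooth_fun g \<Longrightarrow>
    partial i (\<lambda>x. f x * g x) = (\<lambda>x. partial i f x * g x + f x * partial i g x)"
  by (rule ext, rule partial_eqI[OF has_derivative_mult[OF smooth_fun_has_derivative
        smooth_fun_has_derivative], THEN trans])
    (auto simp: partial_def)

lemma partial_const [simp]: "partial i (\<lambda>x. c) = (\<lambda>x. 0)"
  by (rule ext, rule partial_eqI[THEN trans]) (auto intro!: derivative_eq_intros)

lemma partial_compose:
  assumes "\<And>t. (J has_real_derivative J' t) (at t)" "smooth_fun f"
  shows "partial i (\<lambda>x. J (f x)) = (\<lambda>x. J' (f x) * partial i f x)"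
proof
  fix x
  have "((\<lambda>x. J (f x)) has_derivative (\<lambda>v. J' (f x) * frechet_derivative f (at x) v)) (at x)"
    using has_derivative_compose[OF smooth_fun_has_derivative[OF assms(2), of x]
        assms(1)[of "f x", unfolded has_field_derivative_def]] by simp
  from partial_eqI[OF this] show "partial i (\<lambda>x. J (f x)) x = J' (f x) * partial i f x"
    by (simp add: partial_def)
qed

lemma smooth_fun_const: "smooth_fun (\<lambda>x. c)"
  by (rule smooth_fun_coinduct[of _ "{\<lambda>x. c, \<lambda>x. 0}"]) auto

lemma smooth_fun_add:
  assumes "smooth_fun f" "smooth_fun g"
  shows "smooth_fun (\<lambda>x. f x + g x)"
proof (rule smooth_fun_coinduct[of _ "{h. \<exists>f g. h = (\<lambda>x. f x + g x) \<and> smooth_fun f \<and> smooth_fun g}"])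
  fix h x assume "h \<in> {h. \<exists>f g. h = (\<lambda>x::(real^'a). f x + g x) \<and> smooth_fun f \<and> smooth_fun g}"
  then show "h differentiable (at x)"
    by (auto intro!: differentiable_add simp: smooth_fun_differentiable)
next
  fix h i assume "h \<in> {h. \<exists>f g. h = (\<lambda>x::(real^'a). f x + g x) \<and> smooth_fun f \<and> smooth_fun g}"
  then obtain f g where h: "h = (\<lambda>x. f x + g x)" "smooth_fun f" "smooth_fun g" by auto
  then show "partial i h \<in> {h. \<exists>f g. h = (\<lambda>x. f x + g x) \<and> smooth_fun f \<and> smooth_fun g}"
    using partial_add[of f g i] smooth_fun_partial[of _ i] by blast
qed (use assms in auto)

text \<open>Products alone are not closed under \<open>partial\<close>, but finite sums of products
  of smooth functions are, by the Leibniz rule. This is the class to which the coinduction is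
  applied.\<close>

inductive_set smooth_products :: "(real^'n::finite \<Rightarrow> real) set" where
  mult: "smooth_fun f \<Longrightarrow> smooth_fun g \<Longrightarrow> (\<lambda>x. f x * g x) \<in> smooth_products"
| add: "f \<in> smooth_products \<Longrightarrow> g \<in> smooth_products \<Longrightarrow> (\<lambda>x. f x + g x) \<in> smooth_products"

lemma smooth_products_closed:
  "f \<in> smooth_products \<Longrightarrow> (\<forall>x. f differentiable (at x)) \<and> (\<forall>i. partial i f \<in> smooth_products)"
proof (induction rule: smooth_products.induct)
  case (mult f g)
  then show ?case
    by (auto simp: partial_mult smooth_fun_differentiable
        intro!: smooth_products.intros smooth_fun_partial differentiable_mult)
next
  case (add f g)
  have "partial i (\<lambda>x. f x + g x) = (\<lambda>x. partial i f x + partial i g x)" for i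
    using add.IH
    by (intro ext, intro partial_eqI[THEN trans])
      (auto intro!: has_derivative_add frechet_derivative_works[THEN iffD1] simp: partial_def)
  with add.IH show ?case
    by (auto intro!: smooth_products.intros differentiable_add)
qed

lemma smooth_fun_mult:
  assumes "smooth_fun f" "smooth_fun g"
  shows "smooth_fun (\<lambda>x. f x * g x)"
  by (rule smooth_fun_coinduct[of _ smooth_products])
    (use assms smooth_products_closed in \<open>auto intro: smooth_products.intros\<close>)

lemma smooth_fun_cmult: "smooth_fun f \<Longrightarrow> smooth_fun (\<lambda>x. c * f x)"
  by (intro smooth_fun_mult smooth_fun_const)

lemma smooth_fun_diff: "smooth_fun f \<Longrightarrow> smooth_fun g \<Longrightarrow> smooth_fun (\<lambda>x. f x - g x)"
  using smooth_fun_add[OF _ smooth_fun_cmult[of g "-1"], of f] by simp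

lemma partial_cmult: "smooth_fun f \<Longrightarrow> partial i (\<lambda>x. c * f x) = (\<lambda>x. c * partial i f x)"
  by (subst partial_mult) (auto intro: smooth_fun_const)

lemma partial_diff:
  "smooth_fun f \<Longrightarrow> smooth_fun g \<Longrightarrow> partial i (\<lambda>x. f x - g x) = (\<lambda>x. partial i f x - partial i g x)"
  using partial_add[of f "\<lambda>x. (-1) * g x" i] smooth_fun_cmult[of g "-1"] partial_cmult[of g i "-1"]
  by simp

lemma smooth_fun_prod:
  "finite I \<Longrightarrow> (\<And>i. i \<in> I \<Longrightarrow> smooth_fun (f i)) \<Longrightarrow> smooth_fun (\<lambda>x. \<Prod>i\<in>I. f i x)"
  by (induction I rule: finite_induct) (auto intro: smooth_fun_const smooth_fun_mult)

lemma smooth_fun_power: "smooth_fun f \<Longrightarrow> smooth_fun (\<lambda>x. f x ^ m)"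
  by (induction m) (auto intro: smooth_fun_const smooth_fun_mult)

lemma partial_power:
  assumes "smooth_fun f"
  shows "partial i (\<lambda>x. f x ^ m) = (\<lambda>x. real m * f x ^ (m - 1) * partial i f x)"
  by (rule partial_compose[OF _ assms]) (auto intro!: derivative_eq_intros)

lemma smooth_fun_nth: "smooth_fun (\<lambda>x::real^'n::finite. x $ i)"
proof (rule smooth_fun_coinduct[of _ "insert (\<lambda>x::real^'n. x $ i) (range (\<lambda>c x. c))"])
  have *: "((\<lambda>x. x $ i) has_derivative (\<lambda>v. v $ i)) (at x)" for x :: "real^'n"
    by (intro bounded_linear_imp_has_derivative bounded_linear_vec_nth)
  fix f and x :: "real^'n" assume "f \<in> insert (\<lambda>x::real^'n. x $ i) (range (\<lambda>c x. c))"
  then show "f differentiable (at x)"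
    using * has_derivative_const unfolding differentiable_def by fastforce
next
  have *: "((\<lambda>x. x $ i) has_derivative (\<lambda>v. v $ i)) (at x)" for x :: "real^'n"
    by (intro bounded_linear_imp_has_derivative bounded_linear_vec_nth)
  fix f and j assume "f \<in> insert (\<lambda>x::real^'n. x $ i) (range (\<lambda>c x. c))"
  moreover have "partial j (\<lambda>x::real^'n. x $ i) = (\<lambda>x. axis j 1 $ i)"
    by (rule ext) (rule partial_eqI[OF *])
  ultimately show "partial j f \<in> insert (\<lambda>x::real^'n. x $ i) (range (\<lambda>c x. c))"
    by auto
qed auto

text \<open>Smoothness on the line is witnessed by an explicit sequence of successive derivatives;
  for \<open>flat\<close> and its rescalings such a sequence can be written down.\<close>

definition smooth_real :: "(real \<Rightarrow> real) \<Rightarrow> bool" where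
  "smooth_real g \<longleftrightarrow> (\<exists>D. D 0 = g \<and> (\<forall>n t. (D n has_real_derivative D (Suc n) t) (at t)))"

lemma smooth_realE:
  assumes "smooth_real g"
  obtains g' where "smooth_real g'" "\<And>t. (g has_real_derivative g' t) (at t)"
proof -
  obtain D where D: "D 0 = g" "\<forall>n t. (D n has_real_derivative D (Suc n) t) (at t)"
    using assms unfolding smooth_real_def by blast
  show thesis
  proof (rule that[of "D 1"])
    show "smooth_real (D 1)"
      unfolding smooth_real_def by (rule exI[of _ "\<lambda>n. D (Suc n)"]) (use D in auto)
  qed (use D in \<open>auto dest: spec[of _ 0]\<close>)
qed

text \<open>The chain rule turns \<open>J (\<phi> x) * \<theta> x\<close> into terms of the same
  shape, with \<open>J\<close> or its derivative in front and a new smooth factor behind. Carrying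
  an arbitrary factor \<open>\<theta>\<close> is what makes the class closed under
  \<open>partial\<close>.\<close>

inductive_set smooth_composites :: "(real^'n::finite \<Rightarrow> real) \<Rightarrow> (real^'n \<Rightarrow> real) set" for \<phi> where
  comp: "smooth_real J \<Longrightarrow> smooth_fun \<theta> \<Longrightarrow> (\<lambda>x. J (\<phi> x) * \<theta> x) \<in> smooth_composites \<phi>"
| add: "f \<in> smooth_composites \<phi> \<Longrightarrow> g \<in> smooth_composites \<phi> \<Longrightarrow> (\<lambda>x. f x + g x) \<in> smooth_composites \<phi>"

lemma smooth_composites_closed:
  assumes "smooth_fun \<phi>"
  shows "f \<in> smooth_composites \<phi> \<Longrightarrow>
    (\<forall>x. f differentiable (at x)) \<and> (\<forall>i. partial i f \<in> smooth_composites \<phi>)"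
proof (induction rule: smooth_composites.induct)
  case (comp J \<theta>)
  then obtain J' where J': "smooth_real J'" "\<And>t. (J has_real_derivative J' t) (at t)"
    using smooth_realE by blast
  have d: "((\<lambda>x. J (\<phi> x)) has_derivative (\<lambda>v. J' (\<phi> x) * frechet_derivative \<phi> (at x) v)) (at x)" for x
    using has_derivative_compose[OF smooth_fun_has_derivative[OF assms, of x]
        J'(2)[of "\<phi> x", unfolded has_field_derivative_def]] by simp
  have D: "((\<lambda>x. J (\<phi> x) * \<theta> x) has_derivative (\<lambda>v. J (\<phi> x) * frechet_derivative \<theta> (at x) v
      + J' (\<phi> x) * frechet_derivative \<phi> (at x) v * \<theta> x)) (at x)" for x
    using has_derivative_mult[OF d smooth_fun_has_derivative[OF comp(2)]] by simp
  have "partial i (\<lambda>x. J (\<phi> x) * \<theta> x) = (\<lambda>x. J (\<phi> x) * partial i \<theta> x + J' (\<phi> x) * (partial i \<phi> x * \<theta> x))" for i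
    by (rule ext, rule partial_eqI[OF D, THEN trans]) (simp add: partial_def mult_ac)
  then show ?case
    using D comp J' assms
    by (auto simp: differentiable_def
        intro!: smooth_composites.intros smooth_fun_partial smooth_fun_mult)
next
  case (add f g)
  have "partial i (\<lambda>x. f x + g x) = (\<lambda>x. partial i f x + partial i g x)" for i
    using add.IH
    by (intro ext, intro partial_eqI[THEN trans])
      (auto intro!: has_derivative_add frechet_derivative_works[THEN iffD1] simp: partial_def)
  with add.IH show ?case
    by (auto intro!: smooth_composites.intros differentiable_add)
qed

lemma smooth_fun_compose:
  assumes "smooth_real J" "smooth_fun \<phi>"
  shows "smooth_fun (\<lambda>x. J (\<phi> x))"
  by (rule smooth_fun_coinduct[of _ "smooth_composites \<phi>"])
    (use assms smooth_composites_closed[OF assms(2)]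
      smooth_composites.comp[OF assms(1) smooth_fun_const[of 1], of \<phi>] in auto)

text \<open>This family is closed under differentiation, which makes \<open>exp (- 1 / t)\<close> smooth across \<open>0\<close>.\<close>

definition flat :: "real poly \<Rightarrow> real \<Rightarrow> real" where
  "flat P t = (if t > 0 then poly P (1 / t) * exp (- 1 / t) else 0)"

text \<open>On the right, the substitution \<open>x = 1 / t\<close> leaves a polynomial divided by
  an exponential at infinity; on the left the function is zero. This is the only limit needed for
  smoothness at \<open>0\<close>.\<close>

lemma flat_tendsto_0: "(flat P \<longlongrightarrow> 0) (at 0)"
proof (rule filterlim_split_at)
  show "(flat P \<longlongrightarrow> 0) (at_left 0)"
    by (rule tendsto_eventually) (auto simp: flat_def eventually_at_filter)
next
  have "((\<lambda>x. (\<Sum>i\<le>degree P. coeff P i * (x ^ i / exp x))) \<longlongrightarrow> (\<Sum>i\<le>degree P. coeff P i * 0)) at_top"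
    by (intro tendsto_sum tendsto_mult tendsto_const tendsto_power_div_exp_0)
  then have "((\<lambda>x. poly P x * exp (- x)) \<longlongrightarrow> 0) at_top"
    by (simp add: poly_altdef sum_distrib_right exp_minus field_simps sum_divide_distrib)
  then have "((\<lambda>t. poly P (inverse t) * exp (- inverse t)) \<longlongrightarrow> 0) (at_right 0)"
    by (rule filterlim_compose) (rule filterlim_inverse_at_top_right)
  then show "(flat P \<longlongrightarrow> 0) (at_right 0)"
    by (rule Lim_transform_eventually)
      (auto simp: flat_def eventually_at_filter inverse_eq_divide)
qed

text \<open>For \<open>t > 0\<close> the derivative of \<open>P(1/t) exp(-1/t)\<close> is
  \<open>(1/t^2) (P - P')(1/t) exp(-1/t)\<close>, that is, \<open>flat\<close> of the polynomial
  \<open>X^2 (P - P')\<close>; here \<open>[:0, 0, 1:]\<close> is \<open>X^2\<close>.\<close>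

lemma flat_has_derivative:
  "(flat P has_real_derivative flat ([:0, 0, 1:] * (P - pderiv P)) t) (at t)"
proof -
  consider "t > 0" | "t < 0" | "t = 0" by linarith
  then show ?thesis
  proof cases
    case 1
    have "((\<lambda>t. poly P (1 / t) * exp (- 1 / t)) has_real_derivative
        flat ([:0, 0, 1:] * (P - pderiv P)) t) (at t)"
      using 1 by (auto intro!: derivative_eq_intros DERIV_chain2[OF poly_DERIV]
          simp: flat_def field_simps power2_eq_square)
    moreover have "eventually (\<lambda>s. flat P s = poly P (1 / s) * exp (- 1 / s)) (nhds t)"
      using 1 by (intro eventually_mono[OF eventually_nhds_in_open[of "{0<..}"]])
        (auto simp: flat_def)
    ultimately show ?thesis
      by (subst DERIV_cong_ev) auto
  next
    case 2
    moreover have "eventually (\<lambda>s. flat P s = 0) (nhds t)"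
      using 2 by (intro eventually_mono[OF eventually_nhds_in_open[of "{..<0}"]])
        (auto simp: flat_def)
    ultimately show ?thesis
      by (subst DERIV_cong_ev[of _ t _ "\<lambda>_. 0" _ 0]) (auto simp: flat_def)
  next
    case 3
    \<comment> \<open>Dividing by \<open>h\<close> multiplies the polynomial in \<open>1 / h\<close>
      by \<open>X\<close>, so the difference quotient at \<open>0\<close> is again a
      \<open>flat\<close> function.\<close>
    have "((\<lambda>h. flat P h / h) \<longlongrightarrow> 0) (at 0)"
      by (rule Lim_transform_eventually[OF flat_tendsto_0[of "[:0, 1:] * P"]])
        (auto simp: flat_def eventually_at_filter)
    then show ?thesis
      using 3 by (simp add: has_field_derivative_iff flat_def)
  qed
qed

lemma smooth_real_flat: "smooth_real (flat P)"
  unfolding smooth_real_def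
  by (rule exI[of _ "\<lambda>n. flat (((\<lambda>P. [:0, 0, 1:] * (P - pderiv P)) ^^ n) P)"])
    (auto simp: flat_has_derivative simp del: mult_pCons_left)

lemma smooth_real_scale:
  assumes "smooth_real g"
  shows "smooth_real (\<lambda>t. g (c * t + d))"
proof -
  obtain D where D: "D 0 = g" "\<forall>n t. (D n has_real_derivative D (Suc n) t) (at t)"
    using assms unfolding smooth_real_def by blast
  have "((\<lambda>t. c ^ n * D n (c * t + d)) has_real_derivative c ^ Suc n * D (Suc n) (c * t + d)) (at t)" for n t
    by (auto intro!: derivative_eq_intros DERIV_chain2[OF D(2)[rule_format]])
  then show ?thesis
    unfolding smooth_real_def
    by (intro exI[of _ "\<lambda>n t. c ^ n * D n (c * t + d)"]) (simp add: D)
qed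

section \<open>Test functions and operations on them\<close>

lemma test_funI:
  assumes "smooth_fun \<phi>" "compact K" "K \<subseteq> \<Omega>" "\<And>x. x \<notin> K \<Longrightarrow> \<phi> x = 0"
  shows "\<phi> \<in> test_fun \<Omega>"
proof -
  have "closure {x. \<phi> x \<noteq> 0} \<subseteq> K"
    by (rule closure_minimal) (use assms compact_imp_closed in auto)
  moreover have "compact (closure {x. \<phi> x \<noteq> 0})"
    using calculation assms(2) by (metis bounded_subset compact_eq_bounded_closed closed_closure)
  ultimately show ?thesis
    using assms by (auto simp: test_fun_def)
qed

lemma test_fun_smooth: "\<phi> \<in> test_fun \<Omega> \<Longrightarrow> smooth_fun \<phi>"
  by (simp add: test_fun_def)

text \<open>Off the closed support the function vanishes in a neighbourhood, so its partial
  derivatives vanish there too, and one compact set serves the function and its gradient.\<close>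

lemma test_funE:
  assumes "\<phi> \<in> test_fun \<Omega>"
  obtains K where "compact K" "K \<subseteq> \<Omega>" "\<And>x. x \<notin> K \<Longrightarrow> \<phi> x = 0"
    "\<And>x i. x \<notin> K \<Longrightarrow> partial i \<phi> x = 0"
proof (rule that[of "closure {x. \<phi> x \<noteq> 0}"])
  let ?K = "closure {x. \<phi> x \<noteq> 0}"
  show "partial i \<phi> x = 0" if "x \<notin> ?K" for x i
  proof -
    have "(\<phi> has_derivative (\<lambda>v. 0)) (at x)"
      by (rule has_derivative_transform_within_open[of "\<lambda>_. 0" _ _ _ "- ?K"])
        (use that closure_subset[of "{x. \<phi> x \<noteq> 0}"] in auto)
    then show ?thesis by (rule partial_eqI)
  qed
  show "\<phi> x = 0" if "x \<notin> ?K" for x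
    using that closure_subset by force
qed (use assms in \<open>auto simp: test_fun_def\<close>)

lemma test_fun_add:
  assumes "\<phi> \<in> test_fun \<Omega>" "\<psi> \<in> test_fun \<Omega>"
  shows "(\<lambda>x. \<phi> x + \<psi> x) \<in> test_fun \<Omega>"
proof -
  obtain K L where "compact K" "K \<subseteq> \<Omega>" "\<And>x. x \<notin> K \<Longrightarrow> \<phi> x = 0" "compact L" "L \<subseteq> \<Omega>" "\<And>x. x \<notin> L \<Longrightarrow> \<psi> x = 0"
    using assms by (metis test_funE)
  then show ?thesis
    using assms by (intro test_funI[of _ "K \<union> L"]) (auto intro: smooth_fun_add test_fun_smooth)
qed

lemma test_fun_mult:
  assumes "\<phi> \<in> test_fun \<Omega>" "smooth_fun \<psi>"
  shows "(\<lambda>x. \<phi> x * \<psi> x) \<in> test_fun \<Omega>"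
proof -
  obtain K where "compact K" "K \<subseteq> \<Omega>" "\<And>x. x \<notin> K \<Longrightarrow> \<phi> x = 0"
    using assms by (metis test_funE)
  then show ?thesis
    using assms by (intro test_funI[of _ K]) (auto intro: smooth_fun_mult test_fun_smooth)
qed

lemma test_fun_cmult: "\<phi> \<in> test_fun \<Omega> \<Longrightarrow> (\<lambda>x. c * \<phi> x) \<in> test_fun \<Omega>"
  using test_fun_mult[OF _ smooth_fun_const[of c], of \<phi> \<Omega>] by (simp add: mult.commute)

lemma test_fun_diff:
  "\<phi> \<in> test_fun \<Omega> \<Longrightarrow> \<psi> \<in> test_fun \<Omega> \<Longrightarrow> (\<lambda>x. \<phi> x - \<psi> x) \<in> test_fun \<Omega>"
  using test_fun_add[OF _ test_fun_cmult[of \<psi> \<Omega> "-1"], of \<phi>] by simp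

lemma test_fun_power:
  assumes "\<phi> \<in> test_fun \<Omega>" "m > 0"
  shows "(\<lambda>x. \<phi> x ^ m) \<in> test_fun \<Omega>"
  using test_fun_mult[OF assms(1) smooth_fun_power[OF test_fun_smooth[OF assms(1)]], of "m - 1"] assms(2)
  by (simp flip: power_Suc)

section \<open>Integration along lines\<close>

lemma grad_continuous: "smooth_fun \<phi> \<Longrightarrow> continuous_on S (grad \<phi>)"
  unfolding grad_def[abs_def]
  by (intro continuous_intros smooth_fun_continuous smooth_fun_partial)

lemma grad_borel: "smooth_fun \<phi> \<Longrightarrow> grad \<phi> \<in> borel_measurable borel"
  by (simp add: borel_measurable_continuous_onI grad_continuous)

lemma nn_integral_translation:
  fixes c :: "'a::euclidean_space"
  assumes [measurable]: "f \<in> borel_measurable borel"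
  shows "(\<integral>\<^sup>+x. f (x + c) \<partial>lborel) = (\<integral>\<^sup>+x. f x \<partial>lborel)"
proof -
  have "(\<integral>\<^sup>+x. f x \<partial>lborel) = (\<integral>\<^sup>+x. f x \<partial>(distr lborel borel ((+) c)))"
    by (simp add: lborel_distr_plus)
  also have "\<dots> = (\<integral>\<^sup>+x. f (x + c) \<partial>lborel)"
    by (subst nn_integral_distr) (auto simp: add.commute)
  finally show ?thesis by simp
qed

lemma integral_translation:
  fixes c :: "'a::euclidean_space" and f :: "'a \<Rightarrow> real"
  assumes [measurable]: "f \<in> borel_measurable borel"
  shows "(LINT x|lborel. f (x + c)) = (LINT x|lborel. f x)"
proof -
  have "(LINT x|lborel. f x) = (LINT x|(distr lborel borel ((+) c)). f x)"
    by (simp add: lborel_distr_plus)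
  also have "\<dots> = (LINT x|lborel. f (x + c))"
    by (subst integral_distr) (auto simp: add.commute)
  finally show ?thesis by simp
qed

lemma line_FTC:
  assumes "smooth_fun \<theta>" "a \<le> b"
  shows "(LINT t|lborel. (grad \<theta> (x + t *\<^sub>R \<xi>) \<bullet> \<xi>) * indicator {a..b} t) = \<theta> (x + b *\<^sub>R \<xi>) - \<theta> (x + a *\<^sub>R \<xi>)"
proof (rule integral_FTC_Icc_real[OF assms(2)])
  fix t :: real
  have "((\<lambda>t. \<theta> (x + t *\<^sub>R \<xi>)) has_derivative (\<lambda>h. grad \<theta> (x + t *\<^sub>R \<xi>) \<bullet> (h *\<^sub>R \<xi>))) (at t)"
    by (rule has_derivative_compose[of "\<lambda>t. x + t *\<^sub>R \<xi>" "\<lambda>h. h *\<^sub>R \<xi>", OF _ smooth_fun_has_derivative_grad[OF assms(1)]])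
      (auto intro!: derivative_eq_intros)
  then show "((\<lambda>t. \<theta> (x + t *\<^sub>R \<xi>)) has_real_derivative grad \<theta> (x + t *\<^sub>R \<xi>) \<bullet> \<xi>) (at t)"
    unfolding has_field_derivative_def by (rule has_derivative_eq_rhs) (auto simp: fun_eq_iff)
  have "continuous_on UNIV (\<lambda>t. grad \<theta> (x + t *\<^sub>R \<xi>) \<bullet> \<xi>)"
    by (intro continuous_intros continuous_on_compose2[OF grad_continuous[OF assms(1), of UNIV]]) auto
  then show "isCont (\<lambda>t. grad \<theta> (x + t *\<^sub>R \<xi>) \<bullet> \<xi>) t"
    by (simp add: continuous_on_eq_continuous_at)
qed

lemma line_FTC_nn:
  assumes "smooth_fun \<theta>" "a \<le> b"
  shows "ennreal \<bar>\<theta> (x + b *\<^sub>R \<xi>) - \<theta> (x + a *\<^sub>R \<xi>)\<bar>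
    \<le> (\<integral>\<^sup>+t. ennreal \<bar>grad \<theta> (x + t *\<^sub>R \<xi>) \<bullet> \<xi>\<bar> * indicator {a..b} t \<partial>lborel)"
proof -
  have "continuous_on {a..b} (\<lambda>t. grad \<theta> (x + t *\<^sub>R \<xi>) \<bullet> \<xi>)"
    by (intro continuous_intros continuous_on_compose2[OF grad_continuous[OF assms(1), of UNIV]]) auto
  from borel_integrable_compact[OF compact_Icc this]
  have int: "integrable lborel (\<lambda>t. (grad \<theta> (x + t *\<^sub>R \<xi>) \<bullet> \<xi>) * indicator {a..b} t)"
    by (simp add: mult.commute)
  have "ennreal \<bar>\<theta> (x + b *\<^sub>R \<xi>) - \<theta> (x + a *\<^sub>R \<xi>)\<bar>
      \<le> (\<integral>\<^sup>+t. ennreal (norm ((grad \<theta> (x + t *\<^sub>R \<xi>) \<bullet> \<xi>) * indicator {a..b} t)) \<partial>lborel)"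
    using integral_norm_bound_ennreal[OF int] line_FTC[OF assms] by simp
  also have "\<dots> = (\<integral>\<^sup>+t. ennreal \<bar>grad \<theta> (x + t *\<^sub>R \<xi>) \<bullet> \<xi>\<bar> * indicator {a..b} t \<partial>lborel)"
    by (intro nn_integral_cong) (auto simp: indicator_def)
  finally show ?thesis .
qed

lemma test_fun_bounded_support:
  assumes "\<phi> \<in> test_fun \<Omega>"
  obtains R where "R > 0" "\<And>x. norm x \<ge> R \<Longrightarrow> \<phi> x = 0" "\<And>x i. norm x \<ge> R \<Longrightarrow> partial i \<phi> x = 0"
proof -
  obtain K where K: "compact K" "\<And>x. x \<notin> K \<Longrightarrow> \<phi> x = 0" "\<And>x i. x \<notin> K \<Longrightarrow> partial i \<phi> x = 0"
    using assms test_funE by metis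
  obtain R where "R > 0" "\<And>x. x \<in> K \<Longrightarrow> norm x < R"
    using compact_imp_bounded[OF K(1)] by (auto simp: bounded_pos_less)
  with K show thesis using that by (metis not_le)
qed

text \<open>Integration starts outside the support, at parameter \<open>- (R + norm x)\<close>,
  which is far enough in every direction. Extending the integral to the whole line makes the bound
  independent of the position on that line.\<close>

lemma test_fun_line_bound:
  fixes \<theta> :: "real^'n::finite \<Rightarrow> real"
  assumes "\<theta> \<in> test_fun \<Omega>"
  shows "ennreal \<bar>\<theta> x\<bar> \<le> (\<integral>\<^sup>+t. ennreal \<bar>partial i \<theta> (x + t *\<^sub>R axis i 1)\<bar> \<partial>lborel)"
proof -
  have sm: "smooth_fun \<theta>" using assms by (rule test_fun_smooth)
  obtain R where R: "R > 0" "\<And>x. norm x \<ge> R \<Longrightarrow> \<theta> x = 0"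
    using assms test_fun_bounded_support by metis
  define a where "a = - (R + norm x)"
  have "norm (x + a *\<^sub>R axis i 1) \<ge> norm (a *\<^sub>R axis i (1::real)) - norm x"
    by (metis add.commute norm_diff_ineq)
  then have "\<theta> (x + a *\<^sub>R axis i 1) = 0"
    using R(1) by (intro R(2)) (simp add: a_def norm_axis_1)
  then have "ennreal \<bar>\<theta> x\<bar> \<le> (\<integral>\<^sup>+t. ennreal \<bar>grad \<theta> (x + t *\<^sub>R axis i 1) \<bullet> axis i 1\<bar> * indicator {a..0} t \<partial>lborel)"
    using line_FTC_nn[OF sm, of a 0 x "axis i 1"] R(1) norm_ge_zero[of x] by (simp add: a_def)
  also have "\<dots> \<le> (\<integral>\<^sup>+t. ennreal \<bar>partial i \<theta> (x + t *\<^sub>R axis i 1)\<bar> \<partial>lborel)"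
    by (intro nn_integral_mono) (simp add: inner_axis partial_nth_grad indicator_def)
  finally show ?thesis .
qed

lemma integrable_compact_support:
  fixes f :: "'a::euclidean_space \<Rightarrow> real"
  assumes "continuous_on UNIV f" "\<And>x. norm x \<ge> R \<Longrightarrow> f x = 0"
  shows "integrable lborel f"
proof -
  have "integrable lborel (\<lambda>x. indicator (cball 0 R) x *\<^sub>R f x)"
    using assms(1) by (intro borel_integrable_compact) (auto intro: continuous_on_subset)
  moreover have "(\<lambda>x. indicator (cball 0 R) x *\<^sub>R f x) = f"
    using assms(2) by (auto simp: indicator_def fun_eq_iff)
  ultimately show ?thesis by simp
qed

text \<open>The increment of \<open>\<theta>\<close> over a unit step in direction \<open>i\<close>
  integrates to zero by translation invariance. By the fundamental theorem and Fubini the same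
  integral is the average over \<open>t\<close> in \<open>[0, 1]\<close> of the integrals of the
  translates of \<open>partial i \<theta>\<close>, which all agree. This avoids splitting the space
  into coordinates.\<close>

lemma integral_partial_eq_0:
  fixes \<theta> :: "real^'n::finite \<Rightarrow> real"
  assumes "\<theta> \<in> test_fun \<Omega>"
  shows "(LINT x|lborel. partial i \<theta> x) = 0"
proof -
  have sm: "smooth_fun \<theta>" using assms by (rule test_fun_smooth)
  obtain R where R: "R > 0" "\<And>x. norm x \<ge> R \<Longrightarrow> \<theta> x = 0" "\<And>x i. norm x \<ge> R \<Longrightarrow> partial i \<theta> x = 0"
    using assms test_fun_bounded_support by metis
  let ?e = "axis i (1::real) :: real^'n"
  define f where "f x t = partial i \<theta> (x + t *\<^sub>R ?e) * indicator {0..1} t" for x t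
  have pc: "continuous_on UNIV (partial i \<theta>)"
    using sm by (intro smooth_fun_continuous smooth_fun_partial)
  note [measurable] = borel_measurable_continuous_onI[OF pc] smooth_fun_borel[OF sm]
  have eq: "(LINT t|lborel. f x t) = \<theta> (x + ?e) - \<theta> x" for x
    using line_FTC[OF sm, of 0 1 x ?e] by (simp add: f_def inner_axis partial_nth_grad)
  \<comment> \<open>Fubini requires joint integrability. For \<open>t\<close> in
    \<open>[0, 1]\<close> the integrand vanishes once \<open>norm x > R + 1\<close>, so cutting off
    to a compact product changes nothing.\<close>
  have "integrable lborel (\<lambda>z::(real^'n) \<times> real. indicator (cball 0 (R + 1) \<times> {0..1}) z *\<^sub>R partial i \<theta> (fst z + snd z *\<^sub>R ?e))"
    by (intro borel_integrable_compact compact_Times compact_cball compact_Icc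
        continuous_on_compose2[OF pc] continuous_intros) auto
  also have "(\<lambda>z. indicator (cball 0 (R + 1) \<times> {0..1}) z *\<^sub>R partial i \<theta> (fst z + snd z *\<^sub>R ?e)) = case_prod f"
  proof
    fix z :: "(real^'n) \<times> real"
    obtain x t where z: "z = (x, t)" by fastforce
    have "partial i \<theta> (x + t *\<^sub>R ?e) = 0" if "t \<in> {0..1}" "norm x > R + 1"
    proof (rule R(3))
      have "norm (x + t *\<^sub>R ?e) \<ge> norm x - norm (t *\<^sub>R ?e)"
        by (metis norm_diff_ineq)
      then show "norm (x + t *\<^sub>R ?e) \<ge> R" using that by (simp add: norm_axis_1)
    qed
    then show "indicator (cball 0 (R + 1) \<times> {0..1}) z *\<^sub>R partial i \<theta> (fst z + snd z *\<^sub>R ?e) = case_prod f z"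
      by (auto simp: z f_def indicator_def)
  qed
  finally have "integrable (lborel \<Otimes>\<^sub>M lborel) (case_prod f)"
    by (simp add: lborel_prod)
  from lborel_pair.Fubini_integral[OF this]
  have "(LINT t|lborel. (LINT x|lborel. f x t)) = (LINT x|lborel. \<theta> (x + ?e) - \<theta> x)"
    by (simp add: eq)
  also have "\<dots> = 0"
  proof -
    have 1: "integrable lborel \<theta>"
      by (rule integrable_compact_support[of _ R]) (use R smooth_fun_continuous[OF sm] in auto)
    have 2: "integrable lborel (\<lambda>x. \<theta> (x + ?e))"
    proof (rule integrable_compact_support[of _ "R + 1"])
      show "continuous_on UNIV (\<lambda>x. \<theta> (x + ?e))"
        by (intro continuous_on_compose2[OF smooth_fun_continuous[OF sm, of UNIV]] continuous_intros) auto
      fix x :: "real^'n" assume "R + 1 \<le> norm x"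
      moreover have "norm (x + ?e) \<ge> norm x - norm ?e"
        by (metis norm_diff_ineq)
      ultimately show "\<theta> (x + ?e) = 0" by (intro R(2)) (simp add: norm_axis_1)
    qed
    show ?thesis
      using 1 2 integral_translation[of \<theta> ?e] by simp
  qed
  finally have "0 = (LINT t|lborel. (LINT x|lborel. partial i \<theta> (x + t *\<^sub>R ?e)) * indicator {0..1} t)"
    by (simp add: f_def)
  also have "\<dots> = (LINT t|lborel. (LINT x|lborel. partial i \<theta> x) * indicator {0..1::real} t)"
    by (subst integral_translation) auto
  finally show ?thesis by simp
qed

lemma test_fun_integration_by_parts:
  fixes \<phi> \<psi> :: "real^'n::finite \<Rightarrow> real"
  assumes "\<phi> \<in> test_fun \<Omega>" "\<psi> \<in> test_fun \<Omega>"
  shows "(LINT x|lborel. \<psi> x * partial i \<phi> x) = - (LINT x|lborel. partial i \<psi> x * \<phi> x)"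
proof -
  have sm: "smooth_fun \<phi>" "smooth_fun \<psi>" using assms test_fun_smooth by auto
  obtain R where R: "\<And>x. norm x \<ge> R \<Longrightarrow> \<phi> x = 0" "\<And>x i. norm x \<ge> R \<Longrightarrow> partial i \<phi> x = 0"
    using assms(1) test_fun_bounded_support by metis
  have int: "integrable lborel (\<lambda>x. \<psi> x * partial i \<phi> x)" "integrable lborel (\<lambda>x. partial i \<psi> x * \<phi> x)"
    using R sm by (auto intro!: integrable_compact_support[of _ R] continuous_intros
        smooth_fun_continuous smooth_fun_partial smooth_fun_mult)
  have "0 = (LINT x|lborel. partial i (\<lambda>x. \<psi> x * \<phi> x) x)"
    using integral_partial_eq_0[OF test_fun_mult[OF assms(2) sm(1)], of i] by simp
  also have "\<dots> = (LINT x|lborel. partial i \<psi> x * \<phi> x + \<psi> x * partial i \<phi> x)"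
    by (simp add: partial_mult sm)
  finally show ?thesis using int by simp
qed

text \<open>The increment is the integral of \<open>grad \<phi> \<bullet> \<xi>\<close> along a
  segment; Cauchy-Schwarz on \<open>[0, 1]\<close>, Fubini and translation invariance give an
  \<open>L2\<close> modulus linear in \<open>norm \<xi>\<close>. In the dual estimate this takes the
  place of a compact embedding.\<close>

lemma translation_estimate:
  fixes \<phi> :: "real^'n::finite \<Rightarrow> real"
  assumes sm: "smooth_fun \<phi>"
  shows "(\<integral>\<^sup>+x. ennreal ((\<phi> (x + \<xi>) - \<phi> x)\<^sup>2) \<partial>lborel)
    \<le> ennreal ((norm \<xi>)\<^sup>2) * (\<integral>\<^sup>+x. ennreal ((norm (grad \<phi> x))\<^sup>2) \<partial>lborel)"
proof -
  note [measurable] = grad_borel[OF sm] smooth_fun_borel[OF sm]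
  define F where "F x t = ennreal (norm (grad \<phi> (x + t *\<^sub>R \<xi>)) * norm \<xi>) * indicator {0..1::real} t" for x t
  have [measurable]: "case_prod F \<in> borel_measurable (borel \<Otimes>\<^sub>M borel)" "F x \<in> borel_measurable borel" for x
    unfolding F_def[abs_def] by measurable
  have "ennreal ((\<phi> (x + \<xi>) - \<phi> x)\<^sup>2) \<le> (\<integral>\<^sup>+t. (F x t)\<^sup>2 \<partial>lborel)" for x
  proof -
    have "ennreal \<bar>\<phi> (x + 1 *\<^sub>R \<xi>) - \<phi> (x + 0 *\<^sub>R \<xi>)\<bar> \<le> (\<integral>\<^sup>+t. F x t * indicator {0..1} t \<partial>lborel)"
      by (rule order_trans[OF line_FTC_nn[OF sm]])
        (auto intro!: nn_integral_mono ennreal_leI Cauchy_Schwarz_ineq2 simp: F_def indicator_def)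
    then have "(ennreal \<bar>\<phi> (x + \<xi>) - \<phi> x\<bar>)\<^sup>2 \<le> (\<integral>\<^sup>+t. F x t * indicator {0..1} t \<partial>lborel)\<^sup>2"
      by (intro power_mono) auto
    also have "\<dots> \<le> (\<integral>\<^sup>+t. (F x t)\<^sup>2 \<partial>lborel) * (\<integral>\<^sup>+t. (indicator {0..1::real} t)\<^sup>2 \<partial>lborel)"
      by (rule Cauchy_Schwarz_nn_integral) auto
    also have "(\<integral>\<^sup>+t. (indicator {0..1::real} t)\<^sup>2 \<partial>lborel) = (\<integral>\<^sup>+t. indicator {0..1::real} t \<partial>lborel)"
      by (intro nn_integral_cong) (auto simp: indicator_def)
    finally show ?thesis
      by (simp add: ennreal_power)
  qed
  then have "(\<integral>\<^sup>+x. ennreal ((\<phi> (x + \<xi>) - \<phi> x)\<^sup>2) \<partial>lborel) \<le> (\<integral>\<^sup>+x. (\<integral>\<^sup>+t. (F x t)\<^sup>2 \<partial>lborel) \<partial>lborel)"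
    by (rule nn_integral_mono)
  also have "\<dots> = (\<integral>\<^sup>+t. (\<integral>\<^sup>+x. (F x t)\<^sup>2 \<partial>lborel) \<partial>lborel)"
    by (rule lborel_pair.Fubini'[symmetric]) measurable
  also have "\<dots> = (\<integral>\<^sup>+t. (\<integral>\<^sup>+x. ennreal ((norm (grad \<phi> x) * norm \<xi>)\<^sup>2) \<partial>lborel) * indicator {0..1::real} t \<partial>lborel)"
  proof (rule nn_integral_cong)
    fix t :: real
    have "(\<integral>\<^sup>+x. (F x t)\<^sup>2 \<partial>lborel) = (\<integral>\<^sup>+x. ennreal ((norm (grad \<phi> (x + t *\<^sub>R \<xi>)) * norm \<xi>)\<^sup>2) * indicator {0..1::real} t \<partial>lborel)"
      by (intro nn_integral_cong) (auto simp: F_def indicator_def ennreal_power)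
    also have "\<dots> = (\<integral>\<^sup>+x. ennreal ((norm (grad \<phi> (x + t *\<^sub>R \<xi>)) * norm \<xi>)\<^sup>2) \<partial>lborel) * indicator {0..1::real} t"
      by (rule nn_integral_multc) measurable
    also have "\<dots> = (\<integral>\<^sup>+x. ennreal ((norm (grad \<phi> x) * norm \<xi>)\<^sup>2) \<partial>lborel) * indicator {0..1::real} t"
      by (subst nn_integral_translation[of "\<lambda>x. ennreal ((norm (grad \<phi> x) * norm \<xi>)\<^sup>2)"]) measurable
    finally show "(\<integral>\<^sup>+x. (F x t)\<^sup>2 \<partial>lborel) = (\<integral>\<^sup>+x. ennreal ((norm (grad \<phi> x) * norm \<xi>)\<^sup>2) \<partial>lborel) * indicator {0..1::real} t" .
  qed
  also have "\<dots> = (\<integral>\<^sup>+x. ennreal ((norm (grad \<phi> x) * norm \<xi>)\<^sup>2) \<partial>lborel)"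
    by (subst nn_integral_cmult) auto
  also have "\<dots> = ennreal ((norm \<xi>)\<^sup>2) * (\<integral>\<^sup>+x. ennreal ((norm (grad \<phi> x))\<^sup>2) \<partial>lborel)"
    by (subst nn_integral_cmult[symmetric]) (auto simp: power_mult_distrib ennreal_mult mult.commute)
  finally show ?thesis .
qed

section \<open>The fundamental lemma of the calculus of variations\<close>

lemma smooth_fun_lebesgue: "smooth_fun \<phi> \<Longrightarrow> \<phi> \<in> borel_measurable lebesgue"
  by (intro measurable_completion) (simp add: smooth_fun_borel)

text \<open>One factor for each face of the box: \<open>flat 1\<close> at \<open>m + 1\<close> times
  the distance to it. There is no plateau; since \<open>exp (- 1 / ((m + 1) c))\<close> tends to
  \<open>1\<close> for each \<open>c > 0\<close>, the bumps converge pointwise to the indicator of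
  the open box. The arguments are expanded into the form that \<open>smooth_real_scale\<close>
  covers.\<close>

definition box_bump :: "real^'n::finite \<Rightarrow> real^'n \<Rightarrow> nat \<Rightarrow> real^'n \<Rightarrow> real" where
  "box_bump l u m x =
    (\<Prod>i\<in>UNIV. flat 1 (real (Suc m) * (x $ i) + (- real (Suc m) * l $ i)) *
      flat 1 (- real (Suc m) * (x $ i) + real (Suc m) * u $ i))"

lemma smooth_fun_box_bump: "smooth_fun (box_bump l u m)"
  unfolding box_bump_def[abs_def]
  by (intro smooth_fun_prod smooth_fun_mult smooth_fun_compose[OF smooth_real_scale[OF smooth_real_flat]]
      smooth_fun_nth) simp

lemma flat_1_pos: "t > 0 \<Longrightarrow> flat 1 t = exp (- 1 / t)"
  by (simp add: flat_def)

lemma flat_1_bounds: "0 \<le> flat 1 t" "flat 1 t \<le> 1"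
  by (auto simp: flat_def)

lemma mem_box_nth: "x \<in> box l u \<longleftrightarrow> (\<forall>i. l $ i < x $ i \<and> x $ i < u $ i)"
  for x :: "real^'n::finite"
  by (auto simp: mem_box Basis_vec_def inner_axis)

lemma box_bump_outside: 
  assumes "x \<notin> box l u"
  shows "box_bump l u m x = 0"
proof -
  obtain i where i: "x $ i \<le> l $ i \<or> u $ i \<le> x $ i"
    using assms by (auto simp: mem_box_nth not_less)
  have "real (Suc m) * (x $ i) + (- real (Suc m) * l $ i) = real (Suc m) * (x $ i - l $ i)"
    "- real (Suc m) * (x $ i) + real (Suc m) * u $ i = real (Suc m) * (u $ i - x $ i)"
    by (simp_all add: algebra_simps)
  then have "flat 1 (real (Suc m) * (x $ i) + (- real (Suc m) * l $ i)) *
      flat 1 (- real (Suc m) * (x $ i) + real (Suc m) * u $ i) = 0"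
    using i by (auto simp: flat_def zero_less_mult_iff simp del: of_nat_Suc)
  then show ?thesis
    unfolding box_bump_def by (intro prod_zero) auto
qed

lemma box_bump_bounds: "0 \<le> box_bump l u m x" "box_bump l u m x \<le> 1"
  unfolding box_bump_def by (auto intro!: prod_nonneg prod_le_1 mult_le_one simp: flat_1_bounds)

lemma box_bump_test_fun:
  assumes "cbox l u \<subseteq> \<Omega>"
  shows "box_bump l u m \<in> test_fun \<Omega>"
proof (rule test_funI[OF smooth_fun_box_bump compact_cbox assms])
  show "box_bump l u m x = 0" if "x \<notin> cbox l u" for x
    using that box_subset_cbox[of l u] by (intro box_bump_outside) auto
qed

lemma flat_1_scale_tendsto:
  assumes "c > 0"
  shows "(\<lambda>m. flat 1 (real (Suc m) * c)) \<longlonglongrightarrow> 1"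
proof -
  have "(\<lambda>m. exp (- (1 / c) * (1 / real (Suc m)))) \<longlonglongrightarrow> exp (- (1 / c) * 0)"
    by (intro tendsto_intros LIMSEQ_Suc lim_1_over_n)
  moreover have "flat 1 (real (Suc m) * c) = exp (- (1 / c) * (1 / real (Suc m)))" for m
    using assms by (subst flat_1_pos) (simp_all add: zero_less_mult_iff del: of_nat_Suc)
  ultimately show ?thesis by simp
qed

lemma box_bump_tendsto: "(\<lambda>m. box_bump l u m x) \<longlonglongrightarrow> indicator (box l u) x"
proof (cases "x \<in> box l u")
  case True
  then have *: "l $ i < x $ i" "x $ i < u $ i" for i
    by (auto simp: mem_box_nth)
  have "(\<lambda>m. \<Prod>i\<in>UNIV. flat 1 (real (Suc m) * (x $ i - l $ i)) * flat 1 (real (Suc m) * (u $ i - x $ i)))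
    \<longlonglongrightarrow> (\<Prod>i\<in>(UNIV::'a set). 1 * 1)"
    using * by (intro tendsto_prod tendsto_mult flat_1_scale_tendsto) auto
  then show ?thesis
    using True by (simp add: box_bump_def algebra_simps del: of_nat_Suc)
qed (simp add: box_bump_outside)

text \<open>The bumps are test functions with values in \<open>[0, 1]\<close> that converge to the
  indicator, so dominated convergence with majorant \<open>\<bar>g\<bar>\<close> on the closed box
  carries the hypothesis over to boxes.\<close>

lemma integral_box_eq_0:
  fixes g :: "real^'n::finite \<Rightarrow> real"
  assumes "open \<Omega>" "L1loc \<Omega> g"
    and test: "\<And>\<phi>. \<phi> \<in> test_fun \<Omega> \<Longrightarrow> (LINT x|lebesgue_on \<Omega>. g x * \<phi> x) = 0"
    and sub: "cbox l u \<subseteq> \<Omega>"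
  shows "(LINT x|lebesgue. (if x \<in> box l u then g x else 0)) = 0"
proof -
  let ?h = "\<lambda>x. if x \<in> cbox l u then g x else 0"
  have int: "integrable lebesgue ?h"
    using assms(2) sub by (subst Lebesgue_Measure.integrable_restrict_UNIV) (auto simp: L1loc_def)
  then have meas[measurable]: "?h \<in> borel_measurable lebesgue"
    by blast
  have b_meas: "box_bump l u m \<in> borel_measurable lebesgue" for m
    by (intro smooth_fun_lebesgue smooth_fun_box_bump)
  have zero: "(LINT x|lebesgue. ?h x * box_bump l u m x) = 0" for m
  proof -
    have "(LINT x|lebesgue. ?h x * box_bump l u m x)
        = (LINT x|lebesgue. (if x \<in> \<Omega> then g x * box_bump l u m x else 0))"
      using sub box_subset_cbox[of l u]
      by (intro Bochner_Integration.integral_cong) (auto simp: subset_iff intro!: box_bump_outside)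
    also have "\<dots> = (LINT x|lebesgue_on \<Omega>. g x * box_bump l u m x)"
      using \<open>open \<Omega>\<close> by (intro Lebesgue_Measure.integral_restrict_UNIV) auto
    finally show ?thesis
      using test[OF box_bump_test_fun[OF sub]] by simp
  qed
  have "(\<lambda>m. LINT x|lebesgue. ?h x * box_bump l u m x)
      \<longlonglongrightarrow> (LINT x|lebesgue. ?h x * indicator (box l u) x)"
  proof (rule integral_dominated_convergence[where w = "\<lambda>x. norm (?h x)"])
    show "AE x in lebesgue. norm (?h x * box_bump l u m x) \<le> norm (?h x)" for m
      using box_bump_bounds[of l u m] by (auto simp: abs_mult mult_left_le)
    show "AE x in lebesgue. (\<lambda>m. ?h x * box_bump l u m x) \<longlonglongrightarrow> ?h x * indicator (box l u) x"
      by (intro AE_I2 tendsto_mult tendsto_const box_bump_tendsto)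
  qed (use int b_meas in \<open>auto intro!: borel_measurable_times borel_measurable_indicator\<close>)
  then have "(LINT x|lebesgue. ?h x * indicator (box l u) x) = 0"
    unfolding zero by (simp add: LIMSEQ_const_iff)
  moreover have "(LINT x|lebesgue. ?h x * indicator (box l u) x) = (LINT x|lebesgue. (if x \<in> box l u then g x else 0))"
    using box_subset_cbox[of l u]
    by (intro Bochner_Integration.integral_cong) (auto simp: indicator_def)
  ultimately show ?thesis by simp
qed

text \<open>Boxes are an intersection-stable generator of the Borel sets, so a function with zero
  integral over each box has zero integral over each Borel set and therefore the same density as
  zero. The Borel representative \<open>h'\<close> is introduced for this measure-theoretic
  induction.\<close>

lemma AE_box_eq_0:
  fixes g :: "real^'n::finite \<Rightarrow> real"
  assumes "open \<Omega>" "L1loc \<Omega> g"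
    and test: "\<And>\<phi>. \<phi> \<in> test_fun \<Omega> \<Longrightarrow> (LINT x|lebesgue_on \<Omega>. g x * \<phi> x) = 0"
    and sub: "cbox L U \<subseteq> \<Omega>"
  shows "AE x in lebesgue. x \<in> box L U \<longrightarrow> g x = 0"
proof -
  let ?h = "\<lambda>x. if x \<in> box L U then g x else 0"
  have "integrable (lebesgue_on (cbox L U)) g"
    using assms(2) sub by (auto simp: L1loc_def)
  then have "integrable lebesgue (\<lambda>x. if x \<in> cbox L U then g x else 0)"
    by (subst Lebesgue_Measure.integrable_restrict_UNIV) auto
  then have "integrable lebesgue (\<lambda>x. indicator (box L U) x *\<^sub>R (if x \<in> cbox L U then g x else 0))"
    by (intro integrable_mult_indicator) auto
  moreover have "(\<lambda>x. indicator (box L U) x *\<^sub>R (if x \<in> cbox L U then g x else 0)) = ?h"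
    using box_subset_cbox[of L U] by (auto simp: indicator_def fun_eq_iff)
  ultimately have int: "integrable lebesgue ?h"
    by metis
  obtain h' where h'[measurable]: "h' \<in> borel_measurable lborel" and eq: "AE x in lborel. ?h x = h' x"
    using completion_ex_borel_measurable_real[of ?h lborel] int by blast
  have eq': "AE x in lebesgue. ?h x = h' x"
    by (rule AE_completion[OF eq])
  have int': "integrable lborel h'"
    using int integrable_cong_AE_imp[OF int _ ] eq' integrable_completion[of h' lborel]
      measurable_completion[OF h']
    by (metis (mono_tags, lifting) h' integrable_cong_AE int borel_measurable_integrable)
  have "(LINT x:A|lborel. h' x) = 0" if "A \<in> sets lborel" for A
  proof -
    have trans: "(LINT x:A|lborel. h' x) = (LINT x|lebesgue. indicator A x * ?h x)" if A[measurable]: "A \<in> sets borel" for A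
    proof -
      have "(LINT x:A|lborel. h' x) = (LINT x|lebesgue. indicator A x * h' x)"
        unfolding set_lebesgue_integral_def using A by (subst integral_completion) auto
      also have "\<dots> = (LINT x|lebesgue. indicator A x * ?h x)"
      proof (rule integral_cong_AE)
        show "AE x in lebesgue. indicat_real A x * h' x = indicat_real A x * ?h x"
          using eq' by eventually_elim auto
        show "(\<lambda>x. indicat_real A x * h' x) \<in> borel_measurable lebesgue"
          by (intro measurable_completion) (use A in measurable)
        show "(\<lambda>x. indicat_real A x * ?h x) \<in> borel_measurable lebesgue"
          using int A by (intro borel_measurable_times borel_measurable_indicator) auto
      qed
      finally show ?thesis .
    qed
    have box: "(LINT x:box l u|lborel. h' x) = 0" for l u
    proof -
      obtain l' u' where lu: "box L U \<inter> box l u = box l' u'"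
        by (simp add: Int_interval box_Int_box)
      have "(LINT x|lebesgue. indicator (box l u) x * ?h x) = (LINT x|lebesgue. (if x \<in> box l' u' then g x else 0))"
        using lu by (intro Bochner_Integration.integral_cong) (auto simp: indicator_def set_eq_iff)
      also have "\<dots> = 0"
      proof (cases "box l' u' = {}")
        case False
        then have "cbox l' u' \<subseteq> cbox L U"
          using lu box_subset_cbox[of L U] closure_box[of l' u']
          by (metis Int_lower1 closed_cbox closure_minimal subset_trans)
        then show ?thesis
          using integral_box_eq_0[OF assms(1-3)] sub by blast
      qed simp
      finally show ?thesis by (simp add: trans)
    qed
    \<comment> \<open>Complements in the induction need the integral over the whole space; it equals
      that over \<open>box L U\<close>, outside of which the function was set to zero.\<close>
    have univ: "(LINT x:UNIV|lborel. h' x) = 0"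
      using box[of L U] trans[of "box L U"] trans[of UNIV]
      by (simp add: indicator_def if_distrib cong: if_cong)
    have stable: "Int_stable (range (\<lambda>(a, b). box a b :: (real^'n) set))"
      by (auto simp: Int_stable_def box_Int_box)
    have A: "A \<in> sigma_sets UNIV (range (\<lambda>(a, b). box a b :: (real^'n) set))"
      using that by (simp add: borel_eq_box)
    have sub: "range (\<lambda>(a, b). box a b :: (real^'n) set) \<subseteq> Pow UNIV"
      by simp
    have si: "set_integrable lborel B h'" if "B \<in> sets borel" for B
      unfolding set_integrable_def using that int' by (intro integrable_mult_indicator) auto
    from stable sub A show ?thesis
    proof (induction rule: sigma_sets_induct_disjoint)
      case (compl A)
      then have [measurable]: "A \<in> sets lborel"
        by (simp add: borel_eq_box)
      have "(LINT x:UNIV|lborel. h' x) = (LINT x:A|lborel. h' x) + (LINT x:UNIV - A|lborel. h' x)"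
        using \<open>A \<in> sets lborel\<close> by (subst set_integral_Un[symmetric]) (auto intro!: si)
      with compl univ show ?case by simp
    next
      case (union A)
      then have A[measurable]: "A i \<in> sets lborel" for i
        by (simp add: borel_eq_box subset_iff image_subset_iff)
      have "(LINT x:(\<Union>i. A i)|lborel. h' x) = (\<Sum>i. LINT x:A i|lborel. h' x)"
        using A union(1) by (intro lebesgue_integral_countable_add si)
          (auto simp: disjoint_family_on_def)
      with union show ?case by simp
    qed (use box in \<open>auto simp: set_lebesgue_integral_def\<close>)
  qed
  then have "AE x in lborel. h' x = 0"
    using density_unique_real[OF int' integrable_zero] by simp
  then have "AE x in lebesgue. h' x = 0"
    by (rule AE_completion)
  with eq' show ?thesis
    by eventually_elim (auto split: if_splits)
qed

text \<open>The claim is local: Lindelof covers \<open>\<Omega>\<close> by countably many open boxes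
  whose closures lie in \<open>\<Omega>\<close>, and countably many null sets remain null.\<close>

theorem fundamental_lemma_calculus_of_variations:
  fixes g :: "real^'n::finite \<Rightarrow> real"
  assumes "open \<Omega>" "L1loc \<Omega> g"
    and test: "\<And>\<phi>. \<phi> \<in> test_fun \<Omega> \<Longrightarrow> (LINT x|lebesgue_on \<Omega>. g x * \<phi> x) = 0"
  shows "AE x in lebesgue_on \<Omega>. g x = 0"
proof -
  let ?F = "{B. \<exists>l u. B = box l u \<and> cbox l u \<subseteq> \<Omega>}"
  obtain F' where F': "F' \<subseteq> ?F" "countable F'" "\<Union>F' = \<Union>?F"
    using Lindelof[of ?F] by auto
  have cover: "\<Omega> \<subseteq> \<Union>?F"
  proof
    fix x assume "x \<in> \<Omega>"
    then obtain e where e: "e > 0" "ball x e \<subseteq> \<Omega>"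
      using \<open>open \<Omega>\<close> openE by blast
    obtain a b where "x \<in> box a b" "cbox a b \<subseteq> ball x e"
      using open_contains_cbox[OF open_ball, of x x e] e(1) by (metis centre_in_ball)
    then show "x \<in> \<Union>?F" using e by blast
  qed
  have "\<forall>B\<in>F'. AE x in lebesgue. x \<in> B \<longrightarrow> g x = 0"
  proof
    fix B assume "B \<in> F'"
    then obtain l u where "B = box l u" "cbox l u \<subseteq> \<Omega>"
      using F'(1) by blast
    then show "AE x in lebesgue. x \<in> B \<longrightarrow> g x = 0"
      using AE_box_eq_0[OF assms] by simp
  qed
  then have "AE x in lebesgue. \<forall>B\<in>F'. x \<in> B \<longrightarrow> g x = 0"
    by (subst AE_ball_countable[OF F'(2)])
  then have "AE x in lebesgue. x \<in> \<Omega> \<longrightarrow> g x = 0"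
    by (rule AE_mp) (use cover F'(3) in \<open>auto intro!: AE_I2\<close>)
  then show ?thesis
    using \<open>open \<Omega>\<close> by (subst AE_restrict_space_iff) auto
qed

lemma L1loc_diff: "L1loc \<Omega> f \<Longrightarrow> L1loc \<Omega> g \<Longrightarrow> L1loc \<Omega> (\<lambda>x. f x - g x)"
  by (auto simp: L1loc_def)

lemma L1loc_mult_test_fun:
  fixes g :: "real^'n::finite \<Rightarrow> real"
  assumes "open \<Omega>" "L1loc \<Omega> g" "\<phi> \<in> test_fun \<Omega>"
  shows "integrable (lebesgue_on \<Omega>) (\<lambda>x. g x * \<phi> x)"
proof -
  obtain K where K: "compact K" "K \<subseteq> \<Omega>" "\<And>x. x \<notin> K \<Longrightarrow> \<phi> x = 0"
    using test_funE[OF assms(3)] by metis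
  then have Ks[measurable]: "K \<in> sets lebesgue"
    by (simp add: borel_compact)
  have "integrable (lebesgue_on K) g"
    using assms(2) K by (simp add: L1loc_def)
  then have int: "integrable lebesgue (\<lambda>x. if x \<in> K then g x else 0)"
    by (simp add: Lebesgue_Measure.integrable_restrict_UNIV)
  have "bounded (\<phi> ` K)"
    using K(1) smooth_fun_continuous[OF test_fun_smooth[OF assms(3)]]
    by (intro compact_imp_bounded compact_continuous_image)
  then obtain B where B: "\<And>x. x \<in> K \<Longrightarrow> \<bar>\<phi> x\<bar> \<le> B"
    by (auto simp: bounded_iff)
  have "\<phi> \<in> borel_measurable lebesgue"
    by (intro smooth_fun_lebesgue test_fun_smooth[OF assms(3)])
  then have "integrable lebesgue (\<lambda>x. (if x \<in> K then g x else 0) * \<phi> x)"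
  proof (intro Bochner_Integration.integrable_bound[OF integrable_mult_right[OF int, of B]] AE_I2)
    fix x
    show "norm ((if x \<in> K then g x else 0) * \<phi> x) \<le> norm (B * (if x \<in> K then g x else 0))"
      using B[of x] abs_ge_self[of B]
      by (auto simp: abs_mult mult.commute[of _ "\<bar>g x\<bar>"] intro!: mult_left_mono)
  qed (use int in \<open>auto intro!: borel_measurable_times\<close>)
  moreover have "(\<lambda>x. (if x \<in> K then g x else 0) * \<phi> x) = (\<lambda>x. if x \<in> \<Omega> then g x * \<phi> x else 0)"
    using K by (auto simp: fun_eq_iff)
  ultimately have "integrable lebesgue (\<lambda>x. if x \<in> \<Omega> then g x * \<phi> x else 0)"
    by metis
  then show ?thesis
    using assms(1) by (subst (asm) Lebesgue_Measure.integrable_restrict_UNIV) auto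
qed

text \<open>Both gradients have the same pairings with test functions, so the fundamental lemma
  applies to each component of the difference. Besides comparing arbitrary weak gradients with
  approximated ones, this is the tool that yields vanishing gradients on level sets.\<close>

theorem weak_grad_unique:
  assumes "open \<Omega>" "weak_grad \<Omega> y G" "weak_grad \<Omega> y H"
  shows "AE x in lebesgue_on \<Omega>. G x = H x"
proof -
  have "AE x in lebesgue_on \<Omega>. G x $ i - H x $ i = 0" for i
  proof (rule fundamental_lemma_calculus_of_variations[OF assms(1)])
    have L: "L1loc \<Omega> (\<lambda>x. G x $ i)" "L1loc \<Omega> (\<lambda>x. H x $ i)"
      using assms by (auto simp: weak_grad_def)
    then show "L1loc \<Omega> (\<lambda>x. G x $ i - H x $ i)"
      by (rule L1loc_diff)
    fix \<phi> assume \<phi>: "\<phi> \<in> test_fun \<Omega>"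
    have "(LINT x|lebesgue_on \<Omega>. G x $ i * \<phi> x) = (LINT x|lebesgue_on \<Omega>. H x $ i * \<phi> x)"
    proof -
      have "(LINT x|lebesgue_on \<Omega>. y x * partial i \<phi> x) = - (LINT x|lebesgue_on \<Omega>. G x $ i * \<phi> x)"
        using assms(2) \<phi> unfolding weak_grad_def by blast
      moreover have "(LINT x|lebesgue_on \<Omega>. y x * partial i \<phi> x) = - (LINT x|lebesgue_on \<Omega>. H x $ i * \<phi> x)"
        using assms(3) \<phi> unfolding weak_grad_def by blast
      ultimately show ?thesis by simp
    qed
    then show "(LINT x|lebesgue_on \<Omega>. (G x $ i - H x $ i) * \<phi> x) = 0"
      using L \<phi> assms(1) by (simp add: left_diff_distrib L1loc_mult_test_fun)
  qed
  then have "AE x in lebesgue_on \<Omega>. \<forall>i. G x $ i - H x $ i = 0"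
    by (simp add: AE_all_countable)
  then show ?thesis
    by eventually_elim (simp add: vec_eq_iff)
qed

section \<open>Gagliardo-Nirenberg inequalities in two and three dimensions\<close>

lemma prod_Basis_vec: "(\<Prod>b\<in>Basis. f b) = (\<Prod>i\<in>UNIV. f (axis (i::'n::finite) (1::real)))"
proof -
  have B: "(Basis :: (real^'n) set) = (\<lambda>i. axis i 1) ` UNIV"
    by (auto simp: Basis_vec_def)
  have "inj (\<lambda>i::'n. axis i (1::real))"
    by (auto simp: inj_def axis_eq_axis)
  then show ?thesis
    unfolding B by (subst prod.reindex) (auto simp: o_def)
qed

text \<open>Lebesgue measure is determined by its values on boxes, so only the volume of the
  preimage of a box has to be computed. The index type is abstract, hence the enumeration of
  \<open>UNIV\<close>.\<close>

lemma lborel_vec2: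
  fixes i j :: "'n::finite"
  assumes U: "UNIV = {i, j}" and ne: "i \<noteq> j"
  shows "(lborel :: (real^'n) measure) =
    distr (lborel \<Otimes>\<^sub>M lborel) borel (\<lambda>z. fst z *\<^sub>R axis i 1 + snd z *\<^sub>R axis j 1)"
proof (rule lborel_eqI)
  let ?T = "\<lambda>z. fst z *\<^sub>R axis i 1 + snd z *\<^sub>R axis j 1 :: real^'n"
  fix l u :: "real^'n"
  assume le: "\<And>b. b \<in> Basis \<Longrightarrow> l \<bullet> b \<le> u \<bullet> b"
  have lu: "l $ k \<le> u $ k" for k
    using le[of "axis k 1"] by (simp add: inner_axis axis_in_Basis_iff)
  have all: "(\<forall>k. P k) \<longleftrightarrow> P i \<and> P j" for P
    using U by (metis UNIV_I insertE singletonD)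
  have "?T -` box l u = {l $ i<..<u $ i} \<times> {l $ j<..<u $ j}"
    unfolding vimage_def mem_box_nth all using ne by (auto simp: axis_def)
  then have "emeasure (distr (lborel \<Otimes>\<^sub>M lborel) borel ?T) (box l u)
      = emeasure (lborel \<Otimes>\<^sub>M lborel) ({l $ i<..<u $ i} \<times> {l $ j<..<u $ j})"
    by (subst emeasure_distr) (auto simp: space_pair_measure)
  also have "\<dots> = ennreal (\<Prod>b\<in>Basis. (u - l) \<bullet> b)"
    using ne lu by (subst lborel.emeasure_pair_measure_Times)
      (auto simp: prod_Basis_vec U inner_axis ennreal_mult)
  finally show "emeasure (distr (lborel \<Otimes>\<^sub>M lborel) borel ?T) (box l u) = ennreal (\<Prod>b\<in>Basis. (u - l) \<bullet> b)" .
qed simp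

text \<open>Coordinate \<open>i\<close> is the last factor, so that it becomes the inner integral
  for fixed remaining coordinates; \<open>loomis_whitney_3\<close> is stated for this order.\<close>

lemma lborel_vec3:
  fixes i j k :: "'n::finite"
  assumes U: "UNIV = {i, j, k}" and ne: "i \<noteq> j" "i \<noteq> k" "j \<noteq> k"
  shows "(lborel :: (real^'n) measure) =
    distr ((lborel \<Otimes>\<^sub>M lborel) \<Otimes>\<^sub>M lborel) borel
      (\<lambda>z. snd z *\<^sub>R axis i 1 + fst (fst z) *\<^sub>R axis j 1 + snd (fst z) *\<^sub>R axis k 1)"
proof (rule lborel_eqI)
  let ?T = "\<lambda>z. snd z *\<^sub>R axis i 1 + fst (fst z) *\<^sub>R axis j 1 + snd (fst z) *\<^sub>R axis k 1 :: real^'n"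
  fix l u :: "real^'n"
  assume le: "\<And>b. b \<in> Basis \<Longrightarrow> l \<bullet> b \<le> u \<bullet> b"
  have lu: "l $ k \<le> u $ k" for k
    using le[of "axis k 1"] by (simp add: inner_axis axis_in_Basis_iff)
  have all: "(\<forall>m. P m) \<longleftrightarrow> P i \<and> P j \<and> P k" for P
    using U by (metis UNIV_I insertE singletonD)
  have "?T -` box l u = ({l $ j<..<u $ j} \<times> {l $ k<..<u $ k}) \<times> {l $ i<..<u $ i}"
    unfolding vimage_def mem_box_nth all using ne by (auto simp: axis_def)
  then have "emeasure (distr ((lborel \<Otimes>\<^sub>M lborel) \<Otimes>\<^sub>M lborel) borel ?T) (box l u)
      = emeasure ((lborel \<Otimes>\<^sub>M lborel) \<Otimes>\<^sub>M lborel) (({l $ j<..<u $ j} \<times> {l $ k<..<u $ k}) \<times> {l $ i<..<u $ i})"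
    by (subst emeasure_distr) (auto simp: space_pair_measure)
  also have "\<dots> = emeasure (lborel \<Otimes>\<^sub>M lborel) ({l $ j<..<u $ j} \<times> {l $ k<..<u $ k}) * emeasure lborel {l $ i<..<u $ i}"
    by (rule lborel.emeasure_pair_measure_Times) auto
  also have "\<dots> = ennreal (\<Prod>b\<in>Basis. (u - l) \<bullet> b)"
    using ne lu by (subst lborel.emeasure_pair_measure_Times)
      (auto simp: prod_Basis_vec U inner_axis ennreal_mult mult_ac)
  finally show "emeasure (distr ((lborel \<Otimes>\<^sub>M lborel) \<Otimes>\<^sub>M lborel) borel ?T) (box l u)
      = ennreal (\<Prod>b\<in>Basis. (u - l) \<bullet> b)" .
qed simp

lemma nn_integral_vec2:
  fixes i j :: "'n::finite" and F :: "real^'n \<Rightarrow> ennreal"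
  assumes U: "UNIV = {i, j}" and ne: "i \<noteq> j"
    and [measurable]: "F \<in> borel_measurable borel"
  shows "(\<integral>\<^sup>+x. F x \<partial>lborel) = (\<integral>\<^sup>+s. \<integral>\<^sup>+t. F (s *\<^sub>R axis i 1 + t *\<^sub>R axis j 1) \<partial>lborel \<partial>lborel)"
  by (subst lborel_vec2[OF U ne], subst nn_integral_distr, measurable,
      subst lborel.nn_integral_fst[symmetric]) auto

lemma nn_integral_vec3:
  fixes i j k :: "'n::finite" and F :: "real^'n \<Rightarrow> ennreal"
  assumes U: "UNIV = {i, j, k}" and ne: "i \<noteq> j" "i \<noteq> k" "j \<noteq> k"
    and [measurable]: "F \<in> borel_measurable borel"
  shows "(\<integral>\<^sup>+x. F x \<partial>lborel) = (\<integral>\<^sup>+p. \<integral>\<^sup>+r. F (r *\<^sub>R axis i 1 + fst p *\<^sub>R axis j 1 + snd p *\<^sub>R axis k 1)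
    \<partial>lborel \<partial>(lborel \<Otimes>\<^sub>M lborel))"
  by (subst lborel_vec3[OF U ne], subst nn_integral_distr, measurable,
      subst lborel.nn_integral_fst[symmetric]) auto

text \<open>Along lines in direction \<open>i\<close> the value is bounded by \<open>A t\<close>,
  which does not involve \<open>s\<close>, and in direction \<open>j\<close> by \<open>B s\<close>.
  The square is thus dominated by a product of functions of separate variables.\<close>

lemma gagliardo_nirenberg_2:
  fixes i j :: "'n::finite" and \<theta> :: "real^'n \<Rightarrow> real"
  assumes U: "UNIV = {i, j}" and ne: "i \<noteq> j" and \<theta>: "\<theta> \<in> test_fun \<Omega>"
  shows "(\<integral>\<^sup>+x. (ennreal \<bar>\<theta> x\<bar>)\<^sup>2 \<partial>lborel)
    \<le> (\<integral>\<^sup>+x. ennreal \<bar>partial i \<theta> x\<bar> \<partial>lborel) * (\<integral>\<^sup>+x. ennreal \<bar>partial j \<theta> x\<bar> \<partial>lborel)"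
proof -
  have sm: "smooth_fun \<theta>" using \<theta> by (rule test_fun_smooth)
  note [measurable] = smooth_fun_borel[OF sm] smooth_fun_borel[OF smooth_fun_partial[OF sm]]
  define x where "x s t = s *\<^sub>R axis i 1 + t *\<^sub>R (axis j 1 :: real^'n)" for s t
  have [measurable]: "case_prod x \<in> borel_measurable (lborel \<Otimes>\<^sub>M lborel)"
      "x s \<in> borel_measurable borel" "(\<lambda>s. x s t) \<in> borel_measurable borel" for s t
    unfolding x_def[abs_def] by measurable
  define A where "A t = (\<integral>\<^sup>+s. ennreal \<bar>partial i \<theta> (x s t)\<bar> \<partial>lborel)" for t
  define B where "B s = (\<integral>\<^sup>+t. ennreal \<bar>partial j \<theta> (x s t)\<bar> \<partial>lborel)" for s
  have [measurable]: "A \<in> borel_measurable borel" "B \<in> borel_measurable borel"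
    unfolding A_def[abs_def] B_def[abs_def] x_def by measurable
  have leA: "ennreal \<bar>\<theta> (x s t)\<bar> \<le> A t" for s t
  proof -
    have "ennreal \<bar>\<theta> (x s t)\<bar> \<le> (\<integral>\<^sup>+\<tau>. ennreal \<bar>partial i \<theta> (x (\<tau> + s) t)\<bar> \<partial>lborel)"
      using test_fun_line_bound[OF \<theta>, of "x s t" i] by (simp add: x_def algebra_simps)
    also have "\<dots> = A t"
      unfolding A_def by (rule nn_integral_translation[of "\<lambda>s. ennreal \<bar>partial i \<theta> (x s t)\<bar>"]) measurable
    finally show ?thesis .
  qed
  have leB: "ennreal \<bar>\<theta> (x s t)\<bar> \<le> B s" for s t
  proof -
    have "ennreal \<bar>\<theta> (x s t)\<bar> \<le> (\<integral>\<^sup>+\<tau>. ennreal \<bar>partial j \<theta> (x s (\<tau> + t))\<bar> \<partial>lborel)"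
      using test_fun_line_bound[OF \<theta>, of "x s t" j] by (simp add: x_def algebra_simps)
    also have "\<dots> = B s"
      unfolding B_def by (rule nn_integral_translation[of "\<lambda>t. ennreal \<bar>partial j \<theta> (x s t)\<bar>"]) measurable
    finally show ?thesis .
  qed
  have "(\<integral>\<^sup>+x. (ennreal \<bar>\<theta> x\<bar>)\<^sup>2 \<partial>lborel) = (\<integral>\<^sup>+s. \<integral>\<^sup>+t. (ennreal \<bar>\<theta> (x s t)\<bar>)\<^sup>2 \<partial>lborel \<partial>lborel)"
    unfolding x_def by (rule nn_integral_vec2[OF U ne]) measurable
  also have "\<dots> \<le> (\<integral>\<^sup>+s. \<integral>\<^sup>+t. A t * B s \<partial>lborel \<partial>lborel)"
    unfolding power2_eq_square by (intro nn_integral_mono mult_mono leA leB) auto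
  also have "\<dots> = (\<integral>\<^sup>+t. A t \<partial>lborel) * (\<integral>\<^sup>+s. B s \<partial>lborel)"
    by (simp add: nn_integral_multc nn_integral_cmult)
  also have "(\<integral>\<^sup>+t. A t \<partial>lborel) = (\<integral>\<^sup>+s. \<integral>\<^sup>+t. ennreal \<bar>partial i \<theta> (x s t)\<bar> \<partial>lborel \<partial>lborel)"
    unfolding A_def by (rule lborel_pair.Fubini') measurable
  also have "\<dots> = (\<integral>\<^sup>+x. ennreal \<bar>partial i \<theta> x\<bar> \<partial>lborel)"
    unfolding x_def by (rule nn_integral_vec2[OF U ne, symmetric]) measurable
  also have "(\<integral>\<^sup>+s. B s \<partial>lborel) = (\<integral>\<^sup>+x. ennreal \<bar>partial j \<theta> x\<bar> \<partial>lborel)"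
    unfolding x_def B_def by (rule nn_integral_vec2[OF U ne, symmetric]) measurable
  finally show ?thesis .
qed

text \<open>Cauchy-Schwarz twice: in \<open>p\<close> to split off \<open>a\<close>, then in the
  inner variable, after which the factors from \<open>b\<close> and \<open>c\<close> depend on
  different components of \<open>p\<close> and the integral factorises.\<close>

lemma loomis_whitney_3:
  fixes a b c :: "real \<Rightarrow> real \<Rightarrow> ennreal"
  assumes [measurable]: "case_prod a \<in> borel_measurable (lborel \<Otimes>\<^sub>M lborel)"
    "case_prod b \<in> borel_measurable (lborel \<Otimes>\<^sub>M lborel)"
    "case_prod c \<in> borel_measurable (lborel \<Otimes>\<^sub>M lborel)"
  shows "(\<integral>\<^sup>+p. \<integral>\<^sup>+r. a (fst p) (snd p) * (b r (snd p) * c r (fst p)) \<partial>lborel \<partial>(lborel \<Otimes>\<^sub>M lborel))\<^sup>2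
    \<le> (\<integral>\<^sup>+p. (a (fst p) (snd p))\<^sup>2 \<partial>(lborel \<Otimes>\<^sub>M lborel)) *
      ((\<integral>\<^sup>+t. \<integral>\<^sup>+r. (b r t)\<^sup>2 \<partial>lborel \<partial>lborel) * (\<integral>\<^sup>+s. \<integral>\<^sup>+r. (c r s)\<^sup>2 \<partial>lborel \<partial>lborel))"
proof -
  define K where "K p = (\<integral>\<^sup>+r. b r (snd p) * c r (fst p) \<partial>lborel)" for p
  define \<beta> where "\<beta> t = (\<integral>\<^sup>+r. (b r t)\<^sup>2 \<partial>lborel)" for t
  define \<gamma> where "\<gamma> s = (\<integral>\<^sup>+r. (c r s)\<^sup>2 \<partial>lborel)" for s
  have [measurable]: "K \<in> borel_measurable (lborel \<Otimes>\<^sub>M lborel)"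
    "\<beta> \<in> borel_measurable lborel" "\<gamma> \<in> borel_measurable lborel"
    unfolding K_def[abs_def] \<beta>_def[abs_def] \<gamma>_def[abs_def] by measurable
  have "(\<integral>\<^sup>+p. \<integral>\<^sup>+r. a (fst p) (snd p) * (b r (snd p) * c r (fst p)) \<partial>lborel \<partial>(lborel \<Otimes>\<^sub>M lborel))
      = (\<integral>\<^sup>+p. a (fst p) (snd p) * K p \<partial>(lborel \<Otimes>\<^sub>M lborel))"
    unfolding K_def by (intro nn_integral_cong nn_integral_cmult) measurable
  also have "\<dots>\<^sup>2
      \<le> (\<integral>\<^sup>+p. (a (fst p) (snd p))\<^sup>2 \<partial>(lborel \<Otimes>\<^sub>M lborel)) * (\<integral>\<^sup>+p. (K p)\<^sup>2 \<partial>(lborel \<Otimes>\<^sub>M lborel))"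
    by (rule Cauchy_Schwarz_nn_integral) measurable
  also have "(\<integral>\<^sup>+p. (K p)\<^sup>2 \<partial>(lborel \<Otimes>\<^sub>M lborel)) \<le> (\<integral>\<^sup>+p. \<beta> (snd p) * \<gamma> (fst p) \<partial>(lborel \<Otimes>\<^sub>M lborel))"
    unfolding K_def \<beta>_def \<gamma>_def by (intro nn_integral_mono Cauchy_Schwarz_nn_integral) measurable
  also have "(\<integral>\<^sup>+p. \<beta> (snd p) * \<gamma> (fst p) \<partial>(lborel \<Otimes>\<^sub>M lborel)) = (\<integral>\<^sup>+s. \<integral>\<^sup>+t. \<beta> t * \<gamma> s \<partial>lborel \<partial>lborel)"
    by (subst lborel.nn_integral_fst[symmetric]) auto
  also have "\<dots> = (\<integral>\<^sup>+t. \<beta> t \<partial>lborel) * (\<integral>\<^sup>+s. \<gamma> s \<partial>lborel)"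
    by (simp add: nn_integral_multc nn_integral_cmult)
  finally show ?thesis
    unfolding \<beta>_def \<gamma>_def by (simp add: mult_left_mono)
qed

text \<open>The square root with \<open>esqrt top = top\<close>, so that squaring inverts it without
  any finiteness assumption on the line integrals.\<close>

definition esqrt :: "ennreal \<Rightarrow> ennreal" where
  "esqrt x = (if x = top then top else ennreal (sqrt (enn2real x)))"

lemma esqrt_measurable [measurable]: "esqrt \<in> borel_measurable borel"
  unfolding esqrt_def[abs_def] by measurable

lemma esqrt_power2 [simp]: "(esqrt x)\<^sup>2 = x"
  by (cases x) (auto simp: esqrt_def power2_eq_square ennreal_top_mult ennreal_mult[symmetric])

lemma le_esqrt: "0 \<le> r \<Longrightarrow> ennreal (r\<^sup>2) \<le> x \<Longrightarrow> ennreal r \<le> esqrt x"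
  by (cases x) (auto simp: esqrt_def intro!: ennreal_leI real_le_rsqrt)

text \<open>The natural power \<open>3/2\<close> of \<open>\<bar>\<theta>\<bar>\<close> becomes the
  cube of \<open>\<bar>w\<bar>\<close> once \<open>\<bar>\<theta>\<bar> = w^2\<close>; that cube is
  bounded by three square roots of line integrals, each independent of one coordinate, as
  Loomis-Whitney requires. In the application \<open>\<theta>\<close> is a fourth power and
  \<open>w\<close> a square.\<close>

lemma gagliardo_nirenberg_3:
  fixes i j k :: "'n::finite" and \<theta> w :: "real^'n \<Rightarrow> real"
  assumes U: "UNIV = {i, j, k}" and ne: "i \<noteq> j" "i \<noteq> k" "j \<noteq> k" and \<theta>: "\<theta> \<in> test_fun \<Omega>"
    and w[measurable]: "w \<in> borel_measurable borel" and w2: "\<And>x. \<bar>\<theta> x\<bar> = (w x)\<^sup>2"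
  shows "(\<integral>\<^sup>+x. ennreal (\<bar>w x\<bar> ^ 3) \<partial>lborel)\<^sup>2
    \<le> (\<integral>\<^sup>+x. ennreal \<bar>partial i \<theta> x\<bar> \<partial>lborel) * ((\<integral>\<^sup>+x. ennreal \<bar>partial j \<theta> x\<bar> \<partial>lborel) *
      (\<integral>\<^sup>+x. ennreal \<bar>partial k \<theta> x\<bar> \<partial>lborel))"
proof -
  have sm: "smooth_fun \<theta>" using \<theta> by (rule test_fun_smooth)
  note [measurable] = smooth_fun_borel[OF sm] smooth_fun_borel[OF smooth_fun_partial[OF sm]]
  define x where "x r s t = r *\<^sub>R axis i 1 + s *\<^sub>R axis j 1 + t *\<^sub>R (axis k 1 :: real^'n)" for r s t
  have x_meas[measurable]: "(\<lambda>p. x (f p) (g p) (h p)) \<in> borel_measurable M"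
    if [measurable]: "f \<in> borel_measurable M" "g \<in> borel_measurable M" "h \<in> borel_measurable M"
    for f g h :: "'z \<Rightarrow> real" and M
    unfolding x_def[abs_def] by measurable
  define A where "A s t = (\<integral>\<^sup>+r. ennreal \<bar>partial i \<theta> (x r s t)\<bar> \<partial>lborel)" for s t
  define B where "B r t = (\<integral>\<^sup>+s. ennreal \<bar>partial j \<theta> (x r s t)\<bar> \<partial>lborel)" for r t
  define C where "C r s = (\<integral>\<^sup>+t. ennreal \<bar>partial k \<theta> (x r s t)\<bar> \<partial>lborel)" for r s
  have [measurable]: "case_prod A \<in> borel_measurable (lborel \<Otimes>\<^sub>M lborel)"
    "case_prod B \<in> borel_measurable (lborel \<Otimes>\<^sub>M lborel)"
    "case_prod C \<in> borel_measurable (lborel \<Otimes>\<^sub>M lborel)"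
    unfolding A_def[abs_def] B_def[abs_def] C_def[abs_def] x_def[abs_def] by measurable
  have leA: "ennreal \<bar>\<theta> (x r s t)\<bar> \<le> A s t" for r s t
  proof -
    have "ennreal \<bar>\<theta> (x r s t)\<bar> \<le> (\<integral>\<^sup>+\<tau>. ennreal \<bar>partial i \<theta> (x (\<tau> + r) s t)\<bar> \<partial>lborel)"
      using test_fun_line_bound[OF \<theta>, of "x r s t" i] by (simp add: x_def algebra_simps)
    also have "\<dots> = A s t"
      unfolding A_def by (rule nn_integral_translation[of "\<lambda>r. ennreal \<bar>partial i \<theta> (x r s t)\<bar>"]) measurable
    finally show ?thesis .
  qed
  have leB: "ennreal \<bar>\<theta> (x r s t)\<bar> \<le> B r t" for r s t
  proof -
    have "ennreal \<bar>\<theta> (x r s t)\<bar> \<le> (\<integral>\<^sup>+\<tau>. ennreal \<bar>partial j \<theta> (x r (\<tau> + s) t)\<bar> \<partial>lborel)"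
      using test_fun_line_bound[OF \<theta>, of "x r s t" j] by (simp add: x_def algebra_simps)
    also have "\<dots> = B r t"
      unfolding B_def by (rule nn_integral_translation[of "\<lambda>s. ennreal \<bar>partial j \<theta> (x r s t)\<bar>"]) measurable
    finally show ?thesis .
  qed
  have leC: "ennreal \<bar>\<theta> (x r s t)\<bar> \<le> C r s" for r s t
  proof -
    have "ennreal \<bar>\<theta> (x r s t)\<bar> \<le> (\<integral>\<^sup>+\<tau>. ennreal \<bar>partial k \<theta> (x r s (\<tau> + t))\<bar> \<partial>lborel)"
      using test_fun_line_bound[OF \<theta>, of "x r s t" k] by (simp add: x_def algebra_simps)
    also have "\<dots> = C r s"
      unfolding C_def by (rule nn_integral_translation[of "\<lambda>t. ennreal \<bar>partial k \<theta> (x r s t)\<bar>"]) measurable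
    finally show ?thesis .
  qed
  have vec: "(\<integral>\<^sup>+x. F x \<partial>lborel) = (\<integral>\<^sup>+p. \<integral>\<^sup>+r. F (x r (fst p) (snd p)) \<partial>lborel \<partial>(lborel \<Otimes>\<^sub>M lborel))"
    if "F \<in> borel_measurable borel" for F
    unfolding x_def by (rule nn_integral_vec3[OF U ne that])
  have le: "ennreal \<bar>w (x r s t)\<bar> \<le> esqrt (A s t)" "ennreal \<bar>w (x r s t)\<bar> \<le> esqrt (B r t)"
      "ennreal \<bar>w (x r s t)\<bar> \<le> esqrt (C r s)" for r s t
    using leA[of r s t] leB[of r s t] leC[of r s t] w2[of "x r s t"] by (auto intro!: le_esqrt)
  have "(\<integral>\<^sup>+x. ennreal (\<bar>w x\<bar> ^ 3) \<partial>lborel) = (\<integral>\<^sup>+p. \<integral>\<^sup>+r. ennreal (\<bar>w (x r (fst p) (snd p))\<bar> ^ 3) \<partial>lborel \<partial>(lborel \<Otimes>\<^sub>M lborel))"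
    by (rule vec) measurable
  also have "\<dots> \<le> (\<integral>\<^sup>+p. \<integral>\<^sup>+r. esqrt (A (fst p) (snd p)) * (esqrt (B r (snd p)) * esqrt (C r (fst p))) \<partial>lborel \<partial>(lborel \<Otimes>\<^sub>M lborel))"
  proof (intro nn_integral_mono)
    fix p :: "real \<times> real" and r :: real
    have "ennreal (\<bar>w y\<bar> ^ 3) = ennreal \<bar>w y\<bar> * (ennreal \<bar>w y\<bar> * ennreal \<bar>w y\<bar>)" for y
      by (simp add: power3_eq_cube mult_ac flip: ennreal_mult)
    then show "ennreal (\<bar>w (x r (fst p) (snd p))\<bar> ^ 3)
        \<le> esqrt (A (fst p) (snd p)) * (esqrt (B r (snd p)) * esqrt (C r (fst p)))"
      by (simp only:) (intro mult_mono le, auto)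
  qed
  finally have "(\<integral>\<^sup>+x. ennreal (\<bar>w x\<bar> ^ 3) \<partial>lborel)\<^sup>2 \<le> \<dots> \<^sup>2"
    by (intro power_mono) auto
  also have "\<dots> \<le> (\<integral>\<^sup>+p. (esqrt (A (fst p) (snd p)))\<^sup>2 \<partial>(lborel \<Otimes>\<^sub>M lborel)) *
      ((\<integral>\<^sup>+t. \<integral>\<^sup>+r. (esqrt (B r t))\<^sup>2 \<partial>lborel \<partial>lborel) * (\<integral>\<^sup>+s. \<integral>\<^sup>+r. (esqrt (C r s))\<^sup>2 \<partial>lborel \<partial>lborel))"
    by (rule loomis_whitney_3) measurable
  also have "(\<integral>\<^sup>+p. (esqrt (A (fst p) (snd p)))\<^sup>2 \<partial>(lborel \<Otimes>\<^sub>M lborel)) = (\<integral>\<^sup>+x. ennreal \<bar>partial i \<theta> x\<bar> \<partial>lborel)"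
    by (subst vec) (simp_all add: A_def)
  also have "(\<integral>\<^sup>+t. \<integral>\<^sup>+r. (esqrt (B r t))\<^sup>2 \<partial>lborel \<partial>lborel) = (\<integral>\<^sup>+x. ennreal \<bar>partial j \<theta> x\<bar> \<partial>lborel)"
  proof -
    have "(\<integral>\<^sup>+x. ennreal \<bar>partial j \<theta> x\<bar> \<partial>lborel)
        = (\<integral>\<^sup>+s. \<integral>\<^sup>+t. \<integral>\<^sup>+r. ennreal \<bar>partial j \<theta> (x r s t)\<bar> \<partial>lborel \<partial>lborel \<partial>lborel)"
      by (subst vec, measurable, subst lborel.nn_integral_fst[symmetric]) auto
    also have "\<dots> = (\<integral>\<^sup>+t. \<integral>\<^sup>+s. \<integral>\<^sup>+r. ennreal \<bar>partial j \<theta> (x r s t)\<bar> \<partial>lborel \<partial>lborel \<partial>lborel)"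
      by (rule lborel_pair.Fubini') measurable
    also have "\<dots> = (\<integral>\<^sup>+t. \<integral>\<^sup>+r. B r t \<partial>lborel \<partial>lborel)"
      unfolding B_def by (intro nn_integral_cong lborel_pair.Fubini') measurable
    finally show ?thesis by simp
  qed
  also have "(\<integral>\<^sup>+s. \<integral>\<^sup>+r. (esqrt (C r s))\<^sup>2 \<partial>lborel \<partial>lborel) = (\<integral>\<^sup>+x. ennreal \<bar>partial k \<theta> x\<bar> \<partial>lborel)"
  proof -
    have "(\<integral>\<^sup>+x. ennreal \<bar>partial k \<theta> x\<bar> \<partial>lborel)
        = (\<integral>\<^sup>+s. \<integral>\<^sup>+t. \<integral>\<^sup>+r. ennreal \<bar>partial k \<theta> (x r s t)\<bar> \<partial>lborel \<partial>lborel \<partial>lborel)"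
      by (subst vec, measurable, subst lborel.nn_integral_fst[symmetric]) auto
    also have "\<dots> = (\<integral>\<^sup>+s. \<integral>\<^sup>+r. C r s \<partial>lborel \<partial>lborel)"
      unfolding C_def by (intro nn_integral_cong lborel_pair.Fubini') measurable
    finally show ?thesis by simp
  qed
  finally show ?thesis .
qed

section \<open>Lebesgue norms\<close>

text \<open>A non-integrable power has integral zero by convention, so a bound on
  \<open>Lnorm\<close> alone says little; integrability is carried as a separate hypothesis
  throughout.\<close>

definition Lnorm :: "'a measure \<Rightarrow> real \<Rightarrow> ('a \<Rightarrow> real) \<Rightarrow> real" where
  "Lnorm M p f = (LINT x|M. \<bar>f x\<bar> powr p) powr (1 / p)"

lemma Lnorm_nonneg [simp]: "0 \<le> Lnorm M p f"
  by (simp add: Lnorm_def)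

lemma Lnorm_powr: "p > 0 \<Longrightarrow> Lnorm M p f powr p = (LINT x|M. \<bar>f x\<bar> powr p)"
  by (simp add: Lnorm_def powr_powr integral_nonneg_AE)

lemma Lnorm_cong_AE:
  assumes "f \<in> borel_measurable M" "g \<in> borel_measurable M" "AE x in M. \<bar>f x\<bar> = \<bar>g x\<bar>"
  shows "Lnorm M p f = Lnorm M p g"
proof -
  have "(LINT x|M. \<bar>f x\<bar> powr p) = (LINT x|M. \<bar>g x\<bar> powr p)"
  proof (rule integral_cong_AE)
    note [measurable] = assms(1,2)
    show "(\<lambda>x. \<bar>f x\<bar> powr p) \<in> borel_measurable M" "(\<lambda>x. \<bar>g x\<bar> powr p) \<in> borel_measurable M"
      by measurable
  qed (use assms(3) in \<open>auto elim: eventually_mono\<close>)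
  then show ?thesis by (simp add: Lnorm_def)
qed

lemma Lnorm_2: "Lnorm M 2 f = sqrt (LINT x|M. (f x)\<^sup>2)"
  by (simp add: Lnorm_def powr_half_sqrt integral_nonneg_AE)

lemma Lnorm_eq_0D:
  assumes "p > 0" "integrable M (\<lambda>x. \<bar>f x\<bar> powr p)" "Lnorm M p f = 0"
  shows "AE x in M. f x = 0"
proof -
  have "(LINT x|M. \<bar>f x\<bar> powr p) = 0"
    using assms Lnorm_powr[of p M f] by simp
  then have "AE x in M. \<bar>f x\<bar> powr p = 0"
    using assms by (subst (asm) integral_nonneg_eq_0_iff_AE) auto
  then show ?thesis by eventually_elim simp
qed

text \<open>Young's inequality is applied after dividing both functions by their norms; if one norm
  is zero, the product vanishes almost everywhere.\<close>

lemma
  fixes f g :: "'a \<Rightarrow> real"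
  assumes pq: "p > 1" "q > 1" "1 / p + 1 / q = 1"
    and [measurable]: "f \<in> borel_measurable M" "g \<in> borel_measurable M"
    and f: "integrable M (\<lambda>x. \<bar>f x\<bar> powr p)" and g: "integrable M (\<lambda>x. \<bar>g x\<bar> powr q)"
  shows Hoelder_integrable: "integrable M (\<lambda>x. f x * g x)"
    and Hoelder_inequality: "(LINT x|M. \<bar>f x * g x\<bar>) \<le> Lnorm M p f * Lnorm M q g"
proof -
  have young: "\<bar>a * b\<bar> \<le> \<bar>a\<bar> powr p / p + \<bar>b\<bar> powr q / q" for a b :: real
    using Youngs_inequality[OF pq, of "\<bar>a\<bar>" "\<bar>b\<bar>"] by (simp add: abs_mult)
  have int: "integrable M (\<lambda>x. \<bar>f x\<bar> powr p / p + \<bar>g x\<bar> powr q / q)"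
    using f g by auto
  show prod: "integrable M (\<lambda>x. f x * g x)"
    by (rule Bochner_Integration.integrable_bound[OF int])
      (use young pq in \<open>auto intro!: AE_I2 order_trans[OF young abs_ge_self]\<close>)
  let ?A = "Lnorm M p f" and ?B = "Lnorm M q g"
  show "(LINT x|M. \<bar>f x * g x\<bar>) \<le> ?A * ?B"
  proof (cases "?A = 0 \<or> ?B = 0")
    case True
    then have "AE x in M. \<bar>f x * g x\<bar> = 0"
      using Lnorm_eq_0D[OF _ f] Lnorm_eq_0D[OF _ g] pq by auto
    then have "(LINT x|M. \<bar>f x * g x\<bar>) = 0"
      by (rule integral_eq_zero_AE)
    then show ?thesis by simp
  next
    case False
    then have AB: "?A > 0" "?B > 0"
      using Lnorm_nonneg[of M p f] Lnorm_nonneg[of M q g] by linarith+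
    have prod': "integrable M (\<lambda>x. \<bar>f x / ?A * (g x / ?B)\<bar>)"
      using integrable_divide[OF integrable_abs[OF prod], of "?A * ?B"] AB by (simp add: abs_mult)
    have "(LINT x|M. \<bar>f x / ?A * (g x / ?B)\<bar>) \<le> (LINT x|M. \<bar>f x / ?A\<bar> powr p / p + \<bar>g x / ?B\<bar> powr q / q)"
      using AB f g by (intro integral_mono young prod') (auto simp: powr_divide)
    also have "\<dots> = (LINT x|M. \<bar>f x\<bar> powr p) / ?A powr p / p + (LINT x|M. \<bar>g x\<bar> powr q) / ?B powr q / q"
      using f g AB by (simp add: powr_divide)
    also have "\<dots> = 1"
      using AB pq Lnorm_powr[of p M f, symmetric] Lnorm_powr[of q M g, symmetric] by simp
    finally have "(LINT x|M. \<bar>f x * g x\<bar> / (?A * ?B)) \<le> 1"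
      using AB by (simp add: abs_mult)
    then show ?thesis
      using AB by (simp add: divide_le_eq)
  qed
qed

lemma
  fixes f g :: "'a \<Rightarrow> real"
  assumes [measurable]: "f \<in> borel_measurable M" "g \<in> borel_measurable M"
    and f: "integrable M (\<lambda>x. (f x)\<^sup>2)" and g: "integrable M (\<lambda>x. (g x)\<^sup>2)"
  shows L2_product_integrable: "integrable M (\<lambda>x. f x * g x)"
    and L2_Cauchy_Schwarz: "(LINT x|M. \<bar>f x * g x\<bar>) \<le> Lnorm M 2 f * Lnorm M 2 g"
  using Hoelder_integrable[of 2 2 f M g] Hoelder_inequality[of 2 2 f M g] f g by auto

lemma (in finite_measure) Lp_nested:
  fixes f :: "'a \<Rightarrow> real"
  assumes [measurable]: "f \<in> borel_measurable M" and "integrable M (\<lambda>x. \<bar>f x\<bar> powr q)" "0 \<le> p" "p \<le> q"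
  shows "integrable M (\<lambda>x. \<bar>f x\<bar> powr p)"
proof (rule Bochner_Integration.integrable_bound[of M "\<lambda>x. 1 + \<bar>f x\<bar> powr q"])
  show "AE x in M. norm (\<bar>f x\<bar> powr p) \<le> norm (1 + \<bar>f x\<bar> powr q)"
  proof (rule AE_I2)
    fix x
    show "norm (\<bar>f x\<bar> powr p) \<le> norm (1 + \<bar>f x\<bar> powr q)"
    proof (cases "\<bar>f x\<bar> \<le> 1")
      case True
      then have "\<bar>f x\<bar> powr p \<le> 1" using assms by (intro powr_le1) auto
      then show ?thesis by (simp add: add_increasing2)
    next
      case False
      then have "\<bar>f x\<bar> powr p \<le> \<bar>f x\<bar> powr q" using assms by (intro powr_mono) auto
      then show ?thesis by (simp add: add_increasing)
    qed
  qed
qed (use assms in auto)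

text \<open>Hoelder with exponent \<open>q / p\<close> for \<open>\<bar>f\<bar>^p\<close> and the
  indicator of \<open>A\<close>. The resulting power of the measure of \<open>A\<close> is the gain
  that later drives Stampacchia's iteration.\<close>

lemma (in finite_measure) Lnorm_nested:
  fixes f :: "'a \<Rightarrow> real"
  assumes [measurable]: "f \<in> borel_measurable M" and f: "integrable M (\<lambda>x. \<bar>f x\<bar> powr q)"
    and pq: "0 < p" "p < q" and A[measurable]: "A \<in> sets M"
  shows "Lnorm M p (\<lambda>x. f x * indicator A x) \<le> measure M A powr (1 / p - 1 / q) * Lnorm M q f"
proof -
  define s where "s = q / p"
  have s: "s > 1" using pq by (simp add: s_def)
  define s' where "s' = s / (s - 1)"
  have s': "s' > 1" "1 / s + 1 / s' = 1" "1 / s' = 1 - p / q"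
    using s pq by (auto simp: s'_def s_def field_simps)
  have "(LINT x|M. \<bar>f x * indicator A x\<bar> powr p) = (LINT x|M. \<bar>\<bar>f x\<bar> powr p * indicator A x\<bar>)"
    using pq by (intro Bochner_Integration.integral_cong) (auto simp: indicator_def)
  also have "\<dots> \<le> Lnorm M s (\<lambda>x. \<bar>f x\<bar> powr p) * Lnorm M s' (indicator A)"
  proof (rule Hoelder_inequality[OF s s'(1,2)])
    show "integrable M (\<lambda>x. \<bar>\<bar>f x\<bar> powr p\<bar> powr s)"
      using f pq by (simp add: powr_powr s_def)
    have eq: "(\<lambda>x. \<bar>indicat_real A x\<bar> powr s') = indicator A"
      using s' by (auto simp: indicator_def)
    show "integrable M (\<lambda>x. \<bar>indicat_real A x\<bar> powr s')"
      unfolding eq by (simp add: less_top[symmetric])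
  qed auto
  also have "Lnorm M s (\<lambda>x. \<bar>f x\<bar> powr p) = (LINT x|M. \<bar>f x\<bar> powr q) powr (p / q)"
    using pq by (simp add: Lnorm_def powr_powr s_def)
  also have "Lnorm M s' (indicator A) = measure M A powr (1 - p / q)"
  proof -
    have "(\<lambda>x. \<bar>indicat_real A x\<bar> powr s') = indicator A"
      using s' by (auto simp: indicator_def)
    then show ?thesis by (simp add: Lnorm_def s'(3))
  qed
  finally have "Lnorm M p (\<lambda>x. f x * indicator A x)
      \<le> ((LINT x|M. \<bar>f x\<bar> powr q) powr (p / q) * measure M A powr (1 - p / q)) powr (1 / p)"
    unfolding Lnorm_def using pq by (intro powr_mono2) (auto intro: integral_nonneg_AE)
  also have "\<dots> = measure M A powr (1 / p - 1 / q) * Lnorm M q f"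
    using pq by (simp add: powr_mult powr_powr Lnorm_def diff_divide_distrib)
  finally show ?thesis .
qed

section \<open>Functions supported in the domain: integrals over the domain and over the whole
  space\<close>

lemma nn_integral_lebesgue_on_supp:
  assumes [measurable]: "f \<in> borel_measurable borel" and "\<Omega> \<in> sets lebesgue" and "\<And>x. x \<notin> \<Omega> \<Longrightarrow> f x = 0"
  shows "(\<integral>\<^sup>+x. f x \<partial>lebesgue_on \<Omega>) = (\<integral>\<^sup>+x. f x \<partial>lborel)"
proof -
  have "(\<integral>\<^sup>+x. f x \<partial>lebesgue_on \<Omega>) = (\<integral>\<^sup>+x. f x * indicator \<Omega> x \<partial>lebesgue)"
    using assms(2) by (simp add: nn_integral_restrict_space)
  also have "\<dots> = (\<integral>\<^sup>+x. f x \<partial>lebesgue)"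
    using assms(3) by (intro nn_integral_cong) (auto simp: indicator_def)
  finally show ?thesis by (simp add: nn_integral_completion)
qed

lemma integral_lebesgue_on_supp:
  fixes f :: "'a::euclidean_space \<Rightarrow> real"
  assumes "f \<in> borel_measurable borel" and "\<Omega> \<in> sets lebesgue" and "\<And>x. x \<notin> \<Omega> \<Longrightarrow> f x = 0"
  shows "(LINT x|lebesgue_on \<Omega>. f x) = (LINT x|lborel. f x)"
proof -
  have "(LINT x|lebesgue_on \<Omega>. f x) = (LINT x|lebesgue. indicator \<Omega> x *\<^sub>R f x)"
    using assms(2) by (simp add: integral_restrict_space)
  also have "\<dots> = (LINT x|lebesgue. f x)"
    using assms(3) by (intro Bochner_Integration.integral_cong) (auto simp: indicator_def)
  finally show ?thesis using assms(1) by (simp add: integral_completion)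
qed

lemma integrable_lebesgue_on_compact_support:
  fixes f :: "'a::euclidean_space \<Rightarrow> real"
  assumes "continuous_on UNIV f" "\<And>x. norm x \<ge> R \<Longrightarrow> f x = 0" "\<Omega> \<in> sets lebesgue"
  shows "integrable (lebesgue_on \<Omega>) f"
proof -
  have "f \<in> borel_measurable borel"
    using assms(1) by (rule borel_measurable_continuous_onI)
  then have "integrable lebesgue f"
    using integrable_compact_support[OF assms(1,2)] by (simp add: integrable_completion)
  then have "integrable lebesgue (\<lambda>x. indicator \<Omega> x *\<^sub>R f x)"
    using assms(3) by (intro integrable_mult_indicator) auto
  then show ?thesis
    using assms(3) by (simp add: integrable_restrict_space)
qed

lemma borel_lebesgue_on:
  "f \<in> borel_measurable borel \<Longrightarrow> f \<in> borel_measurable (lebesgue_on \<Omega>)"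
  by (intro measurable_restrict_space1 measurable_completion) simp

lemma test_fun_powr_integrable:
  assumes "\<phi> \<in> test_fun \<Omega>'" "p > 0" "\<Omega> \<in> sets lebesgue"
  shows "integrable (lebesgue_on \<Omega>) (\<lambda>x. \<bar>\<phi> x\<bar> powr p)"
proof -
  obtain R where R: "\<And>x. norm x \<ge> R \<Longrightarrow> \<phi> x = 0"
    using assms(1) test_fun_bounded_support by metis
  have "continuous_on UNIV (\<lambda>x. \<bar>\<phi> x\<bar> powr p)"
    using assms(2) by (intro continuous_on_powr' continuous_intros smooth_fun_continuous test_fun_smooth[OF assms(1)]) auto
  then show ?thesis
    using R assms by (intro integrable_lebesgue_on_compact_support[of _ R]) auto
qed

lemma grad_eq_0: "(\<And>i. partial i \<phi> x = 0) \<Longrightarrow> grad \<phi> x = 0"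
  by (simp add: grad_def vec_eq_iff)

lemma test_fun_grad_integrable:
  assumes "\<phi> \<in> test_fun \<Omega>'" "\<Omega> \<in> sets lebesgue"
  shows "integrable (lebesgue_on \<Omega>) (\<lambda>x. (norm (grad \<phi> x))\<^sup>2)"
proof -
  obtain R where R: "\<And>x i. norm x \<ge> R \<Longrightarrow> partial i \<phi> x = 0"
    using assms(1) test_fun_bounded_support by metis
  have "continuous_on UNIV (\<lambda>x. (norm (grad \<phi> x))\<^sup>2)"
    by (intro continuous_intros grad_continuous test_fun_smooth[OF assms(1)])
  then show ?thesis
    using R assms by (intro integrable_lebesgue_on_compact_support[of _ R]) (auto simp: grad_eq_0)
qed

section \<open>Sobolev inequality for test functions\<close>

lemma nn_integral_Cauchy_Schwarz_le:
  assumes [measurable]: "f \<in> borel_measurable M" "g \<in> borel_measurable M"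
    and fg: "\<And>x. 0 \<le> f x" "\<And>x. 0 \<le> (g x :: real)"
  shows "(\<integral>\<^sup>+x. ennreal (f x * g x) \<partial>M)\<^sup>2 \<le> (\<integral>\<^sup>+x. ennreal ((f x)\<^sup>2) \<partial>M) * (\<integral>\<^sup>+x. ennreal ((g x)\<^sup>2) \<partial>M)"
  using Cauchy_Schwarz_nn_integral[of "\<lambda>x. ennreal (f x)" M "\<lambda>x. ennreal (g x)"] fg
  by (simp add: ennreal_mult ennreal_power)

lemma power_gradient_bound:
  fixes \<phi> :: "real^'n::finite \<Rightarrow> real"
  assumes \<phi>: "\<phi> \<in> test_fun \<Omega>" and \<Omega>: "\<Omega> \<in> sets lebesgue"
  shows "(\<integral>\<^sup>+x. ennreal \<bar>partial i (\<lambda>x. \<phi> x ^ Suc m) x\<bar> \<partial>lborel)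
    \<le> ennreal (real (Suc m)) * (\<integral>\<^sup>+x. ennreal (\<bar>\<phi> x\<bar> ^ m * norm (grad \<phi> x)) \<partial>lebesgue_on \<Omega>)"
proof -
  have sm: "smooth_fun \<phi>" using \<phi> by (rule test_fun_smooth)
  have p0: "partial i \<phi> x = 0" if "x \<notin> \<Omega>" for x
    using \<phi> that by (metis test_funE subsetD)
  note [measurable] = smooth_fun_borel[OF sm] smooth_fun_borel[OF smooth_fun_partial[OF sm]] grad_borel[OF sm]
  have "(\<integral>\<^sup>+x. ennreal \<bar>partial i (\<lambda>x. \<phi> x ^ Suc m) x\<bar> \<partial>lborel)
      = (\<integral>\<^sup>+x. ennreal (real (Suc m)) * ennreal (\<bar>\<phi> x\<bar> ^ m * \<bar>partial i \<phi> x\<bar>) \<partial>lborel)"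
    by (simp add: partial_power[OF sm] abs_mult power_abs ennreal_mult mult.assoc del: of_nat_Suc power_Suc)
  also have "\<dots> = (\<integral>\<^sup>+x. ennreal (real (Suc m)) * ennreal (\<bar>\<phi> x\<bar> ^ m * \<bar>partial i \<phi> x\<bar>) \<partial>lebesgue_on \<Omega>)"
    by (rule nn_integral_lebesgue_on_supp[symmetric]) (use \<Omega> p0 in \<open>auto\<close>)
  also have "\<dots> \<le> (\<integral>\<^sup>+x. ennreal (real (Suc m)) * ennreal (\<bar>\<phi> x\<bar> ^ m * norm (grad \<phi> x)) \<partial>lebesgue_on \<Omega>)"
    by (intro nn_integral_mono mult_left_mono ennreal_leI)
      (auto simp flip: partial_nth_grad simp: component_le_norm_cart)
  also have "\<dots> = ennreal (real (Suc m)) * (\<integral>\<^sup>+x. ennreal (\<bar>\<phi> x\<bar> ^ m * norm (grad \<phi> x)) \<partial>lebesgue_on \<Omega>)"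
    by (intro nn_integral_cmult borel_lebesgue_on) measurable
  finally show ?thesis .
qed

lemma power_gradient_Cauchy_Schwarz:
  fixes \<phi> :: "real^'n::finite \<Rightarrow> real"
  assumes \<phi>: "\<phi> \<in> test_fun \<Omega>"
  shows "(\<integral>\<^sup>+x. ennreal (\<bar>\<phi> x\<bar> ^ m * norm (grad \<phi> x)) \<partial>lebesgue_on \<Omega>)\<^sup>2
    \<le> (\<integral>\<^sup>+x. ennreal (\<phi> x ^ (2 * m)) \<partial>lebesgue_on \<Omega>) * (\<integral>\<^sup>+x. ennreal ((norm (grad \<phi> x))\<^sup>2) \<partial>lebesgue_on \<Omega>)"
proof -
  have sm: "smooth_fun \<phi>" using \<phi> by (rule test_fun_smooth)
  have "(\<lambda>x. \<bar>\<phi> x\<bar> ^ m) \<in> borel_measurable (lebesgue_on \<Omega>)" "(\<lambda>x. norm (grad \<phi> x)) \<in> borel_measurable (lebesgue_on \<Omega>)"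
    using smooth_fun_borel[OF sm] grad_borel[OF sm] by (auto intro!: borel_lebesgue_on)
  from nn_integral_Cauchy_Schwarz_le[OF this] show ?thesis
    by (simp add: power_even_eq flip: power_abs)
qed

text \<open>Gagliardo-Nirenberg is applied to \<open>\<phi>^(m+1)\<close>, whose derivative carries
  \<open>\<bar>\<phi>\<bar>^m\<close>; Cauchy-Schwarz then returns the integral of
  \<open>\<phi>^(2m)\<close> times one more Dirichlet integral. Induction gives every even exponent,
  starting from the measure of \<open>\<Omega>\<close>, which is where boundedness enters.\<close>

lemma sobolev_2_nn:
  fixes i j :: "'n::finite"
  assumes U: "UNIV = {i, j}" and ne: "i \<noteq> j" and \<Omega>: "open \<Omega>" "bounded \<Omega>"
  shows "\<exists>c\<ge>0. \<forall>\<phi>::real^'n \<Rightarrow> real. \<phi> \<in> test_fun \<Omega> \<longrightarrow> (\<integral>\<^sup>+x. ennreal (\<phi> x ^ (2 * m)) \<partial>lebesgue_on \<Omega>)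
    \<le> ennreal c * (\<integral>\<^sup>+x. ennreal ((norm (grad \<phi> x))\<^sup>2) \<partial>lebesgue_on \<Omega>) ^ m"
proof (induction m)
  case 0
  have L: "\<Omega> \<in> lmeasurable"
    using \<Omega> by (simp add: lmeasurable_open)
  then have "emeasure (lebesgue_on \<Omega>) \<Omega> = ennreal (measure lebesgue \<Omega>)"
    by (simp add: emeasure_restrict_space emeasure_eq_measure2 fmeasurableD)
  then show ?case
    by (intro exI[of _ "measure lebesgue \<Omega>"]) (auto simp: space_restrict_space)
next
  case (Suc m)
  then obtain c where c: "c \<ge> 0" and IH: "\<And>\<phi>::real^'n \<Rightarrow> real. \<phi> \<in> test_fun \<Omega> \<Longrightarrow>
    (\<integral>\<^sup>+x. ennreal (\<phi> x ^ (2 * m)) \<partial>lebesgue_on \<Omega>)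
    \<le> ennreal c * (\<integral>\<^sup>+x. ennreal ((norm (grad \<phi> x))\<^sup>2) \<partial>lebesgue_on \<Omega>) ^ m" by blast
  have \<Omega>s: "\<Omega> \<in> sets lebesgue" using \<Omega>(1) by auto
  have "(\<integral>\<^sup>+x. ennreal (\<phi> x ^ (2 * Suc m)) \<partial>lebesgue_on \<Omega>)
    \<le> ennreal ((real (Suc m))\<^sup>2 * c) * (\<integral>\<^sup>+x. ennreal ((norm (grad \<phi> x))\<^sup>2) \<partial>lebesgue_on \<Omega>) ^ Suc m"
    if \<phi>: "\<phi> \<in> test_fun \<Omega>" for \<phi> :: "real^'n \<Rightarrow> real"
  proof -
    let ?D = "\<integral>\<^sup>+x. ennreal ((norm (grad \<phi> x))\<^sup>2) \<partial>lebesgue_on \<Omega>"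
    let ?X = "\<integral>\<^sup>+x. ennreal (\<bar>\<phi> x\<bar> ^ m * norm (grad \<phi> x)) \<partial>lebesgue_on \<Omega>"
    have sm: "smooth_fun \<phi>" using \<phi> by (rule test_fun_smooth)
    have \<phi>0: "\<phi> x = 0" if "x \<notin> \<Omega>" for x
      using \<phi> that by (metis test_funE subsetD)
    note [measurable] = smooth_fun_borel[OF sm]
    have "(\<integral>\<^sup>+x. ennreal (\<phi> x ^ (2 * Suc m)) \<partial>lebesgue_on \<Omega>) = (\<integral>\<^sup>+x. ennreal (\<phi> x ^ (2 * Suc m)) \<partial>lborel)"
      by (rule nn_integral_lebesgue_on_supp) (use \<Omega>s \<phi>0 in auto)
    also have "\<dots> = (\<integral>\<^sup>+x. (ennreal \<bar>\<phi> x ^ Suc m\<bar>)\<^sup>2 \<partial>lborel)"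
      by (simp add: ennreal_power power_mult[symmetric] mult.commute[of 2] del: power_Suc)
    also have "\<dots> \<le> (\<integral>\<^sup>+x. ennreal \<bar>partial i (\<lambda>x. \<phi> x ^ Suc m) x\<bar> \<partial>lborel) *
        (\<integral>\<^sup>+x. ennreal \<bar>partial j (\<lambda>x. \<phi> x ^ Suc m) x\<bar> \<partial>lborel)"
      by (rule gagliardo_nirenberg_2[OF U ne test_fun_power[OF \<phi>]]) simp
    also have "\<dots> \<le> (ennreal (real (Suc m)) * ?X) * (ennreal (real (Suc m)) * ?X)"
      by (intro mult_mono power_gradient_bound \<phi> \<Omega>s) auto
    also have "\<dots> = ennreal ((real (Suc m))\<^sup>2) * ?X\<^sup>2"
      by (simp add: power2_eq_square ennreal_mult mult_ac del: of_nat_Suc)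
    also have "\<dots> \<le> ennreal ((real (Suc m))\<^sup>2) * ((\<integral>\<^sup>+x. ennreal (\<phi> x ^ (2 * m)) \<partial>lebesgue_on \<Omega>) * ?D)"
      by (intro mult_left_mono power_gradient_Cauchy_Schwarz \<phi>) auto
    also have "\<dots> \<le> ennreal ((real (Suc m))\<^sup>2) * ((ennreal c * ?D ^ m) * ?D)"
      by (intro mult_left_mono mult_right_mono IH \<phi>) auto
    also have "\<dots> = ennreal ((real (Suc m))\<^sup>2 * c) * ?D ^ Suc m"
      using c by (simp add: ennreal_mult mult_ac del: of_nat_Suc)
    finally show ?thesis .
  qed
  then show ?case
    using c by (intro exI[of _ "(real (Suc m))\<^sup>2 * c"]) auto
qed

lemma test_fun_nn_integrals:
  fixes \<phi> :: "real^'n::finite \<Rightarrow> real"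
  assumes "\<phi> \<in> test_fun \<Omega>" "\<Omega> \<in> sets lebesgue"
  shows "m > 0 \<Longrightarrow> (\<integral>\<^sup>+x. ennreal (\<phi> x ^ (2 * m)) \<partial>lebesgue_on \<Omega>) = ennreal (LINT x|lebesgue_on \<Omega>. \<phi> x ^ (2 * m))"
    and "(\<integral>\<^sup>+x. ennreal ((norm (grad \<phi> x))\<^sup>2) \<partial>lebesgue_on \<Omega>) = ennreal (LINT x|lebesgue_on \<Omega>. (norm (grad \<phi> x))\<^sup>2)"
proof -
  assume m: "m > 0"
  have "(\<lambda>x. \<bar>\<phi> x\<bar> powr real (2 * m)) = (\<lambda>x. \<phi> x ^ (2 * m))"
    using m by (auto simp: powr_realpow' power_even_abs simp del: of_nat_mult)
  then show "(\<integral>\<^sup>+x. ennreal (\<phi> x ^ (2 * m)) \<partial>lebesgue_on \<Omega>) = ennreal (LINT x|lebesgue_on \<Omega>. \<phi> x ^ (2 * m))"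
    using test_fun_powr_integrable[OF assms(1), of "real (2 * m)", OF _ assms(2)] m
    by (intro nn_integral_eq_integral) auto
qed (use test_fun_grad_integrable[OF assms] in \<open>auto intro!: nn_integral_eq_integral\<close>)

text \<open>For \<open>\<theta> = \<phi>^4\<close> the same two inequalities reproduce the integral
  \<open>n\<close> of \<open>\<phi>^6\<close> on the right: \<open>n^4 \<le> 4^6 (n d)^3\<close>.
  Cancelling \<open>n^3\<close> requires finiteness of \<open>n\<close>, which holds for test
  functions, so the argument ends in real integrals.\<close>

lemma sobolev_3_real:
  fixes i j k :: "'n::finite" and \<phi> :: "real^'n \<Rightarrow> real"
  assumes U: "UNIV = {i, j, k}" and ne: "i \<noteq> j" "i \<noteq> k" "j \<noteq> k" and \<Omega>: "\<Omega> \<in> sets lebesgue"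
    and \<phi>: "\<phi> \<in> test_fun \<Omega>"
  shows "(LINT x|lebesgue_on \<Omega>. \<phi> x ^ 6) \<le> 4 ^ 6 * (LINT x|lebesgue_on \<Omega>. (norm (grad \<phi> x))\<^sup>2) ^ 3"
proof -
  let ?D = "\<integral>\<^sup>+x. ennreal ((norm (grad \<phi> x))\<^sup>2) \<partial>lebesgue_on \<Omega>"
  let ?X = "\<integral>\<^sup>+x. ennreal (\<bar>\<phi> x\<bar> ^ 3 * norm (grad \<phi> x)) \<partial>lebesgue_on \<Omega>"
  let ?N = "\<integral>\<^sup>+x. ennreal (\<phi> x ^ 6) \<partial>lebesgue_on \<Omega>"
  define n d where "n = (LINT x|lebesgue_on \<Omega>. \<phi> x ^ 6)" and "d = (LINT x|lebesgue_on \<Omega>. (norm (grad \<phi> x))\<^sup>2)"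
  have nd: "?N = ennreal n" "?D = ennreal d" "n \<ge> 0" "d \<ge> 0"
    using test_fun_nn_integrals(1)[OF \<phi> \<Omega>, of 3] test_fun_nn_integrals(2)[OF \<phi> \<Omega>] by (auto simp: n_def d_def)
  have sm: "smooth_fun \<phi>" using \<phi> by (rule test_fun_smooth)
  have \<phi>0: "\<phi> x = 0" if "x \<notin> \<Omega>" for x
    using \<phi> that by (metis test_funE subsetD)
  note [measurable] = smooth_fun_borel[OF sm]
  have "?N = (\<integral>\<^sup>+x. ennreal (\<phi> x ^ 6) \<partial>lborel)"
    by (rule nn_integral_lebesgue_on_supp) (use \<Omega> \<phi>0 in auto)
  also have "\<dots> = (\<integral>\<^sup>+x. ennreal (\<bar>(\<phi> x)\<^sup>2\<bar> ^ 3) \<partial>lborel)"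
    by simp
  finally have "?N\<^sup>2 = (\<integral>\<^sup>+x. ennreal (\<bar>(\<phi> x)\<^sup>2\<bar> ^ 3) \<partial>lborel)\<^sup>2" by simp
  also have "\<dots> \<le> (\<integral>\<^sup>+x. ennreal \<bar>partial i (\<lambda>x. \<phi> x ^ Suc 3) x\<bar> \<partial>lborel) *
      ((\<integral>\<^sup>+x. ennreal \<bar>partial j (\<lambda>x. \<phi> x ^ Suc 3) x\<bar> \<partial>lborel) *
       (\<integral>\<^sup>+x. ennreal \<bar>partial k (\<lambda>x. \<phi> x ^ Suc 3) x\<bar> \<partial>lborel))"
    by (rule gagliardo_nirenberg_3[OF U ne test_fun_power[OF \<phi>]]) auto
  also have "\<dots> \<le> (ennreal (real (Suc 3)) * ?X) * ((ennreal (real (Suc 3)) * ?X) * (ennreal (real (Suc 3)) * ?X))"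
    by (intro mult_mono power_gradient_bound \<phi> \<Omega>) auto
  also have "\<dots> = (4 * ?X) ^ 3"
    by (simp add: power3_eq_cube mult.assoc)
  \<comment> \<open>Squaring once more turns \<open>?X ^ 3\<close> into a power of
    \<open>?X\<^sup>2\<close>, the quantity that Cauchy-Schwarz bounds.\<close>
  finally have "(?N\<^sup>2)\<^sup>2 \<le> ((4 * ?X) ^ 3)\<^sup>2"
    by (intro power_mono) auto
  also have "\<dots> = 4 ^ 6 * (?X\<^sup>2) ^ 3"
    by (simp add: power_mult_distrib flip: power_mult)
  also have "\<dots> \<le> 4 ^ 6 * (?N * ?D) ^ 3"
    using power_gradient_Cauchy_Schwarz[OF \<phi>, of 3] by (intro mult_left_mono power_mono) auto
  also have "4 ^ 6 * (?N * ?D) ^ 3 = ennreal (4 ^ 6 * (n * d) ^ 3)"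
    unfolding nd(1,2) using nd(3,4) by (simp add: ennreal_mult ennreal_power[symmetric])
  also have "(?N\<^sup>2)\<^sup>2 = ennreal (n ^ 4)"
    unfolding nd(1) using nd(3) by (simp add: ennreal_power flip: power_mult)
  finally have "ennreal (n ^ 4) \<le> ennreal (4 ^ 6 * (n * d) ^ 3)" .
  then have "n ^ 4 \<le> 4 ^ 6 * (n * d) ^ 3"
    using nd by (simp add: ennreal_le_iff)
  then have "n ^ 3 * n \<le> n ^ 3 * (4 ^ 6 * d ^ 3)"
    by (simp add: power_mult_distrib mult_ac eval_nat_numeral)
  then have "n \<le> 4 ^ 6 * d ^ 3"
    using nd by (cases "n = 0") (auto simp: mult_le_cancel_left_pos)
  then show ?thesis by (simp add: n_def d_def)
qed

theorem sobolev_test_fun: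
  fixes \<Omega> :: "(real^'n::finite) set"
  assumes \<Omega>: "open \<Omega>" "bounded \<Omega>" and m: "m > 0"
    and dim: "CARD('n) = 2 \<or> CARD('n) = 3 \<and> m = 3"
  shows "\<exists>C>0. \<forall>\<phi>\<in>test_fun \<Omega>. Lnorm (lebesgue_on \<Omega>) (real (2 * m)) \<phi>
    \<le> C * Lnorm (lebesgue_on \<Omega>) 2 (\<lambda>x. norm (grad \<phi> x))"
proof -
  have \<Omega>s: "\<Omega> \<in> sets lebesgue" using \<Omega>(1) by auto
  have "\<exists>c\<ge>0. \<forall>\<phi>\<in>test_fun \<Omega>. (LINT x|lebesgue_on \<Omega>. \<phi> x ^ (2 * m))
      \<le> c * (LINT x|lebesgue_on \<Omega>. (norm (grad \<phi> x))\<^sup>2) ^ m"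
  proof (cases "CARD('n) = 2")
    case True
    then obtain i j :: 'n where "UNIV = {i, j}" "i \<noteq> j"
      by (auto simp: card_2_iff)
    from sobolev_2_nn[OF this \<Omega>, of m] obtain c where c: "c \<ge> 0"
      and le: "\<And>\<phi>::real^'n \<Rightarrow> real. \<phi> \<in> test_fun \<Omega> \<Longrightarrow> (\<integral>\<^sup>+x. ennreal (\<phi> x ^ (2 * m)) \<partial>lebesgue_on \<Omega>)
      \<le> ennreal c * (\<integral>\<^sup>+x. ennreal ((norm (grad \<phi> x))\<^sup>2) \<partial>lebesgue_on \<Omega>) ^ m" by blast
    have "(LINT x|lebesgue_on \<Omega>. \<phi> x ^ (2 * m)) \<le> c * (LINT x|lebesgue_on \<Omega>. (norm (grad \<phi> x))\<^sup>2) ^ m"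
      if \<phi>: "\<phi> \<in> test_fun \<Omega>" for \<phi> :: "real^'n \<Rightarrow> real"
    proof -
      have "ennreal (LINT x|lebesgue_on \<Omega>. \<phi> x ^ (2 * m)) \<le> ennreal (c * (LINT x|lebesgue_on \<Omega>. (norm (grad \<phi> x))\<^sup>2) ^ m)"
        using le[OF \<phi>] c by (simp add: test_fun_nn_integrals[OF \<phi> \<Omega>s] m ennreal_power ennreal_mult)
      then show ?thesis
        using c by (subst (asm) ennreal_le_iff) auto
    qed
    with c show ?thesis by blast
  next
    case False
    then have m3: "m = 3" and "CARD('n) = 3" using dim by auto
    then obtain i j k :: 'n where "UNIV = {i, j, k}" "i \<noteq> j" "i \<noteq> k" "j \<noteq> k"
      by (auto simp: card_3_iff)
    from sobolev_3_real[OF this \<Omega>s] show ?thesis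
      by (intro exI[of _ "4 ^ 6"]) (auto simp: m3)
  qed
  then obtain c where c: "c \<ge> 0" and le: "\<And>\<phi>. \<phi> \<in> test_fun \<Omega> \<Longrightarrow> (LINT x|lebesgue_on \<Omega>. \<phi> x ^ (2 * m))
      \<le> c * (LINT x|lebesgue_on \<Omega>. (norm (grad \<phi> x))\<^sup>2) ^ m" by blast
  \<comment> \<open>The constant \<open>c\<close> may be zero; \<open>c + 1\<close> makes the
    Sobolev constant positive.\<close>
  have "Lnorm (lebesgue_on \<Omega>) (real (2 * m)) \<phi> \<le> (c + 1) powr (1 / real (2 * m)) * Lnorm (lebesgue_on \<Omega>) 2 (\<lambda>x. norm (grad \<phi> x))"
    if \<phi>: "\<phi> \<in> test_fun \<Omega>" for \<phi>
  proof -
    let ?d = "LINT x|lebesgue_on \<Omega>. (norm (grad \<phi> x))\<^sup>2"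
    have d: "?d \<ge> 0" by simp
    have "Lnorm (lebesgue_on \<Omega>) (real (2 * m)) \<phi> = (LINT x|lebesgue_on \<Omega>. \<phi> x ^ (2 * m)) powr (1 / real (2 * m))"
      using m by (simp add: Lnorm_def powr_realpow' power_even_abs del: of_nat_mult)
    also have "\<dots> \<le> ((c + 1) * ?d ^ m) powr (1 / real (2 * m))"
      using le[OF \<phi>] d by (intro powr_mono2) (auto simp: distrib_right intro!: add_increasing2)
    also have "\<dots> = (c + 1) powr (1 / real (2 * m)) * (?d ^ m) powr (1 / real (2 * m))"
      by (rule powr_mult)
    also have "(?d ^ m) powr (1 / real (2 * m)) = ?d powr (1 / 2)"
      using m d by (subst powr_realpow'[symmetric]) (auto simp: powr_powr)
    also have "\<dots> = Lnorm (lebesgue_on \<Omega>) 2 (\<lambda>x. norm (grad \<phi> x))"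
      by (simp add: Lnorm_def)
    finally show ?thesis .
  qed
  then show ?thesis
    using c by (intro exI[of _ "(c + 1) powr (1 / real (2 * m))"]) auto
qed

section \<open>Square-integrable functions\<close>

text \<open>Stated for vector values, so that functions and their gradients share one
  calculus.\<close>

definition L2 :: "'a measure \<Rightarrow> ('a \<Rightarrow> 'b::euclidean_space) \<Rightarrow> bool" where
  "L2 M f \<longleftrightarrow> f \<in> borel_measurable M \<and> integrable M (\<lambda>x. (norm (f x))\<^sup>2)"

text \<open>Only the integrals of squared distances are required to tend to zero. As such an
  integral is zero by convention when it does not exist, results that need membership in
  \<open>L2\<close> assume it separately.\<close>

definition L2conv :: "'a measure \<Rightarrow> (nat \<Rightarrow> 'a \<Rightarrow> 'b::euclidean_space) \<Rightarrow> ('a \<Rightarrow> 'b) \<Rightarrow> bool" where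
  "L2conv M F f \<longleftrightarrow> (\<lambda>k. LINT x|M. (norm (F k x - f x))\<^sup>2) \<longlonglongrightarrow> 0"

lemma L2_measurable [measurable_dest]: "L2 M f \<Longrightarrow> f \<in> borel_measurable M"
  by (simp add: L2_def)

lemma L2_norm_integrable: "L2 M f \<Longrightarrow> integrable M (\<lambda>x. (norm (f x))\<^sup>2)"
  by (simp add: L2_def)

lemma L2_bound:
  fixes f :: "'a \<Rightarrow> 'b::euclidean_space"
  assumes "f \<in> borel_measurable M" "integrable M w" "AE x in M. (norm (f x))\<^sup>2 \<le> w x"
  shows "L2 M f"
  unfolding L2_def
proof
  show "integrable M (\<lambda>x. (norm (f x))\<^sup>2)"
    by (rule Bochner_Integration.integrable_bound[OF assms(2)]) (use assms(1,3) in auto)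
qed (rule assms(1))

lemma norm_add_squared_le: "(norm (a + b))\<^sup>2 \<le> 2 * (norm a)\<^sup>2 + 2 * (norm b)\<^sup>2"
  for a b :: "'b::real_inner"
proof -
  have "(norm (a + b))\<^sup>2 \<le> (norm a + norm b)\<^sup>2"
    by (intro power_mono norm_triangle_ineq) auto
  also have "\<dots> \<le> 2 * (norm a)\<^sup>2 + 2 * (norm b)\<^sup>2"
    using sum_squares_bound[of "norm a" "norm b"] by (simp add: power2_sum)
  finally show ?thesis .
qed

lemma L2_add: "L2 M f \<Longrightarrow> L2 M g \<Longrightarrow> L2 M (\<lambda>x. f x + g x)"
  by (rule L2_bound[of _ _ "\<lambda>x. 2 * (norm (f x))\<^sup>2 + 2 * (norm (g x))\<^sup>2"])
    (auto simp: L2_def norm_add_squared_le)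

lemma L2_scaleR: "L2 M f \<Longrightarrow> L2 M (\<lambda>x. c *\<^sub>R f x)"
  by (auto simp: L2_def power_mult_distrib)

lemma L2_diff: "L2 M f \<Longrightarrow> L2 M g \<Longrightarrow> L2 M (\<lambda>x. f x - g x)"
  using L2_add[of M f "\<lambda>x. (-1) *\<^sub>R g x"] L2_scaleR[of M g "-1"] by simp

lemma L2_mono:
  assumes "L2 M g" "f \<in> borel_measurable M" "AE x in M. norm (f x) \<le> norm (g x)"
  shows "L2 M f"
  by (rule L2_bound[OF assms(2) L2_norm_integrable[OF assms(1)]])
    (use assms(3) in \<open>auto elim!: eventually_mono intro!: power_mono\<close>)

lemma L2_zero [simp]: "L2 M (\<lambda>x. 0)"
  by (simp add: L2_def)

lemma L2_norm: "L2 M f \<Longrightarrow> L2 M (\<lambda>x. norm (f x))"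
  by (auto simp: L2_def)

lemma borel_measurable_vec_nth:
  "G \<in> borel_measurable M \<Longrightarrow> (\<lambda>x. G x $ i) \<in> borel_measurable M" for G :: "_ \<Rightarrow> real^'n::finite"
  using borel_measurable_inner[of G M "\<lambda>_. axis i 1"] by (simp add: inner_axis)

lemma L2_nth: "L2 M G \<Longrightarrow> L2 M (\<lambda>x. G x $ i)" for G :: "_ \<Rightarrow> real^'n::finite"
  by (rule L2_mono[of M G]) (auto simp: component_le_norm_cart L2_def intro: borel_measurable_vec_nth)

lemma L2_vec_iff: "L2 M G \<longleftrightarrow> (\<forall>i. L2 M (\<lambda>x. G x $ i))" for G :: "_ \<Rightarrow> real^'n::finite"
proof
  assume *: "\<forall>i. L2 M (\<lambda>x. G x $ i)"
  have eq: "(norm (G x))\<^sup>2 = (\<Sum>i\<in>UNIV. (norm (G x $ i))\<^sup>2)" for x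
    by (simp add: norm_vec_def L2_set_def sum_nonneg)
  have "G \<in> borel_measurable M"
    using * by (subst borel_measurable_euclidean_space) (auto simp: L2_def Basis_vec_def inner_axis)
  with * show "L2 M G"
    unfolding L2_def eq by simp
qed (auto intro: L2_nth)

lemma L2_mult_integrable:
  fixes f g :: "'a \<Rightarrow> real"
  assumes "L2 M f" "L2 M g"
  shows "integrable M (\<lambda>x. f x * g x)"
  using L2_product_integrable[of f M g] assms by (simp add: L2_def)

lemma L2_integral_mult_le:
  fixes f g :: "'a \<Rightarrow> real"
  assumes "L2 M f" "L2 M g"
  shows "\<bar>LINT x|M. f x * g x\<bar> \<le> Lnorm M 2 f * Lnorm M 2 g"
proof -
  have "\<bar>LINT x|M. f x * g x\<bar> \<le> (LINT x|M. \<bar>f x * g x\<bar>)"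
    using integral_norm_bound[of M "\<lambda>x. f x * g x"] by simp
  also have "\<dots> \<le> Lnorm M 2 f * Lnorm M 2 g"
    using L2_Cauchy_Schwarz[of f M g] assms by (simp add: L2_def)
  finally show ?thesis .
qed

lemma L2conv_triangle:
  assumes "L2 M f" "L2 M g" "L2 M h"
  shows "(LINT x|M. (norm (f x - h x))\<^sup>2) \<le> 2 * (LINT x|M. (norm (f x - g x))\<^sup>2) + 2 * (LINT x|M. (norm (g x - h x))\<^sup>2)"
proof -
  have i: "integrable M (\<lambda>x. (norm (f x - g x))\<^sup>2)" "integrable M (\<lambda>x. (norm (g x - h x))\<^sup>2)"
      "integrable M (\<lambda>x. (norm (f x - h x))\<^sup>2)"
    using assms by (auto intro!: L2_norm_integrable L2_diff)
  have "(LINT x|M. (norm (f x - h x))\<^sup>2) \<le> (LINT x|M. 2 * (norm (f x - g x))\<^sup>2 + 2 * (norm (g x - h x))\<^sup>2)"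
  proof (rule integral_mono)
    fix x
    show "(norm (f x - h x))\<^sup>2 \<le> 2 * (norm (f x - g x))\<^sup>2 + 2 * (norm (g x - h x))\<^sup>2"
      using norm_add_squared_le[of "f x - g x" "g x - h x"] by simp
  qed (use i in auto)
  also have "\<dots> = 2 * (LINT x|M. (norm (f x - g x))\<^sup>2) + 2 * (LINT x|M. (norm (g x - h x))\<^sup>2)"
    using i by simp
  finally show ?thesis .
qed

lemma L2conv_bounded_by:
  assumes "\<And>k. 0 \<le> (LINT x|M. (norm (F k x - f x))\<^sup>2) \<Longrightarrow> (LINT x|M. (norm (F k x - f x))\<^sup>2) \<le> e k" "e \<longlonglongrightarrow> 0"
  shows "L2conv M F f"
  unfolding L2conv_def
  by (rule tendsto_sandwich[OF _ _ tendsto_const assms(2)]) (use assms(1) in auto)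

lemma L2conv_add:
  assumes "\<And>k. L2 M (F k)" "L2 M f" "\<And>k. L2 M (H k)" "L2 M h" "L2conv M F f" "L2conv M H h"
  shows "L2conv M (\<lambda>k x. F k x + H k x) (\<lambda>x. f x + h x)"
proof (rule L2conv_bounded_by)
  show "(\<lambda>k. 2 * (LINT x|M. (norm (F k x - f x))\<^sup>2) + 2 * (LINT x|M. (norm (H k x - h x))\<^sup>2)) \<longlonglongrightarrow> 0"
    using assms(5,6) unfolding L2conv_def by (auto intro!: tendsto_eq_intros)
  fix k
  have i: "integrable M (\<lambda>x. (norm (F k x - f x))\<^sup>2)" "integrable M (\<lambda>x. (norm (H k x - h x))\<^sup>2)"
      "integrable M (\<lambda>x. (norm (F k x + H k x - (f x + h x)))\<^sup>2)"
    using assms by (auto intro!: L2_norm_integrable L2_diff L2_add)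
  have "(LINT x|M. (norm (F k x + H k x - (f x + h x)))\<^sup>2) \<le> (LINT x|M. 2 * (norm (F k x - f x))\<^sup>2 + 2 * (norm (H k x - h x))\<^sup>2)"
  proof (rule integral_mono)
    fix x
    show "(norm (F k x + H k x - (f x + h x)))\<^sup>2 \<le> 2 * (norm (F k x - f x))\<^sup>2 + 2 * (norm (H k x - h x))\<^sup>2"
      using norm_add_squared_le[of "F k x - f x" "H k x - h x"] by (simp add: algebra_simps)
  qed (use i in auto)
  then show "(LINT x|M. (norm (F k x + H k x - (f x + h x)))\<^sup>2)
      \<le> 2 * (LINT x|M. (norm (F k x - f x))\<^sup>2) + 2 * (LINT x|M. (norm (H k x - h x))\<^sup>2)"
    using i by simp
qed

lemma L2conv_scaleR:
  assumes "L2conv M F f"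
  shows "L2conv M (\<lambda>k x. c *\<^sub>R F k x) (\<lambda>x. c *\<^sub>R f x)"
proof -
  have "(norm (c *\<^sub>R F k x - c *\<^sub>R f x))\<^sup>2 = c\<^sup>2 * (norm (F k x - f x))\<^sup>2" for k x
    by (simp add: power_mult_distrib flip: scaleR_diff_right)
  then show ?thesis
    using assms tendsto_mult[OF tendsto_const[of "c\<^sup>2"]] unfolding L2conv_def by fastforce
qed

lemma L2conv_diff:
  assumes "\<And>k. L2 M (F k)" "L2 M f" "\<And>k. L2 M (H k)" "L2 M h" "L2conv M F f" "L2conv M H h"
  shows "L2conv M (\<lambda>k x. F k x - H k x) (\<lambda>x. f x - h x)"
  using L2conv_add[OF assms(1,2) L2_scaleR[OF assms(3), of "-1"] L2_scaleR[OF assms(4), of "-1"] assms(5)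
      L2conv_scaleR[OF assms(6), of "-1"]] by simp

lemma L2conv_subseq: "L2conv M F f \<Longrightarrow> strict_mono r \<Longrightarrow> L2conv M (\<lambda>k. F (r k)) f"
  unfolding L2conv_def using LIMSEQ_subseq_LIMSEQ[of _ 0 r] by (auto simp: o_def)

lemma L2conv_AE_subseq:
  assumes "\<And>k. L2 M (F k)" "L2 M f" "L2conv M F f"
  obtains r :: "nat \<Rightarrow> nat" where "strict_mono r" "AE x in M. (\<lambda>k. F (r k) x) \<longlonglongrightarrow> f x"
proof -
  have "\<exists>r. strict_mono r \<and> (AE x in M. (\<lambda>k. (norm (F (r k) x - f x))\<^sup>2) \<longlonglongrightarrow> 0)"
    using assms by (intro tendsto_L1_AE_subseq) (auto simp: L2conv_def intro!: L2_norm_integrable L2_diff)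
  then obtain r :: "nat \<Rightarrow> nat" where r: "strict_mono r" "AE x in M. (\<lambda>k. (norm (F (r k) x - f x))\<^sup>2) \<longlonglongrightarrow> 0"
    by blast
  have "AE x in M. (\<lambda>k. F (r k) x) \<longlonglongrightarrow> f x"
    using r(2)
  proof eventually_elim
    case (elim x)
    then have "(\<lambda>k. sqrt ((norm (F (r k) x - f x))\<^sup>2)) \<longlonglongrightarrow> sqrt 0"
      by (intro tendsto_real_sqrt)
    then show "(\<lambda>k. F (r k) x) \<longlonglongrightarrow> f x"
      by (simp add: tendsto_norm_zero_iff LIM_zero_iff)
  qed
  with r(1) show thesis by (rule that)
qed

lemma L2conv_dominated:
  assumes F: "\<And>k. F k \<in> borel_measurable M" and f: "f \<in> borel_measurable M"
    and w: "integrable M w"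
    and lim: "AE x in M. (\<lambda>k. F k x) \<longlonglongrightarrow> f x" and bound: "\<And>k. AE x in M. (norm (F k x - f x))\<^sup>2 \<le> w x"
  shows "L2conv M F f"
proof -
  have "(\<lambda>k. LINT x|M. (norm (F k x - f x))\<^sup>2) \<longlonglongrightarrow> (LINT x|M. 0)"
  proof (rule integral_dominated_convergence[where w = w])
    show "AE x in M. (\<lambda>k. (norm (F k x - f x))\<^sup>2) \<longlonglongrightarrow> 0"
      using lim
    proof eventually_elim
      case (elim x)
      then have "(\<lambda>k. (norm (F k x - f x))\<^sup>2) \<longlonglongrightarrow> (norm (f x - f x))\<^sup>2"
        by (intro tendsto_intros)
      then show ?case by simp
    qed
  qed (use F f w bound in auto)
  then show ?thesis by (simp add: L2conv_def)
qed

lemma L2conv_integral_mult: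
  fixes f g :: "'a \<Rightarrow> real"
  assumes "\<And>k. L2 M (F k)" "L2 M f" "L2 M g" "L2conv M F f"
  shows "(\<lambda>k. LINT x|M. F k x * g x) \<longlonglongrightarrow> (LINT x|M. f x * g x)"
proof (rule LIM_zero_cancel, rule Lim_null_comparison)
  show "(\<lambda>k. sqrt (LINT x|M. (norm (F k x - f x))\<^sup>2) * Lnorm M 2 g) \<longlonglongrightarrow> 0"
    using assms(4) tendsto_real_sqrt unfolding L2conv_def by (auto intro!: tendsto_eq_intros)
  have "\<bar>(LINT x|M. F k x * g x) - (LINT x|M. f x * g x)\<bar> \<le> sqrt (LINT x|M. (norm (F k x - f x))\<^sup>2) * Lnorm M 2 g" for k
  proof -
    have "(LINT x|M. F k x * g x) - (LINT x|M. f x * g x) = (LINT x|M. (F k x - f x) * g x)"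
      using assms by (simp add: left_diff_distrib L2_mult_integrable)
    then show ?thesis
      using L2_integral_mult_le[OF L2_diff[OF assms(1)[of k] assms(2)] assms(3)] by (simp add: Lnorm_2)
  qed
  then show "\<forall>\<^sub>F k in sequentially. norm ((LINT x|M. F k x * g x) - (LINT x|M. f x * g x))
      \<le> sqrt (LINT x|M. (norm (F k x - f x))\<^sup>2) * Lnorm M 2 g"
    by simp
qed

lemma L2conv_nth:
  fixes F :: "nat \<Rightarrow> 'a \<Rightarrow> real^'n::finite"
  assumes "\<And>k. L2 M (F k)" "L2 M f" "L2conv M F f"
  shows "L2conv M (\<lambda>k x. F k x $ i) (\<lambda>x. f x $ i)"
proof (rule L2conv_bounded_by)
  show "(\<lambda>k. LINT x|M. (norm (F k x - f x))\<^sup>2) \<longlonglongrightarrow> 0"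
    using assms(3) by (simp add: L2conv_def)
  fix k
  have d: "L2 M (\<lambda>x. F k x - f x)" using assms by (intro L2_diff)
  have "(norm (F k x $ i - f x $ i))\<^sup>2 \<le> (norm (F k x - f x))\<^sup>2" for x
    using component_le_norm_cart[of "F k x - f x" i] by (intro power_mono) auto
  then show "(LINT x|M. (norm (F k x $ i - f x $ i))\<^sup>2) \<le> (LINT x|M. (norm (F k x - f x))\<^sup>2)"
    using L2_norm_integrable[OF d] L2_norm_integrable[OF L2_nth[OF d, of i]]
    by (intro integral_mono) auto
qed

text \<open>Minkowski's inequality in \<open>L2\<close>, obtained by expanding the square and
  Cauchy-Schwarz, makes the norm continuous.\<close>

lemma L2_conv_Lnorm:
  assumes "\<And>k. L2 M (F k)" "L2 M f" "L2conv M F f"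
  shows "(\<lambda>k. Lnorm M 2 (\<lambda>x. norm (F k x))) \<longlonglongrightarrow> Lnorm M 2 (\<lambda>x. norm (f x))"
proof -
  have tri: "Lnorm M 2 (\<lambda>x. norm (g x)) \<le> Lnorm M 2 (\<lambda>x. norm (h x)) + Lnorm M 2 (\<lambda>x. norm (g x - h x))"
    if "L2 M g" "L2 M h" for g h :: "'a \<Rightarrow> 'b"
  proof -
    let ?d = "\<lambda>x. norm (g x - h x)" and ?h = "\<lambda>x. norm (h x)"
    have L: "L2 M ?d" "L2 M ?h" using that by (auto intro: L2_norm L2_diff)
    have "(LINT x|M. (norm (g x))\<^sup>2) \<le> (LINT x|M. (?h x)\<^sup>2 + 2 * (?h x * ?d x) + (?d x)\<^sup>2)"
    proof (rule integral_mono)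
      fix x
      have "norm (g x) \<le> ?h x + ?d x" using norm_triangle_ineq[of "h x" "g x - h x"] by simp
      then have "(norm (g x))\<^sup>2 \<le> (?h x + ?d x)\<^sup>2" by (intro power_mono) auto
      then show "(norm (g x))\<^sup>2 \<le> (?h x)\<^sup>2 + 2 * (?h x * ?d x) + (?d x)\<^sup>2" by (simp add: power2_sum)
    qed (use L that L2_mult_integrable[OF L(2,1)] L2_norm_integrable[OF L(1)] L2_norm_integrable[OF L(2)]
         in \<open>auto simp: L2_norm_integrable\<close>)
    also have "\<dots> = (LINT x|M. (?h x)\<^sup>2) + 2 * (LINT x|M. ?h x * ?d x) + (LINT x|M. (?d x)\<^sup>2)"
      using L2_mult_integrable[OF L(2,1)] L2_norm_integrable[OF L(1)] L2_norm_integrable[OF L(2)] by simp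
    also have "\<dots> \<le> (Lnorm M 2 ?h)\<^sup>2 + 2 * (Lnorm M 2 ?h * Lnorm M 2 ?d) + (Lnorm M 2 ?d)\<^sup>2"
      using L2_integral_mult_le[OF L(2,1)] by (simp add: Lnorm_2)
    also have "\<dots> = (Lnorm M 2 ?h + Lnorm M 2 ?d)\<^sup>2" by (simp add: power2_sum)
    finally show ?thesis
      unfolding Lnorm_2[of M "\<lambda>x. norm (g x)"] by (intro real_le_lsqrt) (auto intro!: add_nonneg_nonneg)
  qed
  show ?thesis
  proof (rule LIM_zero_cancel, rule Lim_null_comparison)
    show "(\<lambda>k. sqrt (LINT x|M. (norm (F k x - f x))\<^sup>2)) \<longlonglongrightarrow> 0"
      using assms(3) tendsto_real_sqrt unfolding L2conv_def by fastforce
    have "\<bar>Lnorm M 2 (\<lambda>x. norm (F k x)) - Lnorm M 2 (\<lambda>x. norm (f x))\<bar> \<le> sqrt (LINT x|M. (norm (F k x - f x))\<^sup>2)" for k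
      using tri[OF assms(1)[of k] assms(2)] tri[OF assms(2) assms(1)[of k]]
      by (simp add: Lnorm_2 norm_minus_commute[of "f _"])
    then show "\<forall>\<^sub>F k in sequentially. norm (Lnorm M 2 (\<lambda>x. norm (F k x)) - Lnorm M 2 (\<lambda>x. norm (f x)))
        \<le> sqrt (LINT x|M. (norm (F k x - f x))\<^sup>2)" by simp
  qed
qed

section \<open>The space of functions with weak gradient and zero trace\<close>

text \<open>Lebesgue measure is complete, so measurability survives a change on a null set. The
  definition of a weak gradient yields measurability on compact subsets; comparison with an
  approximated gradient extends it to \<open>\<Omega>\<close>.\<close>

lemma borel_measurable_lebesgue_on_AE:
  fixes f g :: "'a::euclidean_space \<Rightarrow> 'b::euclidean_space"
  assumes \<Omega>: "\<Omega> \<in> sets lebesgue" and f: "f \<in> borel_measurable (lebesgue_on \<Omega>)"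
    and ae: "AE x in lebesgue_on \<Omega>. f x = g x"
  shows "g \<in> borel_measurable (lebesgue_on \<Omega>)"
proof -
  let ?f = "\<lambda>x. if x \<in> \<Omega> then f x else 0" and ?g = "\<lambda>x. if x \<in> \<Omega> then g x else 0"
  have f': "?f \<in> borel_measurable lebesgue"
    by (rule borel_measurable_if_I[OF f \<Omega>])
  have ae': "AE x in lebesgue. ?f x = ?g x"
    using ae \<Omega> by (subst (asm) AE_restrict_space_iff) (auto elim: eventually_mono)
  have "?g \<in> borel_measurable lebesgue"
  proof (rule measurableI)
    fix A :: "'b set" assume A: "A \<in> sets borel"
    show "?g -` A \<inter> space lebesgue \<in> sets lebesgue"
    proof (rule completion.in_sets_AE)
      show "?f -` A \<inter> space lebesgue \<in> sets lebesgue"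
        using f' A by (rule measurable_sets)
      show "AE x in lebesgue. (x \<in> ?f -` A \<inter> space lebesgue) = (x \<in> ?g -` A \<inter> space lebesgue)"
        using ae' by eventually_elim (auto simp: vimage_def)
    qed auto
  qed simp
  then show ?thesis by (rule borel_measurable_if_D)
qed

lemma Lp_2_iff: "Lp \<Omega> 2 f \<longleftrightarrow> L2 (lebesgue_on \<Omega>) f"
  by (simp add: Lp_def L2_def)

lemma test_fun_L2:
  assumes "\<phi> \<in> test_fun \<Omega>'" "\<Omega> \<in> sets lebesgue"
  shows "L2 (lebesgue_on \<Omega>) \<phi>" "L2 (lebesgue_on \<Omega>) (grad \<phi>)" "L2 (lebesgue_on \<Omega>) (partial i \<phi>)"
proof -
  have sm: "smooth_fun \<phi>" using assms(1) by (rule test_fun_smooth)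
  show "L2 (lebesgue_on \<Omega>) \<phi>"
    using test_fun_powr_integrable[OF assms(1) _ assms(2), of 2] smooth_fun_borel[OF sm]
    by (simp add: L2_def borel_lebesgue_on)
  show G: "L2 (lebesgue_on \<Omega>) (grad \<phi>)"
    using test_fun_grad_integrable[OF assms] grad_borel[OF sm]
    by (simp add: L2_def borel_lebesgue_on)
  show "L2 (lebesgue_on \<Omega>) (partial i \<phi>)"
    using L2_nth[OF G, of i] by (simp add: partial_nth_grad)
qed

text \<open>The function and its gradient as one joint \<open>L2\<close> limit. In
  \<open>H01\<close> the gradient is existentially bound and the weak identity is demanded; here the
  gradient is explicit and the identity becomes a consequence.\<close>

definition H01_grad :: "(real^'n::finite) set \<Rightarrow> (real^'n \<Rightarrow> real) \<Rightarrow> (real^'n \<Rightarrow> real^'n) \<Rightarrow> bool" where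
  "H01_grad \<Omega> y G \<longleftrightarrow> L2 (lebesgue_on \<Omega>) y \<and> L2 (lebesgue_on \<Omega>) G \<and>
    (\<exists>\<phi>. (\<forall>k. \<phi> k \<in> test_fun \<Omega>) \<and> L2conv (lebesgue_on \<Omega>) \<phi> y \<and>
      L2conv (lebesgue_on \<Omega>) (\<lambda>k. grad (\<phi> k)) G)"

lemma test_fun_H01_grad:
  assumes "\<phi> \<in> test_fun \<Omega>" "\<Omega> \<in> sets lebesgue"
  shows "H01_grad \<Omega> \<phi> (grad \<phi>)"
  unfolding H01_grad_def
  using test_fun_L2[OF assms] assms(1) by (auto intro!: exI[of _ "\<lambda>_. \<phi>"] simp: L2conv_def)

lemma L2_L1loc:
  fixes y :: "real^'n::finite \<Rightarrow> real"
  assumes \<Omega>: "\<Omega> \<in> sets lebesgue" and y: "L2 (lebesgue_on \<Omega>) y"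
  shows "L1loc \<Omega> y"
  unfolding L1loc_def
proof (intro allI impI)
  fix K assume K: "compact K \<and> K \<subseteq> \<Omega>"
  then have KL: "K \<in> lmeasurable" by (simp add: lmeasurable_compact)
  then interpret finite_measure "lebesgue_on K" by (rule finite_measure_lebesgue_on)
  have Ks: "K \<in> sets lebesgue" using KL by auto
  have m: "y \<in> borel_measurable (lebesgue_on K)"
    using y K by (auto simp: L2_def intro: measurable_restrict_mono)
  have "integrable lebesgue (\<lambda>x. if x \<in> \<Omega> then (norm (y x))\<^sup>2 else 0)"
    using y \<Omega> by (subst Lebesgue_Measure.integrable_restrict_UNIV) (auto simp: L2_def)
  then have "integrable lebesgue (\<lambda>x. indicator K x *\<^sub>R (if x \<in> \<Omega> then (norm (y x))\<^sup>2 else 0))"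
    using Ks by (intro integrable_mult_indicator)
  moreover have "(\<lambda>x. indicator K x *\<^sub>R (if x \<in> \<Omega> then (norm (y x))\<^sup>2 else 0)) = (\<lambda>x. if x \<in> K then (norm (y x))\<^sup>2 else 0)"
    using K by (auto simp: indicator_def fun_eq_iff)
  ultimately have "integrable lebesgue (\<lambda>x. if x \<in> K then (norm (y x))\<^sup>2 else 0)" by metis
  then have "integrable (lebesgue_on K) (\<lambda>x. (norm (y x))\<^sup>2)"
    using Ks by (subst (asm) Lebesgue_Measure.integrable_restrict_UNIV)
  then have "integrable (lebesgue_on K) (\<lambda>x. \<bar>y x\<bar> powr 1)"
    using Lp_nested[OF m, of 2 1] by simp
  then show "integrable (lebesgue_on K) y"
    using m by (simp add: integrable_abs_iff)
qed

text \<open>Integration by parts holds for the approximating test functions, and both sides are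
  continuous under \<open>L2\<close> convergence against a fixed \<open>\<psi>\<close>.\<close>

lemma H01_grad_weak_grad:
  assumes \<Omega>: "open \<Omega>" and H: "H01_grad \<Omega> y G"
  shows "weak_grad \<Omega> y G"
  unfolding weak_grad_def
proof (intro conjI allI ballI)
  have \<Omega>s: "\<Omega> \<in> sets lebesgue" using \<Omega> by auto
  have L: "L2 (lebesgue_on \<Omega>) y" "L2 (lebesgue_on \<Omega>) G" using H by (auto simp: H01_grad_def)
  then show "L1loc \<Omega> y" "L1loc \<Omega> (\<lambda>x. G x $ i)" for i
    by (auto intro!: L2_L1loc \<Omega>s L2_nth)
  fix \<psi> i assume \<psi>: "\<psi> \<in> test_fun \<Omega>"
  obtain \<phi> where \<phi>: "\<And>k. \<phi> k \<in> test_fun \<Omega>" "L2conv (lebesgue_on \<Omega>) \<phi> y"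
      "L2conv (lebesgue_on \<Omega>) (\<lambda>k. grad (\<phi> k)) G"
    using H by (auto simp: H01_grad_def)
  have \<psi>0: "\<psi> x = 0" "partial i \<psi> x = 0" if "x \<notin> \<Omega>" for x
    using \<psi> that by (metis test_funE subsetD)+
  have parts: "(LINT x|lebesgue_on \<Omega>. \<phi> k x * partial i \<psi> x) = - (LINT x|lebesgue_on \<Omega>. grad (\<phi> k) x $ i * \<psi> x)" for k
  proof -
    have sm: "smooth_fun (\<phi> k)" "smooth_fun \<psi>" using \<phi>(1) \<psi> test_fun_smooth by auto
    have "(LINT x|lebesgue_on \<Omega>. \<phi> k x * partial i \<psi> x) = (LINT x|lborel. \<phi> k x * partial i \<psi> x)"
      by (rule integral_lebesgue_on_supp)
        (use \<Omega>s \<psi>0 sm in \<open>auto intro!: smooth_fun_borel smooth_fun_partial smooth_fun_mult\<close>)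
    moreover have "(LINT x|lebesgue_on \<Omega>. partial i (\<phi> k) x * \<psi> x) = (LINT x|lborel. partial i (\<phi> k) x * \<psi> x)"
      by (rule integral_lebesgue_on_supp)
        (use \<Omega>s \<psi>0 sm in \<open>auto intro!: smooth_fun_borel smooth_fun_partial smooth_fun_mult\<close>)
    ultimately show ?thesis
      using test_fun_integration_by_parts[OF \<psi> \<phi>(1)[of k], of i] by (simp add: partial_nth_grad)
  qed
  have 1: "(\<lambda>k. LINT x|lebesgue_on \<Omega>. \<phi> k x * partial i \<psi> x) \<longlonglongrightarrow> (LINT x|lebesgue_on \<Omega>. y x * partial i \<psi> x)"
    by (intro L2conv_integral_mult test_fun_L2(1)[OF \<phi>(1) \<Omega>s] L(1) test_fun_L2(3)[OF \<psi> \<Omega>s] \<phi>(2))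
  have 2: "(\<lambda>k. LINT x|lebesgue_on \<Omega>. grad (\<phi> k) x $ i * \<psi> x) \<longlonglongrightarrow> (LINT x|lebesgue_on \<Omega>. G x $ i * \<psi> x)"
    by (intro L2conv_integral_mult L2conv_nth L2_nth test_fun_L2(2)[OF \<phi>(1) \<Omega>s] test_fun_L2(1)[OF \<psi> \<Omega>s] L(2) \<phi>(3))
  show "(LINT x|lebesgue_on \<Omega>. y x * partial i \<psi> x) = - (LINT x|lebesgue_on \<Omega>. G x $ i * \<psi> x)"
    using LIMSEQ_unique[OF 1[unfolded parts] tendsto_minus[OF 2]] .
qed

lemma L2conv_cong_AE:
  assumes "AE x in M. f x = g x" "f \<in> borel_measurable M" "g \<in> borel_measurable M"
    "\<And>k. F k \<in> borel_measurable M" "L2conv M F f"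
  shows "L2conv M F g"
proof -
  have "(LINT x|M. (norm (F k x - f x))\<^sup>2) = (LINT x|M. (norm (F k x - g x))\<^sup>2)" for k
    using assms by (intro integral_cong_AE) (auto elim: eventually_mono)
  then show ?thesis using assms(5) by (simp add: L2conv_def)
qed

lemma L2_cong_AE:
  assumes "AE x in M. f x = g x" "g \<in> borel_measurable M" "L2 M f"
  shows "L2 M g"
  by (rule L2_mono[OF assms(3,2)]) (use assms(1) in \<open>auto elim: eventually_mono\<close>)

lemma H01_grad_cong_AE:
  assumes \<Omega>: "\<Omega> \<in> sets lebesgue" and H: "H01_grad \<Omega> y G"
    and ae: "AE x in lebesgue_on \<Omega>. y x = z x" "AE x in lebesgue_on \<Omega>. G x = H x"
  shows "H01_grad \<Omega> z H"
proof -
  have L: "L2 (lebesgue_on \<Omega>) y" "L2 (lebesgue_on \<Omega>) G" using H by (auto simp: H01_grad_def)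
  have m: "z \<in> borel_measurable (lebesgue_on \<Omega>)" "H \<in> borel_measurable (lebesgue_on \<Omega>)"
    using borel_measurable_lebesgue_on_AE[OF \<Omega> _ ae(1)] borel_measurable_lebesgue_on_AE[OF \<Omega> _ ae(2)] L
    by (auto simp: L2_def)
  obtain \<phi> where \<phi>: "\<And>k. \<phi> k \<in> test_fun \<Omega>" "L2conv (lebesgue_on \<Omega>) \<phi> y"
      "L2conv (lebesgue_on \<Omega>) (\<lambda>k. grad (\<phi> k)) G"
    using H by (auto simp: H01_grad_def)
  show ?thesis
    unfolding H01_grad_def
    using L2_cong_AE[OF ae(1) m(1) L(1)] L2_cong_AE[OF ae(2) m(2) L(2)] \<phi>(1)
      L2conv_cong_AE[OF ae(1) _ m(1) _ \<phi>(2)] L2conv_cong_AE[OF ae(2) _ m(2) _ \<phi>(3)] L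
      test_fun_L2[OF \<phi>(1) \<Omega>]
    by (auto simp: L2_def intro!: exI[of _ \<phi>])
qed

text \<open>The gradient that witnesses \<open>H01\<close> equals any other weak gradient almost
  everywhere, so the approximation transfers. This makes the gradient occurring in
  \<open>is_solution\<close> accessible to all later estimates.\<close>

lemma H01_grad_of_weak_grad:
  assumes \<Omega>: "open \<Omega>" and y: "H01 \<Omega> y" and G: "weak_grad \<Omega> y G"
  shows "H01_grad \<Omega> y G"
proof -
  have \<Omega>s: "\<Omega> \<in> sets lebesgue" using \<Omega> by auto
  obtain H \<phi> where H: "weak_grad \<Omega> y H" "\<forall>i. Lp \<Omega> 2 (\<lambda>x. H x $ i)" and \<phi>: "\<forall>k. \<phi> k \<in> test_fun \<Omega>"
      "(\<lambda>k. LINT x|lebesgue_on \<Omega>. (\<phi> k x - y x)^2) \<longlonglongrightarrow> 0"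
      "(\<lambda>k. LINT x|lebesgue_on \<Omega>. (norm (grad (\<phi> k) x - H x))^2) \<longlonglongrightarrow> 0"
    using y by (auto simp: H01_def)
  have "H01_grad \<Omega> y H"
    using y H(2) \<phi> unfolding H01_grad_def H01_def L2conv_def Lp_2_iff L2_vec_iff[symmetric]
    by auto
  then show ?thesis
    by (rule H01_grad_cong_AE[OF \<Omega>s]) (use weak_grad_unique[OF \<Omega> H(1) G] in auto)
qed

lemma H01_grad_H01:
  assumes \<Omega>: "open \<Omega>" and H: "H01_grad \<Omega> y G"
  shows "H01 \<Omega> y"
  using H01_grad_weak_grad[OF assms] H
  unfolding H01_def H01_grad_def Lp_2_iff L2_vec_iff[symmetric] L2conv_def
  by (auto simp: L2_nth)

lemma H01_grad_diff:
  assumes \<Omega>: "\<Omega> \<in> sets lebesgue" and y: "H01_grad \<Omega> y G" and z: "H01_grad \<Omega> z H"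
  shows "H01_grad \<Omega> (\<lambda>x. y x - z x) (\<lambda>x. G x - H x)"
proof -
  obtain \<phi> where \<phi>: "\<And>k. \<phi> k \<in> test_fun \<Omega>" "L2conv (lebesgue_on \<Omega>) \<phi> y"
      "L2conv (lebesgue_on \<Omega>) (\<lambda>k. grad (\<phi> k)) G"
    using y by (auto simp: H01_grad_def)
  obtain \<psi> where \<psi>: "\<And>k. \<psi> k \<in> test_fun \<Omega>" "L2conv (lebesgue_on \<Omega>) \<psi> z"
      "L2conv (lebesgue_on \<Omega>) (\<lambda>k. grad (\<psi> k)) H"
    using z by (auto simp: H01_grad_def)
  have g: "grad (\<lambda>x. \<phi> k x - \<psi> k x) = (\<lambda>x. grad (\<phi> k) x - grad (\<psi> k) x)" for k
    using partial_diff[OF test_fun_smooth[OF \<phi>(1)] test_fun_smooth[OF \<psi>(1)]]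
    by (auto simp: grad_def vec_eq_iff fun_eq_iff)
  show ?thesis
    unfolding H01_grad_def
    using y z \<phi> \<psi> test_fun_L2[OF \<phi>(1) \<Omega>] test_fun_L2[OF \<psi>(1) \<Omega>]
    by (intro conjI exI[of _ "\<lambda>k x. \<phi> k x - \<psi> k x"])
      (auto simp: H01_grad_def g intro!: L2_diff L2conv_diff test_fun_diff)
qed

lemma L2conv_choose:
  assumes "L2conv M F f" "e > 0"
  shows "\<forall>\<^sub>F k in sequentially. (LINT x|M. (norm (F k x - f x))\<^sup>2) < e"
  using assms order_tendstoD(2) unfolding L2conv_def by blast

text \<open>A diagonal choice: one test function per \<open>m\<close> that is within
  \<open>1 / (m + 1)\<close> of \<open>Y m\<close> in squared distance, for function and gradient at
  once.\<close>

lemma H01_grad_closed: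
  assumes \<Omega>: "\<Omega> \<in> sets lebesgue" and Y: "\<And>m. H01_grad \<Omega> (Y m) (G m)"
    and y: "L2 (lebesgue_on \<Omega>) y" "L2 (lebesgue_on \<Omega>) H"
    and conv: "L2conv (lebesgue_on \<Omega>) Y y" "L2conv (lebesgue_on \<Omega>) G H"
  shows "H01_grad \<Omega> y H"
proof -
  let ?M = "lebesgue_on \<Omega>"
  have L: "L2 ?M (Y m)" "L2 ?M (G m)" for m using Y[of m] by (auto simp: H01_grad_def)
  have "\<exists>\<phi>\<in>test_fun \<Omega>. (LINT x|?M. (norm (\<phi> x - Y m x))\<^sup>2) < 1 / real (Suc m) \<and>
      (LINT x|?M. (norm (grad \<phi> x - G m x))\<^sup>2) < 1 / real (Suc m)" for m
  proof -
    obtain \<phi> where \<phi>: "\<And>k. \<phi> k \<in> test_fun \<Omega>" "L2conv ?M \<phi> (Y m)" "L2conv ?M (\<lambda>k. grad (\<phi> k)) (G m)"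
      using Y[of m] by (auto simp: H01_grad_def)
    have "\<forall>\<^sub>F k in sequentially. (LINT x|?M. (norm (\<phi> k x - Y m x))\<^sup>2) < 1 / real (Suc m) \<and>
      (LINT x|?M. (norm (grad (\<phi> k) x - G m x))\<^sup>2) < 1 / real (Suc m)"
      by (intro eventually_conj L2conv_choose \<phi>) auto
    then show ?thesis using \<phi>(1) by (auto dest!: eventually_happens'[OF sequentially_bot])
  qed
  then have "\<forall>m. \<exists>\<phi>. \<phi> \<in> test_fun \<Omega> \<and> (LINT x|?M. (norm (\<phi> x - Y m x))\<^sup>2) < 1 / real (Suc m) \<and>
      (LINT x|?M. (norm (grad \<phi> x - G m x))\<^sup>2) < 1 / real (Suc m)"
    by (simp add: Bex_def)
  from choice[OF this] obtain \<phi> where \<phi>: "\<And>m. \<phi> m \<in> test_fun \<Omega>"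
      "\<And>m. (LINT x|?M. (norm (\<phi> m x - Y m x))\<^sup>2) < 1 / real (Suc m)"
      "\<And>m. (LINT x|?M. (norm (grad (\<phi> m) x - G m x))\<^sup>2) < 1 / real (Suc m)"
    by auto
  have T: "L2 ?M (\<phi> m)" "L2 ?M (grad (\<phi> m))" for m
    using test_fun_L2[OF \<phi>(1) \<Omega>] by auto
  have lim: "(\<lambda>m. 2 * (1 / real (Suc m)) + 2 * e m) \<longlonglongrightarrow> 0" if "e \<longlonglongrightarrow> 0" for e
    using tendsto_add[OF tendsto_mult[OF tendsto_const[of 2] LIMSEQ_Suc[OF lim_1_over_n]]
        tendsto_mult[OF tendsto_const[of 2] that]] by simp
  have "L2conv ?M \<phi> y"
  proof (rule L2conv_bounded_by[OF _ lim[OF conv(1)[unfolded L2conv_def]]])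
    show "(LINT x|?M. (norm (\<phi> m x - y x))\<^sup>2) \<le> 2 * (1 / real (Suc m)) + 2 * (LINT x|?M. (norm (Y m x - y x))\<^sup>2)" for m
      using L2conv_triangle[OF T(1) L(1) y(1), of m m] \<phi>(2)[of m] by linarith
  qed
  moreover have "L2conv ?M (\<lambda>m. grad (\<phi> m)) H"
  proof (rule L2conv_bounded_by[OF _ lim[OF conv(2)[unfolded L2conv_def]]])
    show "(LINT x|?M. (norm (grad (\<phi> m) x - H x))\<^sup>2) \<le> 2 * (1 / real (Suc m)) + 2 * (LINT x|?M. (norm (G m x - H x))\<^sup>2)" for m
      using L2conv_triangle[OF T(2) L(2) y(2), of m m] \<phi>(3)[of m] by linarith
  qed
  ultimately show ?thesis
    using \<phi>(1) y unfolding H01_grad_def by auto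
qed

lemma H01_grad_approx_AE:
  assumes \<Omega>: "\<Omega> \<in> sets lebesgue" and H: "H01_grad \<Omega> y G"
  obtains \<phi> where "\<And>k. \<phi> k \<in> test_fun \<Omega>" "L2conv (lebesgue_on \<Omega>) \<phi> y"
    "L2conv (lebesgue_on \<Omega>) (\<lambda>k. grad (\<phi> k)) G" "AE x in lebesgue_on \<Omega>. (\<lambda>k. \<phi> k x) \<longlonglongrightarrow> y x"
proof -
  obtain \<phi> where \<phi>: "\<And>k. \<phi> k \<in> test_fun \<Omega>" "L2conv (lebesgue_on \<Omega>) \<phi> y"
      "L2conv (lebesgue_on \<Omega>) (\<lambda>k. grad (\<phi> k)) G"
    using H by (auto simp: H01_grad_def)
  obtain r where r: "strict_mono r" "AE x in lebesgue_on \<Omega>. (\<lambda>k. \<phi> (r k) x) \<longlonglongrightarrow> y x"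
    using L2conv_AE_subseq[OF test_fun_L2(1)[OF \<phi>(1) \<Omega>] _ \<phi>(2)] H by (auto simp: H01_grad_def)
  show thesis
    by (rule that[of "\<lambda>k. \<phi> (r k)"]) (use \<phi> r L2conv_subseq in auto)
qed

section \<open>Smooth truncations, the positive part, and gradients on level sets\<close>

lemma flat_continuous: "continuous_on S (flat P)"
  using flat_has_derivative DERIV_continuous_on by (metis DERIV_subset top_greatest continuous_at_imp_continuous_on DERIV_isCont)

text \<open>This is \<open>1 + x \<le> exp x\<close> at \<open>x = 1 / t\<close>. The function is
  the derivative of \<open>t * flat 1 t\<close>, and the bound by one makes the smooth truncations
  nonexpansive.\<close>

lemma flat_11_bounds: "0 \<le> flat [:1, 1:] t" "flat [:1, 1:] t \<le> 1"
proof -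
  show "0 \<le> flat [:1, 1:] t" by (simp add: flat_def)
  have "(1 + 1 / t) * exp (- 1 / t) \<le> exp (1 / t) * exp (- 1 / t)" if "t > 0"
    by (intro mult_right_mono exp_ge_add_one_self) auto
  then show "flat [:1, 1:] t \<le> 1" by (simp add: flat_def flip: exp_add)
qed

text \<open>For \<open>t > s\<close> this is \<open>(t - s) exp (- 1 / ((m + 1) (t - s)))\<close>,
  below \<open>s\<close> it is zero. Multiplying by \<open>t - s\<close> rather than mollifying the
  positive part gives a derivative that is an explicit \<open>flat\<close> function with values in
  \<open>[0, 1]\<close>.\<close>

definition smooth_pos :: "real \<Rightarrow> nat \<Rightarrow> real \<Rightarrow> real" where
  "smooth_pos s m t = (t - s) * flat 1 (real (Suc m) * t + - real (Suc m) * s)"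

definition smooth_step :: "real \<Rightarrow> nat \<Rightarrow> real \<Rightarrow> real" where
  "smooth_step s m t = flat [:1, 1:] (real (Suc m) * t + - real (Suc m) * s)"

lemma smooth_pos_has_derivative: "(smooth_pos s m has_real_derivative smooth_step s m t) (at t)"
proof -
  let ?\<tau> = "real (Suc m) * t + - real (Suc m) * s"
  have "((\<lambda>t. (t - s) * flat 1 (real (Suc m) * t + - real (Suc m) * s)) has_real_derivative
      flat 1 ?\<tau> + (t - s) * (flat ([:0, 0, 1:] * (1 - pderiv 1)) ?\<tau> * real (Suc m))) (at t)"
    by (auto intro!: derivative_eq_intros DERIV_chain2[OF flat_has_derivative])
  moreover have "flat 1 ?\<tau> + (t - s) * (flat ([:0, 0, 1:] * (1 - pderiv 1)) ?\<tau> * real (Suc m)) = smooth_step s m t"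
  proof -
    have "(t - s) * real (Suc m) = ?\<tau>" by (simp add: algebra_simps)
    then have eq: "(t - s) * (z * real (Suc m)) = ?\<tau> * z" for z
      by (metis mult.assoc mult.commute)
    have "flat 1 \<tau> + \<tau> * flat ([:0, 0, 1:] * (1 - pderiv 1)) \<tau> = flat [:1, 1:] \<tau>" for \<tau>
      by (auto simp: flat_def field_simps)
    from this[of ?\<tau>] show ?thesis
      unfolding eq by (simp only: smooth_step_def)
  qed
  ultimately show ?thesis unfolding smooth_pos_def[abs_def] by simp
qed

lemma smooth_step_bounds: "0 \<le> smooth_step s m t" "smooth_step s m t \<le> 1"
  by (auto simp: smooth_step_def flat_11_bounds)

lemma smooth_pos_lipschitz: "\<bar>smooth_pos s m a - smooth_pos s m b\<bar> \<le> \<bar>a - b\<bar>"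
proof -
  have "norm (smooth_pos s m a - smooth_pos s m b) \<le> 1 * norm (a - b)"
    by (rule field_differentiable_bound[of UNIV "smooth_pos s m" "smooth_step s m"])
      (use smooth_step_bounds[of s m] smooth_pos_has_derivative in auto)
  then show ?thesis by simp
qed

lemma smooth_pos_zero: "0 \<le> s \<Longrightarrow> smooth_pos s m 0 = 0"
  by (simp add: smooth_pos_def flat_def zero_less_mult_iff mult_less_0_iff)

lemma scaled_diff: "real (Suc m) * t + - real (Suc m) * s = real (Suc m) * (t - s)"
  by (simp add: algebra_simps)

lemma smooth_pos_tendsto: "(\<lambda>m. smooth_pos s m t) \<longlonglongrightarrow> max (t - s) 0"
proof (cases "t > s")
  case True
  then have "(\<lambda>m. (t - s) * flat 1 (real (Suc m) * (t - s))) \<longlonglongrightarrow> (t - s) * 1"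
    by (intro tendsto_mult tendsto_const flat_1_scale_tendsto) auto
  then show ?thesis using True unfolding smooth_pos_def scaled_diff by (simp add: max_def)
next
  case False
  then have "smooth_pos s m t = 0" for m
    unfolding smooth_pos_def scaled_diff by (simp add: flat_def zero_less_mult_iff)
  then show ?thesis using False by (simp add: max_def)
qed

lemma smooth_step_tendsto: "(\<lambda>m. smooth_step s m t) \<longlonglongrightarrow> (if t > s then 1 else 0)"
proof (cases "t > s")
  case True
  have "(\<lambda>m. (1 + 1 / (t - s) * (1 / real (Suc m))) * flat 1 (real (Suc m) * (t - s))) \<longlonglongrightarrow> (1 + 1 / (t - s) * 0) * 1"
    by (intro tendsto_mult tendsto_add tendsto_const flat_1_scale_tendsto LIMSEQ_Suc[OF lim_1_over_n])
      (use True in auto)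
  moreover have "(1 + 1 / (t - s) * (1 / real (Suc m))) * flat 1 (real (Suc m) * (t - s)) = smooth_step s m t" for m
    using True unfolding smooth_step_def scaled_diff by (simp add: flat_def field_simps del: of_nat_Suc)
  ultimately show ?thesis using True by simp
next
  case False
  then have "smooth_step s m t = 0" for m
    unfolding smooth_step_def scaled_diff by (simp add: flat_def zero_less_mult_iff)
  then show ?thesis using False by simp
qed

lemma smooth_pos_test_fun:
  assumes "\<phi> \<in> test_fun \<Omega>" "0 \<le> s"
  shows "(\<lambda>x. smooth_pos s m (\<phi> x)) \<in> test_fun \<Omega>"
    and "grad (\<lambda>x. smooth_pos s m (\<phi> x)) = (\<lambda>x. smooth_step s m (\<phi> x) *\<^sub>R grad \<phi> x)"
proof -
  have sm: "smooth_fun \<phi>" using assms(1) by (rule test_fun_smooth)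
  have "smooth_fun (\<lambda>x. smooth_pos s m (\<phi> x))"
    unfolding smooth_pos_def
    by (intro smooth_fun_mult smooth_fun_diff sm smooth_fun_const
        smooth_fun_compose[OF smooth_real_scale[OF smooth_real_flat]])
  moreover obtain K where "compact K" "K \<subseteq> \<Omega>" "\<And>x. x \<notin> K \<Longrightarrow> \<phi> x = 0"
    using test_funE[OF assms(1)] by metis
  ultimately show "(\<lambda>x. smooth_pos s m (\<phi> x)) \<in> test_fun \<Omega>"
    using smooth_pos_zero[OF assms(2)] by (intro test_funI[of _ K]) auto
  show "grad (\<lambda>x. smooth_pos s m (\<phi> x)) = (\<lambda>x. smooth_step s m (\<phi> x) *\<^sub>R grad \<phi> x)"
    using partial_compose[OF smooth_pos_has_derivative sm] by (auto simp: grad_def vec_eq_iff fun_eq_iff)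
qed

lemma smooth_step_continuous: "continuous_on S (smooth_step s m)"
  unfolding smooth_step_def[abs_def]
  by (intro continuous_on_compose2[OF flat_continuous[of UNIV]] continuous_intros) auto

lemma smooth_pos_continuous: "continuous_on S (smooth_pos s m)"
  using smooth_pos_has_derivative by (meson DERIV_isCont continuous_at_imp_continuous_on)

text \<open>Both factors of the approximating gradients vary. Replacing
  \<open>grad (\<phi> k)\<close> by \<open>G\<close> costs at most their \<open>L2\<close> distance
  because the step is bounded by one; the step itself converges almost everywhere along a
  subsequence, and dominated convergence applies with majorant \<open>\<bar>G\<bar>^2\<close>. The
  condition \<open>0 \<le> s\<close> keeps the truncation zero at zero, hence compactly
  supported.\<close>

lemma H01_grad_smooth_pos:
  assumes \<Omega>: "\<Omega> \<in> sets lebesgue" and H: "H01_grad \<Omega> y G" and s: "0 \<le> s"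
  shows "H01_grad \<Omega> (\<lambda>x. smooth_pos s m (y x)) (\<lambda>x. smooth_step s m (y x) *\<^sub>R G x)"
proof -
  let ?M = "lebesgue_on \<Omega>"
  let ?P = "smooth_pos s m" and ?S = "smooth_step s m"
  have L: "L2 ?M y" "L2 ?M G" using H by (auto simp: H01_grad_def)
  obtain \<phi> where \<phi>: "\<And>k. \<phi> k \<in> test_fun \<Omega>" "L2conv ?M \<phi> y"
    "L2conv ?M (\<lambda>k. grad (\<phi> k)) G" "AE x in ?M. (\<lambda>k. \<phi> k x) \<longlonglongrightarrow> y x"
    by (rule H01_grad_approx_AE[OF \<Omega> H]) (rule that)
  have T: "L2 ?M (\<phi> k)" "L2 ?M (grad (\<phi> k))" for k
    using test_fun_L2[OF \<phi>(1) \<Omega>] by auto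
  have Pm: "?P \<in> borel_measurable borel" and Sm: "?S \<in> borel_measurable borel"
    by (auto intro!: borel_measurable_continuous_onI smooth_pos_continuous smooth_step_continuous)
  have SG: "L2 ?M (\<lambda>x. ?S (z x) *\<^sub>R K x)" if "L2 ?M z" "L2 ?M K" for z and K :: "real^'a \<Rightarrow> real^'a"
  proof (rule L2_mono[OF that(2)])
    show "(\<lambda>x. ?S (z x) *\<^sub>R K x) \<in> borel_measurable ?M"
      using that by (intro borel_measurable_scaleR measurable_compose[OF _ Sm]) (auto simp: L2_def)
  qed (use smooth_step_bounds[of s m] in \<open>auto intro!: mult_left_le_one_le\<close>)
  have PL: "L2 ?M (\<lambda>x. ?P (z x))" if "L2 ?M z" for z
  proof (rule L2_mono[OF that])
    show "(\<lambda>x. ?P (z x)) \<in> borel_measurable ?M"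
      using that by (intro measurable_compose[OF _ Pm]) (auto simp: L2_def)
  qed (use smooth_pos_lipschitz[of s m _ 0] smooth_pos_zero[OF s, of m] in auto)
  have c1: "L2conv ?M (\<lambda>k x. ?P (\<phi> k x)) (\<lambda>x. ?P (y x))"
  proof (rule L2conv_bounded_by[OF _ \<phi>(2)[unfolded L2conv_def]])
    show "(LINT x|?M. (norm (?P (\<phi> k x) - ?P (y x)))\<^sup>2) \<le> (LINT x|?M. (norm (\<phi> k x - y x))\<^sup>2)" for k
    proof (rule integral_mono)
      show "(norm (?P (\<phi> k x) - ?P (y x)))\<^sup>2 \<le> (norm (\<phi> k x - y x))\<^sup>2" for x
        using smooth_pos_lipschitz by (intro power_mono) auto
    qed (intro L2_norm_integrable L2_diff PL T(1) L(1))+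
  qed
  have c2: "L2conv ?M (\<lambda>k x. ?S (\<phi> k x) *\<^sub>R grad (\<phi> k) x - ?S (\<phi> k x) *\<^sub>R G x) (\<lambda>x. 0)"
  proof (rule L2conv_bounded_by[OF _ \<phi>(3)[unfolded L2conv_def]])
    show "(LINT x|?M. (norm (?S (\<phi> k x) *\<^sub>R grad (\<phi> k) x - ?S (\<phi> k x) *\<^sub>R G x - 0))\<^sup>2) \<le> (LINT x|?M. (norm (grad (\<phi> k) x - G x))\<^sup>2)" for k
    proof (rule integral_mono)
      show "(norm (?S (\<phi> k x) *\<^sub>R grad (\<phi> k) x - ?S (\<phi> k x) *\<^sub>R G x - 0))\<^sup>2 \<le> (norm (grad (\<phi> k) x - G x))\<^sup>2" for x
        using smooth_step_bounds[of s m "\<phi> k x"]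
        by (intro power_mono) (auto simp flip: scaleR_diff_right intro!: mult_left_le_one_le)
    qed (use T L SG in \<open>auto intro!: L2_norm_integrable L2_diff\<close>)
  qed
  have c3: "L2conv ?M (\<lambda>k x. ?S (\<phi> k x) *\<^sub>R G x) (\<lambda>x. ?S (y x) *\<^sub>R G x)"
  proof (rule L2conv_dominated[OF _ _ L2_norm_integrable[OF L(2)]])
    show "AE x in ?M. (\<lambda>k. ?S (\<phi> k x) *\<^sub>R G x) \<longlonglongrightarrow> ?S (y x) *\<^sub>R G x"
      using \<phi>(4)
    proof eventually_elim
      case (elim x)
      then show ?case
        using smooth_step_continuous[of UNIV s m]
        by (intro tendsto_scaleR tendsto_const isCont_tendsto_compose[of _ ?S])
          (auto simp: continuous_on_eq_continuous_at)
    qed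
    show "AE x in ?M. (norm (?S (\<phi> k x) *\<^sub>R G x - ?S (y x) *\<^sub>R G x))\<^sup>2 \<le> (norm (G x))\<^sup>2" for k
    proof (intro AE_I2 power_mono)
      fix x
      have "\<bar>?S (\<phi> k x) - ?S (y x)\<bar> \<le> 1"
        using smooth_step_bounds[of s m "\<phi> k x"] smooth_step_bounds[of s m "y x"] by linarith
      then show "norm (?S (\<phi> k x) *\<^sub>R G x - ?S (y x) *\<^sub>R G x) \<le> norm (G x)"
        by (auto simp flip: scaleR_diff_left intro!: mult_left_le_one_le)
    qed auto
  qed (use SG[OF T(1) L(2)] SG[OF L] in \<open>auto simp: L2_def\<close>)
  have "L2conv ?M (\<lambda>k x. (?S (\<phi> k x) *\<^sub>R grad (\<phi> k) x - ?S (\<phi> k x) *\<^sub>R G x) + ?S (\<phi> k x) *\<^sub>R G x) (\<lambda>x. 0 + ?S (y x) *\<^sub>R G x)"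
    by (rule L2conv_add[OF _ _ _ _ c2 c3]) (auto intro!: SG T L L2_diff)
  then have "L2conv ?M (\<lambda>k. grad (\<lambda>x. ?P (\<phi> k x))) (\<lambda>x. ?S (y x) *\<^sub>R G x)"
    by (simp add: smooth_pos_test_fun(2)[OF \<phi>(1) s])
  with c1 show ?thesis
    unfolding H01_grad_def using PL[OF L(1)] SG[OF L] smooth_pos_test_fun(1)[OF \<phi>(1) s]
    by (intro conjI exI[of _ "\<lambda>k x. ?P (\<phi> k x)"]) auto
qed

text \<open>Now \<open>y\<close> is fixed and \<open>m\<close> grows, with dominated convergence for
  the function and the gradient. The steps tend to zero at \<open>t = s\<close>, which produces the
  strict inequality in the gradient.\<close>

lemma H01_grad_pos_part:
  assumes \<Omega>: "\<Omega> \<in> sets lebesgue" and H: "H01_grad \<Omega> y G" and s: "0 \<le> s"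
  shows "H01_grad \<Omega> (\<lambda>x. max (y x - s) 0) (\<lambda>x. if y x > s then G x else 0)"
proof (rule H01_grad_closed[OF \<Omega> H01_grad_smooth_pos[OF \<Omega> H s]])
  let ?M = "lebesgue_on \<Omega>"
  have L: "L2 ?M y" "L2 ?M G" using H by (auto simp: H01_grad_def)
  note [measurable] = L[THEN L2_measurable]
  show "L2 ?M (\<lambda>x. max (y x - s) 0)"
    by (rule L2_mono[OF L(1)]) (use s in auto)
  show "L2 ?M (\<lambda>x. if y x > s then G x else 0)"
    by (rule L2_mono[OF L(2)]) auto
  have LP: "L2 ?M (\<lambda>x. smooth_pos s m (y x))" "L2 ?M (\<lambda>x. smooth_step s m (y x) *\<^sub>R G x)" for m
    using H01_grad_smooth_pos[OF \<Omega> H s, of m] by (auto simp: H01_grad_def)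
  show "L2conv ?M (\<lambda>m x. smooth_pos s m (y x)) (\<lambda>x. max (y x - s) 0)"
  proof (rule L2conv_dominated[where w = "\<lambda>x. (2 * norm (y x))\<^sup>2"])
    show "integrable ?M (\<lambda>x. (2 * norm (y x))\<^sup>2)"
      using L2_norm_integrable[OF L(1)] by (simp add: power_mult_distrib)
    show "AE x in ?M. (norm (smooth_pos s m (y x) - max (y x - s) 0))\<^sup>2 \<le> (2 * norm (y x))\<^sup>2" for m
    proof (intro AE_I2 power_mono)
      fix x
      have "\<bar>smooth_pos s m (y x)\<bar> \<le> \<bar>y x\<bar>"
        using smooth_pos_lipschitz[of s m "y x" 0] smooth_pos_zero[OF s, of m] by simp
      then show "norm (smooth_pos s m (y x) - max (y x - s) 0) \<le> 2 * norm (y x)"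
        using s by auto
    qed auto
  qed (use LP in \<open>auto simp: L2_def smooth_pos_tendsto\<close>)
  show "L2conv ?M (\<lambda>m x. smooth_step s m (y x) *\<^sub>R G x) (\<lambda>x. if y x > s then G x else 0)"
  proof (rule L2conv_dominated[OF _ _ L2_norm_integrable[OF L(2)]])
    show "AE x in ?M. (\<lambda>m. smooth_step s m (y x) *\<^sub>R G x) \<longlonglongrightarrow> (if y x > s then G x else 0)"
    proof (rule AE_I2)
      fix x
      show "(\<lambda>m. smooth_step s m (y x) *\<^sub>R G x) \<longlonglongrightarrow> (if y x > s then G x else 0)"
        using tendsto_scaleR[OF smooth_step_tendsto[of s "y x"] tendsto_const[of "G x"]]
        by (auto split: if_splits)
    qed
    show "AE x in ?M. (norm (smooth_step s m (y x) *\<^sub>R G x - (if y x > s then G x else 0)))\<^sup>2 \<le> (norm (G x))\<^sup>2" for m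
    proof (intro AE_I2 power_mono)
      fix x
      have "smooth_step s m (y x) *\<^sub>R G x - (if y x > s then G x else 0) = (smooth_step s m (y x) - (if y x > s then 1 else 0)) *\<^sub>R G x"
        by (simp add: scaleR_diff_left)
      moreover have "\<bar>smooth_step s m (y x) - (if y x > s then 1 else 0)\<bar> \<le> 1"
        using smooth_step_bounds[of s m "y x"] by auto
      ultimately show "norm (smooth_step s m (y x) *\<^sub>R G x - (if y x > s then G x else 0)) \<le> norm (G x)"
        by (auto intro!: mult_left_le_one_le)
    qed auto
  qed (use LP in \<open>auto simp: L2_def\<close>)
qed

text \<open>Truncating at levels rising to \<open>s\<close> gives the limit the gradient
  \<open>G\<close> on \<open>{y \<ge> s}\<close>, truncating at \<open>s\<close> gives it on
  \<open>{y > s}\<close>; uniqueness forces \<open>G = 0\<close> on the difference. The approach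
  from below needs admissible levels under \<open>s\<close>, so level zero is treated later by
  another argument.\<close>

lemma H01_grad_level_set:
  assumes \<Omega>: "open \<Omega>" and H: "H01_grad \<Omega> y G" and s: "0 < s"
  shows "AE x in lebesgue_on \<Omega>. y x = s \<longrightarrow> G x = 0"
proof -
  let ?M = "lebesgue_on \<Omega>"
  have \<Omega>s: "\<Omega> \<in> sets lebesgue" using \<Omega> by auto
  have L: "L2 ?M y" "L2 ?M G" using H by (auto simp: H01_grad_def)
  note [measurable] = L[THEN L2_measurable]
  define t where "t m = s - s / real (Suc m)" for m
  have t: "0 \<le> t m" "t m < s" for m
    using s by (auto simp: t_def field_simps)
  have tlim: "t \<longlonglongrightarrow> s"
  proof -
    have "(\<lambda>m. s - s * (1 / real (Suc m))) \<longlonglongrightarrow> s - s * 0"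
      by (intro tendsto_intros LIMSEQ_Suc[OF lim_1_over_n])
    then show ?thesis by (simp add: t_def[abs_def])
  qed
  have Lp: "L2 ?M (\<lambda>x. max (y x - s) 0)"
    by (rule L2_mono[OF L(1)]) (use s in auto)
  have LG: "L2 ?M (\<lambda>x. if y x \<ge> s then G x else 0)"
    by (rule L2_mono[OF L(2)]) auto
  have "H01_grad \<Omega> (\<lambda>x. max (y x - s) 0) (\<lambda>x. if y x \<ge> s then G x else 0)"
  proof (rule H01_grad_closed[OF \<Omega>s H01_grad_pos_part[OF \<Omega>s H t(1)] Lp LG])
    show "L2conv ?M (\<lambda>m x. max (y x - t m) 0) (\<lambda>x. max (y x - s) 0)"
    proof (rule L2conv_dominated[where w = "\<lambda>x. (2 * norm (y x))\<^sup>2"])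
      show "integrable ?M (\<lambda>x. (2 * norm (y x))\<^sup>2)"
        using L2_norm_integrable[OF L(1)] by (simp add: power_mult_distrib)
      show "AE x in ?M. (norm (max (y x - t m) 0 - max (y x - s) 0))\<^sup>2 \<le> (2 * norm (y x))\<^sup>2" for m
        using s t[of m] by (intro AE_I2 power_mono) auto
      show "AE x in ?M. (\<lambda>m. max (y x - t m) 0) \<longlonglongrightarrow> max (y x - s) 0"
        by (intro AE_I2 tendsto_intros tlim)
    qed auto
    show "L2conv ?M (\<lambda>m x. if y x > t m then G x else 0) (\<lambda>x. if y x \<ge> s then G x else 0)"
    proof (rule L2conv_dominated[OF _ _ L2_norm_integrable[OF L(2)]])
      show "AE x in ?M. (\<lambda>m. if y x > t m then G x else 0) \<longlonglongrightarrow> (if y x \<ge> s then G x else 0)"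
      proof (rule AE_I2)
        fix x
        show "(\<lambda>m. if y x > t m then G x else 0) \<longlonglongrightarrow> (if y x \<ge> s then G x else 0)"
        proof (cases "y x \<ge> s")
          case True
          then have "y x > t m" for m using t(2)[of m] by linarith
          then show ?thesis using True by simp
        next
          case False
          then have "\<forall>\<^sub>F m in sequentially. t m > y x"
            using order_tendstoD(1)[OF tlim] by auto
          then have "\<forall>\<^sub>F m in sequentially. (if y x > t m then G x else 0) = (if y x \<ge> s then G x else 0)"
            by eventually_elim (use False in auto)
          then show ?thesis by (rule tendsto_eventually)
        qed
      qed
    qed auto
  qed
  from weak_grad_unique[OF \<Omega> H01_grad_weak_grad[OF \<Omega> this] H01_grad_weak_grad[OF \<Omega> H01_grad_pos_part[OF \<Omega>s H]]] s
  have "AE x in ?M. (if y x \<ge> s then G x else 0) = (if y x > s then G x else 0)"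
    by auto
  then show ?thesis by eventually_elim auto
qed

section \<open>Weak boundedness\<close>

text \<open>The interface through which the later estimates see the dimension: an exponent and a
  constant. Integrability is included since the norm alone would not imply it.\<close>

definition sobolev_bound :: "(real^'n::finite) set \<Rightarrow> real \<Rightarrow> real \<Rightarrow> bool" where
  "sobolev_bound \<Omega> q C \<longleftrightarrow> C > 0 \<and> (\<forall>y G. H01_grad \<Omega> y G \<longrightarrow>
    integrable (lebesgue_on \<Omega>) (\<lambda>x. \<bar>y x\<bar> powr q) \<and>
    Lnorm (lebesgue_on \<Omega>) q y \<le> C * Lnorm (lebesgue_on \<Omega>) 2 (\<lambda>x. norm (G x)))"

text \<open>Fatou along an almost everywhere convergent sequence of test functions, whose gradient
  norms converge. Working with nonnegative integrals first yields the integrability of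
  \<open>\<bar>y\<bar>^q\<close> as well.\<close>

theorem sobolev_H01:
  fixes \<Omega> :: "(real^'n::finite) set"
  assumes \<Omega>: "\<Omega> \<in> sets lebesgue" and q: "q > 0" and C: "C > 0"
    and test: "\<And>\<phi>. \<phi> \<in> test_fun \<Omega> \<Longrightarrow> Lnorm (lebesgue_on \<Omega>) q \<phi> \<le> C * Lnorm (lebesgue_on \<Omega>) 2 (\<lambda>x. norm (grad \<phi> x))"
  shows "sobolev_bound \<Omega> q C"
  unfolding sobolev_bound_def
proof (intro conjI allI impI C)
  let ?M = "lebesgue_on \<Omega>"
  fix y :: "real^'n \<Rightarrow> real" and G assume H: "H01_grad \<Omega> y G"
  have L: "L2 ?M y" "L2 ?M G" using H by (auto simp: H01_grad_def)
  note [measurable] = L[THEN L2_measurable]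
  obtain \<phi> where \<phi>: "\<And>k. \<phi> k \<in> test_fun \<Omega>" "L2conv ?M \<phi> y"
    "L2conv ?M (\<lambda>k. grad (\<phi> k)) G" "AE x in ?M. (\<lambda>k. \<phi> k x) \<longlonglongrightarrow> y x"
    by (rule H01_grad_approx_AE[OF \<Omega> H]) (rule that)
  have T: "L2 ?M (\<phi> k)" "L2 ?M (grad (\<phi> k))" for k
    using test_fun_L2[OF \<phi>(1) \<Omega>] by auto
  have [measurable]: "\<phi> k \<in> borel_measurable ?M" for k using T(1) by (rule L2_measurable)
  let ?D = "C * Lnorm ?M 2 (\<lambda>x. norm (G x))"
  have "(\<lambda>k. C * Lnorm ?M 2 (\<lambda>x. norm (grad (\<phi> k) x))) \<longlonglongrightarrow> ?D"
    by (intro tendsto_mult tendsto_const L2_conv_Lnorm T L \<phi>)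
  then have lim: "(\<lambda>k. ennreal ((C * Lnorm ?M 2 (\<lambda>x. norm (grad (\<phi> k) x))) powr q)) \<longlonglongrightarrow> ennreal (?D powr q)"
    using q C by (intro tendsto_ennrealI tendsto_powr') (auto simp: mult_nonneg_nonneg)
  have "(\<integral>\<^sup>+x. ennreal (\<bar>y x\<bar> powr q) \<partial>?M) = (\<integral>\<^sup>+x. liminf (\<lambda>k. ennreal (\<bar>\<phi> k x\<bar> powr q)) \<partial>?M)"
  proof (rule nn_integral_cong_AE)
    show "AE x in ?M. ennreal (\<bar>y x\<bar> powr q) = liminf (\<lambda>k. ennreal (\<bar>\<phi> k x\<bar> powr q))"
      using \<phi>(4)
    proof eventually_elim
      case (elim x)
      then have "(\<lambda>k. ennreal (\<bar>\<phi> k x\<bar> powr q)) \<longlonglongrightarrow> ennreal (\<bar>y x\<bar> powr q)"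
        using q by (intro tendsto_ennrealI tendsto_powr' tendsto_rabs tendsto_const) auto
      then show ?case
        by (rule lim_imp_Liminf[OF sequentially_bot, symmetric])
    qed
  qed
  also have "\<dots> \<le> liminf (\<lambda>k. \<integral>\<^sup>+x. ennreal (\<bar>\<phi> k x\<bar> powr q) \<partial>?M)"
    by (rule nn_integral_liminf) measurable
  also have "\<dots> \<le> liminf (\<lambda>k. ennreal ((C * Lnorm ?M 2 (\<lambda>x. norm (grad (\<phi> k) x))) powr q))"
  proof (intro Liminf_mono always_eventually allI)
    fix k
    have "(\<integral>\<^sup>+x. ennreal (\<bar>\<phi> k x\<bar> powr q) \<partial>?M) = ennreal (Lnorm ?M q (\<phi> k) powr q)"
      using test_fun_powr_integrable[OF \<phi>(1) q \<Omega>] q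
      by (subst nn_integral_eq_integral) (auto simp: Lnorm_powr)
    also have "\<dots> \<le> ennreal ((C * Lnorm ?M 2 (\<lambda>x. norm (grad (\<phi> k) x))) powr q)"
      using q by (intro ennreal_leI powr_mono2 test \<phi>) auto
    finally show "(\<integral>\<^sup>+x. ennreal (\<bar>\<phi> k x\<bar> powr q) \<partial>?M) \<le> \<dots>" .
  qed
  also have "\<dots> = ennreal (?D powr q)"
    using lim by (simp add: lim_imp_Liminf)
  finally have le: "(\<integral>\<^sup>+x. ennreal (\<bar>y x\<bar> powr q) \<partial>?M) \<le> ennreal (?D powr q)" .
  show int: "integrable ?M (\<lambda>x. \<bar>y x\<bar> powr q)"
    by (rule integrableI_bounded) (use le in \<open>auto intro: order_le_less_trans\<close>)
  have "ennreal (LINT x|?M. \<bar>y x\<bar> powr q) \<le> ennreal (?D powr q)"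
    using le int by (subst (asm) nn_integral_eq_integral) auto
  then have "(LINT x|?M. \<bar>y x\<bar> powr q) \<le> ?D powr q"
    by (subst (asm) ennreal_le_iff) auto
  then have "Lnorm ?M q y \<le> (?D powr q) powr (1 / q)"
    unfolding Lnorm_def using q by (intro powr_mono2) (auto intro!: integral_nonneg_AE)
  also have "\<dots> = ?D"
    using q C by (simp add: powr_powr)
  finally show "Lnorm ?M q y \<le> ?D" .
qed

lemma summable_geometric_pow: "summable (\<lambda>n. (1 / 3 :: real) ^ n)" "(\<Sum>n. (1 / 3 :: real) ^ n) = 3 / 2"
  using suminf_geometric[of "1 / 3 :: real"] summable_geometric[of "1 / 3 :: real"] by auto

text \<open>
  A gliding hump: \<open>g n\<close> is the normalised dual function of a member \<open>w n\<close> of norm above \<open>4^n\<close>, and in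
  \<open>h = (\<Sum>n. \<sigma> n * (1/3)^n * g n)\<close> each sign is chosen such that the first \<open>n\<close> terms together have a
  pairing with \<open>w n\<close> of size at least \<open>(1/3)^n * N n\<close>; the remaining terms cancel at most half of it.
\<close>

theorem weakly_bounded_imp_bounded:
  fixes v :: "nat \<Rightarrow> 'a \<Rightarrow> real"
  assumes p: "p > 1" and v[measurable]: "\<And>k. v k \<in> borel_measurable M"
    and vp: "\<And>k. integrable M (\<lambda>x. \<bar>v k x\<bar> powr p)"
    and weak: "\<And>g. g \<in> borel_measurable M \<Longrightarrow> integrable M (\<lambda>x. \<bar>g x\<bar> powr (p / (p - 1))) \<Longrightarrow>
      \<exists>B. \<forall>k. \<bar>LINT x|M. v k x * g x\<bar> \<le> B"
  shows "\<exists>B. \<forall>k. Lnorm M p (v k) \<le> B"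
proof (rule ccontr)
  assume "\<not> (\<exists>B. \<forall>k. Lnorm M p (v k) \<le> B)"
  then have "\<forall>n. \<exists>k. Lnorm M p (v k) > 4 ^ n"
    by (auto simp: not_le)
  then obtain \<kappa> where \<kappa>: "\<And>n::nat. Lnorm M p (v (\<kappa> n)) > 4 ^ n"
    by metis
  define w where "w n = v (\<kappa> n)" for n
  define N where "N n = Lnorm M p (w n)" for n
  have Ng: "N n > 4 ^ n" for n using \<kappa> by (simp add: N_def w_def)
  have N0: "N n > 0" for n using Ng[of n] by (rule less_trans[rotated]) simp
  have [measurable]: "w n \<in> borel_measurable M" for n by (simp add: w_def)
  have wp: "integrable M (\<lambda>x. \<bar>w n x\<bar> powr p)" for n by (simp add: w_def vp)
  define p' where "p' = p / (p - 1)"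
  have p': "p' > 1" "1 / p + 1 / p' = 1" "(p - 1) * p' = p"
    using p by (auto simp: p'_def field_simps)
  have Np: "N n powr p = (LINT x|M. \<bar>w n x\<bar> powr p)" for n
    unfolding N_def using p by (intro Lnorm_powr) auto
  define g where "g n x = sgn (w n x) * (\<bar>w n x\<bar> / N n) powr (p - 1)" for n x
  have [measurable]: "g n \<in> borel_measurable M" for n unfolding g_def[abs_def] by measurable
  have gp: "\<bar>g n x\<bar> powr p' = \<bar>w n x\<bar> powr p / N n powr p" for n x
    using p p' N0[of n] by (cases "w n x = 0") (auto simp: g_def abs_mult abs_sgn_eq powr_powr powr_divide)
  have g_int: "integrable M (\<lambda>x. \<bar>g n x\<bar> powr p')" for n
    unfolding gp using wp by simp
  have g1: "(LINT x|M. \<bar>g n x\<bar> powr p') = 1" for n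
    unfolding gp using N0[of n] by (simp flip: Np)
  have gN: "Lnorm M p' (g n) = 1" for n
    by (simp add: Lnorm_def g1)
  have wg: "(LINT x|M. w n x * g n x) = N n" for n
  proof -
    have "w n x * g n x = \<bar>w n x\<bar> powr p / N n powr (p - 1)" for x
    proof (cases "w n x = 0")
      case False
      then have "w n x * g n x = \<bar>w n x\<bar> powr 1 * \<bar>w n x\<bar> powr (p - 1) / N n powr (p - 1)"
        using N0[of n] by (auto simp: g_def powr_divide sgn_if)
      then show ?thesis by (simp add: powr_mult_base)
    qed (use p in \<open>simp add: g_def\<close>)
    then have "(LINT x|M. w n x * g n x) = N n powr p / N n powr (p - 1)"
      by (simp add: Np)
    also have "\<dots> = N n" using N0[of n] by (simp flip: powr_diff)
    finally show ?thesis .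
  qed
  define c where "c n m = (LINT x|M. w n x * g m x)" for n m
  have wg_int: "integrable M (\<lambda>x. w n x * g m x)"
    and wg_abs: "(LINT x|M. \<bar>w n x * g m x\<bar>) \<le> N n" for n m
  proof -
    show "integrable M (\<lambda>x. w n x * g m x)"
      by (rule Hoelder_integrable[OF p p'(1,2)]) (use wp g_int in auto)
    show "(LINT x|M. \<bar>w n x * g m x\<bar>) \<le> N n"
      using Hoelder_inequality[OF p p'(1,2), of "w n" M "g m"] wp g_int by (simp add: gN N_def)
  qed
  have "\<exists>\<sigma>. \<forall>n. \<bar>\<sigma> n\<bar> = (1::real) \<and> \<bar>\<Sum>m\<le>n. \<sigma> m * (1/3) ^ m * c n m\<bar> \<ge> (1/3) ^ n * N n"
  proof -
    have "\<exists>\<sigma>::nat \<Rightarrow> real. \<forall>n. \<bar>\<sigma> n\<bar> = 1 \<and> \<bar>(\<Sum>m<n. \<sigma> m * (1/3) ^ m * c n m) + \<sigma> n * (1/3) ^ n * c n n\<bar> \<ge> (1/3) ^ n * N n"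
    proof (rule dependent_wellorder_choice)
      fix n and \<sigma> :: "nat \<Rightarrow> real"
      let ?S = "\<Sum>m<n. \<sigma> m * (1/3) ^ m * c n m"
      have cn: "c n n = N n" by (simp add: c_def wg)
      show "\<exists>r. \<bar>r\<bar> = 1 \<and> \<bar>?S + r * (1/3) ^ n * c n n\<bar> \<ge> (1/3) ^ n * N n"
      proof (cases "?S \<ge> 0")
        case True
        then show ?thesis using N0[of n] by (intro exI[of _ 1]) (auto simp: cn)
      next
        case False
        moreover have "0 \<le> (1/3) ^ n * N n" using N0[of n] by simp
        ultimately show ?thesis by (intro exI[of _ "-1"]) (simp add: cn abs_if)
      qed
    qed auto
    then show ?thesis
      by (simp add: lessThan_Suc_atMost[symmetric])
  qed
  then obtain \<sigma> :: "nat \<Rightarrow> real" where \<sigma>: "\<And>n. \<bar>\<sigma> n\<bar> = 1"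
      "\<And>n. \<bar>\<Sum>m\<le>n. \<sigma> m * (1/3) ^ m * c n m\<bar> \<ge> (1/3) ^ n * N n" by metis
  \<comment> \<open>A pointwise majorant for the whole series: the weights \<open>(1/2)^n\<close>
    give \<open>T\<close> the integral \<open>2\<close>, and each \<open>\<bar>g n x\<bar>\<close>
    is at most \<open>2^(n/p') T(x)^(1/p')\<close>. As \<open>(1/3) 2^(1/p') < 1\<close>, a
    geometric series remains, so \<open>\<bar>h\<bar>^p'\<close> is bounded by a multiple of
    \<open>T\<close>.\<close>
  define T where "T x = (\<Sum>n. ennreal ((1/2) ^ n * \<bar>g n x\<bar> powr p'))" for x
  have [measurable]: "T \<in> borel_measurable M" unfolding T_def[abs_def] by measurable
  have "(\<integral>\<^sup>+x. T x \<partial>M) = (\<Sum>n. (\<integral>\<^sup>+x. ennreal ((1/2) ^ n * \<bar>g n x\<bar> powr p') \<partial>M))"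
    unfolding T_def by (rule nn_integral_suminf) measurable
  also have "\<dots> = (\<Sum>n. ennreal ((1/2) ^ n))"
    using g_int g1 by (intro suminf_cong) (subst nn_integral_eq_integral, auto)
  also have "\<dots> = ennreal 2"
    using geometric_sums[of "1/2::real"] by (intro suminf_ennreal_eq) auto
  finally have T2: "(\<integral>\<^sup>+x. T x \<partial>M) = ennreal 2" .
  have Tfin: "AE x in M. T x \<noteq> \<infinity>"
    by (rule nn_integral_PInf_AE) (auto simp: T2)
  have two: "2 powr (1 / p') \<le> (2::real)"
    using powr_mono[of "1 / p'" 1 "2::real"] p'(1) by simp
  define \<rho> where "\<rho> = (1/3) * 2 powr (1 / p')"
  have \<rho>: "0 \<le> \<rho>" "\<rho> < 1" using two by (auto simp: \<rho>_def)
  have pt: "\<bar>(1/3) ^ n * g n x\<bar> \<le> \<rho> ^ n * enn2real (T x) powr (1 / p')" if "T x \<noteq> \<infinity>" for n x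
  proof -
    have "ennreal ((1/2) ^ n * \<bar>g n x\<bar> powr p') \<le> T x"
      unfolding T_def
      by (rule order_trans[OF _ sum_le_suminf[of "\<lambda>n. ennreal ((1/2) ^ n * \<bar>g n x\<bar> powr p')" "{n}"]]) simp_all
    then have "(1/2) ^ n * \<bar>g n x\<bar> powr p' \<le> enn2real (T x)"
      using that by (cases "T x") auto
    then have "\<bar>g n x\<bar> powr p' \<le> 2 ^ n * enn2real (T x)"
      by (simp add: field_simps power_one_over)
    then have "(\<bar>g n x\<bar> powr p') powr (1 / p') \<le> (2 ^ n * enn2real (T x)) powr (1 / p')"
      using p'(1) by (intro powr_mono2) auto
    then have "\<bar>g n x\<bar> \<le> (2 powr (1 / p')) ^ n * enn2real (T x) powr (1 / p')"
      using p'(1) by (simp add: powr_powr powr_mult powr_realpow[symmetric] mult.commute)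
    then have "(1/3) ^ n * \<bar>g n x\<bar> \<le> (1/3) ^ n * ((2 powr (1 / p')) ^ n * enn2real (T x) powr (1 / p'))"
      by (intro mult_left_mono) auto
    moreover have "\<rho> ^ n = (1/3) ^ n * (2 powr (1 / p')) ^ n"
      by (simp only: \<rho>_def power_mult_distrib)
    moreover have "\<bar>(1/3) ^ n * g n x\<bar> = (1/3) ^ n * \<bar>g n x\<bar>"
      by (simp add: abs_mult)
    ultimately show ?thesis by (simp only: mult.assoc)
  qed
  have summ: "summable (\<lambda>n. \<bar>(1/3) ^ n * g n x\<bar>)" if "T x \<noteq> \<infinity>" for x
    by (rule summable_comparison_test'[OF summable_mult2[OF summable_geometric[of \<rho>]]])
      (use \<rho> pt[OF that] in auto)
  define h where "h x = (\<Sum>n. \<sigma> n * (1/3) ^ n * g n x)" for x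
  have [measurable]: "h \<in> borel_measurable M" unfolding h_def[abs_def] by measurable
  have h_le: "\<bar>h x\<bar> powr p' \<le> (1 / (1 - \<rho>)) powr p' * enn2real (T x)" if "T x \<noteq> \<infinity>" for x
  proof -
    have eq: "\<bar>\<sigma> n * (1/3) ^ n * g n x\<bar> = \<bar>(1/3) ^ n * g n x\<bar>" for n
      by (simp add: abs_mult \<sigma>(1))
    have "\<bar>h x\<bar> \<le> (\<Sum>n. \<bar>\<sigma> n * (1/3) ^ n * g n x\<bar>)"
      unfolding h_def using summ[OF that] by (intro summable_rabs) (simp add: eq)
    also have "\<dots> \<le> (\<Sum>n. \<rho> ^ n * enn2real (T x) powr (1 / p'))"
      unfolding eq using \<rho> by (intro suminf_le pt[OF that] summ[OF that] summable_mult2 summable_geometric) auto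
    also have "\<dots> = 1 / (1 - \<rho>) * enn2real (T x) powr (1 / p')"
      using \<rho> by (subst suminf_mult2[symmetric]) (auto intro: summable_geometric simp: suminf_geometric)
    finally have "\<bar>h x\<bar> powr p' \<le> (1 / (1 - \<rho>) * enn2real (T x) powr (1 / p')) powr p'"
      using p'(1) by (intro powr_mono2) auto
    also have "\<dots> = (1 / (1 - \<rho>)) powr p' * enn2real (T x)"
      using p'(1) \<rho> by (simp add: powr_divide powr_powr)
    finally show ?thesis .
  qed
  have Tint: "integrable M (\<lambda>x. enn2real (T x))"
  proof (rule integrableI_bounded)
    have "(\<integral>\<^sup>+x. ennreal (norm (enn2real (T x))) \<partial>M) \<le> (\<integral>\<^sup>+x. T x \<partial>M)"
      by (intro nn_integral_mono) (simp add: ennreal_enn2real_if)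
    then show "(\<integral>\<^sup>+x. ennreal (norm (enn2real (T x))) \<partial>M) < \<infinity>"
      using T2 by (simp add: order_le_less_trans)
  qed measurable
  have "integrable M (\<lambda>x. \<bar>h x\<bar> powr p')"
  proof (rule Bochner_Integration.integrable_bound)
    show "integrable M (\<lambda>x. (1 / (1 - \<rho>)) powr p' * enn2real (T x))"
      using Tint by (rule integrable_mult_right)
    show "AE x in M. norm (\<bar>h x\<bar> powr p') \<le> norm ((1 / (1 - \<rho>)) powr p' * enn2real (T x))"
      using Tfin
    proof eventually_elim
      case (elim x)
      then show ?case using h_le[OF elim] by simp
    qed
  qed measurable
  then obtain B where B: "\<And>k. \<bar>LINT x|M. v k x * h x\<bar> \<le> B"
    using weak[of h] unfolding p'_def[symmetric] by auto
  have big: "\<bar>LINT x|M. w n x * h x\<bar> \<ge> (1/3) ^ n * N n / 2" for n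
  proof -
    define F where "F m x = w n x * (\<sigma> m * (1/3) ^ m * g m x)" for m x
    have F_int: "integrable M (F m)" for m
    proof -
      have "F m = (\<lambda>x. (\<sigma> m * (1/3) ^ m) * (w n x * g m x))" by (auto simp: F_def)
      then show ?thesis using wg_int by simp
    qed
    have F_eq: "(LINT x|M. F m x) = \<sigma> m * (1/3) ^ m * c n m" for m
    proof -
      have "F m = (\<lambda>x. (\<sigma> m * (1/3) ^ m) * (w n x * g m x))" by (auto simp: F_def)
      then show ?thesis by (simp add: c_def)
    qed
    have F_abs: "(LINT x|M. norm (F m x)) \<le> (1/3) ^ m * N n" for m
    proof -
      have "(\<lambda>x. norm (F m x)) = (\<lambda>x. (1/3) ^ m * \<bar>w n x * g m x\<bar>)"
        by (auto simp: F_def abs_mult \<sigma>(1))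
      then show ?thesis using wg_abs[of n m] by simp
    qed
    have ae: "AE x in M. summable (\<lambda>m. norm (F m x))"
      using Tfin
    proof eventually_elim
      case (elim x)
      have "(\<lambda>m. norm (F m x)) = (\<lambda>m. \<bar>w n x\<bar> * \<bar>(1/3) ^ m * g m x\<bar>)"
        by (auto simp: F_def abs_mult \<sigma>(1))
      then show ?case using summable_mult[OF summ[OF elim]] by simp
    qed
    have s1: "summable (\<lambda>m. (1/3) ^ m * N n)"
      by (intro summable_mult2 summable_geometric_pow)
    have s2: "summable (\<lambda>m. LINT x|M. norm (F m x))"
      by (rule summable_comparison_test'[OF s1]) (use F_abs in auto)
    have s3: "summable (\<lambda>m. LINT x|M. F m x)"
      by (rule summable_integral[OF F_int ae s2])
    have le3: "\<bar>LINT x|M. F m x\<bar> \<le> (1/3) ^ m * N n" for m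
      by (rule order_trans[OF integral_abs_bound]) (use F_abs[of m] in simp)
    have "(LINT x|M. w n x * h x) = (LINT x|M. (\<Sum>m. F m x))"
    proof (rule integral_cong_AE)
      show "AE x in M. w n x * h x = (\<Sum>m. F m x)"
        using Tfin
      proof eventually_elim
        case (elim x)
        have "summable (\<lambda>m. \<sigma> m * (1/3) ^ m * g m x)"
          by (rule summable_rabs_cancel) (use summ[OF elim] in \<open>simp add: abs_mult \<sigma>(1)\<close>)
        then show ?case unfolding F_def h_def by (rule suminf_mult[symmetric])
      qed
    qed (auto simp: F_def)
    also have "\<dots> = (\<Sum>m. LINT x|M. F m x)"
      by (rule integral_suminf[OF F_int ae s2])
    also have "\<dots> = (\<Sum>m. LINT x|M. F (m + Suc n) x) + (\<Sum>m<Suc n. LINT x|M. F m x)"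
      by (rule suminf_split_initial_segment[OF s3])
    finally have eq: "(LINT x|M. w n x * h x) = (\<Sum>m. LINT x|M. F (m + Suc n) x) + (\<Sum>m\<le>n. \<sigma> m * (1/3) ^ m * c n m)"
      by (simp add: F_eq lessThan_Suc_atMost)
    \<comment> \<open>The powers of \<open>1/3\<close> beyond \<open>n\<close> sum to
      \<open>(1/3)^n / 2\<close>; with ratio one half the tail could cancel everything.\<close>
    have tail: "\<bar>\<Sum>m. LINT x|M. F (m + Suc n) x\<bar> \<le> (1/3) ^ n * N n / 2"
    proof -
      have g: "\<bar>LINT x|M. F (m + Suc n) x\<bar> \<le> (1/3) ^ m * ((1/3) ^ Suc n * N n)" for m
        using le3[of "m + Suc n"] by (simp add: power_add mult_ac)
      have s4: "summable (\<lambda>m. (1/3) ^ m * ((1/3) ^ Suc n * N n))"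
        by (intro summable_mult2 summable_geometric_pow)
      have s5: "summable (\<lambda>m. \<bar>LINT x|M. F (m + Suc n) x\<bar>)"
        by (rule summable_comparison_test'[OF s4]) (use g in auto)
      have "\<bar>\<Sum>m. LINT x|M. F (m + Suc n) x\<bar> \<le> (\<Sum>m. \<bar>LINT x|M. F (m + Suc n) x\<bar>)"
        by (rule summable_rabs[OF s5])
      also have "\<dots> \<le> (\<Sum>m. (1/3) ^ m * ((1/3) ^ Suc n * N n))"
        by (rule suminf_le[OF g s5 s4])
      also have "\<dots> = 3 / 2 * ((1/3) ^ Suc n * N n)"
        using summable_geometric_pow by (subst suminf_mult2[symmetric]) auto
      finally show ?thesis by (simp add: mult.commute)
    qed
    show ?thesis
      using \<sigma>(2)[of n] tail unfolding eq by linarith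
  qed
  \<comment> \<open>The growth \<open>4^n\<close> of the norms outweighs the coefficients
    \<open>(1/3)^n\<close>, so a single \<open>h\<close> has unbounded pairings.\<close>
  have "(4/3) ^ n \<le> 2 * B" for n
  proof -
    have "(4/3) ^ n = (1/3) ^ n * (4::real) ^ n" by (simp flip: power_mult_distrib)
    also have "\<dots> \<le> (1/3) ^ n * N n" using Ng[of n] by (intro mult_left_mono) auto
    also have "\<dots> \<le> 2 * B" using big[of n] B[of "\<kappa> n"] by (simp add: w_def)
    finally show ?thesis .
  qed
  moreover obtain n where "2 * B < (4/3 :: real) ^ n"
    using real_arch_pow[of "4/3" "2 * B"] by auto
  ultimately show False by (metis not_le)
qed

section \<open>Weak convergence and the dual norm\<close>

lemma Lnorm_lebesgue_on_supp:
  fixes f :: "'a::euclidean_space \<Rightarrow> real"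
  assumes "f \<in> borel_measurable borel" "\<Omega> \<in> sets lebesgue" "\<And>x. x \<notin> \<Omega> \<Longrightarrow> f x = 0" 
  shows "Lnorm (lebesgue_on \<Omega>) p f = Lnorm lborel p f"
proof -
  have "(LINT x|lebesgue_on \<Omega>. \<bar>f x\<bar> powr p) = (LINT x|lborel. \<bar>f x\<bar> powr p)"
    using assms by (intro integral_lebesgue_on_supp) auto
  then show ?thesis by (simp add: Lnorm_def)
qed

lemma test_fun_powr_integrable_lborel:
  assumes "\<phi> \<in> test_fun \<Omega>" "p > 0"
  shows "integrable lborel (\<lambda>x. \<bar>\<phi> x\<bar> powr p)"
proof -
  obtain R where R: "\<And>x. norm x \<ge> R \<Longrightarrow> \<phi> x = 0"
    using assms(1) test_fun_bounded_support by metis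
  have "continuous_on UNIV (\<lambda>x. \<bar>\<phi> x\<bar> powr p)"
    using assms(2) by (intro continuous_on_powr' continuous_intros smooth_fun_continuous test_fun_smooth[OF assms(1)]) auto
  then show ?thesis
    using R assms by (intro integrable_compact_support[of _ R]) auto
qed

lemma test_fun_bounded:
  assumes "\<phi> \<in> test_fun \<Omega>"
  obtains B where "B \<ge> 0" "\<And>x. \<bar>\<phi> x\<bar> \<le> B"
proof -
  obtain K where K: "compact K" "\<And>x. x \<notin> K \<Longrightarrow> \<phi> x = 0"
    using test_funE[OF assms] by metis
  have "bounded (\<phi> ` K)"
    using K(1) smooth_fun_continuous[OF test_fun_smooth[OF assms]]
    by (intro compact_imp_bounded compact_continuous_image)
  then obtain B where B: "\<And>x. x \<in> K \<Longrightarrow> \<bar>\<phi> x\<bar> \<le> B"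
    by (auto simp: bounded_iff)
  have "\<bar>\<phi> x\<bar> \<le> max B 0" for x
    using B[of x] K(2)[of x] by (cases "x \<in> K") auto
  then show thesis by (intro that[of "max B 0"]) auto
qed

lemma powr_diff_le: "q \<ge> 0 \<Longrightarrow> \<bar>a - b\<bar> powr q \<le> 2 powr q * (\<bar>a\<bar> powr q + \<bar>b\<bar> powr q)" for a b :: real
proof -
  assume q: "q \<ge> 0"
  have "\<bar>a - b\<bar> powr q \<le> (2 * max \<bar>a\<bar> \<bar>b\<bar>) powr q"
    using q by (intro powr_mono2) auto
  also have "\<dots> = 2 powr q * (max \<bar>a\<bar> \<bar>b\<bar>) powr q"
    by (simp add: powr_mult)
  also have "(max \<bar>a\<bar> \<bar>b\<bar>) powr q \<le> \<bar>a\<bar> powr q + \<bar>b\<bar> powr q"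
    by (auto simp: max_def)
  finally show ?thesis by simp
qed

text \<open>The constant four comes from the pointwise bound \<open>powr_diff_le\<close> and
  \<open>2 * 2 powr (1 / q) \<le> 4\<close>. Minkowski would give two, but the value is
  immaterial.\<close>

lemma
  fixes \<phi> :: "'a::euclidean_space \<Rightarrow> real"
  assumes [measurable]: "\<phi> \<in> borel_measurable borel" and int: "integrable lborel (\<lambda>x. \<bar>\<phi> x\<bar> powr q)" and q: "q \<ge> 1"
  shows translation_Lp_integrable: "integrable lborel (\<lambda>x. \<bar>\<phi> (x + \<xi>) - \<phi> x\<bar> powr q)"
    and translation_Lnorm_le: "Lnorm lborel q (\<lambda>x. \<phi> (x + \<xi>) - \<phi> x) \<le> 4 * Lnorm lborel q \<phi>"
proof -
  have int2: "integrable lborel (\<lambda>x. \<bar>\<phi> (x + \<xi>)\<bar> powr q)"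
  proof (rule integrableI_bounded)
    have "(\<integral>\<^sup>+x. ennreal (norm (\<bar>\<phi> (x + \<xi>)\<bar> powr q)) \<partial>lborel) = (\<integral>\<^sup>+x. ennreal (norm (\<bar>\<phi> x\<bar> powr q)) \<partial>lborel)"
      by (rule nn_integral_translation[of "\<lambda>x. ennreal (norm (\<bar>\<phi> x\<bar> powr q))"]) measurable
    also have "\<dots> < \<infinity>" using int by (simp add: integrable_iff_bounded)
    finally show "(\<integral>\<^sup>+x. ennreal (norm (\<bar>\<phi> (x + \<xi>)\<bar> powr q)) \<partial>lborel) < \<infinity>" .
  qed measurable
  have le: "\<bar>\<phi> (x + \<xi>) - \<phi> x\<bar> powr q \<le> 2 powr q * (\<bar>\<phi> (x + \<xi>)\<bar> powr q + \<bar>\<phi> x\<bar> powr q)" for x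
    using q by (intro powr_diff_le) auto
  show i: "integrable lborel (\<lambda>x. \<bar>\<phi> (x + \<xi>) - \<phi> x\<bar> powr q)"
    by (rule Bochner_Integration.integrable_bound[of _ "\<lambda>x. 2 powr q * (\<bar>\<phi> (x + \<xi>)\<bar> powr q + \<bar>\<phi> x\<bar> powr q)"])
      (use int int2 le in \<open>auto intro!: AE_I2 order_trans[OF le abs_ge_self]\<close>)
  have "(LINT x|lborel. \<bar>\<phi> (x + \<xi>) - \<phi> x\<bar> powr q) \<le> (LINT x|lborel. 2 powr q * (\<bar>\<phi> (x + \<xi>)\<bar> powr q + \<bar>\<phi> x\<bar> powr q))"
    using i int int2 le by (intro integral_mono) auto
  also have "\<dots> = 2 powr q * (2 * (LINT x|lborel. \<bar>\<phi> x\<bar> powr q))"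
    using int int2 integral_translation[of "\<lambda>x. \<bar>\<phi> x\<bar> powr q" \<xi>] by simp
  finally have "Lnorm lborel q (\<lambda>x. \<phi> (x + \<xi>) - \<phi> x) \<le> (2 powr q * (2 * (LINT x|lborel. \<bar>\<phi> x\<bar> powr q))) powr (1 / q)"
    unfolding Lnorm_def using q by (intro powr_mono2) (auto intro: integral_nonneg_AE)
  also have "\<dots> = 2 * (2 powr (1 / q) * Lnorm lborel q \<phi>)"
    using q by (simp add: Lnorm_def powr_mult powr_powr)
  also have "\<dots> \<le> 2 * (2 * Lnorm lborel q \<phi>)"
    using powr_mono[of "1 / q" 1 "2::real"] q by (intro mult_left_mono mult_right_mono) auto
  finally show "Lnorm lborel q (\<lambda>x. \<phi> (x + \<xi>) - \<phi> x) \<le> 4 * Lnorm lborel q \<phi>" by simp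
qed

text \<open>Where \<open>\<bar>v\<bar> > K\<close>, the factor \<open>\<bar>v\<bar>^(r - p)\<close>
  is at most \<open>K^(r - p)\<close>, the exponent being negative. Hence the high part of
  \<open>v\<close> is small in \<open>Lr\<close>, uniformly over bounded sets of
  \<open>Lp\<close>.\<close>

lemma
  fixes v :: "'a \<Rightarrow> real"
  assumes [measurable]: "v \<in> borel_measurable M" and int: "integrable M (\<lambda>x. \<bar>v x\<bar> powr p)"
    and rp: "0 < r" "r < p" and K: "K > 0"
  shows truncation_integrable: "integrable M (\<lambda>x. \<bar>if \<bar>v x\<bar> > K then v x else 0\<bar> powr r)"
    and truncation_Lnorm_le: "Lnorm M r (\<lambda>x. if \<bar>v x\<bar> > K then v x else 0) \<le> K powr ((r - p) / r) * Lnorm M p v powr (p / r)"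
proof -
  have le: "\<bar>if \<bar>v x\<bar> > K then v x else 0\<bar> powr r \<le> K powr (r - p) * \<bar>v x\<bar> powr p" for x
  proof (cases "\<bar>v x\<bar> > K")
    case True
    then have "\<bar>v x\<bar> powr r = \<bar>v x\<bar> powr (r - p) * \<bar>v x\<bar> powr p"
      using K by (simp flip: powr_add)
    also have "\<dots> \<le> K powr (r - p) * \<bar>v x\<bar> powr p"
      using True K rp by (intro mult_right_mono powr_mono2') auto
    finally show ?thesis using True by simp
  qed (use rp in auto)
  show i: "integrable M (\<lambda>x. \<bar>if \<bar>v x\<bar> > K then v x else 0\<bar> powr r)"
    by (rule Bochner_Integration.integrable_bound[of _ "\<lambda>x. K powr (r - p) * \<bar>v x\<bar> powr p"])
      (use int le in \<open>auto intro!: AE_I2\<close>)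
  have "(LINT x|M. \<bar>if \<bar>v x\<bar> > K then v x else 0\<bar> powr r) \<le> (LINT x|M. K powr (r - p) * \<bar>v x\<bar> powr p)"
    using i int le by (intro integral_mono) auto
  also have "\<dots> = K powr (r - p) * Lnorm M p v powr p"
    using rp by (simp add: Lnorm_powr)
  finally have "Lnorm M r (\<lambda>x. if \<bar>v x\<bar> > K then v x else 0) \<le> (K powr (r - p) * Lnorm M p v powr p) powr (1 / r)"
    unfolding Lnorm_def using rp by (intro powr_mono2) (auto intro: integral_nonneg_AE)
  also have "\<dots> = K powr ((r - p) / r) * Lnorm M p v powr (p / r)"
    using K by (simp add: powr_mult powr_powr)
  finally show "Lnorm M r (\<lambda>x. if \<bar>v x\<bar> > K then v x else 0) \<le> \<dots>" .
qed

text \<open>Split \<open>v\<close> at height \<open>K\<close>. The low part is bounded and lives on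
  a set of finite measure, so it pairs with the \<open>L2\<close> norm of the increment, which is
  linear in \<open>norm \<xi>\<close>; the high part is small in \<open>Lr\<close> and pairs with
  the \<open>Lq\<close> norm of the increment, which is merely bounded.\<close>

lemma translation_pairing_bound:
  fixes v \<phi> :: "real^'n::finite \<Rightarrow> real"
  assumes \<phi>: "\<phi> \<in> test_fun \<Omega>'" and v[measurable]: "v \<in> borel_measurable borel" and v0: "\<And>x. x \<notin> \<Omega> \<Longrightarrow> v x = 0"
    and \<Omega>: "open \<Omega>" "bounded \<Omega>" and vp: "integrable lborel (\<lambda>x. \<bar>v x\<bar> powr p)"
    and q: "q > 1" "r = q / (q - 1)" "r < p" and K: "K > 0"
  shows "(\<integral>\<^sup>+x. ennreal \<bar>v x * (\<phi> (x + \<xi>) - \<phi> x)\<bar> \<partial>lborel)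
    \<le> ennreal (K * sqrt (measure lborel \<Omega>) * (norm \<xi> * Lnorm lborel 2 (\<lambda>x. norm (grad \<phi> x)))
      + Lnorm lborel r (\<lambda>x. if \<bar>v x\<bar> > K then v x else 0) * (4 * Lnorm lborel q \<phi>))"
proof -
  have sm: "smooth_fun \<phi>" using \<phi> by (rule test_fun_smooth)
  note [measurable] = smooth_fun_borel[OF sm]
  let ?d = "\<lambda>x. \<phi> (x + \<xi>) - \<phi> x" and ?t = "\<lambda>x. if \<bar>v x\<bar> > K then v x else 0"
  have r: "r > 1" "1 / r + 1 / q = 1"
    unfolding q(2) using q(1) by (auto simp: field_simps)
  have dq: "integrable lborel (\<lambda>x. \<bar>?d x\<bar> powr q)" and dqn: "Lnorm lborel q ?d \<le> 4 * Lnorm lborel q \<phi>"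
    using test_fun_powr_integrable_lborel[OF \<phi>, of q] q
    by (auto intro!: translation_Lp_integrable translation_Lnorm_le)
  have d2: "integrable lborel (\<lambda>x. (?d x)\<^sup>2)"
    using translation_Lp_integrable[OF smooth_fun_borel[OF sm], of 2 \<xi>] test_fun_powr_integrable_lborel[OF \<phi>, of 2] by simp
  have "(norm \<xi>)\<^sup>2 * (LINT x|lborel. (norm (grad \<phi> x))\<^sup>2) \<ge> (LINT x|lborel. (?d x)\<^sup>2)"
  proof -
    obtain R where R: "\<And>x i. norm x \<ge> R \<Longrightarrow> partial i \<phi> x = 0"
      using \<phi> test_fun_bounded_support by metis
    have g2: "integrable lborel (\<lambda>x. (norm (grad \<phi> x))\<^sup>2)"
      by (rule integrable_compact_support[of _ R])
        (use R in \<open>auto simp: grad_eq_0 intro!: continuous_intros grad_continuous sm\<close>)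
    have "ennreal (LINT x|lborel. (?d x)\<^sup>2) = (\<integral>\<^sup>+x. ennreal ((?d x)\<^sup>2) \<partial>lborel)"
      using d2 by (intro nn_integral_eq_integral[symmetric]) auto
    also have "\<dots> \<le> ennreal ((norm \<xi>)\<^sup>2) * (\<integral>\<^sup>+x. ennreal ((norm (grad \<phi> x))\<^sup>2) \<partial>lborel)"
      by (rule translation_estimate[OF sm])
    also have "\<dots> = ennreal ((norm \<xi>)\<^sup>2 * (LINT x|lborel. (norm (grad \<phi> x))\<^sup>2))"
      using g2 by (subst nn_integral_eq_integral) (auto simp: ennreal_mult)
    finally show ?thesis by (subst (asm) ennreal_le_iff) auto
  qed
  then have d2n: "Lnorm lborel 2 ?d \<le> norm \<xi> * Lnorm lborel 2 (\<lambda>x. norm (grad \<phi> x))"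
    unfolding Lnorm_2 by (intro real_le_lsqrt) (auto simp: power_mult_distrib)
  have \<Omega>f: "emeasure lborel \<Omega> < \<infinity>" "\<Omega> \<in> sets lborel"
    using \<Omega> emeasure_bounded_finite by auto
  have ind: "integrable lborel (\<lambda>x. (indicat_real \<Omega> x)\<^sup>2)" "Lnorm lborel 2 (indicat_real \<Omega>) = sqrt (measure lborel \<Omega>)"
    using \<Omega>f by (auto simp: Lnorm_2 power2_eq_square simp flip: indicator_inter_arith)
  have i1: "integrable lborel (\<lambda>x. indicat_real \<Omega> x * ?d x)" and
    n1: "(LINT x|lborel. \<bar>indicat_real \<Omega> x * ?d x\<bar>) \<le> sqrt (measure lborel \<Omega>) * Lnorm lborel 2 ?d"
    using L2_product_integrable[OF _ _ ind(1) d2] L2_Cauchy_Schwarz[OF _ _ ind(1) d2] \<Omega>f ind(2) by auto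
  have ti: "integrable lborel (\<lambda>x. \<bar>?t x\<bar> powr r)"
    using r by (intro truncation_integrable[OF _ vp _ q(3) K]) auto
  have i2: "integrable lborel (\<lambda>x. ?t x * ?d x)" and
    n2: "(LINT x|lborel. \<bar>?t x * ?d x\<bar>) \<le> Lnorm lborel r ?t * Lnorm lborel q ?d"
    using Hoelder_integrable[OF r(1) q(1) r(2), of ?t lborel ?d] Hoelder_inequality[OF r(1) q(1) r(2), of ?t lborel ?d] ti dq by auto
  have "\<bar>v x * ?d x\<bar> \<le> K * \<bar>indicat_real \<Omega> x * ?d x\<bar> + \<bar>?t x * ?d x\<bar>" for x
  proof (cases "\<bar>v x\<bar> > K \<or> x \<notin> \<Omega>")
    case True
    then show ?thesis using K v0[of x] by (auto simp: abs_mult)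
  next
    case False
    then show ?thesis by (auto simp: abs_mult intro: mult_right_mono)
  qed
  then have "(\<integral>\<^sup>+x. ennreal \<bar>v x * ?d x\<bar> \<partial>lborel) \<le> (\<integral>\<^sup>+x. ennreal (K * \<bar>indicat_real \<Omega> x * ?d x\<bar> + \<bar>?t x * ?d x\<bar>) \<partial>lborel)"
    by (intro nn_integral_mono ennreal_leI)
  also have "\<dots> = ennreal (LINT x|lborel. K * \<bar>indicat_real \<Omega> x * ?d x\<bar> + \<bar>?t x * ?d x\<bar>)"
    using i1 i2 K by (intro nn_integral_eq_integral) auto
  also have "(LINT x|lborel. K * \<bar>indicat_real \<Omega> x * ?d x\<bar> + \<bar>?t x * ?d x\<bar>)
      = K * (LINT x|lborel. \<bar>indicat_real \<Omega> x * ?d x\<bar>) + (LINT x|lborel. \<bar>?t x * ?d x\<bar>)"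
    using i1 i2 by simp
  also have "ennreal \<dots> \<le> ennreal (K * (sqrt (measure lborel \<Omega>) * (norm \<xi> * Lnorm lborel 2 (\<lambda>x. norm (grad \<phi> x))))
      + Lnorm lborel r ?t * (4 * Lnorm lborel q \<phi>))"
    using K by (intro ennreal_leI add_mono mult_left_mono order_trans[OF n1] order_trans[OF n2] d2n dqn) auto
  finally show ?thesis by (simp add: mult.assoc)
qed

text \<open>Compare \<open>\<phi>\<close> with its averages over balls of radius \<open>h\<close>.
  The difference is an average of increments with \<open>norm \<xi> < h\<close>, covered by the
  translation bound; the averaged function is paired with \<open>v\<close> by moving the symmetric
  kernel onto \<open>v\<close>, which leaves the local averages \<open>V h\<close>. Multiplying
  through by the ball volume avoids a division.\<close>

lemma mollified_pairing_bound:
  fixes v \<phi> :: "real^'n::finite \<Rightarrow> real"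
  defines "V h y \<equiv> (LINT x|lborel. v x * (if dist y x < h then 1 else 0))"
  assumes \<phi>: "\<phi> \<in> test_fun \<Omega>" and v[measurable]: "v \<in> borel_measurable borel" and v0: "\<And>x. x \<notin> \<Omega> \<Longrightarrow> v x = 0"
    and \<Omega>: "open \<Omega>" "bounded \<Omega>" and vp: "integrable lborel (\<lambda>x. \<bar>v x\<bar> powr p)" and v1: "integrable lborel v"
    and q: "q > 1" "r = q / (q - 1)" "r < p" and K: "K > 0" and h: "h > 0"
  shows "measure lborel (ball (0::real^'n) h) * \<bar>LINT x|lborel. v x * \<phi> x\<bar>
    \<le> measure lborel (ball (0::real^'n) h) * (K * sqrt (measure lborel \<Omega>) * (h * Lnorm lborel 2 (\<lambda>x. norm (grad \<phi> x)))
      + Lnorm lborel r (\<lambda>x. if \<bar>v x\<bar> > K then v x else 0) * (4 * Lnorm lborel q \<phi>))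
      + \<bar>LINT y|lborel. \<phi> y * V h y\<bar>"
proof -
  have sm: "smooth_fun \<phi>" using \<phi> by (rule test_fun_smooth)
  note [measurable] = smooth_fun_borel[OF sm]
  let ?\<beta> = "measure lborel (ball (0::real^'n) h)"
  let ?I = "\<lambda>x y :: real^'n. if dist y x < h then 1 else (0::real)"
  let ?E = "K * sqrt (measure lborel \<Omega>) * (h * Lnorm lborel 2 (\<lambda>x. norm (grad \<phi> x)))
      + Lnorm lborel r (\<lambda>x. if \<bar>v x\<bar> > K then v x else 0) * (4 * Lnorm lborel q \<phi>)"
  have [measurable]: "ball (0::real^'n) h \<in> sets borel" by simp
  have E0: "?E \<ge> 0" using K h by simp
  obtain R where R: "\<And>x. norm x \<ge> R \<Longrightarrow> \<phi> x = 0"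
    using \<phi> test_fun_bounded_support by metis
  have \<phi>1: "integrable lborel \<phi>"
    by (rule integrable_compact_support[of _ R]) (use R smooth_fun_continuous[OF sm] in auto)
  obtain B where B: "B \<ge> 0" "\<And>x. \<bar>\<phi> x\<bar> \<le> B"
    by (rule test_fun_bounded[OF \<phi>]) (rule that)
  have v\<phi>: "integrable lborel (\<lambda>x. v x * \<phi> x)"
    by (rule Bochner_Integration.integrable_bound[OF integrable_mult_right[OF v1, of B]])
      (use B in \<open>auto simp: abs_mult mult.commute[of B] intro!: mult_left_mono\<close>)
  define \<Phi> where "\<Phi> x = (LINT y|lborel. \<phi> y * ?I x y)" for x
  have IB: "(LINT y|lborel. ?I x y) = ?\<beta>" for x
  proof -
    have "(LINT y|lborel. ?I x y) = (LINT y|lborel. indicator (ball 0 h) (y + (- x)))"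
      by (intro Bochner_Integration.integral_cong) (auto simp: dist_norm indicator_def norm_minus_commute)
    also have "\<dots> = (LINT y|lborel. indicator (ball (0::real^'n) h) y)"
      using integral_translation[of "indicator (ball (0::real^'n) h)" "- x", OF borel_measurable_indicator[OF borel_open[OF open_ball]]] by simp
    finally show ?thesis by simp
  qed
  have II: "integrable lborel (?I x)" for x
  proof -
    have "?I x = indicator (ball x h)" by (auto simp: indicator_def dist_commute fun_eq_iff)
    then show ?thesis using emeasure_bounded_finite[of "ball x h"] by simp
  qed
  have \<phi>I: "integrable lborel (\<lambda>y. \<phi> y * ?I x y)" for x
    by (rule Bochner_Integration.integrable_bound[OF \<phi>1]) auto
  have Fub: "(LINT x|lborel. v x * \<Phi> x) = (LINT y|lborel. \<phi> y * V h y)"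
    and v\<Phi>: "integrable lborel (\<lambda>x. v x * \<Phi> x)"
  proof -
    have i: "integrable (lborel \<Otimes>\<^sub>M lborel) (\<lambda>(x, y). v x * (\<phi> y * ?I x y))"
    proof (rule integrableI_bounded)
      have "(\<integral>\<^sup>+z. ennreal (norm (case z of (x, y) \<Rightarrow> v x * (\<phi> y * ?I x y))) \<partial>(lborel \<Otimes>\<^sub>M lborel))
        \<le> (\<integral>\<^sup>+z. ennreal \<bar>v (fst z)\<bar> * ennreal \<bar>\<phi> (snd z)\<bar> \<partial>(lborel \<Otimes>\<^sub>M lborel))"
        by (intro nn_integral_mono) (auto simp: abs_mult ennreal_mult intro!: mult_left_mono)
      also have "\<dots> = (\<integral>\<^sup>+x. \<integral>\<^sup>+y. ennreal \<bar>v x\<bar> * ennreal \<bar>\<phi> y\<bar> \<partial>lborel \<partial>lborel)"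
        by (subst lborel.nn_integral_fst[symmetric]) auto
      also have "\<dots> = (\<integral>\<^sup>+x. ennreal \<bar>v x\<bar> \<partial>lborel) * (\<integral>\<^sup>+y. ennreal \<bar>\<phi> y\<bar> \<partial>lborel)"
        by (simp add: nn_integral_cmult nn_integral_multc)
      also have "\<dots> < \<infinity>"
        using v1 \<phi>1 by (auto simp: integrable_iff_bounded ennreal_mult_less_top)
      finally show "(\<integral>\<^sup>+z. ennreal (norm (case z of (x, y) \<Rightarrow> v x * (\<phi> y * ?I x y))) \<partial>(lborel \<Otimes>\<^sub>M lborel)) < \<infinity>" .
    qed measurable
    have "(LINT y|lborel. (LINT x|lborel. v x * (\<phi> y * ?I x y))) = (LINT x|lborel. (LINT y|lborel. v x * (\<phi> y * ?I x y)))"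
      by (rule lborel_pair.Fubini_integral[OF i])
    moreover have "(LINT x|lborel. v x * (\<phi> y * ?I x y)) = \<phi> y * V h y" for y
    proof -
      have "(LINT x|lborel. v x * (\<phi> y * ?I x y)) = (LINT x|lborel. \<phi> y * (v x * ?I x y))"
        by (simp add: mult_ac)
      then show ?thesis by (simp add: V_def)
    qed
    moreover have "(LINT y|lborel. v x * (\<phi> y * ?I x y)) = v x * \<Phi> x" for x
      by (simp add: \<Phi>_def)
    ultimately show "(LINT x|lborel. v x * \<Phi> x) = (LINT y|lborel. \<phi> y * V h y)" by (simp only:)
    have "integrable lborel (\<lambda>x. LINT y|lborel. v x * (\<phi> y * ?I x y))"
      using lborel_pair.integrable_fst'[OF i] by simp
    then show "integrable lborel (\<lambda>x. v x * \<Phi> x)"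
      by (simp add: \<Phi>_def)
  qed
  have [measurable]: "\<Phi> \<in> borel_measurable borel"
    unfolding \<Phi>_def[abs_def] by measurable
  have ptw: "?\<beta> * \<phi> x - \<Phi> x = (LINT y|lborel. (\<phi> x - \<phi> y) * ?I x y)" for x
    using IB[of x] II[of x] \<phi>I[of x] by (simp add: \<Phi>_def left_diff_distrib)
  have "ennreal \<bar>LINT x|lborel. v x * (?\<beta> * \<phi> x - \<Phi> x)\<bar> \<le> (\<integral>\<^sup>+x. ennreal \<bar>v x * (?\<beta> * \<phi> x - \<Phi> x)\<bar> \<partial>lborel)"
    using integral_norm_bound_ennreal[of lborel "\<lambda>x. v x * (?\<beta> * \<phi> x - \<Phi> x)"] v\<phi> v\<Phi>
    by (simp add: right_diff_distrib mult.left_commute[of _ ?\<beta>])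
  also have "\<dots> \<le> (\<integral>\<^sup>+x. \<integral>\<^sup>+\<xi>. ennreal \<bar>v x * (\<phi> (x + \<xi>) - \<phi> x)\<bar> * indicator (ball 0 h) \<xi> \<partial>lborel \<partial>lborel)"
  proof (rule nn_integral_mono)
    fix x
    have "integrable lborel (\<lambda>y. (\<phi> x - \<phi> y) * ?I x y)"
      using II[of x] \<phi>I[of x] by (simp add: left_diff_distrib)
    then have "ennreal \<bar>?\<beta> * \<phi> x - \<Phi> x\<bar> \<le> (\<integral>\<^sup>+y. ennreal \<bar>(\<phi> x - \<phi> y) * ?I x y\<bar> \<partial>lborel)"
      unfolding ptw using integral_norm_bound_ennreal by fastforce
    also have "\<dots> = (\<integral>\<^sup>+\<xi>. ennreal \<bar>(\<phi> x - \<phi> (\<xi> + x)) * ?I x (\<xi> + x)\<bar> \<partial>lborel)"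
      by (rule nn_integral_translation[of "\<lambda>y. ennreal \<bar>(\<phi> x - \<phi> y) * ?I x y\<bar>", symmetric]) measurable
    finally have "ennreal \<bar>v x\<bar> * ennreal \<bar>?\<beta> * \<phi> x - \<Phi> x\<bar>
        \<le> ennreal \<bar>v x\<bar> * (\<integral>\<^sup>+\<xi>. ennreal \<bar>(\<phi> x - \<phi> (\<xi> + x)) * ?I x (\<xi> + x)\<bar> \<partial>lborel)"
      by (rule mult_left_mono) simp
    also have "\<dots> = (\<integral>\<^sup>+\<xi>. ennreal \<bar>v x\<bar> * ennreal \<bar>(\<phi> x - \<phi> (\<xi> + x)) * ?I x (\<xi> + x)\<bar> \<partial>lborel)"
      by (rule nn_integral_cmult[symmetric]) measurable
    also have "\<dots> = (\<integral>\<^sup>+\<xi>. ennreal \<bar>v x * (\<phi> (x + \<xi>) - \<phi> x)\<bar> * indicator (ball 0 h) \<xi> \<partial>lborel)"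
      by (intro nn_integral_cong)
        (auto simp: abs_mult dist_norm indicator_def add.commute abs_minus_commute ennreal_mult)
    finally show "ennreal \<bar>v x * (?\<beta> * \<phi> x - \<Phi> x)\<bar> \<le> (\<integral>\<^sup>+\<xi>. ennreal \<bar>v x * (\<phi> (x + \<xi>) - \<phi> x)\<bar> * indicator (ball 0 h) \<xi> \<partial>lborel)"
      by (simp add: abs_mult ennreal_mult)
  qed
  also have "\<dots> = (\<integral>\<^sup>+\<xi>. \<integral>\<^sup>+x. ennreal \<bar>v x * (\<phi> (x + \<xi>) - \<phi> x)\<bar> * indicator (ball 0 h) \<xi> \<partial>lborel \<partial>lborel)"
    by (rule lborel_pair.Fubini'[symmetric]) measurable
  also have "\<dots> = (\<integral>\<^sup>+\<xi>. (\<integral>\<^sup>+x. ennreal \<bar>v x * (\<phi> (x + \<xi>) - \<phi> x)\<bar> \<partial>lborel) * indicator (ball 0 h) \<xi> \<partial>lborel)"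
    by (intro nn_integral_cong nn_integral_multc) measurable
  also have "\<dots> \<le> (\<integral>\<^sup>+\<xi>. ennreal ?E * indicator (ball (0::real^'n) h) \<xi> \<partial>lborel)"
  proof (rule nn_integral_mono)
    fix \<xi> :: "real^'n"
    have "(\<integral>\<^sup>+x. ennreal \<bar>v x * (\<phi> (x + \<xi>) - \<phi> x)\<bar> \<partial>lborel) \<le> ennreal ?E" if "norm \<xi> < h"
    proof (rule order_trans[OF translation_pairing_bound[OF \<phi> v v0 \<Omega> vp q K, of \<xi>]])
      show "ennreal (K * sqrt (measure lborel \<Omega>) * (norm \<xi> * Lnorm lborel 2 (\<lambda>x. norm (grad \<phi> x)))
          + Lnorm lborel r (\<lambda>x. if \<bar>v x\<bar> > K then v x else 0) * (4 * Lnorm lborel q \<phi>)) \<le> ennreal ?E"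
        using that K by (intro ennreal_leI add_mono mult_left_mono mult_right_mono) auto
    qed
    then show "(\<integral>\<^sup>+x. ennreal \<bar>v x * (\<phi> (x + \<xi>) - \<phi> x)\<bar> \<partial>lborel) * indicator (ball 0 h) \<xi> \<le> ennreal ?E * indicator (ball 0 h) \<xi>"
      by (auto simp: indicator_def)
  qed
  also have "\<dots> = ennreal ?E * emeasure lborel (ball (0::real^'n) h)"
    by (rule nn_integral_cmult_indicator) auto
  also have "\<dots> = ennreal (?\<beta> * ?E)"
    using emeasure_bounded_finite[of "ball (0::real^'n) h"] E0
    by (subst emeasure_eq_ennreal_measure) (auto simp: ennreal_mult[symmetric] mult.commute)
  finally have "\<bar>LINT x|lborel. v x * (?\<beta> * \<phi> x - \<Phi> x)\<bar> \<le> ?\<beta> * ?E"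
    using E0 by (subst (asm) ennreal_le_iff) auto
  moreover have "(LINT x|lborel. v x * (?\<beta> * \<phi> x - \<Phi> x)) = ?\<beta> * (LINT x|lborel. v x * \<phi> x) - (LINT x|lborel. v x * \<Phi> x)"
    using v\<phi> v\<Phi> by (simp add: right_diff_distrib mult.left_commute[of _ ?\<beta>])
  moreover have "\<bar>?\<beta> * (LINT x|lborel. v x * \<phi> x)\<bar> = ?\<beta> * \<bar>LINT x|lborel. v x * \<phi> x\<bar>"
    by (simp add: abs_mult)
  ultimately show ?thesis
    unfolding Fub by linarith
qed

text \<open>The condition \<open>1/p + 1/q < 1\<close> says that the conjugate exponent of
  \<open>p\<close> is below \<open>q\<close>; the slack reappears as the exponent of the measure of
  \<open>A\<close>.\<close>

lemma (in finite_measure)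
  fixes v y :: "'a \<Rightarrow> real"
  assumes [measurable]: "v \<in> borel_measurable M" "y \<in> borel_measurable M" "A \<in> sets M"
    and v: "integrable M (\<lambda>x. \<bar>v x\<bar> powr p)" and y: "integrable M (\<lambda>x. \<bar>y x\<bar> powr q)"
    and pq: "p > 1" "q > 0" "1 / p + 1 / q < 1"
  shows pairing_integrable: "integrable M (\<lambda>x. v x * y x)"
    and pairing_bound: "(LINT x|M. \<bar>v x * (y x * indicator A x)\<bar>)
      \<le> Lnorm M p v * (measure M A powr (1 - 1 / p - 1 / q) * Lnorm M q y)"
proof -
  define p' where "p' = p / (p - 1)"
  have p': "p' > 1" "1 / p + 1 / p' = 1" "1 / p' = 1 - 1 / p"
    using pq by (auto simp: p'_def field_simps)
  have "1 / q < 1 / p'" using pq p' by simp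
  then have p'q: "p' < q" using p'(1) pq(2) by (simp add: divide_less_cancel frac_less2 field_simps)
  have yp: "integrable M (\<lambda>x. \<bar>y x\<bar> powr p')"
    using Lp_nested[OF _ y, of p'] p' p'q by simp
  show "integrable M (\<lambda>x. v x * y x)"
    by (rule Hoelder_integrable[OF pq(1) p'(1,2)]) (use v yp in auto)
  have yA: "integrable M (\<lambda>x. \<bar>y x * indicator A x\<bar> powr p')"
    by (rule Bochner_Integration.integrable_bound[OF yp]) (use p' in \<open>auto simp: indicator_def\<close>)
  have "(LINT x|M. \<bar>v x * (y x * indicator A x)\<bar>) \<le> Lnorm M p v * Lnorm M p' (\<lambda>x. y x * indicator A x)"
    by (rule Hoelder_inequality[OF pq(1) p'(1,2)]) (use v yA in auto)
  also have "\<dots> \<le> Lnorm M p v * (measure M A powr (1 - 1 / p - 1 / q) * Lnorm M q y)"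
    using Lnorm_nested[OF _ y, of p' A] p' p'q by (intro mult_left_mono) auto
  finally show "(LINT x|M. \<bar>v x * (y x * indicator A x)\<bar>)
      \<le> Lnorm M p v * (measure M A powr (1 - 1 / p - 1 / q) * Lnorm M q y)" .
qed

lemma integrable_lebesgue_on_supp:
  fixes f :: "'a::euclidean_space \<Rightarrow> real"
  assumes "f \<in> borel_measurable borel" and "\<Omega> \<in> sets lebesgue" and "\<And>x. x \<notin> \<Omega> \<Longrightarrow> f x = 0"
  shows "integrable (lebesgue_on \<Omega>) f \<longleftrightarrow> integrable lborel f"
proof -
  have "integrable (lebesgue_on \<Omega>) f \<longleftrightarrow> integrable lebesgue (\<lambda>x. indicator \<Omega> x *\<^sub>R f x)"
    using assms(2) by (simp add: integrable_restrict_space)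
  also have "(\<lambda>x. indicator \<Omega> x *\<^sub>R f x) = f"
    using assms(3) by (auto simp: indicator_def fun_eq_iff)
  finally show ?thesis using assms(1) by (simp add: integrable_completion)
qed

text \<open>A Borel version that vanishes off \<open>\<Omega>\<close> gives access to translations
  and product integrals, which are formulated for \<open>lborel\<close>.\<close>

lemma borel_representative:
  fixes v :: "'a::euclidean_space \<Rightarrow> real"
  assumes \<Omega>: "open \<Omega>" and v: "v \<in> borel_measurable (lebesgue_on \<Omega>)"
  obtains v' where "v' \<in> borel_measurable borel" "\<And>x. x \<notin> \<Omega> \<Longrightarrow> v' x = 0" "AE x in lebesgue_on \<Omega>. v x = v' x"
proof -
  have \<Omega>s: "\<Omega> \<in> sets lebesgue" using \<Omega> by auto
  have "(\<lambda>x. if x \<in> \<Omega> then v x else 0) \<in> borel_measurable (completion lborel)"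
    by (rule borel_measurable_if_I[OF v \<Omega>s])
  from completion_ex_borel_measurable_real[OF this] obtain g where
    g: "g \<in> borel_measurable lborel" "AE x in lborel. (if x \<in> \<Omega> then v x else 0) = g x" by blast
  show thesis
  proof (rule that[of "\<lambda>x. indicator \<Omega> x * g x"])
    show "(\<lambda>x. indicator \<Omega> x * g x) \<in> borel_measurable borel"
      using g(1) \<Omega> by (intro borel_measurable_times borel_measurable_indicator) auto
    have "AE x in lebesgue. (if x \<in> \<Omega> then v x else 0) = g x"
      by (rule AE_completion[OF g(2)])
    then show "AE x in lebesgue_on \<Omega>. v x = indicator \<Omega> x * g x"
      using \<Omega>s by (subst AE_restrict_space_iff) (auto elim: eventually_mono)
  qed auto
qed

text \<open>A local average is the pairing with the indicator of a ball, so it tends to zero at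
  every point; the uniform \<open>L1\<close> bound supplies a constant majorant on a set of finite
  measure, which upgrades this to \<open>L2\<close> convergence.\<close>

lemma local_averages_tendsto_0:
  fixes v :: "nat \<Rightarrow> 'a::euclidean_space \<Rightarrow> real" and h :: real
  defines "V k y \<equiv> (LINT x|lborel. v k x * (if dist y x < h then 1 else 0))"
  assumes \<Omega>: "open \<Omega>" "bounded \<Omega>" and v[measurable]: "\<And>k. v k \<in> borel_measurable borel"
    and vB: "\<And>k. integrable lborel (v k)" "\<And>k. (LINT x|lborel. \<bar>v k x\<bar>) \<le> B"
    and lim: "\<And>y. (\<lambda>k. LINT x|lborel. v k x * indicator (ball y h) x) \<longlonglongrightarrow> 0"
  shows "(\<lambda>k. Lnorm (lebesgue_on \<Omega>) 2 (V k)) \<longlonglongrightarrow> 0" "\<And>k. L2 (lebesgue_on \<Omega>) (V k)"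
proof -
  let ?M = "lebesgue_on \<Omega>"
  have L: "\<Omega> \<in> lmeasurable" using \<Omega> by (simp add: lmeasurable_open)
  interpret finite_measure ?M by (rule finite_measure_lebesgue_on[OF L])
  have Vm: "V k \<in> borel_measurable ?M" for k
    unfolding V_def by (intro borel_lebesgue_on) measurable
  have Vb: "\<bar>V k y\<bar> \<le> B" for k y
  proof -
    have "\<bar>V k y\<bar> \<le> (LINT x|lborel. \<bar>v k x * (if dist y x < h then 1 else 0)\<bar>)"
      unfolding V_def by (rule integral_abs_bound)
    also have "\<dots> \<le> (LINT x|lborel. \<bar>v k x\<bar>)"
      by (rule integral_mono_AE') (use vB(1) in auto)
    finally show ?thesis using vB(2)[of k] by simp
  qed
  have bd: "(norm (V k y))\<^sup>2 \<le> B\<^sup>2" for k y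
    using Vb[of k y] by (intro power_mono) auto
  show VL: "L2 ?M (V k)" for k
    by (rule L2_bound[of _ _ "\<lambda>_. B\<^sup>2"]) (use Vm bd in auto)
  have "L2conv ?M V (\<lambda>_. 0)"
  proof (rule L2conv_dominated[where w = "\<lambda>_. B\<^sup>2"])
    show "AE y in ?M. (\<lambda>k. V k y) \<longlonglongrightarrow> 0"
    proof (rule AE_I2)
      fix y
      have "V k y = (LINT x|lborel. v k x * indicator (ball y h) x)" for k
        unfolding V_def by (intro Bochner_Integration.integral_cong) (auto simp: indicator_def)
      then show "(\<lambda>k. V k y) \<longlonglongrightarrow> 0" using lim[of y] by simp
    qed
  qed (use Vm bd in auto)
  then have "(\<lambda>k. sqrt (LINT x|?M. (norm (V k x - 0))\<^sup>2)) \<longlonglongrightarrow> sqrt 0"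
    unfolding L2conv_def by (rule tendsto_real_sqrt)
  then show "(\<lambda>k. Lnorm ?M 2 (V k)) \<longlonglongrightarrow> 0" by (simp add: Lnorm_2)
qed

text \<open>The order of choices matters: \<open>K\<close> makes the high parts of all
  \<open>v k\<close> contribute at most \<open>e / 4\<close>, then \<open>h\<close> does the same
  for the low parts, and only then \<open>k\<close> is taken large enough for the local averages at
  the fixed scale \<open>h\<close>. Each bound is a multiple of the gradient norm of
  \<open>\<phi>\<close>, hence uniform in \<open>\<phi>\<close>.\<close>

lemma test_fun_dual_bound:
  fixes v :: "nat \<Rightarrow> real^'n::finite \<Rightarrow> real"
  assumes \<Omega>: "open \<Omega>" "bounded \<Omega>" and S: "sobolev_bound \<Omega> q C" and pq: "q > 2" "p > 1" "1 / p + 1 / q < 1"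
    and v: "\<And>k. v k \<in> borel_measurable (lebesgue_on \<Omega>)" "\<And>k. integrable (lebesgue_on \<Omega>) (\<lambda>x. \<bar>v k x\<bar> powr p)"
    and B: "\<And>k. Lnorm (lebesgue_on \<Omega>) p (v k) \<le> B"
    and lim: "\<And>y h. (\<lambda>k. LINT x|lebesgue_on \<Omega>. v k x * indicator (ball y h) x) \<longlonglongrightarrow> 0"
    and e: "e > 0"
  shows "\<forall>\<^sub>F k in sequentially. \<forall>\<phi>\<in>test_fun \<Omega>. \<bar>LINT x|lebesgue_on \<Omega>. v k x * \<phi> x\<bar>
    \<le> e * Lnorm (lebesgue_on \<Omega>) 2 (\<lambda>x. norm (grad \<phi> x))"
proof -
  let ?M = "lebesgue_on \<Omega>"
  have L: "\<Omega> \<in> lmeasurable" using \<Omega> by (simp add: lmeasurable_open)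
  then have \<Omega>s: "\<Omega> \<in> sets lebesgue" by auto
  interpret finite_measure ?M by (rule finite_measure_lebesgue_on[OF L])
  have "\<exists>v'. v' \<in> borel_measurable borel \<and> (\<forall>x. x \<notin> \<Omega> \<longrightarrow> v' x = 0) \<and> (AE x in ?M. v k x = v' x)" for k
    by (rule borel_representative[OF \<Omega>(1) v(1)[of k]]) blast
  then obtain v' where v'[measurable]: "\<And>k. v' k \<in> borel_measurable borel" and v0: "\<And>k x. x \<notin> \<Omega> \<Longrightarrow> v' k x = 0"
    and ae: "\<And>k. AE x in ?M. v k x = v' k x" by metis
  have vM: "v' k \<in> borel_measurable ?M" for k by (rule borel_lebesgue_on) simp
  have trans: "(LINT x|?M. v k x * g x) = (LINT x|lborel. v' k x * g x)"
    if g[measurable]: "g \<in> borel_measurable borel" for k and g :: "real^'n \<Rightarrow> real"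
  proof -
    have "(LINT x|?M. v k x * g x) = (LINT x|?M. v' k x * g x)"
    proof (rule integral_cong_AE)
      show "AE x in ?M. v k x * g x = v' k x * g x" using ae[of k] by eventually_elim simp
    qed (use v(1) vM borel_lebesgue_on[OF g] in auto)
    also have "\<dots> = (LINT x|lborel. v' k x * g x)"
      by (rule integral_lebesgue_on_supp) (use \<Omega>s v0 in auto)
    finally show ?thesis .
  qed
  have vpM: "integrable ?M (\<lambda>x. \<bar>v' k x\<bar> powr p)" for k
  proof (rule integrable_cong_AE_imp[OF v(2)[of k]])
    show "AE x in ?M. \<bar>v k x\<bar> powr p = \<bar>v' k x\<bar> powr p" using ae[of k] by eventually_elim simp
  qed (use vM[of k] in measurable)
  have vp: "integrable lborel (\<lambda>x. \<bar>v' k x\<bar> powr p)" for k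
    using vpM[of k] \<Omega>s v0 by (subst (asm) integrable_lebesgue_on_supp) auto
  have vN: "Lnorm lborel p (v' k) \<le> B" for k
  proof -
    have "Lnorm lborel p (v' k) = Lnorm ?M p (v' k)"
      using \<Omega>s v0 by (intro Lnorm_lebesgue_on_supp[symmetric]) auto
    also have "\<dots> = Lnorm ?M p (v k)"
      using ae[of k] v(1) vM by (intro Lnorm_cong_AE) (auto elim: eventually_mono)
    finally show ?thesis using B[of k] by simp
  qed
  have v1: "integrable lborel (v' k)" and v1B: "(LINT x|lborel. \<bar>v' k x\<bar>) \<le> measure ?M \<Omega> powr (1 - 1 / p) * B" for k
  proof -
    have "integrable ?M (\<lambda>x. \<bar>v' k x\<bar> powr 1)"
      by (rule Lp_nested[OF vM vpM]) (use pq in auto)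
    then have "integrable ?M (v' k)" using vM[of k] by (simp add: integrable_abs_iff)
    then show "integrable lborel (v' k)"
      using \<Omega>s v0 by (subst (asm) integrable_lebesgue_on_supp) auto
    have \<Omega>m: "\<Omega> \<in> sets ?M" using \<Omega>s by (simp add: sets_restrict_space_iff)
    have "Lnorm ?M 1 (\<lambda>x. v' k x * indicator \<Omega> x) \<le> measure ?M \<Omega> powr (1 / 1 - 1 / p) * Lnorm ?M p (v' k)"
      by (rule Lnorm_nested[OF vM vpM _ _ \<Omega>m]) (use pq in auto)
    also have "(\<lambda>x. v' k x * indicator \<Omega> x) = v' k"
      using v0 by (auto simp: indicator_def fun_eq_iff)
    also have "Lnorm ?M p (v' k) = Lnorm lborel p (v' k)"
      using \<Omega>s v0 by (intro Lnorm_lebesgue_on_supp) auto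
    also have "Lnorm ?M 1 (v' k) = Lnorm lborel 1 (v' k)"
      using \<Omega>s v0 by (intro Lnorm_lebesgue_on_supp) auto
    also have "\<dots> = (LINT x|lborel. \<bar>v' k x\<bar>)"
      by (simp add: Lnorm_def)
    finally show "(LINT x|lborel. \<bar>v' k x\<bar>) \<le> measure ?M \<Omega> powr (1 - 1 / p) * B"
      using vN[of k] mult_left_mono[OF vN[of k], of "measure ?M \<Omega> powr (1 - 1 / p)"] by simp
  qed
  define r where "r = q / (q - 1)"
  \<comment> \<open>This is the subcriticality: \<open>p\<close> exceeds the exponent
    \<open>r\<close> conjugate to \<open>q\<close>, so high parts become small in
    \<open>Lr\<close>.\<close>
  have "r < p"
  proof -
    have "1 / p < 1 / r" using pq by (simp add: r_def field_simps)
    moreover have "r > 0" using pq by (simp add: r_def)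
    ultimately show ?thesis using pq by (simp add: field_simps)
  qed
  have r: "q > 1" "r = q / (q - 1)" "r < p" "r > 0"
    using pq \<open>r < p\<close> by (auto simp: r_def)
  have "((\<lambda>K. K powr ((r - p) / r) * (B powr (p / r) * (4 * C))) \<longlongrightarrow> 0 * (B powr (p / r) * (4 * C))) at_top"
    using r(3,4) by (intro tendsto_mult tendsto_const tendsto_neg_powr filterlim_ident) (auto simp: divide_neg_pos)
  from order_tendstoD(2)[OF this, of "e / 4"] e
  have "\<forall>\<^sub>F K in at_top. K powr ((r - p) / r) * (B powr (p / r) * (4 * C)) < e / 4"
    by simp
  then have "\<forall>\<^sub>F K in at_top. K powr ((r - p) / r) * (B powr (p / r) * (4 * C)) < e / 4 \<and> K > 0"
    using eventually_gt_at_top by (rule eventually_conj)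
  then obtain K where K: "K powr ((r - p) / r) * (B powr (p / r) * (4 * C)) < e / 4" "K > 0"
    by (auto dest!: eventually_happens'[OF trivial_limit_at_top_linorder])
  \<comment> \<open>The summand \<open>1\<close> keeps the denominator positive whatever the measure
    of \<open>\<Omega>\<close> is.\<close>
  define h where "h = e / (4 * (K * sqrt (measure lborel \<Omega>) + 1))"
  have den: "K * sqrt (measure lborel \<Omega>) + 1 > 0"
    using K(2) by (intro add_nonneg_pos) auto
  have h0: "h > 0" using e den by (simp add: h_def)
  have hK: "K * sqrt (measure lborel \<Omega>) * h \<le> e / 4"
  proof -
    have "K * sqrt (measure lborel \<Omega>) * h \<le> (K * sqrt (measure lborel \<Omega>) + 1) * h"
      using h0 by (intro mult_right_mono) auto
    also have "\<dots> = e / 4"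
    proof -
      have "A * (e / (4 * A)) = e / 4" if "A > 0" for A using that by simp
      from this[OF den] show ?thesis by (simp only: h_def)
    qed
    finally show ?thesis .
  qed
  define \<beta> where "\<beta> = measure lborel (ball (0::real^'n) h)"
  have \<beta>0: "\<beta> > 0"
    unfolding \<beta>_def using h0 emeasure_bounded_finite[of "ball (0::real^'n) h"]
    by (metis bounded_ball content_ball_pos)
  define V where "V k y = (LINT x|lborel. v' k x * (if dist y x < h then 1 else 0))" for k y
  have limB: "(\<lambda>k. LINT x|lborel. v' k x * indicator (ball y h) x) \<longlonglongrightarrow> 0" for y
  proof -
    have eq: "(LINT x|?M. v k x * indicator (ball y h) x) = (LINT x|lborel. v' k x * indicator (ball y h) x)" for k
    proof (rule trans)
      show "indicat_real (ball y h) \<in> borel_measurable borel"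
        by (intro borel_measurable_indicator borel_open open_ball)
    qed
    show ?thesis using lim[of y h] by (simp only: eq)
  qed
  note V = local_averages_tendsto_0[where v = v' and h = h, OF \<Omega> v' v1 v1B limB, folded V_def]
  define c2 where "c2 = measure ?M \<Omega> powr (1 / 2 - 1 / q) * C"
  have "(\<lambda>k. c2 * Lnorm ?M 2 (V k)) \<longlonglongrightarrow> c2 * 0"
    by (intro tendsto_mult tendsto_const V(1))
  from order_tendstoD(2)[OF this, of "\<beta> * (e / 4)"] e \<beta>0
  have "\<forall>\<^sub>F k in sequentially. c2 * Lnorm ?M 2 (V k) < \<beta> * (e / 4)"
    by simp
  then show ?thesis
  proof eventually_elim
    case (elim k)
    show ?case
    proof
      fix \<phi> assume \<phi>: "\<phi> \<in> test_fun \<Omega>"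
      let ?D = "Lnorm ?M 2 (\<lambda>x. norm (grad \<phi> x))"
      have sm: "smooth_fun \<phi>" using \<phi> by (rule test_fun_smooth)
      have \<phi>0: "\<phi> x = 0" "partial i \<phi> x = 0" if "x \<notin> \<Omega>" for x i
        using \<phi> that by (metis test_funE subsetD)+
      note [measurable] = smooth_fun_borel[OF sm] grad_borel[OF sm]
      have \<phi>M: "\<phi> \<in> borel_measurable ?M" by (rule borel_lebesgue_on) simp
      have \<phi>q: "integrable ?M (\<lambda>x. \<bar>\<phi> x\<bar> powr q)" "Lnorm ?M q \<phi> \<le> C * ?D"
        using S test_fun_H01_grad[OF \<phi> \<Omega>s] by (auto simp: sobolev_bound_def)
      have D: "Lnorm lborel 2 (\<lambda>x. norm (grad \<phi> x)) = ?D"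
        using \<Omega>s \<phi>0 by (intro Lnorm_lebesgue_on_supp[symmetric]) (auto simp: grad_eq_0)
      have Q: "Lnorm lborel q \<phi> = Lnorm ?M q \<phi>"
        using \<Omega>s \<phi>0 by (intro Lnorm_lebesgue_on_supp[symmetric]) auto
      have \<Omega>m: "\<Omega> \<in> sets ?M" using \<Omega>s by (simp add: sets_restrict_space_iff)
      have \<phi>2: "Lnorm ?M 2 \<phi> \<le> c2 * ?D"
      proof -
        have "(\<lambda>x. \<phi> x * indicator \<Omega> x) = \<phi>" using \<phi>0 by (auto simp: indicator_def fun_eq_iff)
        then have "Lnorm ?M 2 \<phi> \<le> measure ?M \<Omega> powr (1 / 2 - 1 / q) * Lnorm ?M q \<phi>"
          using Lnorm_nested[OF \<phi>M \<phi>q(1) _ pq(1) \<Omega>m] by simp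
        also have "\<dots> \<le> measure ?M \<Omega> powr (1 / 2 - 1 / q) * (C * ?D)"
          by (intro mult_left_mono \<phi>q(2)) auto
        finally show ?thesis by (simp add: c2_def mult.assoc)
      qed
      have "(LINT y|lborel. \<phi> y * V k y) = (LINT y|?M. \<phi> y * V k y)"
      proof (rule integral_lebesgue_on_supp[symmetric])
        show "(\<lambda>x. \<phi> x * V k x) \<in> borel_measurable borel"
          unfolding V_def by measurable
      qed (use \<Omega>s \<phi>0 in auto)
      then have "\<bar>LINT y|lborel. \<phi> y * V k y\<bar> \<le> Lnorm ?M 2 \<phi> * Lnorm ?M 2 (V k)"
        using L2_integral_mult_le[OF test_fun_L2(1)[OF \<phi> \<Omega>s] V(2)[of k]] by simp
      also have "\<dots> \<le> (c2 * ?D) * Lnorm ?M 2 (V k)"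
        by (intro mult_right_mono \<phi>2) auto
      also have "\<dots> = (c2 * Lnorm ?M 2 (V k)) * ?D" by simp
      also have "\<dots> \<le> (\<beta> * (e / 4)) * ?D"
        using elim by (intro mult_right_mono) auto
      finally have t3: "\<bar>LINT y|lborel. \<phi> y * V k y\<bar> \<le> \<beta> * (e / 4 * ?D)" by simp
      have t1: "K * sqrt (measure lborel \<Omega>) * (h * ?D) \<le> e / 4 * ?D"
        using mult_right_mono[OF hK, of ?D] by (simp add: mult.assoc)
      have "Lnorm lborel r (\<lambda>x. if \<bar>v' k x\<bar> > K then v' k x else 0) \<le> K powr ((r - p) / r) * Lnorm lborel p (v' k) powr (p / r)"
        by (rule truncation_Lnorm_le) (use vp r K in auto)
      also have "\<dots> \<le> K powr ((r - p) / r) * B powr (p / r)"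
        using vN[of k] r(3,4) pq by (intro mult_left_mono powr_mono2) auto
      finally have "Lnorm lborel r (\<lambda>x. if \<bar>v' k x\<bar> > K then v' k x else 0) * (4 * Lnorm lborel q \<phi>)
          \<le> (K powr ((r - p) / r) * B powr (p / r)) * (4 * (C * ?D))"
        unfolding Q using \<phi>q(2) by (intro mult_mono mult_left_mono) auto
      also have "\<dots> = (K powr ((r - p) / r) * (B powr (p / r) * (4 * C))) * ?D"
        by simp
      also have "\<dots> \<le> e / 4 * ?D"
        using K(1) by (intro mult_right_mono) auto
      finally have t2: "Lnorm lborel r (\<lambda>x. if \<bar>v' k x\<bar> > K then v' k x else 0) * (4 * Lnorm lborel q \<phi>) \<le> e / 4 * ?D" .
      have "\<beta> * \<bar>LINT x|lborel. v' k x * \<phi> x\<bar> \<le> \<beta> * (K * sqrt (measure lborel \<Omega>) * (h * ?D)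
          + Lnorm lborel r (\<lambda>x. if \<bar>v' k x\<bar> > K then v' k x else 0) * (4 * Lnorm lborel q \<phi>)) + \<bar>LINT y|lborel. \<phi> y * V k y\<bar>"
        unfolding D[symmetric] \<beta>_def V_def
        by (rule mollified_pairing_bound[where p = p]) (assumption | rule \<phi> v' \<Omega> vp v1 r(1-3) K(2) h0 v0)+
      also have "\<dots> \<le> \<beta> * (e / 4 * ?D + e / 4 * ?D) + \<beta> * (e / 4 * ?D)"
        using t1 t2 t3 \<beta>0 by (intro add_mono mult_left_mono) auto
      also have "\<dots> = \<beta> * (3 / 4 * e * ?D)" by (simp add: algebra_simps)
      finally have "\<bar>LINT x|lborel. v' k x * \<phi> x\<bar> \<le> 3 / 4 * e * ?D"
        using \<beta>0 by (simp add: mult_le_cancel_left_pos)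
      also have "\<dots> \<le> e * ?D" using e by (intro mult_right_mono) auto
      finally show "\<bar>LINT x|?M. v k x * \<phi> x\<bar> \<le> e * ?D"
        by (subst trans) auto
    qed
  qed
qed

text \<open>For fixed \<open>k\<close> both sides are continuous under the approximation by test
  functions, by Hoelder and the Sobolev bound. The good indices \<open>k\<close> are those of
  \<open>test_fun_dual_bound\<close>, so uniformity over all functions is kept; the later
  truncations depend on \<open>k\<close> themselves.\<close>

theorem dual_bound_tendsto_0:
  fixes v :: "nat \<Rightarrow> real^'n::finite \<Rightarrow> real"
  assumes \<Omega>: "open \<Omega>" "bounded \<Omega>" and S: "sobolev_bound \<Omega> q C" and pq: "q > 2" "p > 1" "1 / p + 1 / q < 1"
    and v: "\<And>k. v k \<in> borel_measurable (lebesgue_on \<Omega>)" "\<And>k. integrable (lebesgue_on \<Omega>) (\<lambda>x. \<bar>v k x\<bar> powr p)"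
    and B: "\<And>k. Lnorm (lebesgue_on \<Omega>) p (v k) \<le> B"
    and lim: "\<And>y h. (\<lambda>k. LINT x|lebesgue_on \<Omega>. v k x * indicator (ball y h) x) \<longlonglongrightarrow> 0"
    and e: "e > 0"
  shows "\<forall>\<^sub>F k in sequentially. \<forall>y G. H01_grad \<Omega> y G \<longrightarrow> \<bar>LINT x|lebesgue_on \<Omega>. v k x * y x\<bar>
    \<le> e * Lnorm (lebesgue_on \<Omega>) 2 (\<lambda>x. norm (G x))"
  using test_fun_dual_bound[where v = v, OF assms]
proof eventually_elim
  case (elim k)
  let ?M = "lebesgue_on \<Omega>"
  have L: "\<Omega> \<in> lmeasurable" using \<Omega> by (simp add: lmeasurable_open)
  then have \<Omega>s: "\<Omega> \<in> sets lebesgue" by auto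
  interpret finite_measure ?M by (rule finite_measure_lebesgue_on[OF L])
  have \<Omega>m: "\<Omega> \<in> sets ?M" using \<Omega>s by (simp add: sets_restrict_space_iff)
  show ?case
  proof (intro allI impI)
    fix y G assume H: "H01_grad \<Omega> y G"
    have L2s: "L2 ?M y" "L2 ?M G" using H by (auto simp: H01_grad_def)
    obtain \<phi> where \<phi>: "\<And>j. \<phi> j \<in> test_fun \<Omega>" "L2conv ?M \<phi> y" "L2conv ?M (\<lambda>j. grad (\<phi> j)) G"
      using H by (auto simp: H01_grad_def)
    have T: "L2 ?M (\<phi> j)" "L2 ?M (grad (\<phi> j))" for j
      using test_fun_L2[OF \<phi>(1) \<Omega>s] by auto
    have sq: "integrable ?M (\<lambda>x. \<bar>z x\<bar> powr q)" "Lnorm ?M q z \<le> C * Lnorm ?M 2 (\<lambda>x. norm (Gz x))"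
      if "H01_grad \<Omega> z Gz" for z Gz
      using S that by (auto simp: sobolev_bound_def)
    define c where "c = Lnorm ?M p (v k) * (measure ?M \<Omega> powr (1 - 1 / p - 1 / q) * C)"
    have vint: "integrable ?M (\<lambda>x. v k x * z x)" if "H01_grad \<Omega> z Gz" for z Gz
      by (rule pairing_integrable[OF v(1) _ \<Omega>m v(2) sq(1)[OF that]])
        (use that pq in \<open>auto simp: H01_grad_def L2_def\<close>)
    have diff: "\<bar>(LINT x|?M. v k x * \<phi> j x) - (LINT x|?M. v k x * y x)\<bar> \<le> c * Lnorm ?M 2 (\<lambda>x. norm (grad (\<phi> j) x - G x))" for j
    proof -
      have Hd: "H01_grad \<Omega> (\<lambda>x. \<phi> j x - y x) (\<lambda>x. grad (\<phi> j) x - G x)"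
        by (rule H01_grad_diff[OF \<Omega>s test_fun_H01_grad[OF \<phi>(1) \<Omega>s] H])
      have dm: "(\<lambda>x. \<phi> j x - y x) \<in> borel_measurable ?M" using Hd by (auto simp: H01_grad_def L2_def)
      have "\<bar>(LINT x|?M. v k x * \<phi> j x) - (LINT x|?M. v k x * y x)\<bar> = \<bar>LINT x|?M. v k x * (\<phi> j x - y x)\<bar>"
        unfolding right_diff_distrib
        by (subst Bochner_Integration.integral_diff[OF vint[OF test_fun_H01_grad[OF \<phi>(1) \<Omega>s]] vint[OF H]]) (rule refl)
      also have "\<dots> \<le> (LINT x|?M. \<bar>v k x * (\<phi> j x - y x)\<bar>)"
        by (rule integral_abs_bound)
      also have "\<dots> = (LINT x|?M. \<bar>v k x * ((\<phi> j x - y x) * indicator \<Omega> x)\<bar>)"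
        by (intro Bochner_Integration.integral_cong) (auto simp: space_restrict_space)
      also have "\<dots> \<le> Lnorm ?M p (v k) * (measure ?M \<Omega> powr (1 - 1 / p - 1 / q) * Lnorm ?M q (\<lambda>x. \<phi> j x - y x))"
        by (rule pairing_bound[OF v(1) dm \<Omega>m v(2) sq(1)[OF Hd]]) (use pq in auto)
      also have "\<dots> \<le> Lnorm ?M p (v k) * (measure ?M \<Omega> powr (1 - 1 / p - 1 / q) * (C * Lnorm ?M 2 (\<lambda>x. norm (grad (\<phi> j) x - G x))))"
        by (intro mult_left_mono sq(2)[OF Hd]) auto
      finally show ?thesis by (simp add: c_def mult.assoc)
    qed
    have "(\<lambda>j. Lnorm ?M 2 (\<lambda>x. norm (grad (\<phi> j) x - G x))) \<longlonglongrightarrow> 0"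
      using tendsto_real_sqrt[OF \<phi>(3)[unfolded L2conv_def]] by (simp add: Lnorm_2)
    from tendsto_mult[OF tendsto_const[of c] this]
    have "(\<lambda>j. c * Lnorm ?M 2 (\<lambda>x. norm (grad (\<phi> j) x - G x))) \<longlonglongrightarrow> 0" by simp
    then have "(\<lambda>j. (LINT x|?M. v k x * \<phi> j x) - (LINT x|?M. v k x * y x)) \<longlonglongrightarrow> 0"
      by (rule Lim_null_comparison[rotated]) (use diff in auto)
    then have "(\<lambda>j. \<bar>LINT x|?M. v k x * \<phi> j x\<bar>) \<longlonglongrightarrow> \<bar>LINT x|?M. v k x * y x\<bar>"
      by (intro tendsto_rabs) (rule LIM_zero_cancel)
    moreover have "(\<lambda>j. e * Lnorm ?M 2 (\<lambda>x. norm (grad (\<phi> j) x))) \<longlonglongrightarrow> e * Lnorm ?M 2 (\<lambda>x. norm (G x))"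
      by (intro tendsto_mult tendsto_const L2_conv_Lnorm T L2s \<phi>)
    ultimately show "\<bar>LINT x|?M. v k x * y x\<bar> \<le> e * Lnorm ?M 2 (\<lambda>x. norm (G x))"
      by (rule LIMSEQ_le) (use elim \<phi>(1) in blast)
  qed
qed

section \<open>Estimates for truncations\<close>

text \<open>The exponents satisfy \<open>1/r + 1/2 + 1/q = 1\<close>. Hoelder for
  \<open>\<beta>^2\<close> and \<open>z^2\<close> with exponents \<open>r / 2\<close> and
  \<open>q / 2\<close> puts \<open>\<beta> z\<close> into \<open>L2\<close>, and Cauchy-Schwarz does
  the rest.\<close>

lemma
  fixes \<beta> g z :: "'a \<Rightarrow> real"
  assumes q: "q > 2" "r = 2 * q / (q - 2)"
    and [measurable]: "\<beta> \<in> borel_measurable M" "z \<in> borel_measurable M"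
    and \<beta>: "integrable M (\<lambda>x. \<bar>\<beta> x\<bar> powr r)" and g: "L2 M g" and z: "integrable M (\<lambda>x. \<bar>z x\<bar> powr q)"
  shows triple_Hoelder_integrable: "integrable M (\<lambda>x. \<beta> x * g x * z x)"
    and triple_Hoelder: "(LINT x|M. \<bar>\<beta> x * g x * z x\<bar>) \<le> Lnorm M r \<beta> * Lnorm M 2 g * Lnorm M q z"
proof -
  have r2: "r > 2" "2 / r + 2 / q = 1"
    using q(1) unfolding q(2) by (auto simp: field_simps)
  have conj: "r / 2 > 1" "q / 2 > 1" "1 / (r / 2) + 1 / (q / 2) = 1"
    using q(1) r2 by auto
  have abs_sq: "\<bar>a\<^sup>2\<bar> = \<bar>a\<bar> powr 2" for a :: real
    by simp
  have sq: "\<bar>(\<beta> x)\<^sup>2\<bar> powr (r / 2) = \<bar>\<beta> x\<bar> powr r" "\<bar>(z x)\<^sup>2\<bar> powr (q / 2) = \<bar>z x\<bar> powr q" for x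
    by (simp_all only: abs_sq powr_powr) simp_all
  have b2: "integrable M (\<lambda>x. \<bar>(\<beta> x)\<^sup>2\<bar> powr (r / 2))" "integrable M (\<lambda>x. \<bar>(z x)\<^sup>2\<bar> powr (q / 2))"
    unfolding sq using \<beta> z by auto
  have m2: "(\<lambda>x. (\<beta> x)\<^sup>2) \<in> borel_measurable M" "(\<lambda>x. (z x)\<^sup>2) \<in> borel_measurable M" by measurable
  have L: "L2 M (\<lambda>x. \<beta> x * z x)"
    using Hoelder_integrable[OF conj m2 b2] by (simp add: L2_def power_mult_distrib)
  have "(LINT x|M. (\<beta> x * z x)\<^sup>2) = (LINT x|M. \<bar>(\<beta> x)\<^sup>2 * (z x)\<^sup>2\<bar>)"
    by (simp add: power_mult_distrib)
  also have "\<dots> \<le> Lnorm M (r / 2) (\<lambda>x. (\<beta> x)\<^sup>2) * Lnorm M (q / 2) (\<lambda>x. (z x)\<^sup>2)"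
    by (rule Hoelder_inequality[OF conj m2 b2])
  also have "Lnorm M (r / 2) (\<lambda>x. (\<beta> x)\<^sup>2) = (Lnorm M r \<beta>)\<^sup>2"
    unfolding Lnorm_def sq by (simp add: powr_powr flip: powr_numeral)
  also have "Lnorm M (q / 2) (\<lambda>x. (z x)\<^sup>2) = (Lnorm M q z)\<^sup>2"
    unfolding Lnorm_def sq by (simp add: powr_powr flip: powr_numeral)
  finally have le: "Lnorm M 2 (\<lambda>x. \<beta> x * z x) \<le> Lnorm M r \<beta> * Lnorm M q z"
    unfolding Lnorm_2 by (intro real_le_lsqrt) (auto simp: power_mult_distrib)
  have "(LINT x|M. \<bar>g x * (\<beta> x * z x)\<bar>) \<le> Lnorm M 2 g * Lnorm M 2 (\<lambda>x. \<beta> x * z x)"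
    using L2_Cauchy_Schwarz[of g M "\<lambda>x. \<beta> x * z x"] g L by (simp add: L2_def)
  also have "\<dots> \<le> Lnorm M 2 g * (Lnorm M r \<beta> * Lnorm M q z)"
    by (rule mult_left_mono[OF le]) simp
  finally have "integrable M (\<lambda>x. g x * (\<beta> x * z x))"
    "(LINT x|M. \<bar>g x * (\<beta> x * z x)\<bar>) \<le> Lnorm M 2 g * (Lnorm M r \<beta> * Lnorm M q z)"
    using L2_mult_integrable[OF g L] by auto
  then show "integrable M (\<lambda>x. \<beta> x * g x * z x)"
    and "(LINT x|M. \<bar>\<beta> x * g x * z x\<bar>) \<le> Lnorm M r \<beta> * Lnorm M 2 g * Lnorm M q z"
    by (simp_all add: mult_ac)
qed

abbreviation pos_grad :: "('a \<Rightarrow> real) \<Rightarrow> ('a \<Rightarrow> 'b::real_normed_vector) \<Rightarrow> real \<Rightarrow> 'a \<Rightarrow> 'b" where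
  "pos_grad w W s \<equiv> \<lambda>x. if w x > s then W x else 0"

abbreviation pos_norm :: "(real^'n::finite) set \<Rightarrow> (real^'n \<Rightarrow> real) \<Rightarrow> (real^'n \<Rightarrow> real^'n) \<Rightarrow> real \<Rightarrow> real" where
  "pos_norm \<Omega> w W s \<equiv> Lnorm (lebesgue_on \<Omega>) 2 (\<lambda>x. norm (pos_grad w W s x))"

text \<open>Here \<open>\<eta>\<close> is any bound, linear in the gradient norm, for the pairing of
  the right-hand side with truncations. It is a dual norm in the proof of \<open>H01\<close>
  convergence and a power of the measure of a level set in the supremum bound.\<close>

definition energy_estimate ::
  "(real^'n::finite) set \<Rightarrow> real \<Rightarrow> (real^'n \<Rightarrow> real) \<Rightarrow> (real^'n \<Rightarrow> real) \<Rightarrow> (real^'n \<Rightarrow> real^'n) \<Rightarrow> real \<Rightarrow> real \<Rightarrow> bool" where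
  "energy_estimate \<Omega> \<Lambda> \<beta> w W \<eta> s \<longleftrightarrow> \<Lambda> * (pos_norm \<Omega> w W s)\<^sup>2
    \<le> (LINT x|lebesgue_on \<Omega>. \<beta> x * norm (pos_grad w W s x) * max (w x - s) 0) + \<eta> * pos_norm \<Omega> w W s"

text \<open>Split \<open>{w > s}\<close> at \<open>t\<close>. In the band the drift has
  \<open>Lr\<close> norm at most \<open>\<theta> powr (1 / r)\<close>; above \<open>t\<close> its
  full norm multiplies the gradient norm at level \<open>t\<close>, which is known already when
  bands are treated from the top. The level \<open>{w = t}\<close> belongs to neither part, but
  \<open>W\<close> vanishes there almost everywhere.\<close>

lemma drift_band_bound:
  fixes w :: "real^'n::finite \<Rightarrow> real"
  assumes \<Omega>: "open \<Omega>" "bounded \<Omega>" and S: "sobolev_bound \<Omega> q C" and q: "q > 2" "r = 2 * q / (q - 2)"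
    and \<beta>[measurable]: "\<beta> \<in> borel_measurable (lebesgue_on \<Omega>)" and \<beta>r: "integrable (lebesgue_on \<Omega>) (\<lambda>x. \<bar>\<beta> x\<bar> powr r)"
    and \<beta>0: "\<And>x. \<beta> x \<ge> 0"
    and H: "H01_grad \<Omega> w W" and st: "0 \<le> s" "s < t"
    and \<theta>: "(LINT x|lebesgue_on \<Omega>. \<bar>\<beta> x\<bar> powr r * (if s < w x \<and> w x < t then 1 else 0)) \<le> \<theta>"
  shows "(LINT x|lebesgue_on \<Omega>. \<beta> x * norm (pos_grad w W s x) * max (w x - s) 0)
    \<le> (\<theta> powr (1 / r) * pos_norm \<Omega> w W s + Lnorm (lebesgue_on \<Omega>) r \<beta> * pos_norm \<Omega> w W t) * (C * pos_norm \<Omega> w W s)"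
proof -
  let ?M = "lebesgue_on \<Omega>" and ?z = "\<lambda>x. max (w x - s) 0"
  have \<Omega>s: "\<Omega> \<in> sets lebesgue" using \<Omega> by auto
  have r: "r > 2" using q(1) unfolding q(2) by (auto simp: field_simps)
  have L: "L2 ?M w" "L2 ?M W" using H by (auto simp: H01_grad_def)
  note [measurable] = L[THEN L2_measurable]
  have Hs: "H01_grad \<Omega> ?z (pos_grad w W s)" by (rule H01_grad_pos_part[OF \<Omega>s H st(1)])
  have Ht: "H01_grad \<Omega> (\<lambda>x. max (w x - t) 0) (pos_grad w W t)" by (rule H01_grad_pos_part[OF \<Omega>s H]) (use st in simp)
  have zq: "integrable ?M (\<lambda>x. \<bar>?z x\<bar> powr q)" "Lnorm ?M q ?z \<le> C * pos_norm \<Omega> w W s"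
    using S Hs unfolding sobolev_bound_def by blast+
  have C0: "C > 0" using S by (simp add: sobolev_bound_def)
  have gs: "L2 ?M (\<lambda>x. norm (pos_grad w W s x))" "L2 ?M (\<lambda>x. norm (pos_grad w W t x))"
    using Hs Ht by (auto simp: H01_grad_def intro: L2_norm)
  define \<beta>1 where "\<beta>1 x = (if s < w x \<and> w x < t then \<beta> x else 0)" for x
  have [measurable]: "\<beta>1 \<in> borel_measurable ?M" unfolding \<beta>1_def[abs_def] by measurable
  have eq1: "\<bar>\<beta>1 x\<bar> powr r = \<bar>\<beta> x\<bar> powr r * (if s < w x \<and> w x < t then 1 else 0)" for x
    using r by (simp add: \<beta>1_def)
  have \<beta>1r: "integrable ?M (\<lambda>x. \<bar>\<beta>1 x\<bar> powr r)"
    by (rule Bochner_Integration.integrable_bound[OF \<beta>r]) (auto simp: eq1)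
  have \<beta>1n: "Lnorm ?M r \<beta>1 \<le> \<theta> powr (1 / r)"
    unfolding Lnorm_def using \<theta> r by (intro powr_mono2) (auto simp: eq1 intro!: integral_nonneg_AE)
  note T1 = triple_Hoelder_integrable[OF q _ _ \<beta>1r gs(1) zq(1)] triple_Hoelder[OF q _ _ \<beta>1r gs(1) zq(1)]
  note T2 = triple_Hoelder_integrable[OF q _ _ \<beta>r gs(2) zq(1)] triple_Hoelder[OF q _ _ \<beta>r gs(2) zq(1)]
  note T0 = triple_Hoelder_integrable[OF q _ _ \<beta>r gs(1) zq(1)]
  have lev: "AE x in ?M. w x = t \<longrightarrow> W x = 0"
    by (rule H01_grad_level_set[OF \<Omega>(1) H]) (use st in simp)
  have "(LINT x|?M. \<beta> x * norm (pos_grad w W s x) * ?z x)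
      \<le> (LINT x|?M. \<bar>\<beta>1 x * norm (pos_grad w W s x) * ?z x\<bar> + \<bar>\<beta> x * norm (pos_grad w W t x) * ?z x\<bar>)"
  proof (rule integral_mono_AE)
    show "integrable ?M (\<lambda>x. \<beta> x * norm (pos_grad w W s x) * ?z x)" by (rule T0) measurable
    show "integrable ?M (\<lambda>x. \<bar>\<beta>1 x * norm (pos_grad w W s x) * ?z x\<bar> + \<bar>\<beta> x * norm (pos_grad w W t x) * ?z x\<bar>)"
      by (intro Bochner_Integration.integrable_add integrable_abs T1(1) T2(1)) measurable
    show "AE x in ?M. \<beta> x * norm (pos_grad w W s x) * ?z x
        \<le> \<bar>\<beta>1 x * norm (pos_grad w W s x) * ?z x\<bar> + \<bar>\<beta> x * norm (pos_grad w W t x) * ?z x\<bar>"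
      using lev
    proof eventually_elim
      case (elim x)
      then show ?case
        using st \<beta>0[of x] by (cases "w x = t") (auto simp: \<beta>1_def)
    qed
  qed
  also have "\<dots> = (LINT x|?M. \<bar>\<beta>1 x * norm (pos_grad w W s x) * ?z x\<bar>) + (LINT x|?M. \<bar>\<beta> x * norm (pos_grad w W t x) * ?z x\<bar>)"
    by (intro Bochner_Integration.integral_add integrable_abs T1(1) T2(1)) measurable
  also have "\<dots> \<le> Lnorm ?M r \<beta>1 * pos_norm \<Omega> w W s * Lnorm ?M q ?z + Lnorm ?M r \<beta> * pos_norm \<Omega> w W t * Lnorm ?M q ?z"
    by (intro add_mono T1(2) T2(2)) measurable
  also have "\<dots> \<le> \<theta> powr (1 / r) * pos_norm \<Omega> w W s * (C * pos_norm \<Omega> w W s)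
      + Lnorm ?M r \<beta> * pos_norm \<Omega> w W t * (C * pos_norm \<Omega> w W s)"
    using \<beta>1n zq(2) C0 by (intro add_mono mult_mono mult_left_mono mult_right_mono) auto
  finally show ?thesis by (simp add: distrib_right)
qed

text \<open>The function \<open>F\<close> is decreasing and right continuous, so the smallest level
  \<open>t\<close> with \<open>F t \<le> c\<close> exists, and \<open>F u > c\<close> for
  \<open>s \<le> u < t\<close> bounds the mass between \<open>s\<close> and \<open>t\<close>. At
  \<open>t\<close> itself \<open>F\<close> may jump by the weight of \<open>{w = t}\<close>, which
  is why the band is open there.\<close>

lemma distribution_tail:
  fixes w f :: "'a \<Rightarrow> real" and M :: "'a measure"
  defines "F s \<equiv> (LINT x|M. f x * (if s < w x then 1 else 0))"
  assumes [measurable]: "w \<in> borel_measurable M" and f: "integrable M f" "\<And>x. 0 \<le> f x"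
    and bound: "\<And>x. x \<in> space M \<Longrightarrow> w x \<le> b"
    and c: "0 \<le> c" "c < F s"
  obtains t where "s < t" "F t \<le> c" "(LINT x|M. f x * (if s < w x \<and> w x < t then 1 else 0)) \<le> F s - c"
proof -
  have int: "integrable M (\<lambda>x. f x * (if P x then 1 else 0))" if "Measurable.pred M P" for P
    using that by (intro Bochner_Integration.integrable_bound[OF f(1)]) (use f in auto)
  have anti: "F t \<le> F u" if "u \<le> t" for u t
    unfolding F_def using f(2) that by (intro integral_mono int) (auto intro: mult_left_mono)
  define T where "T = {t. s \<le> t \<and> F t \<le> c}"
  \<comment> \<open>The bound \<open>b\<close> supplies a level with no mass above it, so the
    infimum is over a nonempty set even when \<open>c = 0\<close>.\<close>
  have "F (max s b) = 0"
    unfolding F_def using bound by (intro integral_eq_zero_AE AE_I2) (force simp: not_less)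
  then have ne: "max s b \<in> T" using c(1) by (simp add: T_def)
  have bdd: "bdd_below T" by (rule bdd_belowI[of _ s]) (simp add: T_def)
  define t where "t = Inf T"
  have T_ge: "s \<le> u" if "u \<in> T" for u using that by (simp add: T_def)
  have "T \<noteq> {}" using ne by blast
  then have st: "s \<le> t" unfolding t_def using T_ge by (rule cInf_greatest)
  have above: "F u \<le> c" if tu: "t < u" for u
  proof -
    obtain t' where "t' \<in> T" "t' < u" using cInf_lessD[OF \<open>T \<noteq> {}\<close> tu[unfolded t_def]] by (elim bexE)
    then show ?thesis using anti[of t' u] by (auto simp: T_def)
  qed
  have below: "c < F u" if "s \<le> u" "u < t" for u
  proof (rule ccontr)
    assume "\<not> c < F u"
    then have "u \<in> T" using that by (simp add: T_def)
    then show False using cInf_lower[OF _ bdd] that(2) unfolding t_def by force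
  qed
  have Ft: "F t \<le> c"
  proof (rule LIMSEQ_le_const2)
    show "(\<lambda>n. F (t + 1 / real (Suc n))) \<longlonglongrightarrow> F t"
      unfolding F_def
    proof (rule integral_dominated_convergence[where w = f])
      show "AE x in M. (\<lambda>n. f x * (if t + 1 / real (Suc n) < w x then 1 else 0)) \<longlonglongrightarrow> f x * (if t < w x then 1 else 0)"
      proof (intro AE_I2 tendsto_mult tendsto_const)
        fix x
        show "(\<lambda>n. if t + 1 / real (Suc n) < w x then 1 else 0) \<longlonglongrightarrow> (if t < w x then 1 else (0::real))"
        proof (cases "t < w x")
          case True
          have "(\<lambda>n. t + 1 / real (Suc n)) \<longlonglongrightarrow> t + 0"
            by (intro tendsto_intros LIMSEQ_Suc[OF lim_1_over_n])
          then have "\<forall>\<^sub>F n in sequentially. t + 1 / real (Suc n) < w x"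
            using True order_tendstoD(2) by fastforce
          then show ?thesis
            using True by (intro tendsto_eventually) (auto elim: eventually_mono)
        next
          case False
          have "\<not> t + 1 / real (Suc n) < w x" for n
            using False by (smt (verit) divide_pos_pos of_nat_0_less_iff zero_less_Suc)
          then show ?thesis using False by simp
        qed
      qed
    qed (use f int in \<open>auto simp: abs_mult\<close>)
    show "\<exists>N. \<forall>n\<ge>N. F (t + 1 / real (Suc n)) \<le> c"
      by (intro exI allI impI above) simp
  qed
  have "s < t" using st Ft c(2) by (cases "s = t") auto
  moreover have "(LINT x|M. f x * (if s < w x \<and> w x < t then 1 else 0)) \<le> F s - c"
  proof (rule LIMSEQ_le_const2)
    define u where "u n = t - (t - s) / real (Suc n)" for n
    have u: "s \<le> u n" "u n < t" for n
      using \<open>s < t\<close> by (auto simp: u_def field_simps mult_left_mono mult_right_mono)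
    have ulim: "u \<longlonglongrightarrow> t"
    proof -
      have "(\<lambda>n. t - (t - s) * (1 / real (Suc n))) \<longlonglongrightarrow> t - (t - s) * 0"
        by (intro tendsto_intros LIMSEQ_Suc[OF lim_1_over_n])
      then show ?thesis by (simp add: u_def[abs_def])
    qed
    show "(\<lambda>n. LINT x|M. f x * (if s < w x \<and> w x \<le> u n then 1 else 0)) \<longlonglongrightarrow> (LINT x|M. f x * (if s < w x \<and> w x < t then 1 else 0))"
    proof (rule integral_dominated_convergence[where w = f])
      show "AE x in M. (\<lambda>n. f x * (if s < w x \<and> w x \<le> u n then 1 else 0)) \<longlonglongrightarrow> f x * (if s < w x \<and> w x < t then 1 else 0)"
      proof (intro AE_I2 tendsto_mult tendsto_const)
        fix x
        show "(\<lambda>n. if s < w x \<and> w x \<le> u n then 1 else 0) \<longlonglongrightarrow> (if s < w x \<and> w x < t then 1 else (0::real))"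
        proof (cases "w x < t")
          case True
          then have "\<forall>\<^sub>F n in sequentially. w x < u n"
            using order_tendstoD(1)[OF ulim] by auto
          then show ?thesis
            using True by (intro tendsto_eventually) (auto elim!: eventually_mono)
        next
          case False
          then have "\<not> w x \<le> u n" for n using u(2)[of n] by linarith
          then show ?thesis using False by simp
        qed
      qed
    qed (use f int in \<open>auto simp: abs_mult\<close>)
    have "(LINT x|M. f x * (if s < w x \<and> w x \<le> u n then 1 else 0)) \<le> F s - c" for n
    proof -
      have "(LINT x|M. f x * (if s < w x \<and> w x \<le> u n then 1 else 0)) + F (u n)
          = (LINT x|M. f x * (if s < w x \<and> w x \<le> u n then 1 else 0) + f x * (if u n < w x then 1 else 0))"
        unfolding F_def by (intro Bochner_Integration.integral_add[symmetric] int) auto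
      also have "\<dots> = F s"
        unfolding F_def using u(1)[of n] by (intro Bochner_Integration.integral_cong) auto
      finally show ?thesis using below[OF u] by (smt (verit))
    qed
    then show "\<exists>N. \<forall>n\<ge>N. (LINT x|M. f x * (if s < w x \<and> w x \<le> u n then 1 else 0)) \<le> F s - c" by blast
  qed
  ultimately show thesis using Ft by (intro that)
qed

lemma mult_left_cancel_or_zero: "x * a \<le> x * b \<Longrightarrow> 0 \<le> x \<Longrightarrow> a \<le> b \<or> x = 0" for x a b :: real
  by (cases "x = 0") (auto simp: mult_le_cancel_left)

text \<open>Splitting the range of \<open>w\<close> into finitely many bands, on each of which the drift has small
  norm, replaces the missing coercivity; the number of bands depends on the drift only.\<close>

theorem band_estimate:
  fixes \<beta> :: "real^'n::finite \<Rightarrow> real"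
  assumes \<Omega>: "open \<Omega>" "bounded \<Omega>" and S: "sobolev_bound \<Omega> q C" and q: "q > 2" "r = 2 * q / (q - 2)"
    and \<beta>[measurable]: "\<beta> \<in> borel_measurable (lebesgue_on \<Omega>)" and \<beta>r: "integrable (lebesgue_on \<Omega>) (\<lambda>x. \<bar>\<beta> x\<bar> powr r)"
    and \<beta>0: "\<And>x. \<beta> x \<ge> 0" and \<Lambda>: "\<Lambda> > 0"
  shows "\<exists>c>0. \<forall>w W s \<eta> b. H01_grad \<Omega> w W \<longrightarrow> (\<forall>x\<in>\<Omega>. w x \<le> b) \<longrightarrow> 0 \<le> s \<longrightarrow> 0 \<le> \<eta> \<longrightarrow>
    (\<forall>t\<ge>s. energy_estimate \<Omega> \<Lambda> \<beta> w W \<eta> t) \<longrightarrow> pos_norm \<Omega> w W s \<le> c * \<eta>"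
proof -
  let ?M = "lebesgue_on \<Omega>"
  have \<Omega>s: "\<Omega> \<in> sets lebesgue" using \<Omega> by auto
  have r: "r > 2" using q(1) unfolding q(2) by (auto simp: field_simps)
  have C0: "C > 0" using S by (simp add: sobolev_bound_def)
  \<comment> \<open>Chosen such that a band of mass \<open>\<theta>\<close> consumes exactly half of
    the ellipticity term.\<close>
  define \<theta> where "\<theta> = (\<Lambda> / (2 * C)) powr r"
  have \<theta>: "\<theta> > 0" "\<theta> powr (1 / r) * C = \<Lambda> / 2"
    using r \<Lambda> C0 by (auto simp: \<theta>_def powr_powr)
  define F where "F w s = (LINT x|?M. \<bar>\<beta> x\<bar> powr r * (if s < w x then 1 else 0))" for w and s :: real
  have fint: "integrable ?M (\<lambda>x. \<bar>\<beta> x\<bar> powr r * (if s < w x then 1 else 0))"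
    if [measurable]: "w \<in> borel_measurable ?M" for w and s :: real
    by (rule Bochner_Integration.integrable_bound[OF \<beta>r]) auto
  define N where "N = Lnorm ?M r \<beta>"
  have N0: "N \<ge> 0" by (simp add: N_def)
  \<comment> \<open>Induction on the number of portions \<open>\<theta>\<close> of drift mass above
    \<open>s\<close>. The constant is quantified before \<open>w\<close>, \<open>W\<close>,
    \<open>s\<close>, \<open>\<eta>\<close> and \<open>b\<close>, so a constant for \<open>m\<close>
    portions may be used at the new level \<open>t\<close>.\<close>
  have "\<exists>c>0. \<forall>w W s \<eta> b. H01_grad \<Omega> w W \<longrightarrow> (\<forall>x\<in>\<Omega>. w x \<le> b) \<longrightarrow> 0 \<le> s \<longrightarrow> 0 \<le> \<eta> \<longrightarrow> F w s \<le> real m * \<theta> \<longrightarrow>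
    (\<forall>t\<ge>s. energy_estimate \<Omega> \<Lambda> \<beta> w W \<eta> t) \<longrightarrow> pos_norm \<Omega> w W s \<le> c * \<eta>" for m
  proof (induction m)
    case 0
    have "pos_norm \<Omega> w W s \<le> (1 / \<Lambda>) * \<eta>"
      if H: "H01_grad \<Omega> w W" and s: "0 \<le> s" "0 \<le> \<eta>" "F w s \<le> real 0 * \<theta>" and E: "energy_estimate \<Omega> \<Lambda> \<beta> w W \<eta> s"
      for w W s \<eta>
    proof -
      have L: "L2 ?M w" using H by (auto simp: H01_grad_def)
      note [measurable] = L[THEN L2_measurable]
      have "F w s \<ge> 0" unfolding F_def by (intro integral_nonneg_AE) auto
      then have "F w s = 0" using s(3) by simp
      then have "AE x in ?M. \<bar>\<beta> x\<bar> powr r * (if s < w x then 1 else 0) = 0"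
        unfolding F_def using fint[OF L2_measurable[OF L], of s] by (subst (asm) integral_nonneg_eq_0_iff_AE) auto
      then have "AE x in ?M. \<beta> x * norm (pos_grad w W s x) * max (w x - s) 0 = 0"
        by eventually_elim (auto split: if_splits)
      then have "(LINT x|?M. \<beta> x * norm (pos_grad w W s x) * max (w x - s) 0) = 0"
        by (rule integral_eq_zero_AE)
      then have "\<Lambda> * (pos_norm \<Omega> w W s)\<^sup>2 \<le> \<eta> * pos_norm \<Omega> w W s"
        using E unfolding energy_estimate_def by simp
      then have "pos_norm \<Omega> w W s * (\<Lambda> * pos_norm \<Omega> w W s) \<le> pos_norm \<Omega> w W s * \<eta>"
        by (simp add: power2_eq_square mult_ac)
      then have "\<Lambda> * pos_norm \<Omega> w W s \<le> \<eta> \<or> pos_norm \<Omega> w W s = 0"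
        by (rule mult_left_cancel_or_zero) simp
      then show ?thesis using \<Lambda> s(2) by (auto simp: field_simps)
    qed
    then show ?case using \<Lambda> by (intro exI[of _ "1 / \<Lambda>"]) auto
  next
    case (Suc m)
    then obtain c where c: "c > 0" and IH: "\<And>w W s \<eta> b. H01_grad \<Omega> w W \<Longrightarrow> (\<forall>x\<in>\<Omega>. w x \<le> b) \<Longrightarrow> 0 \<le> s \<Longrightarrow> 0 \<le> \<eta> \<Longrightarrow>
      F w s \<le> real m * \<theta> \<Longrightarrow> (\<forall>t\<ge>s. energy_estimate \<Omega> \<Lambda> \<beta> w W \<eta> t) \<Longrightarrow> pos_norm \<Omega> w W s \<le> c * \<eta>"
      by blast
    \<comment> \<open>After absorption, \<open>\<Lambda> / 2\<close> times the norm at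
      \<open>s\<close> is at most \<open>N C\<close> times the norm at \<open>t\<close> plus
      \<open>\<eta>\<close>, and the norm at \<open>t\<close> is at most \<open>c * \<eta>\<close>.
      Adding \<open>c\<close> covers levels with at most \<open>m\<close> portions above
      them.\<close>
    define c' where "c' = 2 / \<Lambda> * (N * C * c + 1) + c"
    have c': "c' > 0" "c \<le> c'" "2 / \<Lambda> * (N * C * c + 1) \<le> c'"
      using c \<Lambda> N0 C0 by (auto simp: c'_def add_nonneg_pos)
    have "pos_norm \<Omega> w W s \<le> c' * \<eta>"
      if H: "H01_grad \<Omega> w W" and b: "\<forall>x\<in>\<Omega>. w x \<le> b" and s: "0 \<le> s" and \<eta>: "0 \<le> \<eta>"
        and Fs: "F w s \<le> real (Suc m) * \<theta>" and E: "\<forall>t\<ge>s. energy_estimate \<Omega> \<Lambda> \<beta> w W \<eta> t"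
      for w W s \<eta> b
    proof (cases "F w s \<le> real m * \<theta>")
      case True
      then have "pos_norm \<Omega> w W s \<le> c * \<eta>" using IH[OF H b s \<eta> _ E] by simp
      also have "\<dots> \<le> c' * \<eta>" using c'(2) \<eta> by (rule mult_right_mono)
      finally show ?thesis .
    next
      case False
      have L: "L2 ?M w" using H by (auto simp: H01_grad_def)
      have wm: "w \<in> borel_measurable ?M" by (rule L2_measurable[OF L])
      have m\<theta>: "0 \<le> real m * \<theta>" "real m * \<theta> < F w s" using False \<theta>(1) by auto
      obtain t where t: "s < t" "F w t \<le> real m * \<theta>"
        "(LINT x|?M. \<bar>\<beta> x\<bar> powr r * (if s < w x \<and> w x < t then 1 else 0)) \<le> F w s - real m * \<theta>"
        unfolding F_def
        by (rule distribution_tail[OF wm \<beta>r _ _ m\<theta>(1) m\<theta>(2)[unfolded F_def], of b])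
          (use b in \<open>auto simp: space_restrict_space\<close>)
      have th: "(LINT x|?M. \<bar>\<beta> x\<bar> powr r * (if s < w x \<and> w x < t then 1 else 0)) \<le> \<theta>"
        using t(3) Fs by (simp add: distrib_right)
      let ?X = "pos_norm \<Omega> w W s" and ?Y = "pos_norm \<Omega> w W t"
      have Y: "?Y \<le> c * \<eta>"
        by (rule IH[OF H b _ \<eta> t(2)]) (use s t(1) E in auto)
      have "\<Lambda> * ?X\<^sup>2 \<le> (\<theta> powr (1 / r) * ?X + N * ?Y) * (C * ?X) + \<eta> * ?X"
        using E drift_band_bound[OF \<Omega> S q \<beta> \<beta>r \<beta>0 H s t(1) th]
        unfolding energy_estimate_def N_def by (meson add_right_mono less_imp_le order_refl order_trans)
      also have "\<dots> = (\<Lambda> / 2) * ?X\<^sup>2 + (N * C * ?Y + \<eta>) * ?X"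
        unfolding \<theta>(2)[symmetric] by (simp add: power2_eq_square algebra_simps)
      also have "\<dots> \<le> (\<Lambda> / 2) * ?X\<^sup>2 + (N * C * (c * \<eta>) + \<eta>) * ?X"
        using Y N0 C0 by (intro add_left_mono mult_right_mono add_right_mono mult_left_mono) auto
      finally have "?X * (\<Lambda> / 2 * ?X) \<le> ?X * ((N * C * c + 1) * \<eta>)"
        by (simp add: power2_eq_square algebra_simps)
      then have "\<Lambda> / 2 * ?X \<le> (N * C * c + 1) * \<eta> \<or> ?X = 0"
        by (rule mult_left_cancel_or_zero) simp
      then show ?thesis
      proof
        assume "\<Lambda> / 2 * ?X \<le> (N * C * c + 1) * \<eta>"
        then have "?X \<le> 2 / \<Lambda> * (N * C * c + 1) * \<eta>"
          using \<Lambda> by (simp add: field_simps)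
        also have "\<dots> \<le> c' * \<eta>" using c'(3) \<eta> by (rule mult_right_mono)
        finally show ?thesis .
      next
        assume "?X = 0"
        then show ?thesis using c'(1) \<eta> by simp
      qed
    qed
    then show ?case using c'(1) by blast
  qed
  note claim = this
  \<comment> \<open>Enough portions for the entire drift, so that the mass hypothesis of the claim
    holds for every \<open>w\<close> and \<open>s\<close>.\<close>
  obtain m :: nat where m: "(LINT x|?M. \<bar>\<beta> x\<bar> powr r) / \<theta> < real m"
    using reals_Archimedean2 by blast
  obtain c where c: "c > 0" "\<And>w W s \<eta> b. H01_grad \<Omega> w W \<Longrightarrow> (\<forall>x\<in>\<Omega>. w x \<le> b) \<Longrightarrow> 0 \<le> s \<Longrightarrow> 0 \<le> \<eta> \<Longrightarrow>
      F w s \<le> real m * \<theta> \<Longrightarrow> (\<forall>t\<ge>s. energy_estimate \<Omega> \<Lambda> \<beta> w W \<eta> t) \<Longrightarrow> pos_norm \<Omega> w W s \<le> c * \<eta>"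
    using claim[of m] by blast
  have "F w s \<le> real m * \<theta>" if "H01_grad \<Omega> w W" for w W s
  proof -
    have wm: "w \<in> borel_measurable ?M" using that by (auto simp: H01_grad_def L2_def)
    have "F w s \<le> (LINT x|?M. \<bar>\<beta> x\<bar> powr r)"
      unfolding F_def using fint[OF wm] \<beta>r by (intro integral_mono) auto
    then show ?thesis using m \<theta>(1) by (simp add: divide_less_eq)
  qed
  then show ?thesis using c by blast
qed

text \<open>On the levels \<open>s j = k + d (1 - 2^(-j))\<close> the shrinking gaps lose a factor
  \<open>2^q\<close> per step, while the superlinear power gains \<open>\<mu>^\<kappa>\<close> if
  \<open>a\<close> decays like \<open>\<mu>^(-j)\<close>. The choice
  \<open>\<mu> = 2^(q/\<kappa>)\<close> balances the two, and \<open>d\<close> is the distance for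
  which the remaining factor is exactly \<open>1 / \<mu>\<close>.\<close>

lemma stampacchia_iteration:
  fixes a :: "real \<Rightarrow> real"
  assumes a0: "\<And>h. 0 \<le> a h" and D: "D \<ge> 0" and q: "q > 0" and \<kappa>: "\<kappa> > 0"
    and step: "\<And>s h. k \<le> s \<Longrightarrow> s < h \<Longrightarrow> (h - s) powr q * a h \<le> D powr q * a s powr (1 + \<kappa>)"
    and anti: "\<And>s h. k \<le> s \<Longrightarrow> s \<le> h \<Longrightarrow> a h \<le> a s"
    and d: "d = 2 * D * a k powr (\<kappa> / q) * 2 powr (1 / \<kappa>)" "d > 0"
  shows "a (k + d) = 0"
proof -
  define \<mu> where "\<mu> = 2 powr (q / \<kappa>)"
  have \<mu>: "\<mu> > 1" using q \<kappa> by (simp add: \<mu>_def)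
  define s where "s j = k + d * (1 - (1/2) ^ j)" for j :: nat
  have s0: "k \<le> s j" "s j \<le> k + d" for j
    using d(2) by (auto simp: s_def mult_left_le power_le_one)
  have ds: "s (Suc j) - s j = d / 2 * (1/2) ^ j" for j
    by (simp add: s_def algebra_simps)
  have ak: "a k > 0"
    using d q \<kappa> a0[of k] by (cases "a k = 0") auto
  have D0: "D > 0" using d D by (cases "D = 0") auto
  have dq: "(d / 2) powr q = D powr q * a k powr \<kappa> * \<mu>"
    using D0 q \<kappa> ak by (simp add: d(1) powr_mult powr_powr \<mu>_def)
  have claim: "a (s j) \<le> a k * (1 / \<mu>) ^ j" for j
  proof (induction j)
    case 0
    then show ?case by (simp add: s_def)
  next
    case (Suc j)
    have lt: "s j < s (Suc j)" using ds[of j] d(2) by (smt (verit) divide_pos_pos mult_pos_pos zero_less_power)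
    have half: "((1/2) ^ j) powr q = 2 powr (- (q * real j))"
      by (simp add: powr_minus powr_powr power_one_over powr_divide mult.commute flip: powr_realpow) (simp add: inverse_eq_divide)
    have muk: "((1 / \<mu>) ^ j) powr \<kappa> = 2 powr (- (q * real j))"
    proof -
      have "(1 / \<mu>) ^ j = 2 powr (- (q / \<kappa>) * real j)"
        using powr_realpow[of "1 / \<mu>" j] \<mu> by (simp add: \<mu>_def powr_powr powr_minus divide_inverse flip: powr_minus)
      then show ?thesis using \<kappa> by (simp add: powr_powr)
    qed
    have "(d / 2 * (1/2) ^ j) powr q * a (s (Suc j)) \<le> D powr q * a (s j) powr (1 + \<kappa>)"
      using step[OF s0(1) lt] unfolding ds .
    also have "\<dots> \<le> D powr q * (a k * (1 / \<mu>) ^ j) powr (1 + \<kappa>)"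
      using Suc \<kappa> a0 by (intro mult_left_mono powr_mono2) auto
    also have "\<dots> = D powr q * a k powr \<kappa> * 2 powr (- (q * real j)) * (a k * (1 / \<mu>) ^ j)"
      using ak \<mu> muk by (simp add: powr_add powr_mult)
    also have "\<dots> = (d / 2 * (1/2) ^ j) powr q * (a k * (1 / \<mu>) ^ Suc j)"
    proof -
      have "(d / 2 * (1/2) ^ j) powr q = D powr q * a k powr \<kappa> * \<mu> * 2 powr (- (q * real j))"
        by (simp only: powr_mult dq half)
      then show ?thesis using \<mu> by simp
    qed
    finally show ?case
      using d(2) by (subst (asm) mult_le_cancel_left_pos) auto
  qed
  have "(\<lambda>j. a k * (1 / \<mu>) ^ j) \<longlonglongrightarrow> a k * 0"
    using \<mu> by (intro tendsto_mult tendsto_const LIMSEQ_power_zero) auto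
  moreover have "a (k + d) \<le> a k * (1 / \<mu>) ^ j" for j
    using claim[of j] anti[OF s0(1)[of j] s0(2)[of j]] by linarith
  ultimately have "a (k + d) \<le> 0"
    by (intro LIMSEQ_le_const[of "\<lambda>j. a k * (1 / \<mu>) ^ j" 0]) auto
  then show ?thesis using a0[of "k + d"] by simp
qed

section \<open>Weak solutions\<close>

text \<open>Rounding \<open>y\<close> down to multiples of \<open>1 / (m + 1)\<close> leaves
  countably many values, for each of which \<open>f\<close> is measurable in \<open>x\<close>;
  continuity in the second variable passes to the limit almost everywhere.\<close>

lemma caratheodory_composition_measurable:
  fixes y :: "real^'n::finite \<Rightarrow> real"
  assumes \<Omega>: "\<Omega> \<in> sets lebesgue" and f: "caratheodory \<Omega> f" and y[measurable]: "y \<in> borel_measurable (lebesgue_on \<Omega>)"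
  shows "(\<lambda>x. f x (y x)) \<in> borel_measurable (lebesgue_on \<Omega>)"
proof -
  let ?M = "lebesgue_on \<Omega>"
  define h where "h m x = f x (real_of_int \<lfloor>real (Suc m) * y x\<rfloor> / real (Suc m))" for m x
  have hm[measurable]: "h m \<in> borel_measurable ?M" for m
  proof -
    have "(\<lambda>x. f x (real_of_int i / real (Suc m))) \<in> borel_measurable ?M" for i :: int
      using f by (simp add: caratheodory_def)
    moreover have "(\<lambda>x. \<lfloor>real (Suc m) * y x\<rfloor>) \<in> measurable ?M (count_space UNIV)"
      by measurable
    ultimately show ?thesis
      unfolding h_def by (rule measurable_compose_countable)
  qed
  have ylim: "(\<lambda>m. real_of_int \<lfloor>real (Suc m) * t\<rfloor> / real (Suc m)) \<longlonglongrightarrow> t" for t :: real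
  proof (rule LIM_zero_cancel, rule Lim_null_comparison)
    show "(\<lambda>m. 1 / real (Suc m)) \<longlonglongrightarrow> 0" by (rule LIMSEQ_Suc[OF lim_1_over_n])
    show "\<forall>\<^sub>F m in sequentially. norm (real_of_int \<lfloor>real (Suc m) * t\<rfloor> / real (Suc m) - t) \<le> 1 / real (Suc m)"
    proof (intro always_eventually allI)
      fix m
      have "real_of_int \<lfloor>real (Suc m) * t\<rfloor> / real (Suc m) - t = (real_of_int \<lfloor>real (Suc m) * t\<rfloor> - real (Suc m) * t) / real (Suc m)"
        by (simp add: diff_divide_distrib del: of_nat_Suc)
      moreover have "\<bar>real_of_int \<lfloor>real (Suc m) * t\<rfloor> - real (Suc m) * t\<bar> \<le> 1"
        by linarith
      ultimately show "norm (real_of_int \<lfloor>real (Suc m) * t\<rfloor> / real (Suc m) - t) \<le> 1 / real (Suc m)"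
        by (simp add: abs_divide divide_right_mono del: of_nat_Suc)
    qed
  qed
  have "AE x in ?M. continuous_on UNIV (f x)" using f by (simp add: caratheodory_def)
  then have ae: "AE x in ?M. lim (\<lambda>m. h m x) = f x (y x)"
  proof eventually_elim
    case (elim x)
    have "(\<lambda>m. h m x) \<longlonglongrightarrow> f x (y x)"
      unfolding h_def using elim by (intro isCont_tendsto_compose[OF _ ylim]) (simp add: continuous_on_eq_continuous_at)
    then show ?case by (rule limI)
  qed
  have "(\<lambda>x. lim (\<lambda>m. h m x)) \<in> borel_measurable ?M"
    by (rule borel_measurable_lim_metric) (rule hm)
  from borel_measurable_lebesgue_on_AE[OF \<Omega> this ae] show ?thesis .
qed

text \<open>The energy inequality before the right-hand side is estimated; both uses, through the
  dual norm and through measures of level sets, start from it and need all levels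
  \<open>s \<ge> 0\<close>.\<close>

definition basic_energy ::
  "(real^'n::finite) set \<Rightarrow> real \<Rightarrow> (real^'n \<Rightarrow> real) \<Rightarrow> (real^'n \<Rightarrow> real) \<Rightarrow> (real^'n \<Rightarrow> real) \<Rightarrow> (real^'n \<Rightarrow> real^'n) \<Rightarrow> bool" where
  "basic_energy \<Omega> \<Lambda> \<beta> v w W \<longleftrightarrow> (\<forall>s\<ge>0. \<Lambda> * (pos_norm \<Omega> w W s)\<^sup>2
    \<le> (LINT x|lebesgue_on \<Omega>. \<beta> x * norm (pos_grad w W s x) * max (w x - s) 0)
      + (LINT x|lebesgue_on \<Omega>. v x * max (w x - s) 0))"

text \<open>On \<open>{w > s}\<close>, of measure \<open>a s\<close>, the pairing with
  \<open>v\<close> gains the factor \<open>a(s)^\<sigma>\<close> with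
  \<open>\<sigma> = 1 - 1/p - 1/q\<close>. The band estimate converts this into a gradient bound,
  Sobolev and Chebyshev into a recursion for \<open>a\<close> with exponent
  \<open>\<sigma> q = 1 + \<kappa>\<close>; the assumption \<open>2/q < 1 - 1/p\<close> means
  \<open>\<kappa> > 0\<close>. The constants depend on \<open>v\<close> only through
  \<open>B\<close>.\<close>

theorem supremum_estimate:
  fixes \<beta> :: "real^'n::finite \<Rightarrow> real"
  assumes \<Omega>: "open \<Omega>" "bounded \<Omega>" and S: "sobolev_bound \<Omega> q C" and q: "q > 2" "r = 2 * q / (q - 2)"
    and \<beta>: "\<beta> \<in> borel_measurable (lebesgue_on \<Omega>)" and \<beta>r: "integrable (lebesgue_on \<Omega>) (\<lambda>x. \<bar>\<beta> x\<bar> powr r)"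
    and \<beta>0: "\<And>x. \<beta> x \<ge> 0" and \<Lambda>: "\<Lambda> > 0" and p: "p > 1" "2 / q < 1 - 1 / p"
  shows "\<exists>K>0. \<exists>\<gamma>>0. \<forall>v w W b \<epsilon>. v \<in> borel_measurable (lebesgue_on \<Omega>) \<longrightarrow> integrable (lebesgue_on \<Omega>) (\<lambda>x. \<bar>v x\<bar> powr p) \<longrightarrow>
    Lnorm (lebesgue_on \<Omega>) p v \<le> B \<longrightarrow> H01_grad \<Omega> w W \<longrightarrow> (\<forall>x\<in>\<Omega>. w x \<le> b) \<longrightarrow> basic_energy \<Omega> \<Lambda> \<beta> v w W \<longrightarrow> 0 \<le> \<epsilon> \<longrightarrow>
    (AE x in lebesgue_on \<Omega>. w x \<le> \<epsilon> + K * measure (lebesgue_on \<Omega>) {x\<in>\<Omega>. w x > \<epsilon>} powr \<gamma>)"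
proof -
  let ?M = "lebesgue_on \<Omega>"
  have L\<Omega>: "\<Omega> \<in> lmeasurable" using \<Omega> by (simp add: lmeasurable_open)
  then have \<Omega>s: "\<Omega> \<in> sets lebesgue" by auto
  interpret finite_measure ?M by (rule finite_measure_lebesgue_on[OF L\<Omega>])
  have C0: "C > 0" using S by (simp add: sobolev_bound_def)
  have sq: "integrable ?M (\<lambda>x. \<bar>z x\<bar> powr q)" "Lnorm ?M q z \<le> C * Lnorm ?M 2 (\<lambda>x. norm (Z x))"
    if "H01_grad \<Omega> z Z" for z Z using S that by (auto simp: sobolev_bound_def)
  obtain c where c: "c > 0" and band: "\<And>w W s \<eta> b. H01_grad \<Omega> w W \<Longrightarrow> (\<forall>x\<in>\<Omega>. w x \<le> b) \<Longrightarrow> 0 \<le> s \<Longrightarrow> 0 \<le> \<eta> \<Longrightarrow>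
    (\<forall>t\<ge>s. energy_estimate \<Omega> \<Lambda> \<beta> w W \<eta> t) \<Longrightarrow> pos_norm \<Omega> w W s \<le> c * \<eta>"
    using band_estimate[OF \<Omega> S q \<beta> \<beta>r \<beta>0 \<Lambda>] by blast
  \<comment> \<open>The number \<open>B\<close> is arbitrary; enlarging it makes \<open>D\<close>
    positive.\<close>
  define B' where "B' = \<bar>B\<bar> + 1"
  have B': "B \<le> B'" "B' > 0" by (auto simp: B'_def)
  define \<sigma> where "\<sigma> = 1 - 1 / p - 1 / q"
  define \<kappa> where "\<kappa> = q * (1 - 1 / p) - 2"
  have "1 / q < 2 / q" using q by (simp add: divide_strict_right_mono)
  then have pq: "1 / p + 1 / q < 1" using p by simp
  have "q * (2 / q) < q * (1 - 1 / p)" using p q by (intro mult_strict_left_mono) auto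
  then have \<kappa>: "\<kappa> > 0" "\<sigma> * q = 1 + \<kappa>" using q by (auto simp: \<kappa>_def \<sigma>_def algebra_simps)
  define D where "D = C * c * B' * C"
  have D: "D > 0" using C0 c B' by (simp add: D_def)
  show ?thesis
  proof (intro exI conjI allI impI)
    show "0 < 2 * D * 2 powr (1 / \<kappa>)" "0 < \<kappa> / q" using D \<kappa> q by auto
    fix v w W b \<epsilon>
    assume v: "v \<in> borel_measurable ?M" "integrable ?M (\<lambda>x. \<bar>v x\<bar> powr p)" "Lnorm ?M p v \<le> B"
      and H: "H01_grad \<Omega> w W" and b: "\<forall>x\<in>\<Omega>. w x \<le> b" and E: "basic_energy \<Omega> \<Lambda> \<beta> v w W" and \<epsilon>: "(0::real) \<le> \<epsilon>"
    have L: "L2 ?M w" "L2 ?M W" using H by (auto simp: H01_grad_def)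
    note [measurable] = L[THEN L2_measurable] v(1)
    have sp: "space ?M = \<Omega>" by (simp add: space_restrict_space)
    have As[measurable]: "{x\<in>\<Omega>. w x > s} \<in> sets ?M" for s
    proof -
      have "{x\<in>space ?M. w x > s} \<in> sets ?M" by measurable
      then show ?thesis by (simp add: sp)
    qed
    define a where "a s = measure ?M {x\<in>\<Omega>. w x > s}" for s
    have a0: "0 \<le> a s" for s by (simp add: a_def)
    have anti: "a h \<le> a s" if "s \<le> h" for s h
      unfolding a_def using that by (intro finite_measure_mono) auto
    have Hp: "H01_grad \<Omega> (\<lambda>x. max (w x - s) 0) (pos_grad w W s)" if "0 \<le> s" for s
      by (rule H01_grad_pos_part[OF \<Omega>s H that])
    have X: "pos_norm \<Omega> w W s \<le> c * (B' * C * a s powr \<sigma>)" if s: "0 \<le> s" for s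
    proof (rule band[OF H b s])
      show "0 \<le> B' * C * a s powr \<sigma>" using B' C0 by simp
      \<comment> \<open>The band estimate wants one \<open>\<eta>\<close> for all levels above
        \<open>s\<close>; the truncation at \<open>t\<close> is supported in \<open>{w > s}\<close>,
        so the measure of that set serves for every \<open>t\<close>.\<close>
      show "\<forall>t\<ge>s. energy_estimate \<Omega> \<Lambda> \<beta> w W (B' * C * a s powr \<sigma>) t"
      proof (intro allI impI)
        fix t assume t: "s \<le> t"
        then have t0: "0 \<le> t" using s by simp
        let ?z = "\<lambda>x. max (w x - t) 0"
        have "(LINT x|?M. v x * ?z x) \<le> (LINT x|?M. \<bar>v x * ?z x\<bar>)"
          by (rule order_trans[OF abs_ge_self integral_abs_bound])
        also have "\<dots> = (LINT x|?M. \<bar>v x * (?z x * indicator {x\<in>\<Omega>. w x > s} x)\<bar>)"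
          using t by (intro Bochner_Integration.integral_cong) (auto simp: indicator_def sp max_def)
        also have "\<dots> \<le> Lnorm ?M p v * (measure ?M {x\<in>\<Omega>. w x > s} powr (1 - 1 / p - 1 / q) * Lnorm ?M q ?z)"
          by (rule pairing_bound[OF v(1) _ As v(2) sq(1)[OF Hp[OF t0]] p(1) _ pq]) (use q in auto)
        also have "\<dots> \<le> B' * (a s powr \<sigma> * (C * pos_norm \<Omega> w W t))"
          unfolding a_def[symmetric] \<sigma>_def[symmetric]
          using v(3) B' by (intro mult_mono mult_left_mono sq(2)[OF Hp[OF t0]]) auto
        finally have "(LINT x|?M. v x * ?z x) \<le> B' * C * a s powr \<sigma> * pos_norm \<Omega> w W t"
          by (simp add: mult_ac)
        then show "energy_estimate \<Omega> \<Lambda> \<beta> w W (B' * C * a s powr \<sigma>) t"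
          using E t0 unfolding energy_estimate_def basic_energy_def by force
      qed
    qed
    have step: "(h - s) powr q * a h \<le> D powr q * a s powr (1 + \<kappa>)" if s: "\<epsilon> \<le> s" and h: "s < h" for s h
    proof -
      have s0: "0 \<le> s" using s \<epsilon> by simp
      let ?z = "\<lambda>x. max (w x - s) 0"
      have "(h - s) powr q * a h = (LINT x|?M. (h - s) powr q * indicator {x\<in>\<Omega>. w x > h} x)"
      proof -
        have "{x\<in>\<Omega>. w x > h} \<inter> \<Omega> = {x\<in>\<Omega>. w x > h}" by blast
        then show ?thesis by (simp add: a_def sp)
      qed
      also have "\<dots> \<le> (LINT x|?M. \<bar>?z x\<bar> powr q)"
      proof (rule integral_mono)
        show "(h - s) powr q * indicator {x\<in>\<Omega>. w x > h} x \<le> \<bar>?z x\<bar> powr q" for x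
          using h q by (auto simp: indicator_def intro!: powr_mono2)
        show "integrable ?M (\<lambda>x. (h - s) powr q * indicat_real {x\<in>\<Omega>. w x > h} x)"
          using As[of h] by (intro integrable_mult_right) (auto simp: less_top[symmetric])
      qed (rule sq(1)[OF Hp[OF s0]])
      also have "\<dots> = Lnorm ?M q ?z powr q" using q by (intro Lnorm_powr[symmetric]) auto
      also have "\<dots> \<le> (C * pos_norm \<Omega> w W s) powr q"
        using q by (intro powr_mono2 sq(2)[OF Hp[OF s0]]) auto
      also have "\<dots> \<le> (C * (c * (B' * C * a s powr \<sigma>))) powr q"
        using q C0 by (intro powr_mono2 mult_left_mono X[OF s0]) auto
      also have "\<dots> = (D * a s powr \<sigma>) powr q" by (simp add: D_def mult_ac)
      also have "\<dots> = D powr q * a s powr (1 + \<kappa>)"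
        by (simp add: powr_mult powr_powr \<kappa>(2))
      finally show ?thesis .
    qed
    have conclude: "AE x in ?M. w x \<le> t" if "a t = 0" for t
    proof -
      have "{x\<in>space ?M. \<not> w x \<le> t} \<in> null_sets ?M"
        using that As[of t] by (simp add: null_sets_def sp not_le a_def emeasure_eq_measure)
      then show ?thesis by (rule AE_I') (auto simp: sp)
    qed
    let ?d = "2 * D * a \<epsilon> powr (\<kappa> / q) * 2 powr (1 / \<kappa>)"
    have d: "?d = 2 * D * 2 powr (1 / \<kappa>) * a \<epsilon> powr (\<kappa> / q)" by simp
    have "a (\<epsilon> + ?d) = 0"
    \<comment> \<open>The iteration requires a positive distance; if
      \<open>a \<epsilon> = 0\<close>, then \<open>?d = 0\<close> and nothing remains to be
      shown.\<close>
    proof (cases "a \<epsilon> = 0")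
      case False
      then have "?d > 0" using D a0[of \<epsilon>] by simp
      then show ?thesis
        using D q \<kappa> a0 step anti by (intro stampacchia_iteration[where D = D and \<kappa> = \<kappa> and q = q]) auto
    qed (use \<kappa> q in simp)
    from conclude[OF this] show "AE x in ?M. w x \<le> \<epsilon> + 2 * D * 2 powr (1 / \<kappa>) * measure ?M {x\<in>\<Omega>. w x > \<epsilon>} powr (\<kappa> / q)"
      unfolding d by (simp add: a_def)
  qed
qed

section \<open>The energy inequality for the difference of two solutions\<close>

lemma Linf_mult_integrable:
  fixes g :: "real^'n::finite \<Rightarrow> real"
  assumes "Linf \<Omega> a" "integrable (lebesgue_on \<Omega>) g"
  shows "integrable (lebesgue_on \<Omega>) (\<lambda>x. a x * g x)"
proof -
  obtain K where K: "AE x in lebesgue_on \<Omega>. \<bar>a x\<bar> \<le> K" and m: "a \<in> borel_measurable (lebesgue_on \<Omega>)"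
    using assms(1) by (auto simp: Linf_def)
  show ?thesis
  proof (rule Bochner_Integration.integrable_bound)
    show "integrable (lebesgue_on \<Omega>) (\<lambda>x. K * g x)" using assms(2) by simp
    show "AE x in lebesgue_on \<Omega>. norm (a x * g x) \<le> norm (K * g x)"
      using K by eventually_elim (auto simp: abs_mult intro!: mult_right_mono)
  qed (use m assms(2) in auto)
qed

text \<open>Both equations are tested with the truncation of \<open>y1 - y2\<close>. Where it is
  positive, \<open>y1 > y2\<close> because \<open>s \<ge> 0\<close>, and monotonicity gives the
  nonlinear term a sign; elsewhere the test function and its gradient vanish. The equations can be
  subtracted only after each term is known to be integrable, and boundedness of the solutions is
  what makes the growth condition on \<open>f\<close> applicable.\<close>

theorem solution_difference_energy:
  fixes a :: "'n::finite \<Rightarrow> 'n \<Rightarrow> real^'n \<Rightarrow> real" and b :: "real^'n \<Rightarrow> real^'n"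
  assumes \<Omega>: "open \<Omega>" "bounded \<Omega>" and S: "sobolev_bound \<Omega> q C" and q: "q > 2" "r = 2 * q / (q - 2)"
    and a: "\<And>i j. Linf \<Omega> (a i j)"
    and ellip: "AE x in lebesgue_on \<Omega>. \<forall>\<xi>::real^'n. (\<Sum>i\<in>UNIV. \<Sum>j\<in>UNIV. a i j x * \<xi> $ i * \<xi> $ j) \<ge> \<Lambda> * (norm \<xi>)^2"
    and bm: "b \<in> borel_measurable (lebesgue_on \<Omega>)" and br: "integrable (lebesgue_on \<Omega>) (\<lambda>x. \<bar>norm (b x)\<bar> powr r)"
    and p: "p > 1" "1 / p + 1 / q < 1"
    and f: "caratheodory \<Omega> f" "AE x in lebesgue_on \<Omega>. mono (f x)"
      "\<And>M. M > 0 \<Longrightarrow> \<exists>\<phi>. Lp \<Omega> p \<phi> \<and> (AE x in lebesgue_on \<Omega>. \<forall>s. \<bar>s\<bar> \<le> M \<longrightarrow> \<bar>f x s\<bar> \<le> \<phi> x)"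
    and v: "Lp \<Omega> p v1" "Lp \<Omega> p v2"
    and y1: "H01_grad \<Omega> y1 G1" "\<forall>x\<in>\<Omega>. \<bar>y1 x\<bar> \<le> K1" and y2: "H01_grad \<Omega> y2 G2" "\<forall>x\<in>\<Omega>. \<bar>y2 x\<bar> \<le> K2"
    and s1: "\<And>z Z. H01_grad \<Omega> z Z \<Longrightarrow>
      (LINT x|lebesgue_on \<Omega>. (\<Sum>i\<in>UNIV. \<Sum>j\<in>UNIV. a i j x * G1 x $ i * Z x $ j) + (b x \<bullet> G1 x) * z x + f x (y1 x) * z x)
      = (LINT x|lebesgue_on \<Omega>. v1 x * z x)"
    and s2: "\<And>z Z. H01_grad \<Omega> z Z \<Longrightarrow>
      (LINT x|lebesgue_on \<Omega>. (\<Sum>i\<in>UNIV. \<Sum>j\<in>UNIV. a i j x * G2 x $ i * Z x $ j) + (b x \<bullet> G2 x) * z x + f x (y2 x) * z x)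
      = (LINT x|lebesgue_on \<Omega>. v2 x * z x)"
  shows "basic_energy \<Omega> \<Lambda> (\<lambda>x. norm (b x)) (\<lambda>x. v1 x - v2 x) (\<lambda>x. y1 x - y2 x) (\<lambda>x. G1 x - G2 x)"
  unfolding basic_energy_def
proof (intro allI impI)
  fix s :: real assume s: "0 \<le> s"
  let ?M = "lebesgue_on \<Omega>"
  have L\<Omega>: "\<Omega> \<in> lmeasurable" using \<Omega> by (simp add: lmeasurable_open)
  then have \<Omega>s: "\<Omega> \<in> sets lebesgue" by auto
  interpret finite_measure ?M by (rule finite_measure_lebesgue_on[OF L\<Omega>])
  have \<Omega>m: "\<Omega> \<in> sets ?M" using \<Omega>s by (simp add: sets_restrict_space_iff)
  have AE\<Omega>: "AE x in ?M. x \<in> \<Omega>" by (rule AE_I2) (simp add: space_restrict_space)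
  define w where "w x = y1 x - y2 x" for x
  define W where "W x = G1 x - G2 x" for x
  define z where "z x = max (w x - s) 0" for x
  define Z where "Z = pos_grad w W s"
  have Hw: "H01_grad \<Omega> w W"
    unfolding w_def[abs_def] W_def[abs_def] by (rule H01_grad_diff[OF \<Omega>s y1(1) y2(1)])
  have Hz: "H01_grad \<Omega> z Z"
    unfolding z_def[abs_def] Z_def by (rule H01_grad_pos_part[OF \<Omega>s Hw s])
  have L: "L2 ?M z" "L2 ?M Z" "L2 ?M G1" "L2 ?M G2" "L2 ?M y1" "L2 ?M y2"
    using Hz y1 y2 by (auto simp: H01_grad_def)
  note [measurable] = L[THEN L2_measurable] bm
  have zq: "integrable ?M (\<lambda>x. \<bar>z x\<bar> powr q)" using S Hz by (auto simp: sobolev_bound_def)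
  have vm[measurable]: "v1 \<in> borel_measurable ?M" "v2 \<in> borel_measurable ?M"
    and vp: "integrable ?M (\<lambda>x. \<bar>v1 x\<bar> powr p)" "integrable ?M (\<lambda>x. \<bar>v2 x\<bar> powr p)"
    using v by (auto simp: Lp_def)
  have q0: "q > 0" using q by simp
  have vz: "integrable ?M (\<lambda>x. v1 x * z x)" "integrable ?M (\<lambda>x. v2 x * z x)"
    using pairing_integrable[OF vm(1) L2_measurable[OF L(1)] \<Omega>m vp(1) zq p(1) q0 p(2)]
      pairing_integrable[OF vm(2) L2_measurable[OF L(1)] \<Omega>m vp(2) zq p(1) q0 p(2)] by auto
  have Aint: "integrable ?M (\<lambda>x. \<Sum>i\<in>UNIV. \<Sum>j\<in>UNIV. a i j x * G x $ i * Z x $ j)" if "L2 ?M G" for G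
  proof (intro Bochner_Integration.integrable_sum)
    fix i j
    have "integrable ?M (\<lambda>x. a i j x * (G x $ i * Z x $ j))"
      by (intro Linf_mult_integrable a L2_mult_integrable L2_nth that L(2))
    then show "integrable ?M (\<lambda>x. a i j x * G x $ i * Z x $ j)" by (simp add: mult.assoc)
  qed
  have bg: "integrable ?M (\<lambda>x. norm (b x) * norm (G x) * z x)" if "L2 ?M G" for G
    by (rule triple_Hoelder_integrable[OF q _ _ br L2_norm[OF that] zq]) measurable
  have Bint: "integrable ?M (\<lambda>x. (b x \<bullet> G x) * z x)" if "L2 ?M G" for G
  proof (rule Bochner_Integration.integrable_bound[OF bg[OF that]])
    note [measurable] = L2_measurable[OF that]
    show "(\<lambda>x. (b x \<bullet> G x) * z x) \<in> borel_measurable ?M" by measurable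
    show "AE x in ?M. norm ((b x \<bullet> G x) * z x) \<le> norm (norm (b x) * norm (G x) * z x)"
      by (intro AE_I2) (auto simp: abs_mult intro!: mult_right_mono Cauchy_Schwarz_ineq2)
  qed
  have Fint: "integrable ?M (\<lambda>x. f x (y x) * z x)" if ym: "y \<in> borel_measurable ?M" and K: "\<forall>x\<in>\<Omega>. \<bar>y x\<bar> \<le> K" for y K
  proof -
    \<comment> \<open>The growth condition on \<open>f\<close> is available for positive bounds,
      whereas \<open>K\<close> need not be positive.\<close>
    have "0 < max K 1" by (simp add: less_max_iff_disj)
    from f(3)[OF this] obtain \<phi> where \<phi>: "Lp \<Omega> p \<phi>" "AE x in ?M. \<forall>s. \<bar>s\<bar> \<le> max K 1 \<longrightarrow> \<bar>f x s\<bar> \<le> \<phi> x"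
      by blast
    have "integrable ?M (\<lambda>x. \<phi> x * z x)"
      by (rule pairing_integrable[OF _ _ \<Omega>m _ zq p(1) q0 p(2)]) (use \<phi> in \<open>auto simp: Lp_def\<close>)
    then show ?thesis
    proof (rule Bochner_Integration.integrable_bound)
      show "(\<lambda>x. f x (y x) * z x) \<in> borel_measurable ?M"
        by (intro borel_measurable_times caratheodory_composition_measurable[OF \<Omega>s f(1) ym]) measurable
      show "AE x in ?M. norm (f x (y x) * z x) \<le> norm (\<phi> x * z x)"
        using \<phi>(2) AE\<Omega>
      proof eventually_elim
        case (elim x)
        then have "\<bar>f x (y x)\<bar> \<le> \<phi> x" using K by (auto simp: max_def split: if_splits)
        then show ?case by (auto simp: abs_mult intro!: mult_right_mono)
      qed
    qed
  qed
  have F1: "integrable ?M (\<lambda>x. f x (y1 x) * z x)" and F2: "integrable ?M (\<lambda>x. f x (y2 x) * z x)"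
    using Fint[OF L2_measurable[OF L(5)] y1(2)] Fint[OF L2_measurable[OF L(6)] y2(2)] by auto
  let ?I1 = "\<lambda>x. (\<Sum>i\<in>UNIV. \<Sum>j\<in>UNIV. a i j x * G1 x $ i * Z x $ j) + (b x \<bullet> G1 x) * z x + f x (y1 x) * z x"
  let ?I2 = "\<lambda>x. (\<Sum>i\<in>UNIV. \<Sum>j\<in>UNIV. a i j x * G2 x $ i * Z x $ j) + (b x \<bullet> G2 x) * z x + f x (y2 x) * z x"
  have I1: "integrable ?M ?I1" and I2: "integrable ?M ?I2"
    using Aint Bint F1 F2 L by (auto intro!: Bochner_Integration.integrable_add)
  have "(LINT x|?M. \<Lambda> * (norm (Z x))\<^sup>2 - norm (b x) * norm (Z x) * z x) \<le> (LINT x|?M. ?I1 x - ?I2 x)"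
  proof (rule integral_mono_AE)
    show "integrable ?M (\<lambda>x. \<Lambda> * (norm (Z x))\<^sup>2 - norm (b x) * norm (Z x) * z x)"
      using L2_norm_integrable[OF L(2)] bg[OF L(2)] by auto
    show "integrable ?M (\<lambda>x. ?I1 x - ?I2 x)" using I1 I2 by (rule Bochner_Integration.integrable_diff)
    show "AE x in ?M. \<Lambda> * (norm (Z x))\<^sup>2 - norm (b x) * norm (Z x) * z x \<le> ?I1 x - ?I2 x"
      using ellip f(2)
    proof eventually_elim
      case (elim x)
      have "?I1 x - ?I2 x = (\<Sum>i\<in>UNIV. \<Sum>j\<in>UNIV. a i j x * W x $ i * Z x $ j) + (b x \<bullet> W x) * z x + (f x (y1 x) - f x (y2 x)) * z x"
        by (simp add: W_def inner_diff_right algebra_simps sum_subtractf)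
      \<comment> \<open>The form pairs \<open>W\<close> with \<open>Z\<close>. They coincide on
        \<open>{w > s}\<close>, where ellipticity applies; elsewhere \<open>Z = 0\<close> and both
        sides are zero.\<close>
      moreover have "(\<Sum>i\<in>UNIV. \<Sum>j\<in>UNIV. a i j x * W x $ i * Z x $ j) \<ge> \<Lambda> * (norm (Z x))\<^sup>2"
      proof (cases "w x > s")
        case True
        then show ?thesis using elim(1) by (simp add: Z_def)
      qed (simp add: Z_def)
      moreover have "(b x \<bullet> W x) * z x \<ge> - (norm (b x) * norm (Z x) * z x)"
      proof (cases "w x > s")
        case True
        then have zw: "Z x = W x" "z x \<ge> 0" by (auto simp: Z_def z_def)
        have "- (norm (b x) * norm (W x)) \<le> b x \<bullet> W x"
          using Cauchy_Schwarz_ineq2[of "b x" "W x"] by linarith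
        from mult_right_mono[OF this zw(2)] show ?thesis by (simp add: zw(1))
      qed (simp add: z_def)
      moreover have "(f x (y1 x) - f x (y2 x)) * z x \<ge> 0"
      proof (cases "w x > s")
        case True
        then have "f x (y2 x) \<le> f x (y1 x)" using elim(2) s by (auto simp: w_def mono_def)
        then show ?thesis by (simp add: z_def)
      qed (simp add: z_def)
      ultimately show ?case by linarith
    qed
  qed
  also have "\<dots> = (LINT x|?M. ?I1 x) - (LINT x|?M. ?I2 x)"
    by (rule Bochner_Integration.integral_diff[OF I1 I2])
  also have "\<dots> = (LINT x|?M. v1 x * z x) - (LINT x|?M. v2 x * z x)"
    by (simp only: s1[OF Hz] s2[OF Hz])
  also have "\<dots> = (LINT x|?M. (v1 x - v2 x) * z x)"
    unfolding left_diff_distrib by (rule Bochner_Integration.integral_diff[OF vz, symmetric])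
  finally have "\<Lambda> * (LINT x|?M. (norm (Z x))\<^sup>2) \<le> (LINT x|?M. norm (b x) * norm (Z x) * z x) + (LINT x|?M. (v1 x - v2 x) * z x)"
    using L2_norm_integrable[OF L(2)] bg[OF L(2)] by simp
  moreover have "(Lnorm ?M 2 (\<lambda>x. norm (Z x)))\<^sup>2 = (LINT x|?M. (norm (Z x))\<^sup>2)"
    by (simp add: Lnorm_2)
  ultimately show "\<Lambda> * (pos_norm \<Omega> (\<lambda>x. y1 x - y2 x) (\<lambda>x. G1 x - G2 x) s)\<^sup>2
      \<le> (LINT x|?M. norm (b x) * norm (pos_grad (\<lambda>x. y1 x - y2 x) (\<lambda>x. G1 x - G2 x) s x) * max (y1 x - y2 x - s) 0)
        + (LINT x|?M. (v1 x - v2 x) * max (y1 x - y2 x - s) 0)"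
    unfolding Z_def z_def w_def W_def by simp
qed

section \<open>Convergence of the solutions\<close>

lemma H01_grad_0: "\<Omega> \<in> sets lebesgue \<Longrightarrow> H01_grad \<Omega> (\<lambda>x. 0) (\<lambda>x. 0)"
proof -
  assume \<Omega>: "\<Omega> \<in> sets lebesgue"
  have "(\<lambda>x. 0) \<in> test_fun \<Omega>"
    by (rule test_funI[of _ "{}"]) (auto intro: smooth_fun_const)
  from test_fun_H01_grad[OF this \<Omega>] show ?thesis by (simp add: grad_def[abs_def] zero_vec_def)
qed

lemma H01_grad_uminus:
  assumes "\<Omega> \<in> sets lebesgue" "H01_grad \<Omega> w W"
  shows "H01_grad \<Omega> (\<lambda>x. - w x) (\<lambda>x. - W x)"
  using H01_grad_diff[OF assms(1) H01_grad_0[OF assms(1)] assms(2)] by simp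

text \<open>Writing \<open>w\<close> as the difference of the positive parts of \<open>w\<close> and
  \<open>- w\<close> produces a second gradient, which is zero wherever \<open>w\<close> is;
  uniqueness identifies it with \<open>W\<close>. This supplies the level missing from
  \<open>H01_grad_level_set\<close>.\<close>

lemma H01_grad_zero_set:
  assumes \<Omega>: "open \<Omega>" and H: "H01_grad \<Omega> w W"
  shows "AE x in lebesgue_on \<Omega>. w x = 0 \<longrightarrow> W x = 0"
proof -
  have \<Omega>s: "\<Omega> \<in> sets lebesgue" using \<Omega> by auto
  have "H01_grad \<Omega> (\<lambda>x. max (w x - 0) 0 - max (- w x - 0) 0) (\<lambda>x. pos_grad w W 0 x - pos_grad (\<lambda>x. - w x) (\<lambda>x. - W x) 0 x)"
    by (intro H01_grad_diff H01_grad_pos_part \<Omega>s H H01_grad_uminus) auto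
  also have "(\<lambda>x. max (w x - 0) 0 - max (- w x - 0) 0) = w" by (auto simp: fun_eq_iff max_def)
  finally have "AE x in lebesgue_on \<Omega>. pos_grad w W 0 x - pos_grad (\<lambda>x. - w x) (\<lambda>x. - W x) 0 x = W x"
    using weak_grad_unique[OF \<Omega> H01_grad_weak_grad[OF \<Omega>] H01_grad_weak_grad[OF \<Omega> H]] by blast
  then show ?thesis by eventually_elim auto
qed

text \<open>The energy bounds control one sign of \<open>w\<close> at a time; the two signs together
  recover the full gradient norm because the zero set contributes nothing.\<close>

lemma gradient_norm_split:
  assumes \<Omega>: "open \<Omega>" and H: "H01_grad \<Omega> w W"
  shows "(LINT x|lebesgue_on \<Omega>. (norm (W x))\<^sup>2)
    = (pos_norm \<Omega> w W 0)\<^sup>2 + (pos_norm \<Omega> (\<lambda>x. - w x) (\<lambda>x. - W x) 0)\<^sup>2"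
proof -
  let ?M = "lebesgue_on \<Omega>"
  have \<Omega>s: "\<Omega> \<in> sets lebesgue" using \<Omega> by auto
  have L: "L2 ?M (pos_grad w W 0)" "L2 ?M (pos_grad (\<lambda>x. - w x) (\<lambda>x. - W x) 0)"
    using H01_grad_pos_part[OF \<Omega>s H, of 0] H01_grad_pos_part[OF \<Omega>s H01_grad_uminus[OF \<Omega>s H], of 0]
    by (auto simp: H01_grad_def)
  have LW: "L2 ?M W" using H by (auto simp: H01_grad_def)
  have "(LINT x|?M. (norm (W x))\<^sup>2)
      = (LINT x|?M. (norm (pos_grad w W 0 x))\<^sup>2 + (norm (pos_grad (\<lambda>x. - w x) (\<lambda>x. - W x) 0 x))\<^sup>2)"
  proof (rule integral_cong_AE)
    show "AE x in ?M. (norm (W x))\<^sup>2 = (norm (pos_grad w W 0 x))\<^sup>2 + (norm (pos_grad (\<lambda>x. - w x) (\<lambda>x. - W x) 0 x))\<^sup>2"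
      using H01_grad_zero_set[OF \<Omega> H]
    proof eventually_elim
      case (elim x)
      then show ?case by (cases "w x" "0::real" rule: linorder_cases) auto
    qed
    show "(\<lambda>x. (norm (W x))\<^sup>2) \<in> borel_measurable ?M"
      using L2_measurable[OF LW] by measurable
    show "(\<lambda>x. (norm (pos_grad w W 0 x))\<^sup>2 + (norm (pos_grad (\<lambda>x. - w x) (\<lambda>x. - W x) 0 x))\<^sup>2) \<in> borel_measurable ?M"
      using borel_measurable_integrable[OF L2_norm_integrable[OF L(1)]]
        borel_measurable_integrable[OF L2_norm_integrable[OF L(2)]]
      by (rule borel_measurable_add)
  qed
  also have "\<dots> = (LINT x|?M. (norm (pos_grad w W 0 x))\<^sup>2) + (LINT x|?M. (norm (pos_grad (\<lambda>x. - w x) (\<lambda>x. - W x) 0 x))\<^sup>2)"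
    by (rule Bochner_Integration.integral_add[OF L2_norm_integrable[OF L(1)] L2_norm_integrable[OF L(2)]])
  finally show ?thesis by (simp add: Lnorm_2)
qed

text \<open>With \<open>q = 2 m\<close>, the condition \<open>r \<le> p\<close> reads
  \<open>p \<le> m (p - 2)\<close> and \<open>2/q < 1 - 1/pbar\<close> reads
  \<open>1 < m (1 - 1/pbar)\<close>. In dimension three, \<open>m = 3\<close> gives
  \<open>q = 6\<close> and \<open>r = 3\<close>, and the two conditions are precisely
  \<open>p \<ge> 3\<close> and \<open>pbar > 3/2\<close>; in dimension two any sufficiently large
  \<open>m\<close> will do.\<close>

lemma exponent_choice:
  fixes p pbar :: real
  assumes dim: "n = 2 \<or> n = 3"
    and p: "n = 3 \<longrightarrow> p \<ge> 3" "n = 2 \<longrightarrow> p > 2" and pbar: "pbar > real n / 2"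
  obtains m :: nat and q r where "m > 0" "n = 2 \<or> n = 3 \<and> m = 3" "q = real (2 * m)" "q > 2"
    "r = 2 * q / (q - 2)" "r > 2" "r \<le> p" "pbar > 1" "2 / q < 1 - 1 / pbar" "1 / pbar + 1 / q < 1"
proof -
  have pb: "pbar > 1" using dim pbar by auto
  note choose = that
  have fin: thesis
    if m: "m > 1" "n = 2 \<or> n = 3 \<and> m = 3" "p \<le> real m * (p - 2)" "1 < real m * (1 - 1 / pbar)" for m :: nat
  proof -
    define q where "q = real (2 * m)"
    have q: "q > 2" using m(1) by (simp add: q_def)
    have "2 * q \<le> p * (q - 2)" using m(3) by (simp add: q_def algebra_simps)
    then have r: "2 * q / (q - 2) > 2" "2 * q / (q - 2) \<le> p"
      using q by (auto simp: field_simps)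
    have b: "2 / q < 1 - 1 / pbar"
      using m(1,4) by (simp add: q_def field_simps)
    moreover have "1 / q < 2 / q" using q by (simp add: divide_strict_right_mono)
    ultimately have "1 / pbar + 1 / q < 1" by linarith
    then show thesis
      using choose[OF _ m(2) q_def q refl r pb b] m(1) by simp
  qed
  show thesis
  proof (cases "n = 3")
    case True
    then have "p \<ge> 3" "pbar > 3 / 2" using p pbar by auto
    then show thesis using True by (intro fin[of 3]) (auto simp: field_simps)
  next
    case False
    then have n2: "n = 2" "p > 2" using dim p by auto
    have pos: "1 - 1 / pbar > 0" using pb by simp
    \<comment> \<open>The sum of the two positive lower bounds dominates each of them, and the extra
      \<open>1\<close> gives \<open>m > 1\<close>.\<close>
    obtain m :: nat where m: "p / (p - 2) + 1 / (1 - 1 / pbar) + 1 < real m"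
      using reals_Archimedean2 by blast
    have nn: "p / (p - 2) > 0" "1 / (1 - 1 / pbar) > 0" using n2 pos by (auto intro: divide_pos_pos)
    have 1: "m > 1" using m nn by (smt (verit) of_nat_1 of_nat_less_iff)
    have "p / (p - 2) \<le> real m" using m nn by linarith
    then have 2: "p \<le> real m * (p - 2)" using n2 by (simp add: pos_divide_le_eq)
    have "1 / (1 - 1 / pbar) < real m" using m nn by linarith
    then have 3: "1 < real m * (1 - 1 / pbar)" using pos by (simp only: pos_divide_less_eq)
    show thesis using fin[OF 1 _ 2 3] n2(1) by simp
  qed
qed

lemma Lp_diff:
  assumes p: "p > 0" and u: "Lp \<Omega> p u" and v: "Lp \<Omega> p v"
  shows "Lp \<Omega> p (\<lambda>x. u x - v x)"
  unfolding Lp_def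
proof
  show m: "(\<lambda>x. u x - v x) \<in> borel_measurable (lebesgue_on \<Omega>)"
    using u v by (auto simp: Lp_def)
  show "integrable (lebesgue_on \<Omega>) (\<lambda>x. \<bar>u x - v x\<bar> powr p)"
  proof (rule Bochner_Integration.integrable_bound)
    show "integrable (lebesgue_on \<Omega>) (\<lambda>x. 2 powr p * (\<bar>u x\<bar> powr p + \<bar>v x\<bar> powr p))"
      using u v by (auto simp: Lp_def)
    show "AE x in lebesgue_on \<Omega>. norm (\<bar>u x - v x\<bar> powr p) \<le> norm (2 powr p * (\<bar>u x\<bar> powr p + \<bar>v x\<bar> powr p))"
      using powr_diff_le[of p] p by (intro AE_I2) (auto intro: order_trans[OF _ abs_ge_self])
    show "(\<lambda>x. \<bar>u x - v x\<bar> powr p) \<in> borel_measurable (lebesgue_on \<Omega>)"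
      using m by measurable
  qed
qed

text \<open>The norm is at most \<open>CARD('n)\<close> times its largest component, whose power is
  one term of the sum of powers. Lowering the exponent from \<open>p\<close> to \<open>r\<close>
  uses the finite measure of the domain.\<close>

lemma norm_powr_integrable:
  fixes b :: "real^'n::finite \<Rightarrow> real^'n"
  assumes \<Omega>: "\<Omega> \<in> lmeasurable" and b: "\<forall>i. Lp \<Omega> p (\<lambda>x. b x $ i)" and r: "0 < r" "r \<le> p"
  shows "b \<in> borel_measurable (lebesgue_on \<Omega>)"
    and "integrable (lebesgue_on \<Omega>) (\<lambda>x. \<bar>norm (b x)\<bar> powr r)"
proof -
  let ?M = "lebesgue_on \<Omega>"
  interpret finite_measure ?M by (rule finite_measure_lebesgue_on[OF \<Omega>])
  have bi: "(\<lambda>x. b x $ i) \<in> borel_measurable ?M" "integrable ?M (\<lambda>x. \<bar>b x $ i\<bar> powr p)" for i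
    using b by (auto simp: Lp_def)
  show bm: "b \<in> borel_measurable ?M"
    using bi by (subst borel_measurable_euclidean_space) (auto simp: Basis_vec_def inner_axis)
  have bri: "integrable ?M (\<lambda>x. \<bar>b x $ i\<bar> powr r)" for i
    by (rule Lp_nested[OF bi]) (use r in auto)
  show "integrable ?M (\<lambda>x. \<bar>norm (b x)\<bar> powr r)"
  proof (rule Bochner_Integration.integrable_bound)
    show "integrable ?M (\<lambda>x. real CARD('n) powr r * (\<Sum>i\<in>UNIV. \<bar>b x $ i\<bar> powr r))"
      using bri by auto
    show "AE x in ?M. norm (\<bar>norm (b x)\<bar> powr r) \<le> norm (real CARD('n) powr r * (\<Sum>i\<in>UNIV. \<bar>b x $ i\<bar> powr r))"
    proof (rule AE_I2)
      fix x
      have "Max (range (\<lambda>i. \<bar>b x $ i\<bar>)) \<in> range (\<lambda>i. \<bar>b x $ i\<bar>)" by (rule Max_in) auto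
      then obtain k where km: "Max (range (\<lambda>i. \<bar>b x $ i\<bar>)) = \<bar>b x $ k\<bar>" by blast
      have k: "\<bar>b x $ i\<bar> \<le> \<bar>b x $ k\<bar>" for i
        unfolding km[symmetric] by (rule Max_ge) auto
      have "norm (b x) \<le> (\<Sum>i\<in>UNIV. \<bar>b x $ i\<bar>)" by (rule norm_le_l1_cart)
      also have "\<dots> \<le> real CARD('n) * \<bar>b x $ k\<bar>" using k by (intro sum_bounded_above) auto
      finally have "norm (b x) powr r \<le> (real CARD('n) * \<bar>b x $ k\<bar>) powr r"
        using r by (intro powr_mono2) auto
      also have "\<dots> = real CARD('n) powr r * \<bar>b x $ k\<bar> powr r" by (rule powr_mult)
      also have "\<bar>b x $ k\<bar> powr r \<le> (\<Sum>i\<in>UNIV. \<bar>b x $ i\<bar> powr r)"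
        by (rule member_le_sum) auto
      finally show "norm (\<bar>norm (b x)\<bar> powr r) \<le> norm (real CARD('n) powr r * (\<Sum>i\<in>UNIV. \<bar>b x $ i\<bar> powr r))"
        by (simp add: mult_left_mono sum_nonneg abs_mult)
    qed
    show "(\<lambda>x. \<bar>norm (b x)\<bar> powr r) \<in> borel_measurable ?M" using bm by measurable
  qed
qed

text \<open>Truncations of \<open>w\<close> have zero trace themselves, so the dual bound applies to
  them at every level with the same \<open>e\<close>.\<close>

lemma basic_energy_dual:
  assumes "\<Omega> \<in> sets lebesgue" "H01_grad \<Omega> w W" "basic_energy \<Omega> \<Lambda> \<beta> v w W"
    and dual: "\<And>z Z. H01_grad \<Omega> z Z \<Longrightarrow> \<bar>LINT x|lebesgue_on \<Omega>. v x * z x\<bar> \<le> e * Lnorm (lebesgue_on \<Omega>) 2 (\<lambda>x. norm (Z x))"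
    and t: "0 \<le> t"
  shows "energy_estimate \<Omega> \<Lambda> \<beta> w W e t"
proof -
  have "\<bar>LINT x|lebesgue_on \<Omega>. v x * max (w x - t) 0\<bar> \<le> e * pos_norm \<Omega> w W t"
    by (rule dual[OF H01_grad_pos_part[OF assms(1,2) t]])
  then show ?thesis
    using assms(3) t unfolding basic_energy_def energy_estimate_def by force
qed

text \<open>The exceptional set inside \<open>\<Omega>\<close> is open by continuity and null, hence
  empty; continuity then extends the inequality to the closure. This turns essential bounds into
  uniform ones.\<close>

lemma AE_le_imp_le_closure:
  fixes w :: "'a::euclidean_space \<Rightarrow> real"
  assumes \<Omega>: "open \<Omega>" and w: "continuous_on (closure \<Omega>) w" and ae: "AE x in lebesgue_on \<Omega>. w x \<le> c"
    and x: "x \<in> closure \<Omega>"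
  shows "w x \<le> c"
proof -
  have le: "w z \<le> c" if "z \<in> \<Omega>" for z
  proof -
    let ?U = "{x \<in> \<Omega>. w x > c}"
    have "continuous_on \<Omega> w" using w closure_subset by (rule continuous_on_subset)
    from continuous_open_preimage[OF this \<Omega> open_greaterThan[of c]] have "open ?U"
      by (simp add: vimage_def Int_def)
    moreover have "AE x in lebesgue. x \<notin> ?U"
    proof -
      have "AE x in lebesgue. x \<in> \<Omega> \<longrightarrow> w x \<le> c"
        using ae \<Omega> by (subst (asm) AE_restrict_space_iff) auto
      then show ?thesis by eventually_elim auto
    qed
    ultimately have "AE x in lebesgue. x \<in> - ?U" "closed (- ?U)" by auto
    then have "z \<in> - ?U" by (intro mem_closed_if_AE_lebesgue)
    then show ?thesis using that by auto
  qed
  show ?thesis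
    by (rule continuous_le_on_closure[OF w x]) (use le in auto)
qed

text \<open>A weak gradient is determined only almost everywhere, so gradient convergence is
  asserted for every choice of weak gradients; uniqueness reduces it to the choice made for the
  solutions.\<close>

theorem theorem2p11:
  fixes \<Omega> :: "(real^'n::finite) set"
    and a :: "'n \<Rightarrow> 'n \<Rightarrow> real^'n \<Rightarrow> real"
    and b :: "real^'n \<Rightarrow> real^'n"
    and f :: "real^'n \<Rightarrow> real \<Rightarrow> real"
    and p pbar \<Lambda> :: real
    and u :: "real^'n \<Rightarrow> real" and us :: "nat \<Rightarrow> real^'n \<Rightarrow> real"
    and y :: "real^'n \<Rightarrow> real" and ys :: "nat \<Rightarrow> real^'n \<Rightarrow> real"
  assumes dim: "CARD('n) = 2 \<or> CARD('n) = 3"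
    and dom: "open \<Omega>" "bounded \<Omega>" "connected \<Omega>" "\<Omega> \<noteq> {}" "lipschitz_boundary \<Omega>"
    and a_Linf: "\<forall>i j. Linf \<Omega> (a i j)"
    and ellip: "\<Lambda> > 0" "AE x in lebesgue_on \<Omega>. \<forall>\<xi>::real^'n.
                   (\<Sum>i\<in>UNIV. \<Sum>j\<in>UNIV. a i j x * \<xi> $ i * \<xi> $ j) \<ge> \<Lambda> * (norm \<xi>)^2"
    and b_Lp: "\<forall>i. Lp \<Omega> p (\<lambda>x. b x $ i)"
    and p_cond: "CARD('n) = 3 \<longrightarrow> p \<ge> 3" "CARD('n) = 2 \<longrightarrow> p > 2"
    and pbar: "pbar > real CARD('n) / 2"
    and f_car: "caratheodory \<Omega> f"
    and f_mono: "AE x in lebesgue_on \<Omega>. mono (f x)"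
    and f_bound: "\<forall>M>0. \<exists>\<phi>. Lp \<Omega> pbar \<phi> \<and>
                   (AE x in lebesgue_on \<Omega>. \<forall>s. \<bar>s\<bar> \<le> M \<longrightarrow> \<bar>f x s\<bar> \<le> \<phi> x)"
    and u_Lp: "Lp \<Omega> pbar u" "\<forall>k. Lp \<Omega> pbar (us k)"
    and weak_conv: "\<forall>g. Lp \<Omega> (pbar / (pbar - 1)) g \<longrightarrow>
                     (\<lambda>k. LINT x|lebesgue_on \<Omega>. us k x * g x) \<longlonglongrightarrow> (LINT x|lebesgue_on \<Omega>. u x * g x)"
    and sol: "is_solution \<Omega> a b f u y"
    and sols: "\<forall>k. is_solution \<Omega> a b f (us k) (ys k)"
  shows "(\<lambda>k. LINT x|lebesgue_on \<Omega>. (ys k x - y x)^2) \<longlonglongrightarrow> 0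
         \<and> (\<forall>G Gs. weak_grad \<Omega> y G \<and> (\<forall>k. weak_grad \<Omega> (ys k) (Gs k)) \<longrightarrow>
              (\<lambda>k. LINT x|lebesgue_on \<Omega>. (norm (Gs k x - G x))^2) \<longlonglongrightarrow> 0)
         \<and> uniform_limit (closure \<Omega>) ys y sequentially"
proof -
  let ?M = "lebesgue_on \<Omega>"
  have L\<Omega>: "\<Omega> \<in> lmeasurable" using dom by (simp add: lmeasurable_open)
  then have \<Omega>s: "\<Omega> \<in> sets lebesgue" by auto
  interpret finite_measure ?M by (rule finite_measure_lebesgue_on[OF L\<Omega>])
  have \<Omega>m: "\<Omega> \<in> sets ?M" using \<Omega>s by (simp add: sets_restrict_space_iff)
  have sp: "space ?M = \<Omega>" by (simp add: space_restrict_space)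
  obtain m :: nat and q r where m: "m > 0" "CARD('n) = 2 \<or> CARD('n) = 3 \<and> m = 3" and qm: "q = real (2 * m)"
    and q: "q > 2" "r = 2 * q / (q - 2)" and r: "r > 2" "r \<le> p"
    and pb: "pbar > 1" "2 / q < 1 - 1 / pbar" "1 / pbar + 1 / q < 1"
    by (rule exponent_choice[OF dim p_cond pbar])
  have q0: "q > 0" using q(1) by simp
  obtain C where "C > 0" "\<forall>\<phi>\<in>test_fun \<Omega>. Lnorm ?M q \<phi> \<le> C * Lnorm ?M 2 (\<lambda>x. norm (grad \<phi> x))"
    using sobolev_test_fun[OF dom(1,2) m] unfolding qm by blast
  then have S: "sobolev_bound \<Omega> q C" using sobolev_H01[OF \<Omega>s q0] by blast
  define \<beta> where "\<beta> x = norm (b x)" for x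
  have bm: "b \<in> borel_measurable ?M" and br: "integrable ?M (\<lambda>x. \<bar>norm (b x)\<bar> powr r)"
    using norm_powr_integrable[OF L\<Omega> b_Lp, of r] r by auto
  have \<beta>: "\<beta> \<in> borel_measurable ?M" "integrable ?M (\<lambda>x. \<bar>\<beta> x\<bar> powr r)" "\<And>x. \<beta> x \<ge> 0"
    using bm br by (auto simp: \<beta>_def[abs_def])

  let ?id = "\<lambda>v y G. \<forall>z Z. H01_grad \<Omega> z Z \<longrightarrow>
    (LINT x|?M. (\<Sum>i\<in>UNIV. \<Sum>j\<in>UNIV. a i j x * G x $ i * Z x $ j) + (b x \<bullet> G x) * z x + f x (y x) * z x)
      = (LINT x|?M. v x * z x)"
  have sol_data: "\<exists>G. H01_grad \<Omega> y' G \<and> ?id v' y' G" if s: "is_solution \<Omega> a b f v' y'" for v' y'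
  proof -
    obtain G where G: "weak_grad \<Omega> y' G" "\<forall>z Gz. H01 \<Omega> z \<and> weak_grad \<Omega> z Gz \<longrightarrow>
          (LINT x|?M. (\<Sum>i\<in>UNIV. \<Sum>j\<in>UNIV. a i j x * G x $ i * Gz x $ j)
              + (b x \<bullet> G x) * z x + f x (y' x) * z x)
          = (LINT x|?M. v' x * z x)"
      using s unfolding is_solution_def by blast
    have "H01_grad \<Omega> y' G"
      using s G(1) by (intro H01_grad_of_weak_grad dom) (auto simp: is_solution_def)
    moreover have "?id v' y' G"
      using G(2) H01_grad_H01[OF dom(1)] H01_grad_weak_grad[OF dom(1)] by blast
    ultimately show ?thesis by blast
  qed
  obtain G0 where G0: "H01_grad \<Omega> y G0" "?id u y G0"
    using sol_data[OF sol] by blast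
  have "\<forall>k. \<exists>G. H01_grad \<Omega> (ys k) G \<and> ?id (us k) (ys k) G"
    using sol_data sols by blast
  from choice[OF this] obtain Gk where "\<forall>k. H01_grad \<Omega> (ys k) (Gk k) \<and> ?id (us k) (ys k) (Gk k)"
    by blast
  then have Gk: "\<And>k. H01_grad \<Omega> (ys k) (Gk k)" "\<And>k. ?id (us k) (ys k) (Gk k)" by auto
  have yc: "continuous_on (closure \<Omega>) y" "\<And>k. continuous_on (closure \<Omega>) (ys k)"
    using sol sols by (auto simp: is_solution_def)
  have bdd: "\<exists>K. \<forall>x\<in>\<Omega>. \<bar>g x\<bar> \<le> K" if "continuous_on (closure \<Omega>) g" for g :: "real^'n \<Rightarrow> real"
  proof -
    have "bounded (g ` closure \<Omega>)"
      using that dom(2) by (intro compact_imp_bounded compact_continuous_image) (auto simp: compact_closure)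
    then obtain K where "\<forall>x\<in>closure \<Omega>. \<bar>g x\<bar> \<le> K" by (auto simp: bounded_iff)
    then show ?thesis using closure_subset by (intro exI[of _ K]) blast
  qed
  obtain K0 where K0: "\<forall>x\<in>\<Omega>. \<bar>y x\<bar> \<le> K0" using bdd[OF yc(1)] by blast
  have "\<forall>k. \<exists>K. \<forall>x\<in>\<Omega>. \<bar>ys k x\<bar> \<le> K" using bdd[OF yc(2)] by blast
  from choice[OF this] obtain Kk where Kk: "\<And>k. \<forall>x\<in>\<Omega>. \<bar>ys k x\<bar> \<le> Kk k" by blast

  define v where "v k x = us k x - u x" for k x
  define w where "w k x = ys k x - y x" for k x
  define W where "W k x = Gk k x - G0 x" for k x
  have Hw: "H01_grad \<Omega> (w k) (W k)" for k
    unfolding w_def[abs_def] W_def[abs_def] by (rule H01_grad_diff[OF \<Omega>s Gk(1) G0(1)])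
  have Hn: "H01_grad \<Omega> (\<lambda>x. - w k x) (\<lambda>x. - W k x)" for k by (rule H01_grad_uminus[OF \<Omega>s Hw])
  have wb: "\<forall>x\<in>\<Omega>. w k x \<le> Kk k + K0" "\<forall>x\<in>\<Omega>. - w k x \<le> Kk k + K0" for k
    using Kk[of k] K0 unfolding w_def by (fastforce dest!: bspec)+
  have fb: "\<exists>\<phi>. Lp \<Omega> pbar \<phi> \<and> (AE x in ?M. \<forall>s. \<bar>s\<bar> \<le> N \<longrightarrow> \<bar>f x s\<bar> \<le> \<phi> x)" if "N > 0" for N
    using f_bound that by blast
  note diff = solution_difference_energy[OF dom(1,2) S q a_Linf[rule_format] ellip(2) bm br pb(1,3) f_car f_mono fb]
  have E1: "basic_energy \<Omega> \<Lambda> \<beta> (v k) (w k) (W k)" for k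
    using diff[OF _ u_Lp(2)[rule_format, of k] u_Lp(1) Gk(1)[of k] Kk[of k] G0(1) K0 Gk(2)[of k, rule_format] G0(2)[rule_format]]
    unfolding \<beta>_def[abs_def] v_def[abs_def] w_def[abs_def] W_def[abs_def] by simp
  \<comment> \<open>Exchanging the two solutions gives the same inequality for \<open>- w k\<close>,
    from which the lower bounds come.\<close>
  have E2: "basic_energy \<Omega> \<Lambda> \<beta> (\<lambda>x. - v k x) (\<lambda>x. - w k x) (\<lambda>x. - W k x)" for k
    using diff[OF _ u_Lp(1) u_Lp(2)[rule_format, of k] G0(1) K0 Gk(1)[of k] Kk[of k] G0(2)[rule_format] Gk(2)[of k, rule_format]]
    unfolding \<beta>_def[abs_def] v_def[abs_def] w_def[abs_def] W_def[abs_def] by simp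

  define p' where "p' = pbar / (pbar - 1)"
  have vLp: "Lp \<Omega> pbar (v k)" for k
    unfolding v_def[abs_def] using pb(1) u_Lp by (intro Lp_diff) auto
  then have v: "\<And>k. v k \<in> borel_measurable ?M" "\<And>k. integrable ?M (\<lambda>x. \<bar>v k x\<bar> powr pbar)"
    by (auto simp: Lp_def)
  have pp': "p' > 1" "1 / pbar + 1 / p' = 1" using pb(1) by (auto simp: p'_def field_simps)
  have vlim: "(\<lambda>k. LINT x|?M. v k x * g x) \<longlonglongrightarrow> 0" if g: "Lp \<Omega> p' g" for g
  proof -
    have i: "integrable ?M (\<lambda>x. h x * g x)" if "Lp \<Omega> pbar h" for h
      by (rule Hoelder_integrable[OF pb(1) pp']) (use g that in \<open>auto simp: Lp_def\<close>)
    have "(LINT x|?M. v k x * g x) = (LINT x|?M. us k x * g x) - (LINT x|?M. u x * g x)" for k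
      unfolding v_def left_diff_distrib
      by (rule Bochner_Integration.integral_diff[OF i[OF u_Lp(2)[rule_format]] i[OF u_Lp(1)]])
    then show ?thesis
      using weak_conv[rule_format, of g] g unfolding p'_def by (simp add: LIM_zero)
  qed
  \<comment> \<open>Each fixed pairing converges and is therefore bounded in \<open>k\<close>; a
    bound on the norms follows from the uniform boundedness theorem proved above.\<close>
  have "\<exists>B. \<forall>k. Lnorm ?M pbar (v k) \<le> B"
  proof (rule weakly_bounded_imp_bounded[where v = v, OF pb(1) v])
    fix g assume "g \<in> borel_measurable ?M" "integrable ?M (\<lambda>x. \<bar>g x\<bar> powr (pbar / (pbar - 1)))"
    then have "Lp \<Omega> p' g" by (simp add: Lp_def p'_def)
    from convergent_imp_Bseq[OF convergentI[OF vlim[OF this]]]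
    show "\<exists>B. \<forall>k. \<bar>LINT x|?M. v k x * g x\<bar> \<le> B" by (auto simp: Bseq_def)
  qed
  then obtain B where B: "\<And>k. Lnorm ?M pbar (v k) \<le> B" by blast
  \<comment> \<open>Apart from the norm bound, weak convergence enters the dual estimate only
    through indicators of balls.\<close>
  have ball_lim: "(\<lambda>k. LINT x|?M. v k x * indicator (ball z h) x) \<longlonglongrightarrow> 0" for z h
  proof (rule vlim)
    have "(indicator (ball z h) :: real^'n \<Rightarrow> real) \<in> borel_measurable ?M"
      by (intro borel_lebesgue_on borel_measurable_indicator) simp
    moreover have "(\<lambda>x. \<bar>indicat_real (ball z h) x\<bar> powr p') = indicat_real (ball z h)"
      using pp' by (auto simp: indicator_def)
    ultimately show "Lp \<Omega> p' (indicator (ball z h))"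
      unfolding Lp_def by (auto intro!: integrable_const_bound[of _ 1])
  qed
  note dual = dual_bound_tendsto_0[where v = v, OF dom(1,2) S q(1) pb(1,3) v B ball_lim]

  obtain c where c: "c > 0" and band: "\<And>w W s \<eta> b. H01_grad \<Omega> w W \<Longrightarrow> (\<forall>x\<in>\<Omega>. w x \<le> b) \<Longrightarrow> 0 \<le> s \<Longrightarrow> 0 \<le> \<eta> \<Longrightarrow>
    (\<forall>t\<ge>s. energy_estimate \<Omega> \<Lambda> \<beta> w W \<eta> t) \<Longrightarrow> pos_norm \<Omega> w W s \<le> c * \<eta>"
    using band_estimate[OF dom(1,2) S q \<beta> ellip(1)] by blast
  define I where "I k = (LINT x|?M. (norm (W k x))\<^sup>2)" for k
  have I0: "I k \<ge> 0" for k by (simp add: I_def)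
  have I_ev: "\<forall>\<^sub>F k in sequentially. I k \<le> 2 * (c * e)\<^sup>2" if e: "e > 0" for e
    using dual[OF e]
  proof eventually_elim
    case (elim k)
    have "pos_norm \<Omega> (w k) (W k) 0 \<le> c * e"
      by (rule band[OF Hw wb(1)]) (use e elim in \<open>auto intro!: basic_energy_dual[OF \<Omega>s Hw E1]\<close>)
    moreover have "pos_norm \<Omega> (\<lambda>x. - w k x) (\<lambda>x. - W k x) 0 \<le> c * e"
      by (rule band[OF Hn wb(2)]) (use e elim in \<open>auto intro!: basic_energy_dual[OF \<Omega>s Hn E2]\<close>)
    ultimately have "(pos_norm \<Omega> (w k) (W k) 0)\<^sup>2 + (pos_norm \<Omega> (\<lambda>x. - w k x) (\<lambda>x. - W k x) 0)\<^sup>2 \<le> (c * e)\<^sup>2 + (c * e)\<^sup>2"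
      by (intro add_mono power_mono) auto
    then show ?case
      unfolding I_def gradient_norm_split[OF dom(1) Hw] by simp
  qed
  have I_lim: "I \<longlonglongrightarrow> 0"
  proof (rule order_tendstoI)
    show "\<forall>\<^sub>F k in sequentially. l < I k" if "l < 0" for l
      using that I0 by (intro always_eventually) (auto intro: less_le_trans)
    show "\<forall>\<^sub>F k in sequentially. I k < l" if l: "0 < l" for l
    proof -
      \<comment> \<open>With this choice \<open>2 (c e)^2\<close> equals
        \<open>l / 2\<close>.\<close>
      define e where "e = sqrt (l / 4) / c"
      have "e > 0" using l c by (simp add: e_def)
      moreover have "2 * (c * e)\<^sup>2 < l" using l c by (simp add: e_def)
      ultimately show ?thesis using I_ev[of e] by (auto elim: eventually_mono)
    qed
  qed

  define c2 where "c2 = measure ?M \<Omega> powr (1 / 2 - 1 / q) * C"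
  have L2w: "L2 ?M (w k)" "L2 ?M (W k)" for k using Hw[of k] by (auto simp: H01_grad_def)
  \<comment> \<open>A Poincare inequality: Sobolev bounds the \<open>Lq\<close> norm by the
    gradient, and the finite measure of the domain passes from \<open>Lq\<close> to
    \<open>L2\<close>.\<close>
  have wI: "(LINT x|?M. (w k x)\<^sup>2) \<le> c2\<^sup>2 * I k" for k
  proof -
    have wq: "integrable ?M (\<lambda>x. \<bar>w k x\<bar> powr q)" "Lnorm ?M q (w k) \<le> C * Lnorm ?M 2 (\<lambda>x. norm (W k x))"
      using S Hw unfolding sobolev_bound_def by blast+
    have "Lnorm ?M 2 (w k) = Lnorm ?M 2 (\<lambda>x. w k x * indicator \<Omega> x)"
      unfolding Lnorm_def
      by (intro arg_cong2[where f = "(powr)"] Bochner_Integration.integral_cong) (auto simp: sp)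
    also have "\<dots> \<le> measure ?M \<Omega> powr (1 / 2 - 1 / q) * Lnorm ?M q (w k)"
      by (rule Lnorm_nested[OF L2_measurable[OF L2w(1)] wq(1) _ q(1) \<Omega>m]) simp
    also have "\<dots> \<le> measure ?M \<Omega> powr (1 / 2 - 1 / q) * (C * Lnorm ?M 2 (\<lambda>x. norm (W k x)))"
      by (intro mult_left_mono wq(2)) auto
    finally have "Lnorm ?M 2 (w k) \<le> c2 * sqrt (I k)"
      by (simp add: c2_def Lnorm_2 I_def mult.assoc)
    then have "(Lnorm ?M 2 (w k))\<^sup>2 \<le> (c2 * sqrt (I k))\<^sup>2"
      by (intro power_mono) auto
    then show ?thesis using I0[of k] by (simp add: Lnorm_2 power_mult_distrib)
  qed
  have w_lim: "(\<lambda>k. LINT x|?M. (w k x)\<^sup>2) \<longlonglongrightarrow> 0"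
  proof (rule Lim_null_comparison)
    show "(\<lambda>k. c2\<^sup>2 * I k) \<longlonglongrightarrow> 0" using tendsto_mult[OF tendsto_const I_lim, of "c2\<^sup>2"] by simp
  qed (use wI in simp)

  obtain K \<gamma> where K\<gamma>: "K > 0" "\<gamma> > 0" and sup: "\<And>v w W b \<epsilon>. v \<in> borel_measurable ?M \<Longrightarrow> integrable ?M (\<lambda>x. \<bar>v x\<bar> powr pbar) \<Longrightarrow>
    Lnorm ?M pbar v \<le> B \<Longrightarrow> H01_grad \<Omega> w W \<Longrightarrow> (\<forall>x\<in>\<Omega>. w x \<le> b) \<Longrightarrow> basic_energy \<Omega> \<Lambda> \<beta> v w W \<Longrightarrow> 0 \<le> \<epsilon> \<Longrightarrow>
    (AE x in ?M. w x \<le> \<epsilon> + K * measure ?M {x\<in>\<Omega>. w x > \<epsilon>} powr \<gamma>)"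
    using supremum_estimate[OF dom(1,2) S q \<beta> ellip(1) pb(1,2), of B] by blast
  \<comment> \<open>By Chebyshev the measures of \<open>{w k > \<epsilon>}\<close> and
    \<open>{- w k > \<epsilon>}\<close> tend to zero with the \<open>L2\<close> norm, so the second
    term of the supremum bound drops below \<open>\<epsilon>\<close>; the two contributions make
    \<open>2 * \<epsilon>\<close>.\<close>
  have unif: "\<forall>\<^sub>F k in sequentially. \<forall>x\<in>closure \<Omega>. \<bar>w k x\<bar> \<le> 2 * \<epsilon>" if \<epsilon>: "\<epsilon> > 0" for \<epsilon>
  proof -
    have cheb: "measure ?M {x\<in>\<Omega>. z x > \<epsilon>} \<le> (LINT x|?M. (z x)\<^sup>2) / \<epsilon>\<^sup>2" if z: "L2 ?M z" for z :: "real^'n \<Rightarrow> real"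
    proof -
      note [measurable] = L2_measurable[OF z]
      have A: "{x\<in>\<Omega>. z x > \<epsilon>} \<in> sets ?M"
      proof -
        have "{x\<in>space ?M. z x > \<epsilon>} \<in> sets ?M" by measurable
        then show ?thesis by (simp add: sp)
      qed
      have "measure ?M {x\<in>\<Omega>. z x > \<epsilon>} * \<epsilon>\<^sup>2 = (LINT x|?M. indicator {x\<in>\<Omega>. z x > \<epsilon>} x * \<epsilon>\<^sup>2)"
      proof -
        have "{x\<in>\<Omega>. z x > \<epsilon>} \<inter> \<Omega> = {x\<in>\<Omega>. z x > \<epsilon>}" by blast
        then show ?thesis by (simp add: sp)
      qed
      also have "\<dots> \<le> (LINT x|?M. (z x)\<^sup>2)"
      proof (rule integral_mono)
        show "integrable ?M (\<lambda>x. indicat_real {x\<in>\<Omega>. z x > \<epsilon>} x * \<epsilon>\<^sup>2)"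
          using A by (intro integrable_mult_left) (auto simp: less_top[symmetric])
        show "integrable ?M (\<lambda>x. (z x)\<^sup>2)" using L2_norm_integrable[OF z] by simp
        show "indicator {x\<in>\<Omega>. z x > \<epsilon>} x * \<epsilon>\<^sup>2 \<le> (z x)\<^sup>2" for x
          using \<epsilon> by (auto simp: indicator_def intro!: power_mono)
      qed
      finally show ?thesis using \<epsilon> by (simp add: pos_le_divide_eq)
    qed
    have "(\<lambda>k. K * ((LINT x|?M. (w k x)\<^sup>2) / \<epsilon>\<^sup>2) powr \<gamma>) \<longlonglongrightarrow> K * (0 / \<epsilon>\<^sup>2) powr \<gamma>"
      using \<epsilon> K\<gamma> by (intro tendsto_mult tendsto_const tendsto_powr' tendsto_divide w_lim) auto
    then have "(\<lambda>k. K * ((LINT x|?M. (w k x)\<^sup>2) / \<epsilon>\<^sup>2) powr \<gamma>) \<longlonglongrightarrow> 0" using K\<gamma> by simp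
    from order_tendstoD(2)[OF this \<epsilon>] show ?thesis
    proof eventually_elim
      case (elim k)
      \<comment> \<open>Stated for any \<open>z\<close> with the same squared integral as
        \<open>w k\<close>, so that it serves \<open>w k\<close> and \<open>- w k\<close>
        alike.\<close>
      have small: "K * measure ?M {x\<in>\<Omega>. z x > \<epsilon>} powr \<gamma> \<le> \<epsilon>"
        if "L2 ?M z" "(LINT x|?M. (z x)\<^sup>2) = (LINT x|?M. (w k x)\<^sup>2)" for z :: "real^'n \<Rightarrow> real"
      proof -
        have "measure ?M {x\<in>\<Omega>. z x > \<epsilon>} powr \<gamma> \<le> ((LINT x|?M. (w k x)\<^sup>2) / \<epsilon>\<^sup>2) powr \<gamma>"
          using cheb[OF that(1)] that(2) K\<gamma>(2) by (intro powr_mono2) auto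
        then have "K * measure ?M {x\<in>\<Omega>. z x > \<epsilon>} powr \<gamma> \<le> K * ((LINT x|?M. (w k x)\<^sup>2) / \<epsilon>\<^sup>2) powr \<gamma>"
          using K\<gamma>(1) by (intro mult_left_mono) auto
        then show ?thesis using elim by linarith
      qed
      have wc: "continuous_on (closure \<Omega>) (w k)" "continuous_on (closure \<Omega>) (\<lambda>x. - w k x)"
        unfolding w_def[abs_def] by (intro continuous_intros yc)+
      have "AE x in ?M. w k x \<le> \<epsilon> + K * measure ?M {x\<in>\<Omega>. w k x > \<epsilon>} powr \<gamma>"
        by (rule sup[OF v B Hw wb(1) E1]) (use \<epsilon> in simp)
      moreover have "K * measure ?M {x\<in>\<Omega>. w k x > \<epsilon>} powr \<gamma> \<le> \<epsilon>"
        by (rule small[OF L2w(1) refl])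
      ultimately have "AE x in ?M. w k x \<le> 2 * \<epsilon>"
        by (auto elim!: eventually_mono)
      from AE_le_imp_le_closure[OF dom(1) wc(1) this] have up: "w k x \<le> 2 * \<epsilon>" if "x \<in> closure \<Omega>" for x
        using that .
      have L2n: "L2 ?M (\<lambda>x. - w k x)" using Hn[of k] by (auto simp: H01_grad_def)
      have "AE x in ?M. - w k x \<le> \<epsilon> + K * measure ?M {x\<in>\<Omega>. - w k x > \<epsilon>} powr \<gamma>"
      proof (rule sup[OF _ _ _ Hn wb(2) E2])
        show "(\<lambda>x. - v k x) \<in> borel_measurable ?M" using v(1) by simp
        show "integrable ?M (\<lambda>x. \<bar>- v k x\<bar> powr pbar)" using v(2) by simp
        show "Lnorm ?M pbar (\<lambda>x. - v k x) \<le> B" using B[of k] by (simp add: Lnorm_def)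
      qed (use \<epsilon> in simp)
      moreover have "K * measure ?M {x\<in>\<Omega>. - w k x > \<epsilon>} powr \<gamma> \<le> \<epsilon>"
        by (rule small[OF L2n]) simp
      ultimately have "AE x in ?M. - w k x \<le> 2 * \<epsilon>"
        by (auto elim!: eventually_mono)
      from AE_le_imp_le_closure[OF dom(1) wc(2) this] have lo: "- w k x \<le> 2 * \<epsilon>" if "x \<in> closure \<Omega>" for x
        using that .
      show ?case using up lo by (auto simp: abs_le_iff)
    qed
  qed

  show ?thesis
  proof (intro conjI allI impI)
    show "(\<lambda>k. LINT x|?M. (ys k x - y x)^2) \<longlonglongrightarrow> 0"
      using w_lim by (simp add: w_def)
    fix G Gs assume GG: "weak_grad \<Omega> y G \<and> (\<forall>k. weak_grad \<Omega> (ys k) (Gs k))"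
    have "(LINT x|?M. (norm (Gs k x - G x))^2) = I k" for k
    proof -
      have ae: "AE x in ?M. G0 x = G x" "AE x in ?M. Gk k x = Gs k x"
        using GG weak_grad_unique[OF dom(1) H01_grad_weak_grad[OF dom(1) G0(1)]]
          weak_grad_unique[OF dom(1) H01_grad_weak_grad[OF dom(1) Gk(1)]] by blast+
      have m0: "G0 \<in> borel_measurable ?M" "Gk k \<in> borel_measurable ?M"
        using G0(1) Gk(1)[of k] by (auto simp: H01_grad_def L2_def)
      have m1[measurable]: "G \<in> borel_measurable ?M" "Gs k \<in> borel_measurable ?M"
        using borel_measurable_lebesgue_on_AE[OF \<Omega>s m0(1) ae(1)] borel_measurable_lebesgue_on_AE[OF \<Omega>s m0(2) ae(2)] by auto
      show ?thesis
        unfolding I_def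
      proof (rule integral_cong_AE)
        show "AE x in ?M. (norm (Gs k x - G x))^2 = (norm (W k x))\<^sup>2"
          using ae by eventually_elim (simp add: W_def)
        show "(\<lambda>x. (norm (W k x))\<^sup>2) \<in> borel_measurable ?M"
          using L2_measurable[OF L2w(2)] by measurable
      qed measurable
    qed
    then show "(\<lambda>k. LINT x|?M. (norm (Gs k x - G x))^2) \<longlonglongrightarrow> 0"
      using I_lim by simp
  next
    show "uniform_limit (closure \<Omega>) ys y sequentially"
    proof (rule uniform_limitI)
      fix e :: real assume e: "e > 0"
      have "\<forall>\<^sub>F k in sequentially. \<forall>x\<in>closure \<Omega>. \<bar>w k x\<bar> \<le> 2 * (e / 4)"
        using unif[of "e / 4"] e by simp
      then show "\<forall>\<^sub>F k in sequentially. \<forall>x\<in>closure \<Omega>. dist (ys k x) (y x) < e"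
      proof eventually_elim
        case (elim k)
        show ?case
        proof
          fix x assume "x \<in> closure \<Omega>"
          then have "\<bar>w k x\<bar> \<le> 2 * (e / 4)" using elim by blast
          then show "dist (ys k x) (y x) < e" using e by (simp add: w_def dist_real_def)
        qed
      qed
    qed
  qed
qed

end
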